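(* Let $R>0$, let $v\in C^1([0,R];\mathbb{R})$ satisfy $v'(\rho)<0$ for all $\rho\in[0,R]$, and let $\overline{\rho}\in L^\infty_c(\mathbb{R})\cap BV(\mathbb{R})$ satisfy $0\le\overline{\rho}(x)\le R$ for a.e. $x\in\mathbb{R}$, with $L=\|\overline{\rho}\|_{L^1(\mathbb{R})}>0$. Fix $T>0$, $\theta\in[0,1]$ and two monotone sequences of positive integers $(M_n)_n,(N_n)_n$ satisfying, for all $n$, the CFL-type condition $$\theta\,N_n\,T\,[v]_{\mathrm{Lip}}\,R^2< L\,M_n .$$ Let $\rho_n=\rho^{M_n}_{N_n}$ be the discrete densities of the fully discrete particle scheme (defined in the context). (a) If $\lim_{n\to\infty}N_n=+\infty$, then $(\rho_n)_n$ converges, up to a subsequence, strongly in $L^1(\mathbb{R}\times[0,T])$ to a weak solution of the Cauchy problem $$\partial_t\rho+\partial_x(\rho\,v(\rho))=0,\qquad \rho(x,0)=\overline{\rho}(x).$$ (b) If moreover $\lim_{n\to\infty}N_n/M_n=0$, then the whole sequence $(\rho_n)_n$ converges strongly in $L^1(\mathbb{R}\times[0,T])$ to the unique entropy solution of this Cauchy problem.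
   Context: $L^\infty_c(\mathbb{R})$ is the space of essentially bounded functions with compact support; $[v]_{\mathrm{Lip}}$ is the Lipschitz constant of $v$ on $[0,R]$. Particle scheme for positive integers $M,N$. Set $\tau=T/M$, $\ell=L/N$, $t^m=m\tau$. Initial positions: $\overline{x}_0=\min(\mathrm{supp}(\overline{\rho}))$ and, for $i\in\{0,\dots,N-1\}$, $\overline{x}_{i+1}=\min\{x\ge\overline{x}_i:\int_{\overline{x}_i}^x\overline{\rho}(y)\,dy\ge\ell\}$. The positions $x_0^m<x_1^m<\dots<x_N^m$, $m\in\{0,\dots,M\}$, are determined by $x_i^0=\overline{x}_i$ and $$x_i^{m+1}=x_i^m+\tau\bigl(\theta\,v(R_i^m)+(1-\theta)\,v(R_i^{m+1})\bigr),\qquad i\in\{0,\dots,N\},\ m\in\{0,\dots,M-1\},$$ where $R_i^m=\ell/(x_{i+1}^m-x_i^m)$ for $i\in\{0,\dots,N-1\}$ and $R_N^m=0$. Under the CFL-type condition the scheme is well defined for all $m$ and $R_i^m\in[0,R]$. Discrete density, for $t\in[0,T)$ (extended to $t=T$ by continuity): $$\rho^M_N(x,t)=\sum_{m=0}^{M-1}\sum_{i=0}^{N-1}R_i^m\,\mathbf{1}_{[x_i^m,x_{i+1}^m)}(x)\,\mathbf{1}_{[t^m,t^{m+1})}(t).$$ Solutions. Let $f(\rho)=\rho\,v(\rho)$. A weak solution is a map $\rho\colon[0,T]\to L^\infty_c(\mathbb{R})$, continuous for the $L^1(\mathbb{R})$ topology (with values in $[0,R]$), such that $$\int_0^T\!\!\int_{\mathbb{R}}\bigl(\rho\,\partial_t\varphi+f(\rho)\,\partial_x\varphi\bigr)\,dx\,dt+\int_{\mathbb{R}}\overline{\rho}(x)\,\varphi(x,0)\,dx=0$$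 for every $\varphi\in C^1_c(\mathbb{R}\times[0,T))$. An entropy solution is such a continuous map satisfying $$\int_0^T\!\!\int_{\mathbb{R}}\bigl(|\rho-k|\,\partial_t\varphi+\mathrm{sign}(\rho-k)(f(\rho)-f(k))\,\partial_x\varphi\bigr)\,dx\,dt+\int_{\mathbb{R}}|\overline{\rho}(x)-k|\,\varphi(x,0)\,dx\ge0$$ for every $k\in[0,R]$ and every non-negative $\varphi\in C^1_c(\mathbb{R}\times[0,T))$. Elements of $L^1(\mathbb{R}\times[0,T])$ are identified a.e., so "the limit is a weak/entropy solution" means that it has such a representative.
   Formalization: In (a), when θ = 0, it is additionally assumed that M_n → ∞; otherwise the claim fails (θ = 0, M_n = 1, v(ρ) = 2−ρ, R = 1, initial datum the indicator of [0,1]). For θ > 0 this follows from the CFL condition and N_n → ∞. *)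

theory Defs
  imports "HOL-Analysis.Analysis"
begin

text \<open>
  Classes of measurable functions on the line are represented by functions that are measurable
  for the (complete) Lebesgue measure; every notion below is invariant under a.e. modification.
\<close>

definition ess_supp :: "(real \<Rightarrow> real) \<Rightarrow> real set" where
  "ess_supp u = - \<Union>{U. open U \<and> (AE x in lebesgue. x \<in> U \<longrightarrow> u x = 0)}"

definition Linfty_c :: "(real \<Rightarrow> real) set" where
  "Linfty_c = {u. u \<in> borel_measurable lebesgue
                \<and> (\<exists>C. AE x in lebesgue. \<bar>u x\<bar> \<le> C) \<and> compact (ess_supp u)}"

text \<open>Integrable functions whose distributional total variation is finite.\<close>

definition BV :: "(real \<Rightarrow> real) set" where
  "BV = {u. integrable lebesgue u \<and>
        (\<exists>C. \<forall>\<phi>. \<phi> C1_differentiable_on UNIV \<longrightarrow> compact (closure {x. \<phi> x \<noteq> 0}) \<longrightarrow>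
              (\<forall>x. \<bar>\<phi> x\<bar> \<le> 1) \<longrightarrow> (LINT x|lebesgue. u x * deriv \<phi> x) \<le> C)}"

definition lip_const :: "(real \<Rightarrow> real) \<Rightarrow> real set \<Rightarrow> real" where
  "lip_const v S = Inf {C. C-lipschitz_on S v}"


subsection \<open>The particle scheme\<close>

primrec initial_position :: "(real \<Rightarrow> real) \<Rightarrow> real \<Rightarrow> nat \<Rightarrow> real" where
  "initial_position \<rho>\<^sub>0 l 0 = (LEAST x. x \<in> ess_supp \<rho>\<^sub>0)"
| "initial_position \<rho>\<^sub>0 l (Suc i) =
     (LEAST x. initial_position \<rho>\<^sub>0 l i \<le> x
             \<and> (LINT y:{initial_position \<rho>\<^sub>0 l i..x}|lebesgue. \<rho>\<^sub>0 y) \<ge> l)"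

definition local_density :: "real \<Rightarrow> nat \<Rightarrow> (nat \<Rightarrow> real) \<Rightarrow> nat \<Rightarrow> real" where
  "local_density l N y i = (if i < N then l / (y (Suc i) - y i) else 0)"

text \<open>
  The position of particle \<open>i\<close> at time step \<open>m\<close> is \<open>x m i\<close>.  Since \<open>v\<close> is given on \<open>[0,R]\<close> only, the
  (in general implicit) recursion makes sense only if the local densities lie in \<open>[0,R]\<close>; this
  requirement also selects the relevant root of the implicit equation.
\<close>

definition is_particle_scheme ::
  "real \<Rightarrow> (real \<Rightarrow> real) \<Rightarrow> (real \<Rightarrow> real) \<Rightarrow> real \<Rightarrow> real \<Rightarrow> nat \<Rightarrow> nat \<Rightarrow> (nat \<Rightarrow> nat \<Rightarrow> real) \<Rightarrow> bool"
where
  "is_particle_scheme R v \<rho>\<^sub>0 T \<theta> M N x \<longleftrightarrow>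
    (let \<tau> = T / real M; l = (LINT y|lebesgue. \<bar>\<rho>\<^sub>0 y\<bar>) / real N;
         r = (\<lambda>m i. local_density l N (x m) i) in
      (\<forall>i\<le>N. x 0 i = initial_position \<rho>\<^sub>0 l i) \<and>
      (\<forall>m\<le>M. \<forall>i<N. x m i < x m (Suc i)) \<and>
      (\<forall>m\<le>M. \<forall>i\<le>N. r m i \<in> {0..R}) \<and>
      (\<forall>m<M. \<forall>i\<le>N. x (Suc m) i = x m i + \<tau> * (\<theta> * v (r m i) + (1 - \<theta>) * v (r (Suc m) i))))"

text \<open>The entries outside the index range are set to zero, so that the description is definite.\<close>

definition particle_positions ::
  "real \<Rightarrow> (real \<Rightarrow> real) \<Rightarrow> (real \<Rightarrow> real) \<Rightarrow> real \<Rightarrow> real \<Rightarrow> nat \<Rightarrow> nat \<Rightarrow> nat \<Rightarrow> nat \<Rightarrow> real"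
where
  "particle_positions R v \<rho>\<^sub>0 T \<theta> M N =
     (THE x. is_particle_scheme R v \<rho>\<^sub>0 T \<theta> M N x \<and> (\<forall>m i. m > M \<or> i > N \<longrightarrow> x m i = 0))"

text \<open>The last time cell is closed: this is the extension to \<open>t = T\<close> by continuity.\<close>

definition time_cell :: "real \<Rightarrow> nat \<Rightarrow> nat \<Rightarrow> real set" where
  "time_cell T M m = {real m * (T / real M)..<real (Suc m) * (T / real M)}
                       \<union> (if Suc m = M then {T} else {})"

definition discrete_density ::
  "real \<Rightarrow> (real \<Rightarrow> real) \<Rightarrow> (real \<Rightarrow> real) \<Rightarrow> real \<Rightarrow> real \<Rightarrow> nat \<Rightarrow> nat \<Rightarrow> real \<times> real \<Rightarrow> real"
where
  "discrete_density R v \<rho>\<^sub>0 T \<theta> M N = (\<lambda>(x, t).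
     let l = (LINT y|lebesgue. \<bar>\<rho>\<^sub>0 y\<bar>) / real N; X = particle_positions R v \<rho>\<^sub>0 T \<theta> M N in
       (\<Sum>m<M. \<Sum>i<N. local_density l N (X m) i
          * indicator {X m i..<X m (Suc i)} x * indicator (time_cell T M m) t))"


subsection \<open>Weak and entropy solutions\<close>

text \<open>
  \<open>\<phi>\<close> belongs to \<open>C\<^sup>1\<^sub>c(\<real> \<times> [0,T))\<close> with partial derivatives \<open>\<phi>x\<close>, \<open>\<phi>t\<close> (one-sided in time at \<open>t = 0\<close>).
  Its support need not avoid \<open>t = 0\<close>, but stays away from \<open>t = T\<close>.
\<close>

definition test_function ::
  "real \<Rightarrow> (real \<times> real \<Rightarrow> real) \<Rightarrow> (real \<times> real \<Rightarrow> real) \<Rightarrow> (real \<times> real \<Rightarrow> real) \<Rightarrow> bool"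
where
  "test_function T \<phi> \<phi>x \<phi>t \<longleftrightarrow>
     (\<forall>p\<in>UNIV \<times> {0..<T}.
        (\<phi> has_derivative (\<lambda>(h, s). \<phi>x p * h + \<phi>t p * s)) (at p within UNIV \<times> {0..<T})) \<and>
     continuous_on (UNIV \<times> {0..<T}) \<phi>x \<and> continuous_on (UNIV \<times> {0..<T}) \<phi>t \<and>
     (\<exists>K. compact K \<and> K \<subseteq> UNIV \<times> {0..<T} \<and> (\<forall>p\<in>UNIV \<times> {0..<T} - K. \<phi> p = 0))"

definition continuous_L1_map :: "real \<Rightarrow> real \<Rightarrow> (real \<Rightarrow> real \<Rightarrow> real) \<Rightarrow> bool" where
  "continuous_L1_map R T \<rho> \<longleftrightarrow>
     (\<forall>t\<in>{0..T}. \<rho> t \<in> Linfty_c \<and> (AE x in lebesgue. \<rho> t x \<in> {0..R})) \<and>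
     (\<forall>t\<in>{0..T}. ((\<lambda>s. LINT x|lebesgue. \<bar>\<rho> s x - \<rho> t x\<bar>) \<longlongrightarrow> 0) (at t within {0..T}))"

text \<open>
  The space-time integrals are iterated, so that they are meaningful for any choice of
  representatives of \<open>\<rho> t\<close>, \<open>0 \<le> t \<le> T\<close>.
\<close>

definition weak_solution ::
  "real \<Rightarrow> (real \<Rightarrow> real) \<Rightarrow> (real \<Rightarrow> real) \<Rightarrow> real \<Rightarrow> (real \<Rightarrow> real \<Rightarrow> real) \<Rightarrow> bool"
where
  "weak_solution R v \<rho>\<^sub>0 T \<rho> \<longleftrightarrow> (let f = (\<lambda>r. r * v r) in
     continuous_L1_map R T \<rho> \<and>
     (\<forall>\<phi> \<phi>x \<phi>t. test_function T \<phi> \<phi>x \<phi>t \<longrightarrow>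
        (LINT t:{0..<T}|lebesgue. LINT x|lebesgue. \<rho> t x * \<phi>t (x, t) + f (\<rho> t x) * \<phi>x (x, t))
        + (LINT x|lebesgue. \<rho>\<^sub>0 x * \<phi> (x, 0)) = 0))"

definition entropy_solution ::
  "real \<Rightarrow> (real \<Rightarrow> real) \<Rightarrow> (real \<Rightarrow> real) \<Rightarrow> real \<Rightarrow> (real \<Rightarrow> real \<Rightarrow> real) \<Rightarrow> bool"
where
  "entropy_solution R v \<rho>\<^sub>0 T \<rho> \<longleftrightarrow> (let f = (\<lambda>r. r * v r) in
     continuous_L1_map R T \<rho> \<and>
     (\<forall>k\<in>{0..R}. \<forall>\<phi> \<phi>x \<phi>t. test_function T \<phi> \<phi>x \<phi>t \<longrightarrow> (\<forall>p\<in>UNIV \<times> {0..<T}. \<phi> p \<ge> 0) \<longrightarrow>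
        (LINT t:{0..<T}|lebesgue. LINT x|lebesgue.
            \<bar>\<rho> t x - k\<bar> * \<phi>t (x, t) + sgn (\<rho> t x - k) * (f (\<rho> t x) - f k) * \<phi>x (x, t))
        + (LINT x|lebesgue. \<bar>\<rho>\<^sub>0 x - k\<bar> * \<phi> (x, 0)) \<ge> 0))"

definition converges_L1_on ::
  "(real \<times> real) set \<Rightarrow> (nat \<Rightarrow> real \<times> real \<Rightarrow> real) \<Rightarrow> (real \<times> real \<Rightarrow> real) \<Rightarrow> bool"
where
  "converges_L1_on S u w \<longleftrightarrow>
     (\<forall>n. integrable (lebesgue_on S) (u n)) \<and> integrable (lebesgue_on S) w \<and>
     (\<lambda>n. LINT p|lebesgue_on S. \<bar>u n p - w p\<bar>) \<longlonglongrightarrow> 0"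

end

theory Submission
  imports Defs "HOL-Complex_Analysis.Great_Picard"
begin

text \<open>
  Since \<open>v\<close> is decreasing, the CFL condition makes the scheme monotone: the local densities stay in \<open>[0,R]\<close> and
  their total variation does not increase, while particles move with speed at most \<open>max \<bar>v 0\<bar> \<bar>v R\<bar>\<close>.  Hence the
  spatial primitives of the discrete densities are equi-Lipschitz up to one time step, and Arzela-Ascoli gives a
  subsequence converging uniformly; the variation bound upgrades this to convergence of the densities in
  \<open>L\<^sup>1(\<real>)\<close>, uniformly in time.

  Each step satisfies the weak form up to an error \<open>\<tau> o(1)\<close>, and the entropy inequality up to an error
  \<open>\<tau> (O(\<tau>/l) + o(1))\<close>, which vanishes relative to \<open>\<tau>\<close> precisely when \<open>N/M\<close> tends to \<open>0\<close>.

  For uniqueness, the time variable need not be doubled because solutions are continuous into \<open>L\<^sup>1(\<real>)\<close>: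
  testing in space only, Kruzkov's functional \<open>H(\<sigma> t, \<rho> t) = \<integral>\<integral> |\<sigma> t x - \<rho> t y| w\<^sub>\<epsilon>(x - y) dx dy\<close> is nonincreasing in time,
  and the variation bound of the constructed solution \<open>\<rho>\<close> controls the defect as \<open>\<epsilon>\<close> tends to \<open>0\<close>.
\<close>


section \<open>Piecewise constant functions\<close>

text \<open>Every cell between two particles carries the same mass \<open>l\<close>, and this drives
  the estimates. The density of a cell is \<open>l\<close> over its length, so one step is a
  discrete transport equation in the particle label, whose implicit part is solved from the leading
  particle backwards. In the weak form a cell enters with weight \<open>l\<close>, which cancels the
  denominator of \<open>\<tau> / l\<close>, the rate at which the densities may change in one step.
  A Kruzkov entropy is not proportional to the mass of a cell: the weight is lost and the factor
  \<open>\<tau> / l\<close>, a multiple of \<open>N / M\<close>, stays. This is why (b) asks for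
  more than (a).

  Two obstacles shape the rest. A continuous map into L1 offers a representative at each time but no
  joint measurability, so arguments about arbitrary entropy solutions go through spatial integrals,
  which are continuous in time. And for k > 0 the function \<open>\<bar>\<rho> - k\<bar>\<close> is
  not integrable on the line, so entropies are normalized to vanish at density 0 whenever sums over
  particles are formed.\<close>

definition jump :: "(nat \<Rightarrow> real) \<Rightarrow> nat \<Rightarrow> real" where
  "jump r j = r j - (if j = 0 then 0 else r (j - 1))"

definition step_fun :: "nat \<Rightarrow> (nat \<Rightarrow> real) \<Rightarrow> (nat \<Rightarrow> real) \<Rightarrow> real \<Rightarrow> real" where
  "step_fun N y r x = (\<Sum>i<N. r i * indicator {y i..<y (Suc i)} x)"

text \<open>The primitive of \<open>step_fun\<close> that vanishes at minus infinity: for increasing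
  nodes, the difference of positive parts is the length of the part of cell i to the left of
  x.\<close>

definition step_prim :: "nat \<Rightarrow> (nat \<Rightarrow> real) \<Rightarrow> (nat \<Rightarrow> real) \<Rightarrow> real \<Rightarrow> real" where
  "step_prim N y r x = (\<Sum>i<N. r i * (max 0 (x - y i) - max 0 (x - y (Suc i))))"

text \<open>Summation by parts. Since \<open>jump r 0 = r 0\<close>, entering the first cell from
  vacuum counts as a jump. In the uses below the last value is 0, so the boundary term drops, and
  the absolute jumps up to N add up to the total variation on the whole line.\<close>

lemma abel_jump: "(\<Sum>i<N. r i * (h i - h (Suc i))) = (\<Sum>j\<le>N. jump r j * h j) - r N * h N"
  by (induction N) (auto simp: jump_def algebra_simps)

lemma step_fun_jump:
  assumes "\<And>i. i < N \<Longrightarrow> y i < y (Suc i)" and "r N = 0"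
  shows "step_fun N y r x = (\<Sum>j\<le>N. jump r j * indicator {y j..} x)"
proof -
  have "step_fun N y r x = (\<Sum>i<N. r i * (indicator {y i..} x - indicator {y (Suc i)..} x))"
    unfolding step_fun_def
    by (intro sum.cong refl) (use assms(1) in \<open>force simp: indicator_def\<close>)
  then show ?thesis
    using abel_jump[of r "\<lambda>j. indicator {y j..} x" N] assms(2) by simp
qed

lemma step_prim_jump:
  assumes "r N = 0"
  shows "step_prim N y r x = (\<Sum>j\<le>N. jump r j * max 0 (x - y j))"
  using abel_jump[of r "\<lambda>j. max 0 (x - y j)" N] assms by (simp add: step_prim_def)

lemma step_fun_measurable [measurable]: "step_fun N y r \<in> borel_measurable borel"
  unfolding step_fun_def[abs_def] by measurable

lemma mono_nodes:
  fixes y :: "nat \<Rightarrow> real"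
  assumes "\<And>i. i < N \<Longrightarrow> y i < y (Suc i)" "i \<le> j" "j \<le> N"
  shows "y i \<le> y j"
  using assms(2,3)
proof (induction j)
  case (Suc j)
  then show ?case using assms(1)[of j] by (cases "i = Suc j") (auto simp: le_Suc_eq)
qed simp

lemma step_fun_cell:
  assumes y: "\<And>i. i < N \<Longrightarrow> y i < y (Suc i)" and "i < N" "y i \<le> x" "x < y (Suc i)"
  shows "step_fun N y r x = r i"
proof -
  have "r j * indicator {y j..<y (Suc j)} x = (if j = i then r i else 0)" if "j < N" for j
  proof (cases j i rule: linorder_cases)
    case less
    then have "y (Suc j) \<le> y i" using mono_nodes[of N y "Suc j" i] y assms(2) by simp
    with less assms show ?thesis by (auto simp: indicator_def)
  next
    case greater
    then have "y (Suc i) \<le> y j" using mono_nodes[of N y "Suc i" j] y that by simp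
    with greater assms show ?thesis by (auto simp: indicator_def)
  qed (use assms in auto)
  then show ?thesis using assms(2) by (simp add: step_fun_def sum.delta)
qed

lemma step_fun_outside:
  assumes y: "\<And>i. i < N \<Longrightarrow> y i < y (Suc i)" and "x < y 0 \<or> y N \<le> x"
  shows "step_fun N y r x = 0"
proof -
  have "x \<notin> {y i..<y (Suc i)}" if "i < N" for i
    using mono_nodes[of N y 0 i] mono_nodes[of N y "Suc i" N] y assms(2) that by auto
  then show ?thesis by (simp add: step_fun_def)
qed

lemma node_cell:
  fixes y :: "nat \<Rightarrow> real"
  assumes "y 0 \<le> x" "x < y N"
  shows "\<exists>i<N. y i \<le> x \<and> x < y (Suc i)"
  using assms(2)
proof (induction N)
  case (Suc N)
  then show ?case using less_Suc_eq by (cases "x < y N") (auto simp: not_less)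
qed (use assms in auto)

lemma step_fun_range:
  assumes y: "\<And>i. i < N \<Longrightarrow> y i < y (Suc i)" and r: "\<And>i. i < N \<Longrightarrow> r i \<in> {0..R}" and "0 \<le> R"
  shows "step_fun N y r x \<in> {0..R}"
proof (cases "y 0 \<le> x \<and> x < y N")
  case True
  then obtain i where "i < N" "y i \<le> x" "x < y (Suc i)" using node_cell by blast
  then show ?thesis using step_fun_cell[of N y i x r] y r by auto
next
  case False
  then show ?thesis using step_fun_outside[of N y x r] y assms(3) by auto
qed

lemma step_prim_increment:
  assumes y: "\<And>i. i < N \<Longrightarrow> y i < y (Suc i)" and r: "\<And>i. i < N \<Longrightarrow> r i \<in> {0..R}" and "0 \<le> h" "0 \<le> R"
  shows "0 \<le> step_prim N y r (x + h) - step_prim N y r x"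
    and "step_prim N y r (x + h) - step_prim N y r x \<le> R * h"
proof -
  define g where "g i = max 0 (x + h - y i) - max 0 (x - y i)" for i
  have eq: "step_prim N y r (x + h) - step_prim N y r x = (\<Sum>i<N. r i * (g i - g (Suc i)))"
    unfolding step_prim_def sum_subtractf[symmetric] g_def by (intro sum.cong refl) (simp add: algebra_simps)
  \<comment> \<open>\<open>g i - g (Suc i)\<close> is the length of the part of [x, x + h] inside
    cell i, so these weights are nonnegative and add up to at most h.\<close>
  have g: "g (Suc i) \<le> g i" if "i < N" for i
    using y[OF that] assms(3) by (auto simp: g_def max_def)
  show "0 \<le> step_prim N y r (x + h) - step_prim N y r x"
    unfolding eq by (intro sum_nonneg mult_nonneg_nonneg) (use g r in auto)
  have "(\<Sum>i<N. r i * (g i - g (Suc i))) \<le> (\<Sum>i<N. R * (g i - g (Suc i)))"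
    by (intro sum_mono mult_right_mono) (use g r in auto)
  also have "\<dots> = R * (g 0 - g N)"
    by (simp add: sum_distrib_left[symmetric] sum_lessThan_telescope')
  also have "\<dots> \<le> R * h"
    using assms(3,4) by (intro mult_left_mono) (auto simp: g_def max_def)
  finally show "step_prim N y r (x + h) - step_prim N y r x \<le> R * h" unfolding eq .
qed

lemma step_prim_lipschitz:
  assumes y: "\<And>i. i < N \<Longrightarrow> y i < y (Suc i)" and r: "\<And>i. i < N \<Longrightarrow> r i \<in> {0..R}" and "0 \<le> R"
  shows "\<bar>step_prim N y r x - step_prim N y r z\<bar> \<le> R * \<bar>x - z\<bar>"
proof (cases "x \<le> z")
  case True
  then show ?thesis using step_prim_increment[of N y r R "z - x" x] y r assms(3) by auto
next
  case False
  then show ?thesis using step_prim_increment[of N y r R "x - z" z] y r assms(3) by auto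
qed

text \<open>The normalized ramp is the distribution function of the uniform law on [a, b]; moving
  both endpoints to the left can only increase it, whatever happens to the length of the
  interval.\<close>

lemma ramp_mono:
  fixes a b a' b' x :: real
  assumes "a < b" "a' < b'" "a' \<le> a" "b' \<le> b"
  shows "(max 0 (x - a) - max 0 (x - b)) / (b - a) \<le> (max 0 (x - a') - max 0 (x - b')) / (b' - a')"
proof -
  consider "x \<le> a" | "b' \<le> x" | "a < x" "x < b'" by linarith
  then show ?thesis
  proof cases
    case 1
    then have "(max 0 (x - a) - max 0 (x - b)) / (b - a) = 0" using assms by auto
    moreover have "0 \<le> (max 0 (x - a') - max 0 (x - b')) / (b' - a')" using assms by auto
    ultimately show ?thesis by linarith
  next
    case 2
    then have "(max 0 (x - a') - max 0 (x - b')) / (b' - a') = 1" using assms by auto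
    moreover have "(max 0 (x - a) - max 0 (x - b)) / (b - a) \<le> 1" using assms by (auto simp: divide_le_eq)
    ultimately show ?thesis by linarith
  next
    case 3
    have "(x - a) * (b' - a') \<le> (x - a') * (b - a)"
    proof -
      have "(x - a') * (b - a) - (x - a) * (b' - a')
          = (a - a') * (b' - x) + (x - a') * (b - b')" by (simp add: algebra_simps)
      moreover have "0 \<le> (a - a') * (b' - x) + (x - a') * (b - b')"
        using 3 assms by (intro add_nonneg_nonneg mult_nonneg_nonneg) auto
      ultimately show ?thesis by linarith
    qed
    then show ?thesis using 3 assms by (simp add: max_def frac_le_eq divide_le_cancel field_simps)
  qed
qed

text \<open>Equal masses are essential: both primitives are \<open>l\<close> times a sum of
  normalized ramps over the same labels, so the configurations can be compared label by label even
  where cells with the same label are disjoint.\<close>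

lemma step_prim_displacement:
  assumes y: "\<And>i. i < N \<Longrightarrow> y i < y (Suc i)" and z: "\<And>i. i < N \<Longrightarrow> z i < z (Suc i)"
    and r: "\<And>i. i < N \<Longrightarrow> r i = l / (y (Suc i) - y i)" "\<And>i. i < N \<Longrightarrow> r i \<le> R"
    and s: "\<And>i. i < N \<Longrightarrow> s i = l / (z (Suc i) - z i)" "\<And>i. i < N \<Longrightarrow> s i \<le> R"
    and d: "\<And>i. i \<le> N \<Longrightarrow> \<bar>y i - z i\<bar> \<le> \<delta>" and "0 \<le> R" "0 \<le> l"
  shows "\<bar>step_prim N y r x - step_prim N z s x\<bar> \<le> R * \<delta>"
proof -
  have one: "step_prim N y r x \<le> step_prim N z s x + R * \<delta>"
    if y: "\<And>i. i < N \<Longrightarrow> y i < y (Suc i)" and z: "\<And>i. i < N \<Longrightarrow> z i < z (Suc i)"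
    and r: "\<And>i. i < N \<Longrightarrow> r i = l / (y (Suc i) - y i)"
    and s: "\<And>i. i < N \<Longrightarrow> s i = l / (z (Suc i) - z i)" "\<And>i. i < N \<Longrightarrow> s i \<le> R"
    and d: "\<And>i. i \<le> N \<Longrightarrow> \<bar>y i - z i\<bar> \<le> \<delta>" for y z r s
  proof -
    have \<delta>: "0 \<le> \<delta>" using d[of 0] by simp
    have "step_prim N y r x = (\<Sum>i<N. l * ((max 0 (x - y i) - max 0 (x - y (Suc i))) / (y (Suc i) - y i)))"
      unfolding step_prim_def by (intro sum.cong refl) (simp add: r)
    \<comment> \<open>Shifting the nodes \<open>z\<close> by \<open>\<delta>\<close> puts each of
      them to the left of its counterpart in \<open>y\<close>. The shifted primitive is that of
      \<open>z\<close> evaluated at \<open>x + \<delta>\<close>, and its Lipschitz constant R turns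
      the shift into \<open>R * \<delta>\<close>.\<close>
    also have "\<dots> \<le> (\<Sum>i<N. l * ((max 0 (x - (z i - \<delta>)) - max 0 (x - (z (Suc i) - \<delta>))) / ((z (Suc i) - \<delta>) - (z i - \<delta>))))"
    proof (intro sum_mono mult_left_mono ramp_mono)
      fix i assume "i \<in> {..<N}"
      then show "y i < y (Suc i)" "z i - \<delta> < z (Suc i) - \<delta>" "z i - \<delta> \<le> y i" "z (Suc i) - \<delta> \<le> y (Suc i)"
        using y[of i] z[of i] d[of i] d[of "Suc i"] by auto
    qed (use assms in auto)
    also have "\<dots> = step_prim N z s (x + \<delta>)"
      unfolding step_prim_def by (intro sum.cong refl) (simp add: s diff_diff_eq2)
    also have "\<dots> \<le> step_prim N z s x + R * \<delta>"
    proof -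
      have "s i \<in> {0..R}" if "i < N" for i
        using s[OF that] z[OF that] assms(9) by auto
      then show ?thesis using step_prim_increment(2)[of N z s R \<delta> x] z \<delta> assms(8) by simp
    qed
    finally show ?thesis .
  qed
  have "step_prim N y r x \<le> step_prim N z s x + R * \<delta>"
    by (rule one) (use assms in auto)
  moreover have "step_prim N z s x \<le> step_prim N y r x + R * \<delta>"
    by (rule one) (use assms in \<open>auto simp: abs_minus_commute\<close>)
  ultimately show ?thesis by linarith
qed

text \<open>The difference quotient of a positive part at scale h is a Heaviside function smeared
  over a window of length h; the two differ only in that window, and by at most 1.\<close>

lemma heaviside_ramp:
  fixes a h x :: real
  assumes "0 < h"
  shows "\<bar>indicator {a..} x - (max 0 (x + h - a) - max 0 (x - a)) / h\<bar> \<le> (indicator {a - h..a} x :: real)"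
proof -
  consider "a \<le> x" | "x < a - h" | "a - h \<le> x" "x < a" by linarith
  then show ?thesis
  proof cases
    case 1
    then have "max 0 (x + h - a) - max 0 (x - a) = h" using assms by simp
    with 1 assms show ?thesis by simp
  next
    case 2
    then have "max 0 (x + h - a) - max 0 (x - a) = 0" using assms by simp
    with 2 assms show ?thesis by simp
  next
    case 3
    then have *: "0 \<le> max 0 (x + h - a) - max 0 (x - a)" "max 0 (x + h - a) - max 0 (x - a) \<le> h" using assms by auto
    then have "(max 0 (x + h - a) - max 0 (x - a)) / h \<le> 1" "0 \<le> (max 0 (x + h - a) - max 0 (x - a)) / h"
      using assms by (simp_all only: divide_le_eq_1_pos divide_nonneg_pos)
    with 3 show ?thesis by simp
  qed
qed

lemma step_fun_difference_quotient:
  assumes y: "\<And>i. i < N \<Longrightarrow> y i < y (Suc i)" and "r N = 0" and "0 < h"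
  shows "\<bar>step_fun N y r x - (step_prim N y r (x + h) - step_prim N y r x) / h\<bar>
    \<le> (\<Sum>j\<le>N. \<bar>jump r j\<bar> * indicator {y j - h..y j} x)"
proof -
  define H where "H j = (indicator {y j..} x :: real)" for j
  define G where "G j = (max 0 (x + h - y j) - max 0 (x - y j)) / h" for j
  have sj: "step_fun N y r x = (\<Sum>j\<le>N. jump r j * H j)"
    unfolding H_def using step_fun_jump[of N y r x, OF y] assms(2) by blast
  have q: "(step_prim N y r (x + h) - step_prim N y r x) / h = (\<Sum>j\<le>N. jump r j * G j)"
    unfolding step_prim_jump[where r = r and N = N, OF assms(2)] G_def
    by (simp add: sum_divide_distrib sum_subtractf right_diff_distrib diff_divide_distrib)
  have eq: "step_fun N y r x - (step_prim N y r (x + h) - step_prim N y r x) / h = (\<Sum>j\<le>N. jump r j * (H j - G j))"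
    unfolding sj q by (simp add: sum_subtractf right_diff_distrib)
  have "\<bar>\<Sum>j\<le>N. jump r j * (H j - G j)\<bar> \<le> (\<Sum>j\<le>N. \<bar>jump r j * (H j - G j)\<bar>)"
    by (rule sum_abs)
  moreover have "(\<Sum>j\<le>N. \<bar>jump r j * (H j - G j)\<bar>) \<le> (\<Sum>j\<le>N. \<bar>jump r j\<bar> * indicator {y j - h..y j} x)"
    unfolding abs_mult H_def G_def by (intro sum_mono mult_left_mono heaviside_ramp assms) auto
  ultimately show ?thesis unfolding eq by (rule order_trans)
qed

lemma integrable_bounded_box:
  fixes f :: "'a::euclidean_space \<Rightarrow> real"
  assumes "f \<in> borel_measurable borel" "\<And>x. \<bar>f x\<bar> \<le> B" "\<And>x. x \<notin> cbox a b \<Longrightarrow> f x = 0"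
  shows "integrable lborel f"
  by (rule integrableI_bounded_set[where A = "cbox a b" and B = B])
     (use assms in \<open>auto simp: emeasure_lborel_cbox_finite less_top[symmetric] emeasure_lborel_cbox_eq\<close>)

lemma integrable_bounded_interval:
  fixes f :: "real \<Rightarrow> real"
  assumes "f \<in> borel_measurable borel" "\<And>x. \<bar>f x\<bar> \<le> B" "\<And>x. x \<notin> {a..b} \<Longrightarrow> f x = 0"
  shows "integrable lborel f"
  by (rule integrable_bounded_box[of f B a b]) (use assms in auto)

text \<open>Interpolation between uniform closeness of the primitives and bounded variation.
  Replacing a density by the difference quotient of its primitive at scale h costs h times its
  variation, and two such quotients differ by at most \<open>2 * e / h\<close>. The scale stays
  free: it is made small first, and then e small compared with it.\<close>

lemma step_fun_L1_diff:
  assumes y: "\<And>i. i < N \<Longrightarrow> y i < y (Suc i)" "r N = 0" "\<And>i. i < N \<Longrightarrow> r i \<in> {0..R}"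
    and z: "\<And>i. i < K \<Longrightarrow> z i < z (Suc i)" "s K = 0" "\<And>i. i < K \<Longrightarrow> s i \<in> {0..R}"
    and AB: "A \<le> y 0" "y N \<le> B" "A \<le> z 0" "z K \<le> B" "A \<le> B"
    and e: "\<And>x. \<bar>step_prim N y r x - step_prim K z s x\<bar> \<le> e" and "0 < h" "0 \<le> R"
  shows "(\<integral>x. \<bar>step_fun N y r x - step_fun K z s x\<bar> \<partial>lborel)
     \<le> h * ((\<Sum>j\<le>N. \<bar>jump r j\<bar>) + (\<Sum>j\<le>K. \<bar>jump s j\<bar>)) + (B - A) * (2 * e / h)"
proof -
  let ?g = "\<lambda>x. (\<Sum>j\<le>N. \<bar>jump r j\<bar> * indicator {y j - h..y j} x)
       + (\<Sum>j\<le>K. \<bar>jump s j\<bar> * indicator {z j - h..z j} x) + 2 * e / h * indicator {A..B} x"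
  have zero: "step_fun N y r x - step_fun K z s x = 0" if "x \<notin> {A..B}" for x
    using step_fun_outside[of N y x r] step_fun_outside[of K z x s] y z AB that by auto
  have bnd: "\<bar>step_fun N y r x - step_fun K z s x\<bar> \<le> R" for x
    using step_fun_range[of N y r R x] step_fun_range[of K z s R x] y z assms(14) by auto
  have e0: "0 \<le> e" using e[of 0] by linarith
  have le: "\<bar>step_fun N y r x - step_fun K z s x\<bar> \<le> ?g x" for x
  proof (cases "x \<in> {A..B}")
    case True
    have q: "\<bar>(step_prim N y r (x + h) - step_prim N y r x) / h - (step_prim K z s (x + h) - step_prim K z s x) / h\<bar> \<le> 2 * e / h"
    proof -
      have "\<bar>(step_prim N y r (x + h) - step_prim N y r x) - (step_prim K z s (x + h) - step_prim K z s x)\<bar> \<le> 2 * e"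
        using e[of x] e[of "x + h"] by linarith
      then show ?thesis using assms(13) by (simp add: diff_divide_distrib[symmetric] divide_right_mono)
    qed
    show ?thesis
      using step_fun_difference_quotient[of N y r h x] step_fun_difference_quotient[of K z s h x] q True y z assms(13)
      by simp
  next
    case False
    have "0 \<le> (\<Sum>j\<le>N. \<bar>jump r j\<bar> * indicator {y j - h..y j} x)" "0 \<le> (\<Sum>j\<le>K. \<bar>jump s j\<bar> * indicator {z j - h..z j} x)"
      by (auto intro!: sum_nonneg)
    then show ?thesis using False zero[OF False] by simp
  qed
  have int1: "integrable lborel (\<lambda>x. \<bar>step_fun N y r x - step_fun K z s x\<bar>)"
    by (rule integrable_bounded_interval[of _ R A B]) (use bnd zero in auto)
  have ind: "has_bochner_integral lborel (indicator {a..b}) (b - a)" if "a \<le> b" for a b :: real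
    using has_bochner_integral_real_indicator[of "{a..b}" lborel] that by simp
  have "has_bochner_integral lborel ?g ((\<Sum>j\<le>N. \<bar>jump r j\<bar> * (y j - (y j - h))) + (\<Sum>j\<le>K. \<bar>jump s j\<bar> * (z j - (z j - h)))
      + 2 * e / h * (B - A))"
    by (intro has_bochner_integral_add has_bochner_integral_sum has_bochner_integral_mult_right ind)
       (use assms(13) AB in auto)
  then have int2: "integrable lborel ?g"
    and val: "(\<integral>x. ?g x \<partial>lborel) = (\<Sum>j\<le>N. \<bar>jump r j\<bar> * h) + (\<Sum>j\<le>K. \<bar>jump s j\<bar> * h) + 2 * e / h * (B - A)"
    by (simp_all add: has_bochner_integral_iff)
  have "(\<integral>x. \<bar>step_fun N y r x - step_fun K z s x\<bar> \<partial>lborel) \<le> (\<integral>x. ?g x \<partial>lborel)"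
    by (intro integral_mono int1 int2 le)
  also have "\<dots> = (\<Sum>j\<le>N. \<bar>jump r j\<bar> * h) + (\<Sum>j\<le>K. \<bar>jump s j\<bar> * h) + 2 * e / h * (B - A)"
    by (rule val)
  finally have "(\<integral>x. \<bar>step_fun N y r x - step_fun K z s x\<bar> \<partial>lborel)
     \<le> (\<Sum>j\<le>N. \<bar>jump r j\<bar> * h) + (\<Sum>j\<le>K. \<bar>jump s j\<bar> * h) + 2 * e / h * (B - A)" .
  moreover have "(\<Sum>j\<le>N. \<bar>jump r j\<bar> * h) + (\<Sum>j\<le>K. \<bar>jump s j\<bar> * h) = h * ((\<Sum>j\<le>N. \<bar>jump r j\<bar>) + (\<Sum>j\<le>K. \<bar>jump s j\<bar>))"
    by (simp add: sum_distrib_right[symmetric] distrib_left mult.commute[of h])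
  moreover have "2 * e / h * (B - A) = (B - A) * (2 * e / h)" by (rule mult.commute)
  ultimately show ?thesis by linarith
qed

text \<open>Through its jumps the function is a combination of Heaviside functions, and translating
  one of these by h changes it by exactly \<open>\<bar>h\<bar>\<close> in L1.\<close>

lemma step_fun_translation:
  assumes y: "\<And>i. i < N \<Longrightarrow> y i < y (Suc i)" "r N = 0"
  shows "(\<integral>x. \<bar>step_fun N y r (x + h) - step_fun N y r x\<bar> \<partial>lborel) \<le> \<bar>h\<bar> * (\<Sum>j\<le>N. \<bar>jump r j\<bar>)"
proof -
  let ?I = "\<lambda>j. {y j - \<bar>h\<bar>..y j + \<bar>h\<bar>}"
  let ?d = "\<lambda>j x. \<bar>indicator {y j..} (x + h) - indicator {y j..} x\<bar> :: real"
  have d: "?d j = indicator (if 0 \<le> h then {y j - h..<y j} else {y j..<y j - h})" for j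
    by (auto simp: indicator_def fun_eq_iff)
  have intd: "integrable lborel (?d j)" and vald: "(\<integral>x. ?d j x \<partial>lborel) = \<bar>h\<bar>" for j
    unfolding d by (auto simp: less_top[symmetric])
  have le: "\<bar>step_fun N y r (x + h) - step_fun N y r x\<bar> \<le> (\<Sum>j\<le>N. \<bar>jump r j\<bar> * ?d j x)" for x
    by (simp only: step_fun_jump[of N y r, OF y] sum_subtractf[symmetric] right_diff_distrib[symmetric] abs_mult[symmetric])
       (rule sum_abs)
  have int2: "integrable lborel (\<lambda>x. \<Sum>j\<le>N. \<bar>jump r j\<bar> * ?d j x)"
    by (intro Bochner_Integration.integrable_sum integrable_mult_right intd)
  have "(\<integral>x. \<bar>step_fun N y r (x + h) - step_fun N y r x\<bar> \<partial>lborel) \<le> (\<integral>x. (\<Sum>j\<le>N. \<bar>jump r j\<bar> * ?d j x) \<partial>lborel)"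
    by (rule integral_mono[OF _ int2 le], rule Bochner_Integration.integrable_bound[OF int2])
       (use le in \<open>auto intro!: AE_I2 order_trans[OF le]\<close>)
  also have "\<dots> = (\<Sum>j\<le>N. \<bar>jump r j\<bar> * \<bar>h\<bar>)"
    by (subst Bochner_Integration.integral_sum) (auto intro!: integrable_mult_right intd simp: vald)
  finally show ?thesis by (simp add: sum_distrib_left mult.commute)
qed

section \<open>The particle scheme\<close>

locale velocity =
  fixes R :: real and v v' :: "real \<Rightarrow> real"
  assumes R_pos: "0 < R"
    and v_deriv: "\<And>r. r \<in> {0..R} \<Longrightarrow> (v has_real_derivative v' r) (at r within {0..R})"
    and v'_cont: "continuous_on {0..R} v'"
    and v'_neg: "\<And>r. r \<in> {0..R} \<Longrightarrow> v' r < 0"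
begin

definition Lv :: real where "Lv = lip_const v {0..R}"

text \<open>Since \<open>v\<close> decreases, its endpoint values bound its modulus on [0, R]; this
  is the maximal particle speed.\<close>

definition Vm :: real where "Vm = max \<bar>v 0\<bar> \<bar>v R\<bar>"

lemma v_cont: "continuous_on {0..R} v"
  by (rule DERIV_continuous_on[of _ _ v']) (rule v_deriv)

lemma v_less:
  assumes "0 \<le> a" "a < b" "b \<le> R"
  shows "v b < v a"
proof (rule DERIV_neg_imp_decreasing_open[OF assms(2)])
  fix x assume *: "a < x" "x < b"
  then have x: "x \<in> {0<..<R}" using assms by auto
  then have "(v has_real_derivative v' x) (at x)"
    using v_deriv[of x] by (simp add: at_within_Icc_at)
  then show "\<exists>y. (v has_real_derivative y) (at x) \<and> y < 0" using v'_neg[of x] x by auto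
next
  show "continuous_on {a..b} v" by (rule continuous_on_subset[OF v_cont]) (use assms in auto)
qed

lemma v_le: "0 \<le> a \<Longrightarrow> a \<le> b \<Longrightarrow> b \<le> R \<Longrightarrow> v b \<le> v a"
  using v_less[of a b] by (cases "a = b") auto

lemma v_bound: "r \<in> {0..R} \<Longrightarrow> \<bar>v r\<bar> \<le> Vm"
  using v_le[of 0 r] v_le[of r R] by (auto simp: Vm_def)

lemma Vm_nonneg: "0 \<le> Vm" by (auto simp: Vm_def)

lemma v_lipschitz_ex: "\<exists>C. C-lipschitz_on {0..R} v"
proof -
  have "compact (v' ` {0..R})" by (intro compact_continuous_image v'_cont) auto
  then obtain C where C: "\<And>x. x \<in> {0..R} \<Longrightarrow> \<bar>v' x\<bar> \<le> C"
    using compact_imp_bounded bounded_pos by (metis (no_types, lifting) imageI real_norm_def)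
  have "\<bar>C\<bar>-lipschitz_on {0..R} v"
  proof (intro lipschitz_onI)
    fix x y assume "x \<in> {0..R}" "y \<in> {0..R}"
    then show "dist (v x) (v y) \<le> \<bar>C\<bar> * dist x y"
      unfolding dist_norm
      by (intro field_differentiable_bound[of "{0..R}" v v']) (use v_deriv C in \<open>force intro: order_trans[OF _ abs_ge_self]\<close>)+
  qed auto
  then show ?thesis by blast
qed

lemma v_lip:
  assumes "a \<in> {0..R}" "b \<in> {0..R}"
  shows "\<bar>v a - v b\<bar> \<le> Lv * \<bar>a - b\<bar>"
proof (cases "a = b")
  case False
  have "\<bar>v a - v b\<bar> / \<bar>a - b\<bar> \<le> Lv"
    unfolding Lv_def lip_const_def
  \<comment> \<open>Every difference quotient is a lower bound of the set of Lipschitz constants, so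
    the infimum is itself a Lipschitz constant; the set has to be nonempty for the infimum to mean
    anything.\<close>
  proof (rule cInf_greatest)
    show "{C. C-lipschitz_on {0..R} v} \<noteq> {}" using v_lipschitz_ex by auto
    fix C assume "C \<in> {C. C-lipschitz_on {0..R} v}"
    then have "\<bar>v a - v b\<bar> \<le> C * \<bar>a - b\<bar>" using lipschitz_onD[of C "{0..R}" v a b] assms by (auto simp: dist_real_def)
    then show "\<bar>v a - v b\<bar> / \<bar>a - b\<bar> \<le> C" using False by (simp add: divide_le_eq)
  qed
  then show ?thesis using False by (simp add: divide_le_eq)
qed simp

lemma Lv_pos: "0 < Lv"
proof -
  have "0 < \<bar>v 0 - v R\<bar>" using v_less[of 0 R] R_pos by simp
  also have "\<dots> \<le> Lv * \<bar>0 - R\<bar>" using v_lip[of 0 R] R_pos by simp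
  finally show ?thesis using R_pos by (simp add: zero_less_mult_iff)
qed

text \<open>Once the particle ahead is placed, the implicit update of a particle becomes an equation
  \<open>spacing_fun l c d = b\<close> for the distance d between the two, with
  \<open>c = \<tau> * (1 - \<theta>)\<close>. As \<open>v\<close> decreases, the left side increases
  strictly in d on the range of admissible distances.\<close>

definition spacing_fun :: "real \<Rightarrow> real \<Rightarrow> real \<Rightarrow> real" where
  "spacing_fun l c d = d + c * v (l / d)"

lemma spacing_density: "0 < l \<Longrightarrow> l / R \<le> d \<Longrightarrow> 0 < d \<and> l / d \<in> {0<..R}"
proof -
  assume *: "0 < l" "l / R \<le> d"
  then have "0 < l / R" using R_pos by simp
  then have "0 < d" using * by linarith
  then show ?thesis using * R_pos by (auto simp: field_simps)
qed

lemma spacing_fun_strict: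
  assumes "0 < l" "0 \<le> c" "l / R \<le> a" "a < b"
  shows "spacing_fun l c a < spacing_fun l c b"
proof -
  have "v (l / a) \<le> v (l / b)"
    using spacing_density[of l a] spacing_density[of l b] assms by (intro v_le) (auto simp: frac_le)
  then show ?thesis using assms by (auto simp: spacing_fun_def intro: add_less_le_mono mult_left_mono)
qed

lemma spacing_fun_solve:
  assumes "0 < l" "0 \<le> c" "l / R + c * v R \<le> b"
  shows "\<exists>d \<ge> l / R. spacing_fun l c d = b"
proof -
  \<comment> \<open>Right end for the intermediate value theorem: \<open>D \<ge> b - c * v R\<close>
    and \<open>v (l / D) \<ge> v R\<close>, so the function is at least b there.\<close>
  define D where "D = max (l / R) (b - c * v R)"
  have lR: "0 < l / R" using assms R_pos by simp
  have "l / D \<in> {0..R}" using spacing_density[of l D] assms(1) by (auto simp: D_def)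
  then have "c * v R \<le> c * v (l / D)" using v_le[of "l / D" R] assms(2) by (intro mult_left_mono) auto
  then have 2: "b \<le> spacing_fun l c D" by (auto simp: spacing_fun_def D_def)
  have "continuous_on {l / R..D} (\<lambda>d. v (l / d))"
    by (rule continuous_on_compose2[OF v_cont])
       (use spacing_density[of l] assms(1) lR in \<open>force intro!: continuous_intros\<close>)+
  then have 3: "continuous_on {l / R..D} (spacing_fun l c)"
    unfolding spacing_fun_def[abs_def] by (intro continuous_intros)
  have 1: "spacing_fun l c (l / R) \<le> b" using assms R_pos by (simp add: spacing_fun_def)
  show ?thesis using IVT'[OF 1 2 _ 3] by (auto simp: D_def)
qed

definition admissible :: "real \<Rightarrow> nat \<Rightarrow> (nat \<Rightarrow> real) \<Rightarrow> bool" where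
  "admissible l N y \<longleftrightarrow> (\<forall>i<N. y i < y (Suc i) \<and> local_density l N y i \<le> R)"

text \<open>For i = N both local densities are 0, so the leading particle moves with the free speed
  \<open>v 0\<close>.\<close>

definition one_step :: "real \<Rightarrow> nat \<Rightarrow> real \<Rightarrow> real \<Rightarrow> (nat \<Rightarrow> real) \<Rightarrow> (nat \<Rightarrow> real) \<Rightarrow> bool" where
  "one_step l N \<tau> \<theta> y z \<longleftrightarrow> (\<forall>i\<le>N. z i = y i +
     \<tau> * (\<theta> * v (local_density l N y i) + (1 - \<theta>) * v (local_density l N z i)))"

lemma admissible_density:
  assumes "admissible l N y" "0 < l"
  shows "local_density l N y i \<in> {0..R}"
  using assms R_pos by (cases "i < N") (auto simp: admissible_def local_density_def intro!: divide_nonneg_pos)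

lemma admissible_spacing:
  assumes "admissible l N y" "0 < l" "i < N"
  shows "l / R \<le> y (Suc i) - y i"
proof -
  have "y i < y (Suc i)" "l / (y (Suc i) - y i) \<le> R"
    using assms by (auto simp: admissible_def local_density_def)
  then show ?thesis using R_pos by (simp add: field_simps)
qed

text \<open>Particles are placed from the leader backwards, because the new position of a particle
  involves only old data and the new position of the particle ahead. The CFL condition gives the
  spacing equation a root of size at least \<open>l / R\<close>, that is, with density at most
  R.\<close>

lemma one_step_exists:
  assumes y: "admissible l N y" and l: "0 < l" and \<tau>: "0 \<le> \<tau>" and \<theta>: "\<theta> \<in> {0..1}"
    and cfl: "\<theta> * \<tau> * Lv * R^2 \<le> l"
  shows "\<exists>z. admissible l N z \<and> one_step l N \<tau> \<theta> y z"
proof -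
  \<comment> \<open>\<open>P n z\<close> says that the last n + 1 particles are placed correctly;
    the entries of \<open>z\<close> below \<open>N - n\<close> are arbitrary.\<close>
  define P where "P n z \<longleftrightarrow> (\<forall>i<N. N - n \<le> i \<longrightarrow> z i < z (Suc i) \<and> local_density l N z i \<le> R) \<and>
     (\<forall>i\<le>N. N - n \<le> i \<longrightarrow> z i = y i + \<tau> * (\<theta> * v (local_density l N y i) + (1 - \<theta>) * v (local_density l N z i)))"
    for n z
  define c where "c = \<tau> * (1 - \<theta>)"
  have c: "0 \<le> c" using \<tau> \<theta> by (simp add: c_def)
  have "\<exists>z. P n z" if "n \<le> N" for n
    using that
  proof (induction n)
    case 0
    show ?case
      by (rule exI[of _ "\<lambda>i. y i + \<tau> * (\<theta> * v (local_density l N y i) + (1 - \<theta>) * v 0)"])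
         (auto simp: P_def local_density_def)
  next
    case (Suc n)
    then obtain z where z: "P n z" by auto
    define i where "i = N - Suc n"
    have i: "i < N" "Suc i = N - n" using Suc.prems by (auto simp: i_def)
    define r where "r = local_density l N y i"
    define r1 where "r1 = local_density l N y (Suc i)"
    define s1 where "s1 = local_density l N z (Suc i)"
    have r: "r \<in> {0..R}" and r1: "r1 \<in> {0..R}" using admissible_density[OF y l] by (auto simp: r_def r1_def)
    have rpos: "0 < r" using y l i by (auto simp: r_def admissible_def local_density_def)
    have d: "y (Suc i) - y i = l / r"
      using y l i by (auto simp: r_def local_density_def admissible_def)
    have s1: "s1 \<in> {0..R}"
    proof (cases "Suc i < N")
      case True
      then show ?thesis using z i l by (auto simp: s1_def P_def local_density_def intro!: divide_nonneg_pos)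
    qed (use R_pos in \<open>simp add: s1_def local_density_def\<close>)
    have zS: "z (Suc i) = y (Suc i) + \<tau> * (\<theta> * v r1 + (1 - \<theta>) * v s1)"
      using z i unfolding P_def s1_def r1_def by auto
    \<comment> \<open>The spacing equation is solvable if the gap left by the explicit part is large
      enough. The explicit part shrinks the gap by at most
      \<open>\<tau> * \<theta> * Lv * (R - r)\<close>, and CFL together with
      \<open>r \<le> R\<close> bounds this by \<open>l / r - l / R\<close>, the excess of the old
      gap over the smallest admissible one.\<close>
    have "v r - v r1 \<le> v r - v R" using v_le[of r1 R] r1 by simp
    also have "\<dots> \<le> Lv * (R - r)" using v_lip[of r R] r R_pos by auto
    finally have 1: "\<tau> * \<theta> * (v r - v r1) \<le> \<tau> * \<theta> * (Lv * (R - r))"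
      using \<tau> \<theta> by (intro mult_left_mono) auto
    have "\<tau> * \<theta> * (Lv * (R - r)) = \<theta> * \<tau> * Lv * R^2 * ((R - r) / R^2)"
      using R_pos by (simp add: field_simps)
    also have "\<dots> \<le> l * ((R - r) / R^2)" using cfl r by (intro mult_right_mono) auto
    also have "\<dots> \<le> l * ((R - r) / (r * R))"
      using r rpos l by (intro mult_left_mono divide_left_mono) (auto simp: power2_eq_square)
    also have "\<dots> = l / r - l / R" using rpos R_pos by (simp add: field_simps)
    finally have 2: "\<tau> * \<theta> * (Lv * (R - r)) \<le> l / r - l / R" .
    have "c * v R \<le> c * v s1" using v_le[of s1 R] s1 c by (intro mult_left_mono) auto
    then have "l / R + c * v R \<le> z (Suc i) - y i - \<tau> * \<theta> * v r"
      using 1 2 d by (simp add: zS c_def algebra_simps)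
    then obtain e where e: "l / R \<le> e" "spacing_fun l c e = z (Suc i) - y i - \<tau> * \<theta> * v r"
      using spacing_fun_solve[OF l c] by blast
    have e0: "0 < e" "l / e \<in> {0<..R}" using spacing_density[OF l e(1)] by auto
    \<comment> \<open>Only entry i changes, and the densities with index above i do not involve
      it.\<close>
    define z' where "z' = z(i := z (Suc i) - e)"
    have ld: "local_density l N z' j = (if j = i then l / e else local_density l N z j)" if "i \<le> j" for j
      using i that by (auto simp: local_density_def z'_def)
    have "P (Suc n) z'"
      unfolding P_def
    proof (intro conjI allI impI)
      fix j assume j: "j < N" "N - Suc n \<le> j"
      have "z' j < z' (Suc j)" "local_density l N z' j \<le> R"
        using ld[of j] z j e0 i by (cases "j = i"; force simp: z'_def P_def i_def)+
      then show "z' j < z' (Suc j)" "local_density l N z' j \<le> R" by auto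
    next
      fix j assume j: "j \<le> N" "N - Suc n \<le> j"
      show "z' j = y j + \<tau> * (\<theta> * v (local_density l N y j) + (1 - \<theta>) * v (local_density l N z' j))"
      proof (cases "j = i")
        case True
        then show ?thesis
          using ld[of j] e(2) by (simp add: z'_def spacing_fun_def r_def c_def algebra_simps)
      next
        case False
        then have "N - n \<le> j" using j i by (auto simp: i_def)
        then show ?thesis using False ld[of j] z j i by (auto simp: z'_def P_def i_def)
      qed
    qed
    then show ?case by blast
  qed
  from this[of N] obtain z where "P N z" by auto
  then show ?thesis unfolding P_def admissible_def one_step_def by auto
qed

text \<open>Uniqueness descends from the leader: at each particle the gap to the one ahead solves
  the same spacing equation in both configurations, and the spacing function is strictly
  increasing.\<close>

lemma one_step_unique:
  assumes z: "admissible l N z" "one_step l N \<tau> \<theta> y z" and w: "admissible l N w" "one_step l N \<tau> \<theta> y' w"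
    and y: "\<And>i. i \<le> N \<Longrightarrow> y i = y' i" and l: "0 < l" and \<tau>: "0 \<le> \<tau>" and \<theta>: "\<theta> \<in> {0..1}"
    and "i \<le> N"
  shows "z i = w i"
  using assms(9)
proof (induction "N - i" arbitrary: i)
  case 0
  then have [simp]: "i = N" by simp
  have "local_density l N u N = 0" for u by (simp add: local_density_def)
  then show ?case using z(2) w(2) y[of N] unfolding one_step_def by (metis \<open>i = N\<close> order_refl)
next
  case (Suc n)
  then have i: "i < N" and IH: "z (Suc i) = w (Suc i)" by auto
  define c where "c = \<tau> * (1 - \<theta>)"
  have c: "0 \<le> c" using \<tau> \<theta> by (simp add: c_def)
  have ld: "local_density l N y i = local_density l N y' i" using i y by (auto simp: local_density_def)
  have sp: "spacing_fun l c (z (Suc i) - z i) = z (Suc i) - (y i + \<tau> * \<theta> * v (local_density l N y i))"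
    if "one_step l N \<tau> \<theta> y z" for y z
  proof -
    have "z i = y i + \<tau> * (\<theta> * v (local_density l N y i) + (1 - \<theta>) * v (l / (z (Suc i) - z i)))"
      using that i unfolding one_step_def by (metis less_imp_le local_density_def)
    then show ?thesis unfolding spacing_fun_def c_def by (simp add: algebra_simps)
  qed
  have "spacing_fun l c (z (Suc i) - z i) = spacing_fun l c (w (Suc i) - w i)"
    using sp[OF z(2)] sp[OF w(2)] IH ld y[of i] i by simp
  then have "z (Suc i) - z i = w (Suc i) - w i"
    using spacing_fun_strict[OF l c admissible_spacing[OF z(1) l i]] spacing_fun_strict[OF l c admissible_spacing[OF w(1) l i]]
    by (metis less_irrefl linorder_neqE_linordered_idom)
  then show ?case using IH by simp
qed

lemma is_particle_scheme_iff:
  assumes "l = (LINT y|lebesgue. \<bar>\<rho>\<^sub>0 y\<bar>) / real N" and "0 < l"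
  shows "is_particle_scheme R v \<rho>\<^sub>0 T \<theta> M N x \<longleftrightarrow>
    (\<forall>i\<le>N. x 0 i = initial_position \<rho>\<^sub>0 l i) \<and> (\<forall>m\<le>M. admissible l N (x m)) \<and>
    (\<forall>m<M. one_step l N (T / real M) \<theta> (x m) (x (Suc m)))"
proof -
  have "(\<forall>m\<le>M. admissible l N (x m)) \<longleftrightarrow>
     (\<forall>m\<le>M. \<forall>i<N. x m i < x m (Suc i)) \<and> (\<forall>m\<le>M. \<forall>i\<le>N. local_density l N (x m) i \<in> {0..R})"
  proof (intro iffI conjI allI impI)
    fix m i assume "\<forall>m\<le>M. admissible l N (x m)" "m \<le> M"
    then show "local_density l N (x m) i \<in> {0..R}" using admissible_density[OF _ assms(2)] by auto
  qed (auto simp: admissible_def)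
  then show ?thesis unfolding is_particle_scheme_def Let_def one_step_def assms(1)[symmetric] by auto
qed

lemma particle_positions_scheme:
  assumes l: "l = (LINT y|lebesgue. \<bar>\<rho>\<^sub>0 y\<bar>) / real N" "0 < l"
    and init: "admissible l N (initial_position \<rho>\<^sub>0 l)"
    and \<tau>: "0 \<le> T" and \<theta>: "\<theta> \<in> {0..1}" and cfl: "\<theta> * (T / real M) * Lv * R^2 \<le> l"
  shows "is_particle_scheme R v \<rho>\<^sub>0 T \<theta> M N (particle_positions R v \<rho>\<^sub>0 T \<theta> M N)"
proof -
  note iff = is_particle_scheme_iff[OF l]
  have \<tau>': "0 \<le> T / real M" using \<tau> by simp
  obtain f where f: "\<And>m. admissible l N (f m) \<and> (m = 0 \<longrightarrow> f m = initial_position \<rho>\<^sub>0 l)"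
     "\<And>m. one_step l N (T / real M) \<theta> (f m) (f (Suc m))"
    using dependent_nat_choice[of "\<lambda>m y. admissible l N y \<and> (m = 0 \<longrightarrow> y = initial_position \<rho>\<^sub>0 l)"
        "\<lambda>m y z. one_step l N (T / real M) \<theta> y z"] init one_step_exists[OF _ l(2) \<tau>' \<theta> cfl]
    by (metis nat.distinct(1))
  \<comment> \<open>Zeros outside the index range single out one function, as the definite
    description of the positions requires.\<close>
  define x where "x m i = (if m > M \<or> i > N then 0 else f m i)" for m i
  have ld: "local_density l N (x m) i = local_density l N (f m) i" if "m \<le> M" for m i
    using that by (auto simp: x_def local_density_def)
  have x: "is_particle_scheme R v \<rho>\<^sub>0 T \<theta> M N x"
    unfolding iff
  proof (intro conjI allI impI)
    fix m assume "m \<le> M"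
    then show "admissible l N (x m)" using f(1)[of m] ld[of m] by (auto simp: admissible_def) (auto simp: x_def)
  next
    fix m assume "m < M"
    then show "one_step l N (T / real M) \<theta> (x m) (x (Suc m))"
      using f(2)[of m] ld[of m] ld[of "Suc m"] by (auto simp: one_step_def) (auto simp: x_def)
  qed (use f(1)[of 0] in \<open>auto simp: x_def\<close>)
  have ex: "is_particle_scheme R v \<rho>\<^sub>0 T \<theta> M N x \<and> (\<forall>m i. m > M \<or> i > N \<longrightarrow> x m i = 0)"
    using x by (auto simp: x_def)
  have uniq: "y = x" if y: "is_particle_scheme R v \<rho>\<^sub>0 T \<theta> M N y \<and> (\<forall>m i. m > M \<or> i > N \<longrightarrow> y m i = 0)" for y
  proof -
    have "\<forall>i\<le>N. y m i = x m i" if "m \<le> M" for m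
      using that
    proof (induction m)
      case 0
      then show ?case using x y unfolding iff by auto
    next
      case (Suc m)
      then show ?case using x y unfolding iff
        by (intro allI impI one_step_unique[of l N "y (Suc m)" "T / real M" \<theta> "y m" "x (Suc m)" "x m"])
           (use l \<tau>' \<theta> in auto)
    qed
    then show ?thesis using y ex by (metis (no_types, lifting) ext not_le)
  qed
  show ?thesis
    unfolding particle_positions_def using theI[of "\<lambda>x. is_particle_scheme R v \<rho>\<^sub>0 T \<theta> M N x \<and> (\<forall>m i. m > M \<or> i > N \<longrightarrow> x m i = 0)" x] ex uniq
    by blast
qed

end

section \<open>Estimates for one time step\<close>

lemma continuous_antiderivative:
  fixes f :: "real \<Rightarrow> real"
  assumes "continuous_on UNIV f"
  obtains F where "\<And>x. (F has_real_derivative f x) (at x)"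
proof -
  have "isCont f x" for x using assms by (simp add: continuous_on_eq_continuous_at)
  then obtain F where "\<forall>x. - \<infinity> < ereal x \<longrightarrow> ereal x < \<infinity> \<longrightarrow> (F has_vector_derivative f x) (at x)"
    using einterval_antiderivative[of "- \<infinity>" \<infinity> f] by auto
  then show ?thesis by (intro that[of F]) (simp add: has_real_derivative_iff_has_vector_derivative)
qed

text \<open>\<open>g 0 = 0\<close> makes the composition vanish outside the particles, so it is
  again a step function on the same cells. For this reason the entropy is later taken as
  \<open>\<bar>r - k\<bar> - k\<close>, which vanishes at r = 0 when
  \<open>k \<ge> 0\<close>.\<close>

lemma step_fun_comp:
  fixes g :: "real \<Rightarrow> real"
  assumes y: "\<And>i. i < N \<Longrightarrow> y i < y (Suc i)" and "g 0 = 0"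
  shows "g (step_fun N y r x) = (\<Sum>i<N. g (r i) * indicator {y i..<y (Suc i)} x)"
proof (cases "y 0 \<le> x \<and> x < y N")
  case True
  then obtain i where i: "i < N" "y i \<le> x" "x < y (Suc i)" using node_cell by blast
  then show ?thesis
    using step_fun_cell[of N y i x r, OF y i] step_fun_cell[of N y i x "\<lambda>i. g (r i)", OF y i]
    by (simp add: step_fun_def)
next
  case False
  then have "x < y 0 \<or> y N \<le> x" by auto
  then show ?thesis
    using step_fun_outside[of N y x r, OF y] step_fun_outside[of N y x "\<lambda>i. g (r i)", OF y] assms(2)
    by (simp add: step_fun_def)
qed

lemma step_fun_integral:
  assumes y: "\<And>i. i < N \<Longrightarrow> y i < y (Suc i)" and g: "g 0 = (0::real)"
    and F: "\<And>x. (F has_real_derivative \<psi> x) (at x)" and \<psi>: "continuous_on UNIV \<psi>"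
  shows "has_bochner_integral lborel (\<lambda>x. g (step_fun N y r x) * \<psi> x) (\<Sum>i<N. g (r i) * (F (y (Suc i)) - F (y i)))"
proof -
  have [measurable]: "\<psi> \<in> borel_measurable borel" using \<psi> by (rule borel_measurable_continuous_onI)
  have "has_bochner_integral lborel (\<lambda>x. \<Sum>i<N. g (r i) * (indicator {y i..<y (Suc i)} x * \<psi> x))
      (\<Sum>i<N. g (r i) * (F (y (Suc i)) - F (y i)))"
  proof (intro has_bochner_integral_sum has_bochner_integral_mult_right)
    fix i assume "i \<in> {..<N}"
    then have le: "y i \<le> y (Suc i)" using y[of i] by simp
    have "has_bochner_integral lborel (\<lambda>x. \<psi> x * indicator {y i..y (Suc i)} x) (F (y (Suc i)) - F (y i))"
      by (rule has_bochner_integral_FTC_Icc_real[OF le F]) (use \<psi> in \<open>simp add: continuous_on_eq_continuous_at\<close>)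
    moreover have "AE x in lborel. \<psi> x * indicator {y i..y (Suc i)} x = indicator {y i..<y (Suc i)} x * \<psi> x"
      using AE_lborel_singleton[of "y (Suc i)"] by eventually_elim (auto simp: indicator_def)
    ultimately show "has_bochner_integral lborel (\<lambda>x. indicator {y i..<y (Suc i)} x * \<psi> x) (F (y (Suc i)) - F (y i))"
      using has_bochner_integral_cong_AE[of "\<lambda>x. \<psi> x * indicator {y i..y (Suc i)} x" lborel "\<lambda>x. indicator {y i..<y (Suc i)} x * \<psi> x"]
      by auto
  qed
  then show ?thesis by (simp only: step_fun_comp[of N y g r, OF y g] sum_distrib_right mult.assoc)
qed

section \<open>Lipschitz bounds for the flux and the Kruzkov entropy flux\<close>

context velocity
begin

definition flux :: "real \<Rightarrow> real" where "flux r = r * v r"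

definition eflux :: "real \<Rightarrow> real \<Rightarrow> real" where "eflux k r = sgn (r - k) * (flux r - flux k)"

definition Lf :: real where "Lf = Vm + R * Lv"

lemma Lf_nonneg: "0 \<le> Lf" using Vm_nonneg R_pos Lv_pos by (simp add: Lf_def)

lemma flux_lip:
  assumes "a \<in> {0..R}" "b \<in> {0..R}"
  shows "\<bar>flux a - flux b\<bar> \<le> Lf * \<bar>a - b\<bar>"
proof -
  have "flux a - flux b = (a - b) * v a + b * (v a - v b)" by (simp add: flux_def algebra_simps)
  then have "\<bar>flux a - flux b\<bar> \<le> \<bar>a - b\<bar> * \<bar>v a\<bar> + \<bar>b\<bar> * \<bar>v a - v b\<bar>"
    by (metis abs_mult abs_triangle_ineq)
  also have "\<dots> \<le> \<bar>a - b\<bar> * Vm + R * (Lv * \<bar>a - b\<bar>)"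
    using assms v_bound v_lip[OF assms] by (intro add_mono mult_mono) auto
  finally show ?thesis by (simp add: Lf_def algebra_simps)
qed

lemma eflux_lip:
  assumes "a \<in> {0..R}" "b \<in> {0..R}" "k \<in> {0..R}"
  shows "\<bar>eflux k a - eflux k b\<bar> \<le> Lf * \<bar>a - b\<bar>"
proof -
  have 1: "\<bar>eflux k a - eflux k b\<bar> \<le> Lf * \<bar>a - b\<bar>" if "a \<in> {0..R}" "b \<in> {0..R}" "b \<le> a" for a b
  proof -
    consider "a \<le> k" | "k \<le> b" | "b < k" "k < a" by linarith
    then show ?thesis
    proof cases
      case 1
      then have "eflux k a - eflux k b = flux b - flux a" using that by (auto simp: eflux_def sgn_if)
      then show ?thesis using flux_lip[OF that(2,1)] by (simp add: abs_minus_commute)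
    next
      case 2
      then have "eflux k a - eflux k b = flux a - flux b" using that by (auto simp: eflux_def sgn_if)
      then show ?thesis using flux_lip[OF that(1,2)] by simp
    next
      \<comment> \<open>When k separates a and b the sign flips, but the distances of a and b to k
        add up to \<open>\<bar>a - b\<bar>\<close>, so the Lipschitz constant does not grow.\<close>
      case 3
      then have "eflux k a - eflux k b = (flux a - flux k) + (flux b - flux k)" using that by (auto simp: eflux_def sgn_if)
      then have "\<bar>eflux k a - eflux k b\<bar> \<le> Lf * \<bar>a - k\<bar> + Lf * \<bar>b - k\<bar>"
        using flux_lip[OF that(1) assms(3)] flux_lip[OF that(2) assms(3)] by linarith
      also have "\<dots> = Lf * \<bar>a - b\<bar>" using 3 by (simp add: algebra_simps)
      finally show ?thesis .
    qed
  qed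
  show ?thesis using 1[of a b] 1[of b a] assms by (cases "b \<le> a") (auto simp: abs_minus_commute)
qed

end

text \<open>One time step in isolation: \<open>y\<close> are the positions before it and
  \<open>z\<close> those after it. The estimates proved here are summed over time later.\<close>

locale scheme_step = velocity +
  fixes l \<tau> \<theta> :: real and N :: nat and y z :: "nat \<Rightarrow> real"
  assumes l_pos: "0 < l" and \<tau>_pos: "0 < \<tau>" and \<theta>: "\<theta> \<in> {0..1}" and cfl: "\<theta> * \<tau> * Lv * R^2 \<le> l"
    and adm_y: "admissible l N y" and adm_z: "admissible l N z" and step: "one_step l N \<tau> \<theta> y z"
begin

abbreviation r :: "nat \<Rightarrow> real" where "r \<equiv> local_density l N y"
abbreviation s :: "nat \<Rightarrow> real" where "s \<equiv> local_density l N z"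

definition V :: "nat \<Rightarrow> real" where "V i = \<theta> * v (r i) + (1 - \<theta>) * v (s i)"

lemma r_range: "r i \<in> {0..R}" and s_range: "s i \<in> {0..R}"
  using admissible_density adm_y adm_z l_pos by auto

lemma r_N: "r N = 0" and s_N: "s N = 0" by (auto simp: local_density_def)

lemma y_less: "i < N \<Longrightarrow> y i < y (Suc i)" and z_less: "i < N \<Longrightarrow> z i < z (Suc i)"
  using adm_y adm_z by (auto simp: admissible_def)

lemma z_eq: "i \<le> N \<Longrightarrow> z i = y i + \<tau> * V i"
  using step by (simp add: one_step_def V_def)

lemma convex_bound: "\<bar>a\<bar> \<le> B \<Longrightarrow> \<bar>b\<bar> \<le> B \<Longrightarrow> u \<in> {0..1} \<Longrightarrow> \<bar>u * a + (1 - u) * b\<bar> \<le> (B::real)"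
proof -
  assume *: "\<bar>a\<bar> \<le> B" "\<bar>b\<bar> \<le> B" "u \<in> {0..1}"
  have "\<bar>u * a + (1 - u) * b\<bar> \<le> u * \<bar>a\<bar> + (1 - u) * \<bar>b\<bar>"
    using *(3) by (metis abs_mult abs_of_nonneg abs_triangle_ineq atLeastAtMost_iff diff_ge_0_iff_ge)
  also have "\<dots> \<le> u * B + (1 - u) * B" using * by (intro add_mono mult_left_mono) auto
  finally show ?thesis by (simp add: algebra_simps)
qed

lemma V_bound: "\<bar>V i\<bar> \<le> Vm"
  unfolding V_def by (intro convex_bound v_bound r_range s_range \<theta>)

lemma r_width: "i < N \<Longrightarrow> r i * (y (Suc i) - y i) = l" and s_width: "i < N \<Longrightarrow> s i * (z (Suc i) - z i) = l"
  using y_less[of i] z_less[of i] by (auto simp: local_density_def)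

text \<open>The natural variable is the spacing, \<open>l / r\<close> before and
  \<open>l / s\<close> after the step, which changes by \<open>\<tau>\<close> times the difference
  of the speeds at the two ends. Multiplication by \<open>r i * s i / l\<close> turns this into an
  equation for the densities.\<close>

lemma density_increment:
  assumes "i < N"
  shows "s i - r i = - (r i * s i / l) * \<tau> * (V (Suc i) - V i)"
proof -
  have "\<tau> * (V (Suc i) - V i) = (z (Suc i) - z i) - (y (Suc i) - y i)"
    using z_eq[of i] z_eq[of "Suc i"] assms by (simp add: algebra_simps)
  then have "r i * s i * (\<tau> * (V (Suc i) - V i)) = r i * s i * ((z (Suc i) - z i) - (y (Suc i) - y i))"
    by (rule arg_cong)
  also have "\<dots> = r i * (s i * (z (Suc i) - z i)) - s i * (r i * (y (Suc i) - y i))"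
    by (simp only: right_diff_distrib mult.assoc mult.left_commute)
  also have "\<dots> = (r i - s i) * l" using r_width[OF assms] s_width[OF assms] by (simp add: algebra_simps)
  finally show ?thesis using l_pos by (simp add: field_simps)
qed

text \<open>Secant slopes take the place of derivatives: they write the nonlinear step as a linear
  one with coefficients of known sign and size.\<close>

lemma v_secant:
  assumes "a \<in> {0..R}" "b \<in> {0..R}"
  shows "\<exists>c \<in> {0..Lv}. v b - v a = - c * (b - a)"
proof (cases "a = b")
  case False
  define c where "c = (v a - v b) / (b - a)"
  have "0 \<le> c"
  proof (cases "a < b")
    case True
    then show ?thesis using v_le[of a b] assms by (simp add: c_def)
  next
    case False
    then show ?thesis using v_le[of b a] assms \<open>a \<noteq> b\<close> by (auto simp: c_def intro!: divide_nonpos_neg)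
  qed
  moreover have "\<bar>c\<bar> \<le> Lv" using v_lip[OF assms] False by (simp add: c_def divide_le_eq abs_minus_commute)
  moreover have "v b - v a = - c * (b - a)" using False by (simp add: c_def)
  ultimately show ?thesis by auto
qed (use Lv_pos in auto)

text \<open>Harten's criterion. With secant slopes the step reads \<open>s i = r i + A (i + 1) * (r
  (i + 1) - r i) + B (i + 1) * (s (i + 1) - s i)\<close>, where CFL gives \<open>A \<le> 1\<close>.
  For the implicit coefficient B only the sign matters, because its diagonal part can be moved to
  the left-hand side.\<close>

lemma tvd: "(\<Sum>j\<le>N. \<bar>jump s j\<bar>) \<le> (\<Sum>j\<le>N. \<bar>jump r j\<bar>)"
proof -
  obtain a where a: "\<And>i. a i \<in> {0..Lv}" "\<And>i. v (r (Suc i)) - v (r i) = - a i * (r (Suc i) - r i)"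
  proof -
    have "\<forall>i. \<exists>c. c \<in> {0..Lv} \<and> v (r (Suc i)) - v (r i) = - c * (r (Suc i) - r i)"
      using v_secant[OF r_range r_range] by blast
    then show ?thesis using that by metis
  qed
  obtain b where b: "\<And>i. b i \<in> {0..Lv}" "\<And>i. v (s (Suc i)) - v (s i) = - b i * (s (Suc i) - s i)"
  proof -
    have "\<forall>i. \<exists>c. c \<in> {0..Lv} \<and> v (s (Suc i)) - v (s i) = - c * (s (Suc i) - s i)"
      using v_secant[OF s_range s_range] by blast
    then show ?thesis using that by metis
  qed
  \<comment> \<open>Index j stands for the interface between cells j - 1 and j. The coefficients
    vanish at 0 and at N + 1, so that shifting the index does not change the sums at the
    end.\<close>
  define A where "A j = (if j = 0 \<or> j > N then 0 else \<tau> / l * r (j - 1) * s (j - 1) * \<theta> * a (j - 1))" for j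
  define B where "B j = (if j = 0 \<or> j > N then 0 else \<tau> / l * r (j - 1) * s (j - 1) * (1 - \<theta>) * b (j - 1))" for j
  have A: "0 \<le> A j" "A j \<le> 1" for j
  proof -
    show "0 \<le> A j" using a(1)[of "j - 1"] r_range[of "j - 1"] s_range[of "j - 1"] \<theta> \<tau>_pos l_pos by (auto simp: A_def)
    have "r (j - 1) * s (j - 1) * a (j - 1) \<le> R * R * Lv"
      using a(1)[of "j - 1"] r_range[of "j - 1"] s_range[of "j - 1"] by (intro mult_mono) auto
    then have "\<theta> * \<tau> * (r (j - 1) * s (j - 1) * a (j - 1)) \<le> \<theta> * \<tau> * (R * R * Lv)"
      using \<theta> \<tau>_pos by (intro mult_left_mono) auto
    also have "\<dots> \<le> l" using cfl by (simp add: power2_eq_square algebra_simps)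
    finally show "A j \<le> 1" using l_pos by (simp add: A_def field_simps)
  qed
  have B: "0 \<le> B j" for j
    using b(1)[of "j - 1"] r_range[of "j - 1"] s_range[of "j - 1"] \<theta> \<tau>_pos l_pos by (auto simp: B_def)
  have rel: "s i = r i + A (Suc i) * jump r (Suc i) + B (Suc i) * jump s (Suc i)" if "i \<le> N" for i
  proof (cases "i < N")
    case True
    have "V (Suc i) - V i = \<theta> * (v (r (Suc i)) - v (r i)) + (1 - \<theta>) * (v (s (Suc i)) - v (s i))"
      by (simp add: V_def algebra_simps)
    then have dV: "V (Suc i) - V i = - \<theta> * a i * (r (Suc i) - r i) - (1 - \<theta>) * b i * (s (Suc i) - s i)"
      unfolding a(2) b(2) by simp
    show ?thesis
      using density_increment[OF True] True unfolding dV A_def B_def jump_def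
      by (simp add: algebra_simps diff_divide_distrib add_divide_distrib)
  next
    case False
    then show ?thesis using that r_N s_N by (simp add: A_def B_def)
  qed
  \<comment> \<open>Subtract the relations for j and j - 1, keep \<open>B j * jump s j\<close> on
    the left, and take absolute values, using \<open>0 \<le> 1 - A j\<close>. After summation over j
    all terms with A and B cancel.\<close>
  have K: "\<bar>jump s j\<bar> + B j * \<bar>jump s j\<bar> \<le> \<bar>jump r j\<bar> - A j * \<bar>jump r j\<bar> + A (Suc j) * \<bar>jump r (Suc j)\<bar> + B (Suc j) * \<bar>jump s (Suc j)\<bar>"
    if j: "j \<le> N" for j
  proof -
    have "jump s j * (1 + B j) = jump r j * (1 - A j) + A (Suc j) * jump r (Suc j) + B (Suc j) * jump s (Suc j)"
    proof (cases j)
      case 0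
      then show ?thesis using rel[of 0] by (simp add: jump_def A_def B_def)
    next
      case (Suc i)
      have "jump s j = s j - s i" "jump r j = r j - r i" using Suc by (auto simp: jump_def)
      then show ?thesis using rel[of j] rel[of i] j Suc by (simp add: algebra_simps)
    qed
    then have "\<bar>jump s j\<bar> * (1 + B j) = \<bar>jump r j * (1 - A j) + A (Suc j) * jump r (Suc j) + B (Suc j) * jump s (Suc j)\<bar>"
      using B[of j] by (metis abs_mult abs_of_nonneg add_nonneg_nonneg zero_le_one)
    also have "\<dots> \<le> \<bar>jump r j * (1 - A j)\<bar> + \<bar>A (Suc j) * jump r (Suc j)\<bar> + \<bar>B (Suc j) * jump s (Suc j)\<bar>" by linarith
    also have "\<dots> = \<bar>jump r j\<bar> * (1 - A j) + A (Suc j) * \<bar>jump r (Suc j)\<bar> + B (Suc j) * \<bar>jump s (Suc j)\<bar>"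
      using A[of j] A[of "Suc j"] B[of "Suc j"] by (simp add: abs_mult)
    finally show ?thesis by (simp add: algebra_simps)
  qed
  have shift: "(\<Sum>j\<le>N. f (Suc j)) = (\<Sum>j\<le>N. f j)" if "f 0 = 0" "f (Suc N) = 0" for f :: "nat \<Rightarrow> real"
    using sum.atMost_Suc_shift[of f N] that by simp
  have "(\<Sum>j\<le>N. \<bar>jump s j\<bar> + B j * \<bar>jump s j\<bar>)
     \<le> (\<Sum>j\<le>N. \<bar>jump r j\<bar> - A j * \<bar>jump r j\<bar> + A (Suc j) * \<bar>jump r (Suc j)\<bar> + B (Suc j) * \<bar>jump s (Suc j)\<bar>)"
    by (intro sum_mono K) auto
  then show ?thesis
    using shift[of "\<lambda>j. A j * \<bar>jump r j\<bar>"] shift[of "\<lambda>j. B j * \<bar>jump s j\<bar>"]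
    by (simp add: sum.distrib sum_subtractf A_def B_def)
qed

lemma speed_variation:
  assumes C: "(\<Sum>j\<le>N. \<bar>jump r j\<bar>) \<le> C"
  shows "(\<Sum>i<N. \<bar>V (Suc i) - V i\<bar>) \<le> Lv * C"
proof -
  have one: "\<bar>V (Suc i) - V i\<bar> \<le> Lv * (\<theta> * \<bar>jump r (Suc i)\<bar> + (1 - \<theta>) * \<bar>jump s (Suc i)\<bar>)" for i
  proof -
    have "V (Suc i) - V i = \<theta> * (v (r (Suc i)) - v (r i)) + (1 - \<theta>) * (v (s (Suc i)) - v (s i))"
      by (simp add: V_def algebra_simps)
    then have "\<bar>V (Suc i) - V i\<bar> \<le> \<theta> * \<bar>v (r (Suc i)) - v (r i)\<bar> + (1 - \<theta>) * \<bar>v (s (Suc i)) - v (s i)\<bar>"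
      using \<theta> by (metis abs_mult abs_of_nonneg abs_triangle_ineq atLeastAtMost_iff diff_ge_0_iff_ge)
    also have "\<dots> \<le> \<theta> * (Lv * \<bar>r (Suc i) - r i\<bar>) + (1 - \<theta>) * (Lv * \<bar>s (Suc i) - s i\<bar>)"
      using \<theta> by (intro add_mono mult_left_mono v_lip r_range s_range) auto
    finally show ?thesis by (simp add: jump_def algebra_simps)
  qed
  have sub: "(\<Sum>i<N. \<bar>jump u (Suc i)\<bar>) \<le> (\<Sum>j\<le>N. \<bar>jump u j\<bar>)" for u
    using sum.lessThan_Suc_shift[of "\<lambda>j. \<bar>jump u j\<bar>" N] by (simp add: lessThan_Suc_atMost)
  have "(\<Sum>i<N. \<bar>V (Suc i) - V i\<bar>) \<le> (\<Sum>i<N. Lv * (\<theta> * \<bar>jump r (Suc i)\<bar> + (1 - \<theta>) * \<bar>jump s (Suc i)\<bar>))"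
    by (intro sum_mono one)
  also have "\<dots> = Lv * (\<theta> * (\<Sum>i<N. \<bar>jump r (Suc i)\<bar>) + (1 - \<theta>) * (\<Sum>i<N. \<bar>jump s (Suc i)\<bar>))"
    by (simp add: sum_distrib_left[symmetric] sum.distrib)
  also have "\<dots> \<le> Lv * (\<theta> * C + (1 - \<theta>) * C)"
    using Lv_pos \<theta> sub[of r] sub[of s] C tvd by (intro mult_left_mono add_mono) auto
  finally show ?thesis by (simp add: algebra_simps)
qed

text \<open>The change of the densities in one step, summed without the weight \<open>l\<close> of
  the cells. For the scheme the factor \<open>\<tau> / l\<close> equals
  \<open>(T / L) * (N / M)\<close>; it is the source of the extra condition in (b).\<close>

lemma density_variation:
  assumes C: "(\<Sum>j\<le>N. \<bar>jump r j\<bar>) \<le> C"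
  shows "(\<Sum>i<N. \<bar>s i - r i\<bar>) \<le> R\<^sup>2 * (\<tau> / l) * (Lv * C)"
proof -
  have "(\<Sum>i<N. \<bar>s i - r i\<bar>) \<le> (\<Sum>i<N. R\<^sup>2 * (\<tau> / l) * \<bar>V (Suc i) - V i\<bar>)"
  proof (intro sum_mono)
    fix i assume "i \<in> {..<N}"
    then have "\<bar>s i - r i\<bar> = r i * s i * (\<tau> / l * \<bar>V (Suc i) - V i\<bar>)"
      using density_increment[of i] r_range[of i] s_range[of i] l_pos \<tau>_pos by (simp add: abs_mult)
    also have "\<dots> \<le> R\<^sup>2 * (\<tau> / l * \<bar>V (Suc i) - V i\<bar>)"
      using r_range[of i] s_range[of i] l_pos \<tau>_pos R_pos
      by (intro mult_right_mono) (auto simp: power2_eq_square intro: mult_mono)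
    finally show "\<bar>s i - r i\<bar> \<le> R\<^sup>2 * (\<tau> / l) * \<bar>V (Suc i) - V i\<bar>" by simp
  qed
  also have "\<dots> \<le> R\<^sup>2 * (\<tau> / l) * (Lv * C)"
    unfolding sum_distrib_left[symmetric] using speed_variation[OF C] l_pos \<tau>_pos by (intro mult_left_mono) auto
  finally show ?thesis .
qed

lemma speed_defect: "\<bar>V i - v (r i)\<bar> \<le> Lv * \<bar>s i - r i\<bar>" "\<bar>V i - v (s i)\<bar> \<le> Lv * \<bar>s i - r i\<bar>"
proof -
  have l: "\<bar>v (s i) - v (r i)\<bar> \<le> Lv * \<bar>s i - r i\<bar>" by (intro v_lip r_range s_range)
  have "V i - v (r i) = (1 - \<theta>) * (v (s i) - v (r i))" "V i - v (s i) = - \<theta> * (v (s i) - v (r i))"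
    by (auto simp: V_def algebra_simps)
  then have "\<bar>V i - v (r i)\<bar> \<le> \<bar>v (s i) - v (r i)\<bar>" "\<bar>V i - v (s i)\<bar> \<le> \<bar>v (s i) - v (r i)\<bar>"
    using \<theta> by (auto simp: abs_mult intro: mult_left_le_one_le)
  then show "\<bar>V i - v (r i)\<bar> \<le> Lv * \<bar>s i - r i\<bar>" "\<bar>V i - v (s i)\<bar> \<le> Lv * \<bar>s i - r i\<bar>" using l by linarith+
qed

end

section \<open>Consistency with the weak form\<close>

context scheme_step
begin

lemma step_integral_y:
  assumes "g 0 = (0::real)" "\<And>x. (F has_real_derivative \<psi> x) (at x)" "continuous_on UNIV \<psi>"
  shows "(\<integral>x. g (step_fun N y r x) * \<psi> x \<partial>lborel) = (\<Sum>i<N. g (r i) * (F (y (Suc i)) - F (y i)))"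
  using has_bochner_integral_integral_eq[OF step_fun_integral[of N y g F \<psi> r, OF y_less assms]] by simp

lemma step_integral_z:
  assumes "g 0 = (0::real)" "\<And>x. (F has_real_derivative \<psi> x) (at x)" "continuous_on UNIV \<psi>"
  shows "(\<integral>x. g (step_fun N z s x) * \<psi> x \<partial>lborel) = (\<Sum>i<N. g (s i) * (F (z (Suc i)) - F (z i)))"
  using has_bochner_integral_integral_eq[OF step_fun_integral[of N z g F \<psi> s, OF z_less assms]] by simp

text \<open>The old and the new cell with the same label are both parametrized affinely over [0, 1].
  Having equal masses, their integrals are \<open>l\<close> times averages over the parameter, and
  the comparison becomes pointwise along straight paths. \<open>\<omega>\<close> bounds the
  oscillation of \<open>\<psi>'\<close> over the distance travelled in one step.\<close>

lemma weak_step: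
  assumes d: "\<And>x. (\<psi> has_real_derivative \<psi>' x) (at x)" and c: "continuous_on UNIV \<psi>'"
    and B1: "\<And>x. \<bar>\<psi>' x\<bar> \<le> B1" and \<omega>: "\<And>x x'. \<bar>x - x'\<bar> \<le> \<tau> * Vm \<Longrightarrow> \<bar>\<psi>' x - \<psi>' x'\<bar> \<le> \<omega>"
    and C: "(\<Sum>j\<le>N. \<bar>jump r j\<bar>) \<le> C"
  shows "\<bar>(\<integral>x. step_fun N z s x * \<psi> x \<partial>lborel) - (\<integral>x. step_fun N y r x * \<psi> x \<partial>lborel)
       - \<tau> * (\<integral>x. flux (step_fun N y r x) * \<psi>' x \<partial>lborel)\<bar>
     \<le> \<tau> * (l * real N * (\<omega> * Vm) + B1 * (l * (Lv * C) + R\<^sup>2 * \<tau> * Lv * (Lv * C)))"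
proof -
  have cont: "continuous_on UNIV \<psi>" by (rule DERIV_continuous_on[of _ _ \<psi>']) (auto intro: d has_field_derivative_at_within)
  obtain F where F: "\<And>x. (F has_real_derivative \<psi> x) (at x)" using continuous_antiderivative[OF cont] by metis
  have B1': "0 \<le> B1" using B1[of 0] by linarith
  define K where "K i = \<tau> * (\<omega> * Vm + B1 * (\<bar>V (Suc i) - V i\<bar> + Lv * \<bar>s i - r i\<bar>))" for i
  have cell: "\<bar>s i * (F (z (Suc i)) - F (z i)) - r i * (F (y (Suc i)) - F (y i)) - \<tau> * (flux (r i) * (\<psi> (y (Suc i)) - \<psi> (y i)))\<bar> \<le> l * K i"
    if i: "i < N" for i
  proof -
    define p where "p = y (Suc i) - y i"
    define q where "q = z (Suc i) - z i"
    have pq: "0 < p" "0 < q" using y_less[OF i] z_less[OF i] by (auto simp: p_def q_def)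
    have rs: "r i = l / p" "s i = l / q" using i by (auto simp: p_def q_def local_density_def)
    \<comment> \<open>\<open>G' u\<close> is the transport defect at the material point with
      parameter u, and \<open>l * (G 1 - G 0)\<close> is exactly the error of the cell, so a bound
      on \<open>G'\<close> suffices.\<close>
    define G where "G u = F (z i + u * q) / q - F (y i + u * p) / p - \<tau> * v (r i) * \<psi> (y i + u * p) / p" for u
    define G' where "G' u = \<psi> (z i + u * q) - \<psi> (y i + u * p) - \<tau> * v (r i) * \<psi>' (y i + u * p)" for u
    have aff: "((\<lambda>u. H (a + u * e) / e) has_real_derivative H' (a + u * e)) (at u)"
      if "\<And>x. (H has_real_derivative H' x) (at x)" "0 < e" for H H' a e u
    proof -
      have "((\<lambda>u. a + u * e) has_real_derivative e) (at u)" by (auto intro!: derivative_eq_intros)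
      from DERIV_chain2[OF that(1) this] have "((\<lambda>u. H (a + u * e)) has_real_derivative H' (a + u * e) * e) (at u)" .
      from DERIV_cdivide[OF this, of e] show ?thesis using that(2) by simp
    qed
    have G: "(G has_real_derivative G' u) (at u)" for u
    proof -
      have "((\<lambda>u. \<tau> * v (r i) * (\<psi> (y i + u * p) / p)) has_real_derivative \<tau> * v (r i) * \<psi>' (y i + u * p)) (at u)"
        by (intro DERIV_cmult aff d pq)
      then show ?thesis
        unfolding G_def[abs_def] G'_def times_divide_eq_right[symmetric] by (intro DERIV_diff aff F pq)
    qed
    have bound: "\<bar>G' u\<bar> \<le> K i" if u: "u \<in> {0..1}" for u
    proof -
      define x where "x = y i + u * p"
      \<comment> \<open>The speed of the material point: the speeds of the two end particles
        interpolated across the cell.\<close>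
      define w where "w = u * V (Suc i) + (1 - u) * V i"
      have w: "\<bar>w\<bar> \<le> Vm" unfolding w_def by (intro convex_bound V_bound u)
      have zx: "z i + u * q = x + \<tau> * w"
        using z_eq[of i] z_eq[of "Suc i"] i by (simp add: x_def w_def q_def p_def algebra_simps)
      \<comment> \<open>The mean value theorem is applied in either direction of motion, since
        speeds may have both signs.\<close>
      obtain \<xi> where \<xi>: "\<bar>\<xi> - x\<bar> \<le> \<bar>\<tau> * w\<bar>" "\<psi> (x + \<tau> * w) - \<psi> x = \<tau> * w * \<psi>' \<xi>"
      proof (cases "\<tau> * w" "0::real" rule: linorder_cases)
        case less
        then obtain \<xi> where "x + \<tau> * w < \<xi>" "\<xi> < x" "\<psi> x - \<psi> (x + \<tau> * w) = (x - (x + \<tau> * w)) * \<psi>' \<xi>"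
          using MVT2[of "x + \<tau> * w" x \<psi> \<psi>'] d by auto
        then show ?thesis using less by (intro that[of \<xi>]) (auto simp: algebra_simps)
      next
        case equal
        then show ?thesis by (intro that[of x]) auto
      next
        case greater
        then obtain \<xi> where "x < \<xi>" "\<xi> < x + \<tau> * w" "\<psi> (x + \<tau> * w) - \<psi> x = (x + \<tau> * w - x) * \<psi>' \<xi>"
          using MVT2[of x "x + \<tau> * w" \<psi> \<psi>'] d by auto
        then show ?thesis using greater by (intro that[of \<xi>]) auto
      qed
      have "\<bar>\<tau> * w\<bar> \<le> \<tau> * Vm" using w \<tau>_pos by (simp add: abs_mult)
      then have "\<bar>\<psi>' \<xi> - \<psi>' x\<bar> \<le> \<omega>" using \<xi>(1) by (intro \<omega>) linarith
      then have 1: "\<bar>w * (\<psi>' \<xi> - \<psi>' x)\<bar> \<le> Vm * \<omega>"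
        unfolding abs_mult using w Vm_nonneg by (intro mult_mono) auto
      have "\<bar>w - v (r i)\<bar> \<le> \<bar>V (Suc i) - V i\<bar> + Lv * \<bar>s i - r i\<bar>"
      proof -
        have "w - v (r i) = u * (V (Suc i) - V i) + (V i - v (r i))" by (simp add: w_def algebra_simps)
        moreover have "\<bar>u * (V (Suc i) - V i)\<bar> \<le> \<bar>V (Suc i) - V i\<bar>"
          using u by (auto simp: abs_mult intro: mult_left_le_one_le)
        ultimately show ?thesis using speed_defect(1)[of i] by linarith
      qed
      then have 2: "\<bar>(w - v (r i)) * \<psi>' x\<bar> \<le> (\<bar>V (Suc i) - V i\<bar> + Lv * \<bar>s i - r i\<bar>) * B1"
        unfolding abs_mult using B1[of x] by (intro mult_mono) auto
      have "G' u = \<tau> * (w * (\<psi>' \<xi> - \<psi>' x) + (w - v (r i)) * \<psi>' x)"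
        unfolding G'_def zx x_def[symmetric] using \<xi>(2) by (simp add: algebra_simps)
      then have "\<bar>G' u\<bar> = \<tau> * \<bar>w * (\<psi>' \<xi> - \<psi>' x) + (w - v (r i)) * \<psi>' x\<bar>" using \<tau>_pos by (simp add: abs_mult)
      also have "\<dots> \<le> \<tau> * (Vm * \<omega> + (\<bar>V (Suc i) - V i\<bar> + Lv * \<bar>s i - r i\<bar>) * B1)"
        using 1 2 \<tau>_pos by (intro mult_left_mono) linarith+
      finally show ?thesis by (simp add: K_def mult.commute)
    qed
    have "norm (G 1 - G 0) \<le> K i * norm (1 - 0 :: real)"
      by (rule field_differentiable_bound[of "{0..1}" G G'])
         (use G bound in \<open>auto intro: has_field_derivative_at_within\<close>)
    then have "\<bar>G 1 - G 0\<bar> \<le> K i" by simp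
    then have "l * \<bar>G 1 - G 0\<bar> \<le> l * K i" using l_pos by simp
    moreover have "s i * (F (z (Suc i)) - F (z i)) - r i * (F (y (Suc i)) - F (y i)) - \<tau> * (flux (r i) * (\<psi> (y (Suc i)) - \<psi> (y i)))
        = l * (G 1 - G 0)"
    proof -
      have "y i + p = y (Suc i)" "z i + q = z (Suc i)" by (auto simp: p_def q_def)
      then show ?thesis unfolding G_def flux_def using rs by (simp add: algebra_simps diff_divide_distrib)
    qed
    ultimately show ?thesis using l_pos by (simp add: abs_mult)
  qed
  have "\<bar>(\<integral>x. step_fun N z s x * \<psi> x \<partial>lborel) - (\<integral>x. step_fun N y r x * \<psi> x \<partial>lborel)
       - \<tau> * (\<integral>x. flux (step_fun N y r x) * \<psi>' x \<partial>lborel)\<bar>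
     = \<bar>\<Sum>i<N. s i * (F (z (Suc i)) - F (z i)) - r i * (F (y (Suc i)) - F (y i)) - \<tau> * (flux (r i) * (\<psi> (y (Suc i)) - \<psi> (y i)))\<bar>"
    using step_integral_z[of "\<lambda>x. x" F \<psi>] step_integral_y[of "\<lambda>x. x" F \<psi>] step_integral_y[of flux \<psi> \<psi>'] F d c cont
    by (simp add: sum_subtractf sum_distrib_left flux_def)
  also have "\<dots> \<le> (\<Sum>i<N. l * K i)"
    by (rule order_trans[OF sum_abs]) (intro sum_mono cell, auto)
  also have "\<dots> = \<tau> * (l * real N * (\<omega> * Vm) + B1 * (l * (\<Sum>i<N. \<bar>V (Suc i) - V i\<bar>) + l * Lv * (\<Sum>i<N. \<bar>s i - r i\<bar>)))"
    by (simp add: K_def sum_distrib_left[symmetric] sum.distrib algebra_simps)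
  \<comment> \<open>The weight \<open>l\<close> of the cells meets the factor
    \<open>\<tau> / l\<close> of the density variation here, and the product is of order
    \<open>\<tau>\<close>.\<close>
  also have "\<dots> \<le> \<tau> * (l * real N * (\<omega> * Vm) + B1 * (l * (Lv * C) + l * Lv * (R\<^sup>2 * (\<tau> / l) * (Lv * C))))"
    using \<tau>_pos l_pos Lv_pos B1' speed_variation[OF C] density_variation[OF C]
    by (intro mult_left_mono add_left_mono add_mono) auto
  also have "\<dots> = \<tau> * (l * real N * (\<omega> * Vm) + B1 * (l * (Lv * C) + R\<^sup>2 * \<tau> * Lv * (Lv * C)))"
    using l_pos by (simp add: field_simps)
  finally show ?thesis .
qed

end

section \<open>Discrete entropy inequality\<close>

context velocity
begin

text \<open>Unless it vanishes, \<open>sgn (a - k) - c\<close> has the sign of \<open>a - k\<close>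
  when a differs from k, while \<open>v\<close> decreases. With c the sign in the cell behind, this
  is the dissipation produced at an interface.\<close>

lemma entropy_flux_sign:
  assumes "a \<in> {0..R}" "k \<in> {0..R}" "c \<in> {-1..1}"
  shows "(sgn (a - k) - c) * (v a - v k) \<le> 0"
proof (cases a k rule: linorder_cases)
  case less
  then have "v k \<le> v a" using v_le[of a k] assms by simp
  then show ?thesis using less assms by (simp add: mult_nonpos_nonneg)
next
  case greater
  then have "v a \<le> v k" using v_le[of k a] assms by simp
  then show ?thesis using greater assms by (simp add: mult_nonneg_nonpos)
qed simp

end

context scheme_step
begin

text \<open>The normalized entropy of a cell times its length is not a constant like the mass, so
  the proof of \<open>weak_step\<close> does not carry over. Convexity at the new density yields an
  inequality, summation by parts leaves interface terms of favourable sign, and the errors come from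
  the second order of the displacement, the variation of the speeds, and the change of the densities
  in one step.\<close>

lemma entropy_step:
  assumes k: "k \<in> {0..R}" and d: "\<And>x. (\<psi> has_real_derivative \<psi>' x) (at x)" and c': "continuous_on UNIV \<psi>'"
    and B0: "\<And>x. \<psi> x \<in> {0..B0}" and B1: "\<And>x. \<bar>\<psi>' x\<bar> \<le> B1"
    and C: "(\<Sum>j\<le>N. \<bar>jump r j\<bar>) \<le> C"
  shows "(\<integral>x. (\<bar>step_fun N z s x - k\<bar> - k) * \<psi> x \<partial>lborel) - (\<integral>x. (\<bar>step_fun N y r x - k\<bar> - k) * \<psi> x \<partial>lborel)
       - \<tau> * (\<integral>x. (eflux k (step_fun N y r x) - eflux k 0) * \<psi>' x \<partial>lborel)
     \<le> \<tau> * (2 * real N * R * B1 * Vm\<^sup>2 * \<tau> + B1 * (l + 2 * R * \<tau> * Vm) * (Lv * C)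
          + (2 * B0 * Lf + 4 * R * B0 * Lv) * (R\<^sup>2 * (\<tau> / l) * (Lv * C)))"
proof -
  have cont: "continuous_on UNIV \<psi>" by (rule DERIV_continuous_on[of _ _ \<psi>']) (auto intro: d has_field_derivative_at_within)
  obtain F where F: "\<And>x. (F has_real_derivative \<psi> x) (at x)" using continuous_antiderivative[OF cont] by metis
  have B1': "0 \<le> B1" using B1[of 0] by linarith
  have B0': "0 \<le> B0" using B0[of 0] by simp
  \<comment> \<open>The sign is taken at the new density, so that convexity gives \<open>\<bar>s i -
    k\<bar> - \<bar>r i - k\<bar> \<le> c i * (s i - r i)\<close>, the direction needed for an upper
    bound.\<close>
  define c where "c i = sgn (s i - k)" for i
  define \<sigma> where "\<sigma> i = \<bar>s i - r i\<bar>" for i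
  define g where "g i = \<psi> (y i) * (V i - v k)" for i
  define bt where "bt i = \<bar>s i - k\<bar> - k" for i
  define at' where "at' i = \<bar>r i - k\<bar> - k" for i
  define \<Delta> where "\<Delta> i = \<psi> (y (Suc i)) - \<psi> (y i)" for i
  define E where "E i = 2 * R * B1 * Vm\<^sup>2 * \<tau> + \<bar>V (Suc i) - V i\<bar> * (B1 * (l + 2 * R * \<tau> * Vm)) + 2 * R * Lv * B0 * \<sigma> i + 2 * Lf * B0 * \<sigma> i" for i
  have c: "c i \<in> {-1..1}" for i by (auto simp: c_def sgn_if)
  have bt: "bt i = c i * (s i - k) - k" for i
    by (simp add: bt_def c_def abs_sgn mult.commute)
  have bt_bound: "\<bar>bt i\<bar> \<le> R" for i using s_range[of i] k by (auto simp: bt_def)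
  \<comment> \<open>First-order expansion of the antiderivative along a particle path; the error is
    quadratic in the displacement \<open>\<tau> * V i\<close>.\<close>
  have D: "\<bar>F (z i) - F (y i) - \<tau> * (\<psi> (y i) * V i)\<bar> \<le> B1 * \<tau>\<^sup>2 * Vm\<^sup>2" if "i \<le> N" for i
  proof -
    define h where "h = \<tau> * V i"
    have h: "\<bar>h\<bar> \<le> \<tau> * Vm" using V_bound[of i] \<tau>_pos by (simp add: h_def abs_mult)
    have "norm ((\<lambda>x. F x - \<psi> (y i) * x) (z i) - (\<lambda>x. F x - \<psi> (y i) * x) (y i)) \<le> (B1 * \<bar>h\<bar>) * norm (z i - y i)"
    proof (rule field_differentiable_bound[of "cball (y i) \<bar>h\<bar>" _ "\<lambda>x. \<psi> x - \<psi> (y i)"])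
      fix x assume x: "x \<in> cball (y i) \<bar>h\<bar>"
      show "((\<lambda>x. F x - \<psi> (y i) * x) has_field_derivative \<psi> x - \<psi> (y i)) (at x within cball (y i) \<bar>h\<bar>)"
        by (rule has_field_derivative_at_within) (auto intro!: derivative_eq_intros F)
      have "norm (\<psi> x - \<psi> (y i)) \<le> B1 * norm (x - y i)"
        by (rule field_differentiable_bound[of UNIV \<psi> \<psi>']) (use d B1 in auto)
      also have "\<dots> \<le> B1 * \<bar>h\<bar>" using x B1' by (intro mult_left_mono) (auto simp: dist_real_def abs_minus_commute)
      finally show "norm (\<psi> x - \<psi> (y i)) \<le> B1 * \<bar>h\<bar>" .
    qed (use z_eq[OF that] in \<open>auto simp: h_def dist_real_def\<close>)
    then have "\<bar>F (z i) - F (y i) - \<psi> (y i) * h\<bar> \<le> B1 * \<bar>h\<bar> * \<bar>h\<bar>"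
      using z_eq[OF that] by (simp add: h_def algebra_simps)
    also have "\<dots> \<le> B1 * (\<tau> * Vm) * (\<tau> * Vm)"
      using h B1' Vm_nonneg \<tau>_pos by (intro mult_mono) auto
    finally show ?thesis by (simp add: h_def power2_eq_square algebra_simps)
  qed
  have cell: "bt i * (F (z (Suc i)) - F (z i)) - at' i * (F (y (Suc i)) - F (y i))
      - \<tau> * ((eflux k (r i) - eflux k 0) * \<Delta> i) \<le> \<tau> * E i + \<tau> * (k * ((c i + 1) * (g i - g (Suc i))))"
    if i: "i < N" for i
  proof -
    define p where "p = y (Suc i) - y i"
    have p: "0 < p" using y_less[OF i] by (simp add: p_def)
    obtain \<xi> where \<xi>: "y i < \<xi>" "\<xi> < y (Suc i)" "F (y (Suc i)) - F (y i) = p * \<psi> \<xi>"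
      using MVT2[of "y i" "y (Suc i)" F \<psi>] F y_less[OF i] unfolding p_def by blast
    define dD where "dD = (F (z (Suc i)) - F (y (Suc i)) - \<tau> * (\<psi> (y (Suc i)) * V (Suc i))) - (F (z i) - F (y i) - \<tau> * (\<psi> (y i) * V i))"
    have "\<bar>dD\<bar> \<le> 2 * (B1 * \<tau>\<^sup>2 * Vm\<^sup>2)" using D[of i] D[of "Suc i"] i by (simp add: dD_def)
    then have "\<bar>bt i * dD\<bar> \<le> R * (2 * (B1 * \<tau>\<^sup>2 * Vm\<^sup>2))"
      unfolding abs_mult using bt_bound[of i] R_pos by (intro mult_mono) auto
    then have e1: "bt i * dD \<le> \<tau> * (2 * R * B1 * Vm\<^sup>2 * \<tau>)" by (simp add: power2_eq_square algebra_simps)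
    \<comment> \<open>In the density increment the factor \<open>r i / l\<close> cancels against the
      old cell length p, since \<open>r i * p = l\<close>.\<close>
    have inc: "(s i - r i) * p = - s i * \<tau> * (V (Suc i) - V i)"
    proof -
      have "(s i - r i) * p = - ((r i * p) * s i / l) * \<tau> * (V (Suc i) - V i)"
        unfolding density_increment[OF i] by simp
      then show ?thesis using r_width[OF i] l_pos by (simp add: p_def)
    qed
    have "bt i - at' i \<le> c i * (s i - r i)"
      using k by (auto simp: bt_def at'_def c_def sgn_if)
    then have "(bt i - at' i) * (p * \<psi> \<xi>) \<le> c i * (s i - r i) * (p * \<psi> \<xi>)"
      using B0[of \<xi>] p by (intro mult_right_mono) auto
    also have "\<dots> = c i * \<psi> \<xi> * ((s i - r i) * p)" by simp
    finally have e2: "(bt i - at' i) * (p * \<psi> \<xi>) \<le> - \<tau> * (c i * s i * (V (Suc i) - V i) * \<psi> \<xi>)"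
      unfolding inc by (simp add: algebra_simps)
    have \<Delta>: "\<bar>\<Delta> i\<bar> \<le> 2 * B0" using B0[of "y i"] B0[of "y (Suc i)"] by (auto simp: \<Delta>_def)
    have "\<bar>(eflux k (s i) - eflux k (r i)) * \<Delta> i\<bar> \<le> (Lf * \<sigma> i) * (2 * B0)"
      unfolding abs_mult using eflux_lip[OF s_range r_range k, of i i] \<Delta> by (intro mult_mono) (auto simp: \<sigma>_def Lf_nonneg)
    then have "(eflux k (s i) - eflux k (r i)) * \<Delta> i \<le> 2 * Lf * B0 * \<sigma> i" by (simp add: algebra_simps)
    then have e3: "\<tau> * ((eflux k (s i) - eflux k (r i)) * \<Delta> i) \<le> \<tau> * (2 * Lf * B0 * \<sigma> i)"
      using \<tau>_pos by (intro mult_left_mono) auto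
    \<comment> \<open>The old cell length is the new one minus the relative displacement of its
      ends, so the product equals \<open>l\<close> up to a term of order
      \<open>\<tau>\<close>.\<close>
    have "s i * p \<le> l + 2 * R * \<tau> * Vm"
    proof -
      have "p = (z (Suc i) - z i) - \<tau> * (V (Suc i) - V i)"
        using z_eq[of i] z_eq[of "Suc i"] i by (simp add: p_def algebra_simps)
      then have "s i * p = s i * (z (Suc i) - z i) - s i * (\<tau> * (V (Suc i) - V i))"
        by (metis right_diff_distrib)
      moreover have "\<bar>s i * (\<tau> * (V (Suc i) - V i))\<bar> \<le> R * (\<tau> * (2 * Vm))"
        unfolding abs_mult using s_range[of i] \<tau>_pos V_bound[of i] V_bound[of "Suc i"]
        by (intro mult_mono) auto
      ultimately show ?thesis using s_width[OF i] by simp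
    qed
    moreover have "\<bar>\<psi> (y (Suc i)) - \<psi> \<xi>\<bar> \<le> B1 * p"
    proof -
      have "norm (\<psi> (y (Suc i)) - \<psi> \<xi>) \<le> B1 * norm (y (Suc i) - \<xi>)"
        by (rule field_differentiable_bound[of UNIV \<psi> \<psi>']) (use d B1 in auto)
      also have "\<dots> \<le> B1 * p" using \<xi> B1' by (intro mult_left_mono) (auto simp: p_def)
      finally show ?thesis by simp
    qed
    ultimately have *: "s i * p \<le> l + 2 * R * \<tau> * Vm" "\<bar>\<psi> (y (Suc i)) - \<psi> \<xi>\<bar> \<le> B1 * p" by auto
    have e4a: "s i * \<bar>\<psi> (y (Suc i)) - \<psi> \<xi>\<bar> \<le> B1 * (l + 2 * R * \<tau> * Vm)"
    proof -
      have "s i * \<bar>\<psi> (y (Suc i)) - \<psi> \<xi>\<bar> \<le> s i * (B1 * p)" using * s_range[of i] by (intro mult_left_mono) auto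
      also have "\<dots> = B1 * (s i * p)" by simp
      also have "\<dots> \<le> B1 * (l + 2 * R * \<tau> * Vm)" using * B1' by (intro mult_left_mono) auto
      finally show ?thesis .
    qed
    have e4: "c i * s i * ((V (Suc i) - V i) * (\<psi> (y (Suc i)) - \<psi> \<xi>)) \<le> \<bar>V (Suc i) - V i\<bar> * (B1 * (l + 2 * R * \<tau> * Vm))"
    proof -
      have "c i * s i * ((V (Suc i) - V i) * (\<psi> (y (Suc i)) - \<psi> \<xi>)) \<le> \<bar>c i\<bar> * (s i * (\<bar>V (Suc i) - V i\<bar> * \<bar>\<psi> (y (Suc i)) - \<psi> \<xi>\<bar>))"
        by (rule order_trans[OF abs_ge_self]) (use s_range[of i] in \<open>simp add: abs_mult\<close>)
      also have "\<dots> \<le> 1 * (s i * (\<bar>V (Suc i) - V i\<bar> * \<bar>\<psi> (y (Suc i)) - \<psi> \<xi>\<bar>))"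
        using c[of i] s_range[of i] by (intro mult_right_mono) auto
      also have "\<dots> = \<bar>V (Suc i) - V i\<bar> * (s i * \<bar>\<psi> (y (Suc i)) - \<psi> \<xi>\<bar>)" by simp
      also have "\<dots> \<le> \<bar>V (Suc i) - V i\<bar> * (B1 * (l + 2 * R * \<tau> * Vm))" by (intro mult_left_mono e4a) auto
      finally show ?thesis .
    qed
    have e5: "c i * s i * ((V i - v (s i)) * \<Delta> i) \<le> 2 * R * Lv * B0 * \<sigma> i"
    proof -
      have "c i * s i * ((V i - v (s i)) * \<Delta> i) \<le> (\<bar>c i\<bar> * s i) * (\<bar>V i - v (s i)\<bar> * \<bar>\<Delta> i\<bar>)"
        by (rule order_trans[OF abs_ge_self]) (use s_range[of i] in \<open>simp add: abs_mult\<close>)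
      also have "\<dots> \<le> (1 * R) * ((Lv * \<sigma> i) * (2 * B0))"
        using c[of i] s_range[of i] speed_defect(2)[of i] \<Delta> R_pos Lv_pos by (intro mult_mono) (auto simp: \<sigma>_def)
      finally show ?thesis by (simp add: algebra_simps)
    qed
    have fl: "eflux k (s i) - eflux k 0 = c i * (s i * v (s i) - k * v k) - k * v k"
      using k by (auto simp: eflux_def c_def flux_def sgn_if)
    \<comment> \<open>Exact splitting into the expansion error, the convexity term, the effect of
      evaluating the flux at the new instead of the old density, and a remainder with entropy and
      flux both taken at the new density.\<close>
    have id: "bt i * (F (z (Suc i)) - F (z i)) - at' i * (F (y (Suc i)) - F (y i)) - \<tau> * ((eflux k (r i) - eflux k 0) * \<Delta> i)
      = bt i * dD + (bt i - at' i) * (p * \<psi> \<xi>) + \<tau> * ((eflux k (s i) - eflux k (r i)) * \<Delta> i)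
       + \<tau> * (bt i * (\<psi> (y (Suc i)) * V (Suc i) - \<psi> (y i) * V i) - (eflux k (s i) - eflux k 0) * \<Delta> i)"
      unfolding dD_def \<xi>(3)[symmetric] by (simp add: algebra_simps)
    \<comment> \<open>Once the convexity term is moved over, the remainder consists of two small
      errors and of \<open>k * ((c i + 1) * (g i - g (Suc i)))\<close>, a difference between the two
      interfaces of the cell.\<close>
    have id2: "bt i * (\<psi> (y (Suc i)) * V (Suc i) - \<psi> (y i) * V i) - c i * s i * (V (Suc i) - V i) * \<psi> \<xi> - (eflux k (s i) - eflux k 0) * \<Delta> i
      = c i * s i * ((V (Suc i) - V i) * (\<psi> (y (Suc i)) - \<psi> \<xi>)) + c i * s i * ((V i - v (s i)) * \<Delta> i) + k * ((c i + 1) * (g i - g (Suc i)))"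
      unfolding bt fl g_def \<Delta>_def by (simp add: algebra_simps)
    have "\<tau> * (c i * s i * ((V (Suc i) - V i) * (\<psi> (y (Suc i)) - \<psi> \<xi>)) + c i * s i * ((V i - v (s i)) * \<Delta> i))
       \<le> \<tau> * (\<bar>V (Suc i) - V i\<bar> * (B1 * (l + 2 * R * \<tau> * Vm)) + 2 * R * Lv * B0 * \<sigma> i)"
      using e4 e5 \<tau>_pos by (intro mult_left_mono) linarith+
    moreover have "\<tau> * (bt i * (\<psi> (y (Suc i)) * V (Suc i) - \<psi> (y i) * V i) - (eflux k (s i) - eflux k 0) * \<Delta> i)
      = \<tau> * (c i * s i * ((V (Suc i) - V i) * (\<psi> (y (Suc i)) - \<psi> \<xi>)) + c i * s i * ((V i - v (s i)) * \<Delta> i))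
        + \<tau> * (k * ((c i + 1) * (g i - g (Suc i)))) + \<tau> * (c i * s i * (V (Suc i) - V i) * \<psi> \<xi>)"
    proof -
      have "bt i * (\<psi> (y (Suc i)) * V (Suc i) - \<psi> (y i) * V i) - (eflux k (s i) - eflux k 0) * \<Delta> i
        = (c i * s i * ((V (Suc i) - V i) * (\<psi> (y (Suc i)) - \<psi> \<xi>)) + c i * s i * ((V i - v (s i)) * \<Delta> i))
        + k * ((c i + 1) * (g i - g (Suc i))) + c i * s i * (V (Suc i) - V i) * \<psi> \<xi>"
        using id2 by linarith
      then show ?thesis by (simp only: distrib_left)
    qed
    moreover have "\<tau> * E i = \<tau> * (2 * R * B1 * Vm\<^sup>2 * \<tau>) + \<tau> * (2 * Lf * B0 * \<sigma> i)
       + \<tau> * (\<bar>V (Suc i) - V i\<bar> * (B1 * (l + 2 * R * \<tau> * Vm)) + 2 * R * Lv * B0 * \<sigma> i)"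
      by (simp add: E_def distrib_left)
    ultimately show ?thesis unfolding id using e1 e2 e3 by linarith
  qed
  \<comment> \<open>The interface terms carry no small factor, so their sign is needed. Summation by
    parts collects at interface j the jump of the sign times
    \<open>\<psi> (y j) * (V j - v k)\<close>; with \<open>v (s j)\<close> in place of
    \<open>V j\<close> this is nonpositive by \<open>entropy_flux_sign\<close>.\<close>
  have kterm: "k * (\<Sum>i<N. (c i + 1) * (g i - g (Suc i))) \<le> 2 * R * B0 * Lv * (\<Sum>i<N. \<sigma> i)"
  \<comment> \<open>For k = 0 the boundary value \<open>h N\<close> would be 1 instead of 0, but
    then the factor k removes the whole sum.\<close>
  proof (cases "k = 0")
    case True
    then show ?thesis using R_pos B0' Lv_pos by (auto simp: \<sigma>_def intro!: mult_nonneg_nonneg sum_nonneg)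
  next
    case False
    define h where "h i = c i + 1" for i
    have hN: "h N = 0" using False k s_N by (simp add: h_def c_def)
    have hj: "jump h j * g j \<le> 2 * B0 * (Lv * \<sigma> j)" for j
    proof -
      \<comment> \<open>The value -1 at j = 0 is the sign in the vacuum behind particle 0: there h
        counts as 0.\<close>
      define e where "e = (if j = 0 then -1 else c (j - 1))"
      have e: "e \<in> {-1..1}" using c[of "j - 1"] by (auto simp: e_def)
      have j: "jump h j = sgn (s j - k) - e" by (auto simp: jump_def h_def e_def c_def)
      have "jump h j * g j = \<psi> (y j) * ((sgn (s j - k) - e) * (v (s j) - v k)) + jump h j * (\<psi> (y j) * (V j - v (s j)))"
        unfolding j g_def by (simp add: algebra_simps)
      moreover have "\<psi> (y j) * ((sgn (s j - k) - e) * (v (s j) - v k)) \<le> 0"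
        by (rule mult_nonneg_nonpos[OF _ entropy_flux_sign[OF s_range k e]]) (use B0[of "y j"] in auto)
      moreover have "jump h j * (\<psi> (y j) * (V j - v (s j))) \<le> \<bar>jump h j\<bar> * (\<bar>\<psi> (y j)\<bar> * \<bar>V j - v (s j)\<bar>)"
        by (rule order_trans[OF abs_ge_self]) (simp add: abs_mult)
      moreover have "\<bar>jump h j\<bar> * (\<bar>\<psi> (y j)\<bar> * \<bar>V j - v (s j)\<bar>) \<le> 2 * (B0 * (Lv * \<sigma> j))"
      proof (intro mult_mono)
        show "\<bar>jump h j\<bar> \<le> 2" using c[of j] e by (auto simp: j c_def)
        show "\<bar>V j - v (s j)\<bar> \<le> Lv * \<sigma> j" using speed_defect(2)[of j] by (simp add: \<sigma>_def)
      qed (use B0[of "y j"] B0' in auto)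
      ultimately show ?thesis by linarith
    qed
    have "(\<Sum>i<N. (c i + 1) * (g i - g (Suc i))) = (\<Sum>j\<le>N. jump h j * g j)"
      using abel_jump[of h g N] hN by (simp add: h_def)
    also have "\<dots> \<le> (\<Sum>j\<le>N. 2 * B0 * (Lv * \<sigma> j))" by (intro sum_mono hj)
    also have "\<dots> = (\<Sum>j<Suc N. 2 * B0 * (Lv * \<sigma> j))" by (simp add: lessThan_Suc_atMost)
    also have "\<dots> = (\<Sum>j<N. 2 * B0 * (Lv * \<sigma> j))" using s_N r_N by (simp add: \<sigma>_def)
    also have "\<dots> = 2 * B0 * Lv * (\<Sum>j<N. \<sigma> j)" by (simp add: sum_distrib_left mult.assoc)
    finally have "k * (\<Sum>i<N. (c i + 1) * (g i - g (Suc i))) \<le> k * (2 * B0 * Lv * (\<Sum>j<N. \<sigma> j))"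
      using k by (intro mult_left_mono) auto
    also have "\<dots> \<le> R * (2 * B0 * Lv * (\<Sum>j<N. \<sigma> j))"
      using k B0' Lv_pos by (intro mult_right_mono mult_nonneg_nonneg sum_nonneg) (auto simp: \<sigma>_def)
    finally show ?thesis by (simp add: algebra_simps)
  qed
  have sE: "(\<Sum>i<N. E i) = 2 * real N * R * B1 * Vm\<^sup>2 * \<tau> + B1 * (l + 2 * R * \<tau> * Vm) * (\<Sum>i<N. \<bar>V (Suc i) - V i\<bar>)
       + (2 * B0 * Lf + 2 * R * B0 * Lv) * (\<Sum>i<N. \<sigma> i)"
  proof -
    have "(\<Sum>i<N. E i) = real N * (2 * R * B1 * Vm\<^sup>2 * \<tau>) + (\<Sum>i<N. \<bar>V (Suc i) - V i\<bar>) * (B1 * (l + 2 * R * \<tau> * Vm))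
       + 2 * R * Lv * B0 * (\<Sum>i<N. \<sigma> i) + 2 * Lf * B0 * (\<Sum>i<N. \<sigma> i)"
      unfolding E_def by (simp only: sum.distrib sum_distrib_left[symmetric] sum_distrib_right[symmetric] sum_constant card_lessThan) simp
    then show ?thesis by (simp add: algebra_simps)
  qed
  have \<sigma>sum: "(\<Sum>i<N. \<sigma> i) \<le> R\<^sup>2 * (\<tau> / l) * (Lv * C)" unfolding \<sigma>_def by (rule density_variation[OF C])
  have "(\<integral>x. (\<bar>step_fun N z s x - k\<bar> - k) * \<psi> x \<partial>lborel) - (\<integral>x. (\<bar>step_fun N y r x - k\<bar> - k) * \<psi> x \<partial>lborel)
       - \<tau> * (\<integral>x. (eflux k (step_fun N y r x) - eflux k 0) * \<psi>' x \<partial>lborel)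
     = (\<Sum>i<N. bt i * (F (z (Suc i)) - F (z i)) - at' i * (F (y (Suc i)) - F (y i))
      - \<tau> * ((eflux k (r i) - eflux k 0) * \<Delta> i))"
    using step_integral_z[of "\<lambda>x. \<bar>x - k\<bar> - k" F \<psi>] step_integral_y[of "\<lambda>x. \<bar>x - k\<bar> - k" F \<psi>]
      step_integral_y[of "\<lambda>x. eflux k x - eflux k 0" \<psi> \<psi>'] F d c' cont k
    by (simp add: sum_subtractf sum_distrib_left bt_def at'_def \<Delta>_def)
  also have "\<dots> \<le> (\<Sum>i<N. \<tau> * E i + \<tau> * (k * ((c i + 1) * (g i - g (Suc i)))))"
    by (intro sum_mono cell) auto
  also have "\<dots> = \<tau> * ((\<Sum>i<N. E i) + k * (\<Sum>i<N. (c i + 1) * (g i - g (Suc i))))"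
    by (simp only: sum.distrib sum_distrib_left distrib_left)
  also have "\<dots> \<le> \<tau> * ((\<Sum>i<N. E i) + 2 * R * B0 * Lv * (\<Sum>i<N. \<sigma> i))"
    using \<tau>_pos kterm by (intro mult_left_mono add_left_mono) auto
  also have "\<dots> = \<tau> * (2 * real N * R * B1 * Vm\<^sup>2 * \<tau> + B1 * (l + 2 * R * \<tau> * Vm) * (\<Sum>i<N. \<bar>V (Suc i) - V i\<bar>)
       + (2 * B0 * Lf + 4 * R * B0 * Lv) * (\<Sum>i<N. \<sigma> i))"
    unfolding sE by (simp add: algebra_simps)
  also have "\<dots> \<le> \<tau> * (2 * real N * R * B1 * Vm\<^sup>2 * \<tau> + B1 * (l + 2 * R * \<tau> * Vm) * (Lv * C)
       + (2 * B0 * Lf + 4 * R * B0 * Lv) * (R\<^sup>2 * (\<tau> / l) * (Lv * C)))"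
    using \<tau>_pos l_pos R_pos Vm_nonneg B1' B0' Lv_pos Lf_nonneg speed_variation[OF C] \<sigma>sum
    by (intro mult_left_mono add_mono order_refl add_nonneg_nonneg mult_nonneg_nonneg) auto
  finally show ?thesis .
qed

end

section \<open>Initial data\<close>

text \<open>The complement of the support is a possibly uncountable union of open sets on each of
  which u vanishes almost everywhere; the Lindelof property reduces it to a countable one.\<close>

lemma AE_ess_supp: "AE x in lebesgue. x \<notin> ess_supp u \<longrightarrow> u x = 0"
proof -
  define \<U> where "\<U> = {U. open U \<and> (AE x in lebesgue. x \<in> U \<longrightarrow> u x = 0)}"
  obtain \<V> where \<V>: "\<V> \<subseteq> \<U>" "countable \<V>" "\<Union>\<V> = \<Union>\<U>"
    using Lindelof[of \<U>] by (auto simp: \<U>_def)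
  have "AE x in lebesgue. \<forall>U\<in>\<V>. x \<in> U \<longrightarrow> u x = 0"
    using \<V> by (subst AE_ball_countable) (auto simp: \<U>_def)
  then show ?thesis
  proof eventually_elim
    case (elim x)
    have "- ess_supp u = \<Union>\<V>" unfolding \<V>(3) by (simp add: ess_supp_def \<U>_def)
    with elim show ?case by blast
  qed
qed

lemma closed_ess_supp: "closed (ess_supp u)"
  unfolding ess_supp_def by (intro closed_Compl open_Union) auto

text \<open>Continuity makes the set closed, so its infimum is attained and is the
  \<open>LEAST\<close> element; by the intermediate value theorem the mass up to it is exactly
  \<open>l\<close> and not more.\<close>

lemma least_mass_point:
  fixes G :: "real \<Rightarrow> real"
  assumes c: "continuous_on UNIV G" and l: "0 < l" and b: "a \<le> b" "G b - G a \<ge> l"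
  defines "p \<equiv> LEAST x. a \<le> x \<and> G x - G a \<ge> l"
  shows "a < p" "p \<le> b" "G p = G a + l"
proof -
  define S where "S = {x. a \<le> x \<and> G x - G a \<ge> l}"
  have "closed S" unfolding S_def
    by (intro closed_Collect_conj closed_Collect_le continuous_intros c)
  moreover have "S \<noteq> {}" "bdd_below S" using b by (auto simp: S_def bdd_below_def)
  ultimately have I: "Inf S \<in> S" by (intro closed_contains_Inf)
  have "p = Inf S"
    unfolding p_def
    by (rule Least_equality) (use I \<open>bdd_below S\<close> in \<open>auto simp: S_def intro!: cInf_lower\<close>)
  then have p: "p \<in> S" "\<And>x. x \<in> S \<Longrightarrow> p \<le> x" using I \<open>bdd_below S\<close> by (auto intro: cInf_lower)
  show "p \<le> b" using p(2)[of b] b by (simp add: S_def)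
  have ap: "a \<le> p" "G a + l \<le> G p" using p(1) by (auto simp: S_def)
  then show "a < p" using l by (cases "a = p") auto
  obtain x where x: "a \<le> x" "x \<le> p" "G x = G a + l"
    using IVT'[of G a "G a + l" p] ap l continuous_on_subset[OF c] by auto
  then have "p \<le> x" by (intro p(2)) (simp add: S_def)
  then show "G p = G a + l" using x by simp
qed

lemma deriv_max0:
  fixes x a :: real
  assumes "x \<noteq> a"
  shows "((\<lambda>x. max 0 (x - a)) has_real_derivative indicator {a..} x) (at x)"
proof (cases "a < x")
  case True
  have "((\<lambda>x. x - a) has_real_derivative 1) (at x)" by (auto intro!: derivative_eq_intros)
  then have "((\<lambda>x. max 0 (x - a)) has_real_derivative 1) (at x)"
    by (rule DERIV_cong_ev[THEN iffD1, rotated -1])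
       (use True in \<open>auto intro!: eventually_mono[OF order_tendstoD(1)[OF tendsto_ident_at True]] simp: eventually_nhds_conv_at\<close>)
  then show ?thesis using True by simp
next
  case False
  then have lt: "x < a" using assms by simp
  have "((\<lambda>x. 0) has_real_derivative 0) (at x)" by simp
  then have "((\<lambda>x. max 0 (x - a)) has_real_derivative 0) (at x)"
    by (rule DERIV_cong_ev[THEN iffD1, rotated -1])
       (use lt in \<open>auto intro!: eventually_mono[OF order_tendstoD(2)[OF tendsto_ident_at lt]] simp: eventually_nhds_conv_at\<close>)
  then show ?thesis using lt by simp
qed

lemma abs_max0_diff: "\<bar>max 0 a - max 0 b\<bar> \<le> \<bar>a - b :: real\<bar>"
  by auto

locale datum =
  fixes R :: real and \<rho>\<^sub>0 :: "real \<Rightarrow> real"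
  assumes R_pos: "0 < R" and \<rho>0: "\<rho>\<^sub>0 \<in> Linfty_c" "\<rho>\<^sub>0 \<in> BV"
    and range_\<rho>0: "AE x in lebesgue. 0 \<le> \<rho>\<^sub>0 x \<and> \<rho>\<^sub>0 x \<le> R"
    and mass_pos: "0 < (LINT x|lebesgue. \<bar>\<rho>\<^sub>0 x\<bar>)"
begin

definition L :: real where "L = (LINT x|lebesgue. \<bar>\<rho>\<^sub>0 x\<bar>)"

lemma supp: "compact (ess_supp \<rho>\<^sub>0)" "ess_supp \<rho>\<^sub>0 \<noteq> {}"
proof -
  show "compact (ess_supp \<rho>\<^sub>0)" using \<rho>0 by (simp add: Linfty_c_def)
  show "ess_supp \<rho>\<^sub>0 \<noteq> {}"
  proof
    assume "ess_supp \<rho>\<^sub>0 = {}"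
    then have "AE x in lebesgue. \<bar>\<rho>\<^sub>0 x\<bar> = 0" using AE_ess_supp[of \<rho>\<^sub>0] by auto
    then have "(LINT x|lebesgue. \<bar>\<rho>\<^sub>0 x\<bar>) = 0" by (rule integral_eq_zero_AE)
    with mass_pos show False by simp
  qed
qed

definition A0 :: real where "A0 = (LEAST x. x \<in> ess_supp \<rho>\<^sub>0)"

definition B0 :: real where "B0 = Sup (ess_supp \<rho>\<^sub>0)"

lemma supp_bounds: "A0 \<in> ess_supp \<rho>\<^sub>0" "ess_supp \<rho>\<^sub>0 \<subseteq> {A0..B0}" "A0 \<le> B0"
proof -
  obtain a where a: "a \<in> ess_supp \<rho>\<^sub>0" "\<And>x. x \<in> ess_supp \<rho>\<^sub>0 \<Longrightarrow> a \<le> x"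
    using compact_attains_inf[OF supp] by blast
  then have "A0 = a" unfolding A0_def by (intro Least_equality) auto
  moreover have "bdd_above (ess_supp \<rho>\<^sub>0)" using supp(1) by (intro bounded_imp_bdd_above compact_imp_bounded)
  ultimately show "A0 \<in> ess_supp \<rho>\<^sub>0" "ess_supp \<rho>\<^sub>0 \<subseteq> {A0..B0}"
    using a by (auto simp: B0_def intro!: cSup_upper)
  then show "A0 \<le> B0" by auto
qed

text \<open>The datum is an almost everywhere class for the complete measure. Truncating a Borel
  modification gives a function whose range and support bounds hold at every point, which spares the
  later integrals their null sets.\<close>

lemma borel_representative:
  "\<exists>g. g \<in> borel_measurable borel \<and> (\<forall>x. g x \<in> {0..R}) \<and> (\<forall>x. x \<notin> {A0..B0} \<longrightarrow> g x = 0) \<and> (AE x in lebesgue. \<rho>\<^sub>0 x = g x)"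
proof -
  have "\<rho>\<^sub>0 \<in> borel_measurable (completion lborel)" using \<rho>0 by (simp add: Linfty_c_def)
  then obtain g where g: "g \<in> borel_measurable lborel" "AE x in lborel. \<rho>\<^sub>0 x = g x"
    using completion_ex_borel_measurable_real by blast
  have [measurable]: "g \<in> borel_measurable borel" using g(1) by simp
  define h where "h x = indicator {A0..B0} x * max 0 (min R (g x))" for x
  have "AE x in lebesgue. \<rho>\<^sub>0 x = h x"
    using AE_ess_supp[of \<rho>\<^sub>0] range_\<rho>0 AE_completion[OF g(2)]
  proof eventually_elim
    case (elim x)
    then show ?case using supp_bounds(2) by (cases "x \<in> {A0..B0}") (auto simp: h_def)
  qed
  moreover have "h \<in> borel_measurable borel" unfolding h_def[abs_def] by measurable
  moreover have "h x \<in> {0..R}" for x using R_pos by (auto simp: h_def indicator_def)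
  moreover have "x \<notin> {A0..B0} \<longrightarrow> h x = 0" for x by (simp add: h_def)
  ultimately show ?thesis by blast
qed

definition \<rho>b :: "real \<Rightarrow> real" where
  "\<rho>b = (SOME g. g \<in> borel_measurable borel \<and> (\<forall>x. g x \<in> {0..R}) \<and> (\<forall>x. x \<notin> {A0..B0} \<longrightarrow> g x = 0)
     \<and> (AE x in lebesgue. \<rho>\<^sub>0 x = g x))"

lemma \<rho>b: "\<rho>b \<in> borel_measurable borel" "\<rho>b x \<in> {0..R}" "x \<notin> {A0..B0} \<Longrightarrow> \<rho>b x = 0" "AE x in lebesgue. \<rho>\<^sub>0 x = \<rho>b x"
  using someI_ex[OF borel_representative] unfolding \<rho>b_def[symmetric] by auto

lemmas \<rho>b_measurable [measurable] = \<rho>b(1)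

lemma \<rho>0_measurable [measurable]: "\<rho>\<^sub>0 \<in> borel_measurable lebesgue"
  using \<rho>0 by (simp add: Linfty_c_def)

lemma integrable_\<rho>b: "integrable lborel \<rho>b"
  by (rule integrable_bounded_interval[of _ R A0 B0]) (use \<rho>b in auto)

lemma integral_\<rho>0:
  assumes [measurable]: "w \<in> borel_measurable borel"
  shows "(LINT x|lebesgue. \<rho>\<^sub>0 x * w x) = (\<integral>x. \<rho>b x * w x \<partial>lborel)"
proof -
  have "(LINT x|lebesgue. \<rho>\<^sub>0 x * w x) = (LINT x|lebesgue. \<rho>b x * w x)"
  proof (rule integral_cong_AE)
    show "AE x in lebesgue. \<rho>\<^sub>0 x * w x = \<rho>b x * w x" using \<rho>b(4) by eventually_elim simp
  qed (auto intro!: borel_measurable_times \<rho>0_measurable measurable_completion[of w] measurable_completion[of \<rho>b])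
  also have "\<dots> = (\<integral>x. \<rho>b x * w x \<partial>lborel)" by (rule integral_completion) simp
  finally show ?thesis .
qed

definition F0 :: "real \<Rightarrow> real" where "F0 x = (\<integral>y. \<rho>b y * indicator {..x} y \<partial>lborel)"

lemma integrable_\<rho>b_ind: "S \<in> sets borel \<Longrightarrow> integrable lborel (\<lambda>y. \<rho>b y * indicator S y)"
  using integrable_real_mult_indicator[of S lborel \<rho>b] integrable_\<rho>b by simp

lemma F0_diff:
  assumes "a \<le> b"
  shows "(\<integral>y. \<rho>b y * indicator {a..<b} y \<partial>lborel) = F0 b - F0 a" "(\<integral>y. \<rho>b y * indicator {a..b} y \<partial>lborel) = F0 b - F0 a"
proof -
  have "F0 b - F0 a = (\<integral>y. \<rho>b y * indicator {..b} y - \<rho>b y * indicator {..a} y \<partial>lborel)"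
    unfolding F0_def by (subst Bochner_Integration.integral_diff) (auto intro!: integrable_\<rho>b_ind)
  moreover have "\<dots> = (\<integral>y. \<rho>b y * indicator {a..<b} y \<partial>lborel)"
  proof (rule integral_cong_AE)
    show "AE y in lborel. \<rho>b y * indicator {..b} y - \<rho>b y * indicator {..a} y = \<rho>b y * indicator {a..<b} y"
      using AE_lborel_singleton[of a] AE_lborel_singleton[of b]
      by eventually_elim (use assms in \<open>auto simp: indicator_def\<close>)
  qed auto
  moreover have "(\<integral>y. \<rho>b y * indicator {a..b} y \<partial>lborel) = (\<integral>y. \<rho>b y * indicator {a..<b} y \<partial>lborel)"
  proof (rule integral_cong_AE)
    show "AE y in lborel. \<rho>b y * indicator {a..b} y = \<rho>b y * indicator {a..<b} y"
      using AE_lborel_singleton[of b]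
      by eventually_elim (use assms in \<open>auto simp: indicator_def\<close>)
  qed auto
  ultimately show "(\<integral>y. \<rho>b y * indicator {a..<b} y \<partial>lborel) = F0 b - F0 a" "(\<integral>y. \<rho>b y * indicator {a..b} y \<partial>lborel) = F0 b - F0 a"
    by auto
qed

lemma F0_increment: "a \<le> b \<Longrightarrow> 0 \<le> F0 b - F0 a" "a \<le> b \<Longrightarrow> F0 b - F0 a \<le> R * (b - a)"
proof -
  assume ab: "a \<le> b"
  show "0 \<le> F0 b - F0 a"
    unfolding F0_diff(2)[OF ab, symmetric] by (rule integral_nonneg_AE) (use \<rho>b(2) in auto)
  have "(\<integral>y. \<rho>b y * indicator {a..b} y \<partial>lborel) \<le> (\<integral>y. R * indicator {a..b} y \<partial>lborel)"
    by (rule integral_mono[OF integrable_\<rho>b_ind])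
       (use \<rho>b(2) ab in \<open>auto intro!: mult_right_mono integrable_mult_right integrable_real_indicator\<close>)
  also have "\<dots> = R * (b - a)" using ab by simp
  finally show "F0 b - F0 a \<le> R * (b - a)" unfolding F0_diff(2)[OF ab] .
qed

lemma F0_cont: "continuous_on UNIV F0"
proof -
  have "R-lipschitz_on UNIV F0"
  proof (rule lipschitz_onI)
    fix x y :: real
    show "dist (F0 x) (F0 y) \<le> R * dist x y"
      using F0_increment[of x y] F0_increment[of y x] by (cases "x \<le> y") (auto simp: dist_real_def)
  qed (use R_pos in auto)
  then show ?thesis by (rule lipschitz_on_continuous_on)
qed

lemma F0_left: "x \<le> A0 \<Longrightarrow> F0 x = 0"
  unfolding F0_def
proof (rule integral_eq_zero_AE)
  assume x: "x \<le> A0"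
  show "AE y in lborel. \<rho>b y * indicator {..x} y = 0"
    using AE_lborel_singleton[of A0] by eventually_elim (use x \<rho>b(3) in \<open>auto simp: indicator_def\<close>)
qed

lemma F0_right: "B0 \<le> x \<Longrightarrow> F0 x = L"
proof -
  assume x: "B0 \<le> x"
  have "L = (LINT y|lebesgue. \<rho>b y)"
    unfolding L_def
  proof (rule integral_cong_AE)
    show "AE y in lebesgue. \<bar>\<rho>\<^sub>0 y\<bar> = \<rho>b y" using \<rho>b(4) by eventually_elim (use \<rho>b(2) in auto)
  qed (auto intro!: measurable_completion)
  also have "\<dots> = (\<integral>y. \<rho>b y \<partial>lborel)" by (rule integral_completion) simp
  also have "\<dots> = F0 x"
    unfolding F0_def by (rule Bochner_Integration.integral_cong) (use x \<rho>b(3) in \<open>auto simp: indicator_def\<close>)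
  finally show ?thesis ..
qed

lemma F0_bounds: "F0 x \<in> {0..L}"
  using F0_increment(1)[of "min x A0" x] F0_left[of "min x A0"] F0_increment(1)[of x "max x B0"] F0_right[of "max x B0"] by auto

lemma L_pos: "0 < L" using mass_pos by (simp add: L_def)

lemma L_eq_integral: "L = (\<integral>y. \<rho>b y \<partial>lborel)"
proof -
  have "(\<integral>y. \<rho>b y \<partial>lborel) = F0 B0"
    unfolding F0_def by (rule Bochner_Integration.integral_cong) (use \<rho>b(3) in \<open>auto simp: indicator_def\<close>)
  then show ?thesis using F0_right[of B0] by simp
qed

lemma initial_position_eq:
  "initial_position \<rho>\<^sub>0 l 0 = A0"
  "initial_position \<rho>\<^sub>0 l (Suc i) = (LEAST x. initial_position \<rho>\<^sub>0 l i \<le> x \<and> F0 x - F0 (initial_position \<rho>\<^sub>0 l i) \<ge> l)"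
proof -
  have "(LINT y:{a..x}|lebesgue. \<rho>\<^sub>0 y) = F0 x - F0 a" if "a \<le> x" for a x
  proof -
    have "(LINT y:{a..x}|lebesgue. \<rho>\<^sub>0 y) = (LINT y|lebesgue. \<rho>\<^sub>0 y * indicator {a..x} y)"
      unfolding set_lebesgue_integral_def by (simp add: mult.commute)
    then show ?thesis using integral_\<rho>0[of "indicator {a..x}"] F0_diff(2)[OF that] by simp
  qed
  then show "initial_position \<rho>\<^sub>0 l (Suc i) = (LEAST x. initial_position \<rho>\<^sub>0 l i \<le> x \<and> F0 x - F0 (initial_position \<rho>\<^sub>0 l i) \<ge> l)"
    by (auto intro!: arg_cong[of _ _ Least])
qed (simp add: A0_def)

context
  fixes N :: nat and l :: real and p :: "nat \<Rightarrow> real"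
  assumes N: "0 < N" and l: "l = L / real N" and p: "p = initial_position \<rho>\<^sub>0 l"
begin

lemma l_pos: "0 < l" using N L_pos l by simp

text \<open>While fewer than N cells have been cut off, at least \<open>l\<close> of the mass still
  lies ahead within the support, so the next \<open>LEAST\<close> ranges over a nonempty
  set.\<close>

lemma initial_mass: "i \<le> N \<Longrightarrow> F0 (p i) = real i * l \<and> A0 \<le> p i \<and> p i \<le> B0"
  and initial_less: "i < N \<Longrightarrow> p i < p (Suc i)"
proof -
  have step: "p i < p (Suc i) \<and> p (Suc i) \<le> B0 \<and> F0 (p (Suc i)) = F0 (p i) + l"
    if "i < N" "F0 (p i) = real i * l" "p i \<le> B0" for i
  proof -
    have "real (Suc i) * l \<le> real N * l" using that(1) l_pos by (intro mult_right_mono) auto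
    also have "\<dots> = L" using N l by simp
    finally have *: "F0 B0 - F0 (p i) \<ge> l" using that(2) F0_right[of B0] by (simp add: algebra_simps)
    show ?thesis
      using least_mass_point[OF F0_cont l_pos that(3) *] initial_position_eq(2)[of l i] unfolding p by auto
  qed
  have main: "F0 (p i) = real i * l \<and> A0 \<le> p i \<and> p i \<le> B0" if "i \<le> N" for i
    using that
  proof (induction i)
    case 0
    then show ?case using F0_left[of A0] initial_position_eq(1)[of l] supp_bounds(3) by (simp add: p)
  next
    case (Suc i)
    then show ?case using step[of i] by (auto simp: algebra_simps)
  qed
  then show "i \<le> N \<Longrightarrow> F0 (p i) = real i * l \<and> A0 \<le> p i \<and> p i \<le> B0" by blast
  show "i < N \<Longrightarrow> p i < p (Suc i)" using main[of i] step[of i] by auto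
qed

lemma initial_density_le: "i < N \<Longrightarrow> local_density l N p i \<le> R"
proof -
  assume i: "i < N"
  have "l = F0 (p (Suc i)) - F0 (p i)" using initial_mass[of i] initial_mass[of "Suc i"] i by (simp add: algebra_simps)
  also have "\<dots> \<le> R * (p (Suc i) - p i)" using F0_increment(2)[of "p i" "p (Suc i)"] initial_less[OF i] by simp
  finally show ?thesis using i initial_less[OF i] by (simp add: local_density_def divide_le_eq)
qed

text \<open>Both functions are nondecreasing and take the value \<open>i * l\<close> at node i, so
  between consecutive nodes they differ by at most \<open>l\<close>; to the left and right of all
  nodes they agree.\<close>

lemma initial_prim: "\<bar>step_prim N p (local_density l N p) x - F0 x\<bar> \<le> l"
proof -
  let ?G = "step_prim N p (local_density l N p)"
  have r: "local_density l N p i \<in> {0..R}" if "i < N" for i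
    using initial_density_le[OF that] initial_less[OF that] l_pos that by (simp add: local_density_def)
  have mono: "?G a \<le> ?G b" if "a \<le> b" for a b
    using step_prim_increment(1)[of N p "local_density l N p" R "b - a" a] initial_less r that R_pos by simp
  have node: "?G (p j) = real j * l" if j: "j \<le> N" for j
  proof -
    have "?G (p j) = (\<Sum>i<N. if i < j then l else 0)"
      unfolding step_prim_def
    proof (intro sum.cong refl)
      fix i assume "i \<in> {..<N}"
      then have i: "i < N" by simp
      show "local_density l N p i * (max 0 (p j - p i) - max 0 (p j - p (Suc i))) = (if i < j then l else 0)"
      proof (cases "i < j")
        case True
        then have "p (Suc i) \<le> p j" using mono_nodes[of N p "Suc i" j] initial_less j by auto
        then have "max 0 (p j - p i) - max 0 (p j - p (Suc i)) = p (Suc i) - p i" using initial_less[OF i] by simp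
        then show ?thesis using True i initial_less[OF i] by (simp add: local_density_def)
      next
        case False
        then have "p j \<le> p i" using mono_nodes[of N p j i] initial_less i by auto
        then show ?thesis using False initial_less[OF i] by simp
      qed
    qed
    also have "\<dots> = (\<Sum>i<j. l)"
      using j by (intro sum.mono_neutral_cong_right) auto
    finally show ?thesis by simp
  qed
  consider "x \<le> p 0" | "p N \<le> x" | "p 0 \<le> x" "x < p N" by linarith
  then show ?thesis
  proof cases
    case 1
    have "0 \<le> ?G x" unfolding step_prim_def
    proof (intro sum_nonneg mult_nonneg_nonneg)
      fix i assume "i \<in> {..<N}"
      then show "0 \<le> local_density l N p i" "0 \<le> max 0 (x - p i) - max 0 (x - p (Suc i))"
        using r[of i] initial_less[of i] by (auto simp: max_def)
    qed
    then have "?G x = 0" using mono[OF 1] node[of 0] by simp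
    then show ?thesis using 1 F0_left[of x] initial_position_eq(1)[of l] l_pos by (simp add: p)
  next
    case 2
    have NL: "real N * l = L" using N l by simp
    have "?G x = ?G (p N)" unfolding step_prim_def
    proof (intro sum.cong refl)
      fix i assume "i \<in> {..<N}"
      then have "p i \<le> p N" "p (Suc i) \<le> p N" using mono_nodes[of N p i N] mono_nodes[of N p "Suc i" N] initial_less by auto
      then show "local_density l N p i * (max 0 (x - p i) - max 0 (x - p (Suc i))) =
         local_density l N p i * (max 0 (p N - p i) - max 0 (p N - p (Suc i)))" using 2 by simp
    qed
    moreover have "F0 x = L" using F0_increment(1)[OF 2] initial_mass[of N] NL F0_bounds[of x] by simp
    ultimately show ?thesis using node[of N] NL l_pos by simp
  next
    case 3
    then obtain i where i: "i < N" "p i \<le> x" "x < p (Suc i)" using node_cell by blast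
    have "real i * l \<le> ?G x" "?G x \<le> real (Suc i) * l"
      using mono[OF i(2)] mono[of x "p (Suc i)"] i node[of i] node[of "Suc i"] by auto
    moreover have "real i * l \<le> F0 x" "F0 x \<le> real (Suc i) * l"
      using F0_increment(1)[OF i(2)] F0_increment(1)[of x "p (Suc i)"] i initial_mass[of i] initial_mass[of "Suc i"] by auto
    ultimately show ?thesis by (simp add: algebra_simps abs_le_iff)
  qed
qed

end

end

section \<open>Total variation of the discretized datum\<close>

lemma compact_support_iff:
  fixes f :: "real \<Rightarrow> real"
  assumes "\<And>x. x \<notin> {a..b} \<Longrightarrow> f x = 0"
  shows "compact (closure {x. f x \<noteq> 0})"
proof -
  have "{x. f x \<noteq> 0} \<subseteq> {a..b}" using assms by blast
  then show ?thesis by (intro compact_closure[THEN iffD2] bounded_subset[OF bounded_closed_interval])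
qed

context datum
begin

text \<open>Some bound for the distributional variation, not necessarily the smallest; the maximum
  with 0 gives it a sign, so that it can be used as a factor in estimates.\<close>

definition TV0 :: real where
  "TV0 = max 0 (SOME C. \<forall>\<phi>. \<phi> C1_differentiable_on UNIV \<longrightarrow> compact (closure {x. \<phi> x \<noteq> 0}) \<longrightarrow>
              (\<forall>x. \<bar>\<phi> x\<bar> \<le> 1) \<longrightarrow> (LINT x|lebesgue. \<rho>\<^sub>0 x * deriv \<phi> x) \<le> C)"

lemma TV0:
  assumes "\<phi> C1_differentiable_on UNIV" "compact (closure {x. \<phi> x \<noteq> 0})" "\<And>x. \<bar>\<phi> x\<bar> \<le> 1"
  shows "(LINT x|lebesgue. \<rho>\<^sub>0 x * deriv \<phi> x) \<le> TV0"
proof -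
  have "\<exists>C. \<forall>\<phi>. \<phi> C1_differentiable_on UNIV \<longrightarrow> compact (closure {x. \<phi> x \<noteq> 0}) \<longrightarrow>
              (\<forall>x. \<bar>\<phi> x\<bar> \<le> 1) \<longrightarrow> (LINT x|lebesgue. \<rho>\<^sub>0 x * deriv \<phi> x) \<le> C"
    using \<rho>0(2) by (auto simp: BV_def)
  from someI_ex[OF this] show ?thesis using assms unfolding TV0_def by fastforce
qed

text \<open>Averaging over symmetric intervals turns a Lipschitz function into an admissible test function.\<close>

lemma TV0_lipschitz:
  assumes lip: "K-lipschitz_on UNIV \<psi>" and bnd: "\<And>x. \<bar>\<psi> x\<bar> \<le> 1" and supp: "\<And>x. x \<notin> {a..b} \<Longrightarrow> \<psi> x = 0"
    and S: "finite S" and g: "\<And>x. x \<notin> S \<Longrightarrow> (\<psi> has_real_derivative g x) (at x)"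
    and [measurable]: "g \<in> borel_measurable borel"
  shows "(\<integral>x. \<rho>b x * g x \<partial>lborel) \<le> TV0"
proof -
  have cont: "continuous_on UNIV \<psi>" using lip by (rule lipschitz_on_continuous_on)
  have [measurable]: "\<psi> \<in> borel_measurable borel" using cont by (rule borel_measurable_continuous_onI)
  obtain F where F: "\<And>x. (F has_real_derivative \<psi> x) (at x)"
    using continuous_antiderivative[OF cont] by metis
  define \<epsilon> where "\<epsilon> n = inverse (real (Suc n))" for n
  have \<epsilon>: "0 < \<epsilon> n" "\<epsilon> n \<le> 1" for n by (auto simp: \<epsilon>_def inverse_le_1_iff)
  \<comment> \<open>The symmetric difference quotient of \<open>\<psi>\<close> is the derivative of
    its average over a window of half-width \<open>\<epsilon> n\<close>, and this average is C1
    although \<open>\<psi>\<close> is only Lipschitz.\<close>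
  define D where "D n x = (\<psi> (x + \<epsilon> n) - \<psi> (x - \<epsilon> n)) / (2 * \<epsilon> n)" for n x
  have le: "(\<integral>x. \<rho>b x * D n x \<partial>lborel) \<le> TV0" for n
  proof -
    define \<phi> where "\<phi> x = (F (x + \<epsilon> n) - F (x - \<epsilon> n)) / (2 * \<epsilon> n)" for x
    have shift: "((\<lambda>x. F (x + c)) has_real_derivative \<psi> (x + c)) (at x)" for c x
    proof -
      have "((\<lambda>x. x + c) has_real_derivative 1) (at x)" by (auto intro!: derivative_eq_intros)
      from DERIV_chain2[OF F this] show ?thesis by simp
    qed
    have d: "(\<phi> has_real_derivative D n x) (at x)" for x
      unfolding \<phi>_def[abs_def] D_def using shift[of "\<epsilon> n" x] shift[of "- \<epsilon> n" x]
      by (intro DERIV_cdivide DERIV_diff) auto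
    have Dc: "continuous_on UNIV (D n)"
      unfolding D_def[abs_def] using \<epsilon>(1)[of n]
      by (intro continuous_intros continuous_on_compose2[OF cont]) auto
    have "\<phi> C1_differentiable_on UNIV"
      unfolding C1_differentiable_on_def
      by (rule exI[of _ "D n"]) (use d Dc in \<open>simp add: has_real_derivative_iff_has_vector_derivative\<close>)
    \<comment> \<open>Each value of the average is a value of \<open>\<psi>\<close> at a nearby
      point, so it inherits the bound 1 and, up to a small enlargement, the support.\<close>
    moreover have mean: "\<exists>\<xi>. \<bar>\<xi> - x\<bar> < \<epsilon> n \<and> \<phi> x = \<psi> \<xi>" for x
    proof -
      have "x - \<epsilon> n < x + \<epsilon> n" using \<epsilon>(1)[of n] by simp
      from MVT2[OF this F] obtain \<xi> where "x - \<epsilon> n < \<xi>" "\<xi> < x + \<epsilon> n"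
        "F (x + \<epsilon> n) - F (x - \<epsilon> n) = (x + \<epsilon> n - (x - \<epsilon> n)) * \<psi> \<xi>" by blast
      then show ?thesis using \<epsilon>(1)[of n] by (intro exI[of _ \<xi>]) (auto simp: \<phi>_def)
    qed
    moreover have "compact (closure {x. \<phi> x \<noteq> 0})"
    proof (rule compact_support_iff[of "a - \<epsilon> n" "b + \<epsilon> n"])
      fix x assume x: "x \<notin> {a - \<epsilon> n..b + \<epsilon> n}"
      obtain \<xi> where "\<bar>\<xi> - x\<bar> < \<epsilon> n" "\<phi> x = \<psi> \<xi>" using mean by blast
      moreover from this have "\<xi> \<notin> {a..b}" using x by (auto simp: abs_less_iff)
      ultimately show "\<phi> x = 0" using supp[of \<xi>] by simp
    qed
    moreover have "\<bar>\<phi> x\<bar> \<le> 1" for x using mean[of x] bnd by auto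
    ultimately have "(LINT x|lebesgue. \<rho>\<^sub>0 x * deriv \<phi> x) \<le> TV0" by (intro TV0)
    moreover have "deriv \<phi> = D n" using d by (auto intro: DERIV_imp_deriv)
    moreover have "D n \<in> borel_measurable borel" using Dc by (rule borel_measurable_continuous_onI)
    ultimately show ?thesis using integral_\<rho>0[of "D n"] by simp
  qed
  have "(\<lambda>n. \<integral>x. \<rho>b x * D n x \<partial>lborel) \<longlonglongrightarrow> (\<integral>x. \<rho>b x * g x \<partial>lborel)"
  proof (rule integral_dominated_convergence[where w = "\<lambda>x. K * \<rho>b x"])
    show "integrable lborel (\<lambda>x. K * \<rho>b x)" using integrable_\<rho>b by simp
    have "AE x in lborel. x \<notin> S" by (rule AE_not_in) (use S in \<open>simp add: finite_imp_null_set_lborel\<close>)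
    then show "AE x in lborel. (\<lambda>n. \<rho>b x * D n x) \<longlonglongrightarrow> \<rho>b x * g x"
    proof eventually_elim
      case (elim x)
      have "((\<lambda>h. (\<psi> (x + h) - \<psi> x) / h) \<longlongrightarrow> g x) (at 0)" using g[OF elim] by (simp add: DERIV_def)
      then have seq: "(\<lambda>n. (\<psi> (x + X n) - \<psi> x) / X n) \<longlonglongrightarrow> g x" if "\<And>n. X n \<noteq> 0" "X \<longlonglongrightarrow> 0" for X :: "nat \<Rightarrow> real"
        by (rule filterlim_compose) (use that in \<open>auto simp: filterlim_at\<close>)
      have e0: "\<epsilon> \<longlonglongrightarrow> 0" unfolding \<epsilon>_def by (rule LIMSEQ_inverse_real_of_nat)
      have 1: "(\<lambda>n. (\<psi> (x + \<epsilon> n) - \<psi> x) / \<epsilon> n) \<longlonglongrightarrow> g x"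
        by (rule seq) (use \<epsilon>(1) e0 in \<open>auto simp: less_imp_neq[symmetric]\<close>)
      have 2: "(\<lambda>n. (\<psi> (x + - \<epsilon> n) - \<psi> x) / - \<epsilon> n) \<longlonglongrightarrow> g x"
        by (rule seq) (use \<epsilon>(1) tendsto_minus[OF e0] in \<open>auto simp: less_imp_neq[symmetric]\<close>)
      have "(\<lambda>n. ((\<psi> (x + \<epsilon> n) - \<psi> x) / \<epsilon> n + (\<psi> (x + - \<epsilon> n) - \<psi> x) / - \<epsilon> n) / 2) \<longlonglongrightarrow> (g x + g x) / 2"
        by (intro tendsto_intros 1 2) auto
      moreover have "((\<psi> (x + \<epsilon> n) - \<psi> x) / \<epsilon> n + (\<psi> (x + - \<epsilon> n) - \<psi> x) / - \<epsilon> n) / 2 = D n x" for n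
        using \<epsilon>(1)[of n] by (simp add: D_def field_simps)
      ultimately have "(\<lambda>n. D n x) \<longlonglongrightarrow> g x" by simp
      then show ?case by (intro tendsto_intros)
    qed
    fix n
    show "(\<lambda>x. \<rho>b x * D n x) \<in> borel_measurable lborel" unfolding D_def by measurable
    show "AE x in lborel. norm (\<rho>b x * D n x) \<le> K * \<rho>b x"
    proof (intro AE_I2)
      fix x
      have "\<bar>\<psi> (x + \<epsilon> n) - \<psi> (x - \<epsilon> n)\<bar> \<le> K * (2 * \<epsilon> n)"
        using lipschitz_onD[OF lip, of "x + \<epsilon> n" "x - \<epsilon> n"] \<epsilon>(1)[of n] by (simp add: dist_real_def)
      then have "\<bar>D n x\<bar> \<le> K" using \<epsilon>(1)[of n] by (simp add: D_def divide_le_eq)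
      then show "norm (\<rho>b x * D n x) \<le> K * \<rho>b x"
        using \<rho>b(2)[of x] by (simp add: abs_mult mult.commute mult_right_mono)
    qed
  qed simp
  then show ?thesis by (rule LIMSEQ_le_const2) (use le in auto)
qed

text \<open>The discrete datum has the cell averages of \<open>\<rho>b\<close> as its values, and
  averaging does not increase the variation. The proof is by duality: it builds a test function of
  modulus at most 1 whose derivative, integrated against \<open>\<rho>b\<close>, gives the sum of
  the absolute jumps.\<close>

lemma initial_tv:
  assumes N: "0 < N" and l: "l = L / real N" and p: "p = initial_position \<rho>\<^sub>0 l"
  shows "(\<Sum>j\<le>N. \<bar>jump (local_density l N p) j\<bar>) \<le> TV0"
proof -
  note less = initial_less[OF N l p] and mass = initial_mass[OF N l p]
  \<comment> \<open>The nodes are shifted by one index and an extra node is added on each side. The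
    two additional cells carry no mass, so the jumps at the outermost particles are handled like
    interior ones.\<close>
  define q where "q j = (if j = 0 then A0 - 1 else if j \<le> Suc N then p (j - 1) else B0 + 1)" for j
  have p0: "p 0 = A0" using initial_position_eq(1)[of l] by (simp add: p)
  have q: "q j < q (Suc j)" if "j \<le> Suc N" for j
  proof (cases j)
    case 0
    then show ?thesis using p0 by (simp add: q_def)
  next
    case (Suc i)
    show ?thesis
    proof (cases "i < N")
      case True
      then show ?thesis using less[OF True] Suc by (simp add: q_def)
    next
      case False
      then have "i = N" using that Suc by simp
      then show ?thesis using mass[of N] Suc by (simp add: q_def)
    qed
  qed
  define d where "d j = q (Suc j) - q j" for j
  have d: "0 < d j" if "j \<le> Suc N" for j using q[OF that] by (simp add: d_def)
  define ramp where "ramp j x = (max 0 (x - q j) - max 0 (x - q (Suc j))) / d j" for j x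
  define e where "e j x = (indicator {q j..<q (Suc j)} x / d j :: real)" for j x
  define \<sigma> where "\<sigma> j = sgn (jump (local_density l N p) j)" for j
  \<comment> \<open>The difference of two consecutive ramps is a tent of height 1 over the node
    between their cells. The tents are weighted with the signs of the jumps; their sum stays below 1
    because the ramps telescope.\<close>
  define \<psi> where "\<psi> x = - (\<Sum>j\<le>N. \<sigma> j * (ramp j x - ramp (Suc j) x))" for x
  define g where "g x = - (\<Sum>j\<le>N. \<sigma> j * (e j x - e (Suc j) x))" for x
  have \<sigma>: "\<bar>\<sigma> j\<bar> \<le> 1" for j by (auto simp: \<sigma>_def sgn_if)
  have ramp01: "0 \<le> ramp j x" "ramp j x \<le> 1" if "j \<le> Suc N" for j x
    using d[OF that] by (auto simp: ramp_def divide_le_eq d_def max_def)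
  have ramp_le: "ramp (Suc j) x \<le> ramp j x" if "j \<le> N" for j x
    unfolding ramp_def d_def by (rule ramp_mono) (use q[of j] q[of "Suc j"] that in auto)
  have bnd: "\<bar>\<psi> x\<bar> \<le> 1" for x
  proof -
    have "\<bar>\<psi> x\<bar> \<le> (\<Sum>j\<le>N. \<bar>\<sigma> j * (ramp j x - ramp (Suc j) x)\<bar>)" unfolding \<psi>_def abs_minus_cancel by (rule sum_abs)
    also have "\<dots> \<le> (\<Sum>j\<le>N. ramp j x - ramp (Suc j) x)"
      unfolding abs_mult by (intro sum_mono) (use \<sigma> ramp_le in \<open>auto intro!: mult_left_le_one_le\<close>)
    also have "\<dots> = ramp 0 x - ramp (Suc N) x" by (rule sum_telescope)
    also have "\<dots> \<le> 1" using ramp01[of 0 x] ramp01[of "Suc N" x] by simp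
    finally show ?thesis .
  qed
  have ramp_lip: "\<bar>ramp j x - ramp j y\<bar> \<le> 2 / d j * \<bar>x - y\<bar>" if "j \<le> Suc N" for j x y
  proof -
    have "\<bar>(max 0 (x - q j) - max 0 (x - q (Suc j))) - (max 0 (y - q j) - max 0 (y - q (Suc j)))\<bar> \<le> 2 * \<bar>x - y\<bar>"
    proof -
      have tri: "\<bar>a - b - (a' - b')\<bar> \<le> \<bar>a - a'\<bar> + \<bar>b - b'\<bar>" for a b a' b' :: real by linarith
      show ?thesis
        by (rule order_trans[OF tri]) (rule order_trans[OF add_mono[OF abs_max0_diff abs_max0_diff]], simp)
    qed
    then show ?thesis
      using d[OF that] unfolding ramp_def diff_divide_distrib[symmetric] by (simp add: divide_le_cancel)
  qed
  define K where "K = (\<Sum>j\<le>N. 2 / d j + 2 / d (Suc j))"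
  have lip: "K-lipschitz_on UNIV \<psi>"
  proof (rule lipschitz_onI)
    fix x y :: real
    have "\<bar>\<psi> x - \<psi> y\<bar> = \<bar>\<Sum>j\<le>N. \<sigma> j * ((ramp j x - ramp j y) - (ramp (Suc j) x - ramp (Suc j) y))\<bar>"
      unfolding \<psi>_def by (subst abs_minus_commute) (simp add: sum_subtractf[symmetric] algebra_simps)
    also have "\<dots> \<le> (\<Sum>j\<le>N. \<bar>\<sigma> j * ((ramp j x - ramp j y) - (ramp (Suc j) x - ramp (Suc j) y))\<bar>)" by (rule sum_abs)
    also have "\<dots> \<le> (\<Sum>j\<le>N. (2 / d j + 2 / d (Suc j)) * \<bar>x - y\<bar>)"
    proof (intro sum_mono)
      fix j assume j: "j \<in> {..N}"
      have "\<bar>\<sigma> j * ((ramp j x - ramp j y) - (ramp (Suc j) x - ramp (Suc j) y))\<bar> \<le> \<bar>(ramp j x - ramp j y) - (ramp (Suc j) x - ramp (Suc j) y)\<bar>"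
        unfolding abs_mult using \<sigma> by (auto intro!: mult_left_le_one_le)
      also have "\<dots> \<le> (2 / d j + 2 / d (Suc j)) * \<bar>x - y\<bar>"
        using ramp_lip[of j x y] ramp_lip[of "Suc j" x y] j by (simp add: distrib_right)
      finally show "\<bar>\<sigma> j * ((ramp j x - ramp j y) - (ramp (Suc j) x - ramp (Suc j) y))\<bar> \<le> (2 / d j + 2 / d (Suc j)) * \<bar>x - y\<bar>" .
    qed
    finally show "dist (\<psi> x) (\<psi> y) \<le> K * dist x y" by (simp add: dist_real_def K_def sum_distrib_right)
  next
    show "0 \<le> K" unfolding K_def by (intro sum_nonneg add_nonneg_nonneg) (use d in \<open>auto simp: less_imp_le\<close>)
  qed
  have qm: "q i \<le> q j" if "i \<le> j" "j \<le> Suc (Suc N)" for i j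
    using mono_nodes[of "Suc (Suc N)" q i j] q that by auto
  have supp: "\<psi> x = 0" if "x \<notin> {q 0..q (Suc (Suc N))}" for x
  proof -
    have "ramp j x = ramp (Suc j) x" if "j \<le> N" for j
    proof (cases "x < q 0")
      case True
      then show ?thesis using qm[of 0 j] qm[of 0 "Suc j"] qm[of 0 "Suc (Suc j)"] that by (simp add: ramp_def)
    next
      case False
      then have "q (Suc (Suc N)) < x" using \<open>x \<notin> {q 0..q (Suc (Suc N))}\<close> by auto
      then have "ramp j x = d j / d j" "ramp (Suc j) x = d (Suc j) / d (Suc j)"
        using qm[of j "Suc (Suc N)"] qm[of "Suc j" "Suc (Suc N)"] qm[of "Suc (Suc j)" "Suc (Suc N)"] that
        by (auto simp: ramp_def d_def)
      then show ?thesis using d[of j] d[of "Suc j"] that by simp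
    qed
    then show ?thesis by (simp add: \<psi>_def)
  qed
  have der: "(\<psi> has_real_derivative g x) (at x)" if x: "x \<notin> q ` {..Suc (Suc N)}" for x
  proof -
    have r: "(ramp j has_real_derivative e j x) (at x)" if "j \<le> Suc N" for j
    proof -
      have ne: "x \<noteq> q j" "x \<noteq> q (Suc j)" using x that by auto
      have "((\<lambda>x. (max 0 (x - q j) - max 0 (x - q (Suc j))) / d j) has_real_derivative
          (indicator {q j..} x - indicator {q (Suc j)..} x) / d j) (at x)"
        by (intro DERIV_cdivide DERIV_diff deriv_max0 ne)
      moreover have "indicator {q j..} x - indicator {q (Suc j)..} x = (indicator {q j..<q (Suc j)} x :: real)"
        using q[OF that] by (auto simp: indicator_def)
      ultimately show ?thesis unfolding ramp_def[abs_def] e_def by simp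
    qed
    show ?thesis
      unfolding \<psi>_def[abs_def] g_def by (intro DERIV_minus DERIV_sum DERIV_cmult DERIV_diff r) auto
  qed
  have gm: "g \<in> borel_measurable borel" unfolding g_def[abs_def] e_def[abs_def] by measurable
  have TV: "(\<integral>x. \<rho>b x * g x \<partial>lborel) \<le> TV0"
    by (rule TV0_lipschitz[OF lip bnd supp _ der gm]) auto
  \<comment> \<open>The mean of \<open>\<rho>b\<close> over cell j of the extended partition, hence
    the local density with its index shifted by one.\<close>
  define a where "a j = (F0 (q (Suc j)) - F0 (q j)) / d j" for j
  have inte: "integrable lborel (\<lambda>x. \<rho>b x * e j x)" "(\<integral>x. \<rho>b x * e j x \<partial>lborel) = a j" if "j \<le> Suc N" for j
  proof -
    have eq: "(\<lambda>x. \<rho>b x * e j x) = (\<lambda>x. (\<rho>b x * indicator {q j..<q (Suc j)} x) / d j)" by (simp add: e_def)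
    show "integrable lborel (\<lambda>x. \<rho>b x * e j x)" unfolding eq by (intro integrable_divide integrable_\<rho>b_ind) auto
    show "(\<integral>x. \<rho>b x * e j x \<partial>lborel) = a j"
      unfolding eq integral_divide_zero a_def using F0_diff(1)[of "q j" "q (Suc j)"] q[OF that] by simp
  qed
  have aj: "a (Suc j) = local_density l N p j" if "j \<le> N" for j
  proof (cases "j < N")
    case True
    then show ?thesis using mass[of j] mass[of "Suc j"] by (simp add: a_def d_def q_def local_density_def algebra_simps)
  next
    case False
    then have "j = N" using that by simp
    moreover have "F0 (B0 + 1) = L" "F0 (p N) = L" using F0_right mass[of N] N l by auto
    ultimately show ?thesis by (simp add: a_def q_def local_density_def)
  qed
  have a0: "a 0 = 0" using F0_left[of A0] F0_left[of "A0 - 1"] p0 by (simp add: a_def q_def)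
  have "(\<integral>x. \<rho>b x * g x \<partial>lborel) = (\<integral>x. - (\<Sum>j\<le>N. \<sigma> j * (\<rho>b x * e j x - \<rho>b x * e (Suc j) x)) \<partial>lborel)"
    by (rule Bochner_Integration.integral_cong) (auto simp: g_def sum_distrib_left algebra_simps)
  also have "\<dots> = - (\<Sum>j\<le>N. \<sigma> j * (a j - a (Suc j)))"
  proof -
    have "(\<integral>x. (\<Sum>j\<le>N. \<sigma> j * (\<rho>b x * e j x - \<rho>b x * e (Suc j) x)) \<partial>lborel) = (\<Sum>j\<le>N. \<integral>x. \<sigma> j * (\<rho>b x * e j x - \<rho>b x * e (Suc j) x) \<partial>lborel)"
      by (rule Bochner_Integration.integral_sum) (auto intro!: integrable_mult_right Bochner_Integration.integrable_diff inte)
    also have "\<dots> = (\<Sum>j\<le>N. \<sigma> j * (a j - a (Suc j)))"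
      using inte by (intro sum.cong refl) (simp add: Bochner_Integration.integral_diff)
    finally show ?thesis by simp
  qed
  also have "\<dots> = (\<Sum>j\<le>N. \<bar>jump (local_density l N p) j\<bar>)"
    unfolding sum_negf[symmetric]
  proof (intro sum.cong refl)
    fix j assume "j \<in> {..N}"
    then have "a (Suc j) - a j = jump (local_density l N p) j"
      using aj[of j] aj[of "j - 1"] a0 by (cases j) (auto simp: jump_def)
    then show "- (\<sigma> j * (a j - a (Suc j))) = \<bar>jump (local_density l N p) j\<bar>"
      by (simp add: \<sigma>_def abs_sgn algebra_simps)
  qed
  finally show ?thesis using TV by simp
qed

end

section \<open>Compactness\<close>

locale lwr = velocity R v v' + datum R \<rho>\<^sub>0
  for R :: real and v v' :: "real \<Rightarrow> real" and \<rho>\<^sub>0 :: "real \<Rightarrow> real" +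
  fixes T \<theta> :: real
  assumes T_pos: "0 < T" and \<theta>01: "\<theta> \<in> {0..1}"
begin

text \<open>The CFL condition in the form used for a single step,
  \<open>\<theta> * \<tau> * Lv * R\<^sup>2 \<le> l\<close> with \<open>\<tau> = T / M\<close> and
  \<open>l = L / N\<close>.\<close>

definition adm_pair :: "nat \<Rightarrow> nat \<Rightarrow> bool" where
  "adm_pair M N \<longleftrightarrow> 0 < M \<and> 0 < N \<and> \<theta> * (T / real M) * Lv * R\<^sup>2 \<le> L / real N"

definition X :: "nat \<Rightarrow> nat \<Rightarrow> nat \<Rightarrow> nat \<Rightarrow> real" where
  "X M N = particle_positions R v \<rho>\<^sub>0 T \<theta> M N"

definition dr :: "nat \<Rightarrow> nat \<Rightarrow> nat \<Rightarrow> nat \<Rightarrow> real" where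
  "dr M N m = local_density (L / real N) N (X M N m)"

definition dens :: "nat \<Rightarrow> nat \<Rightarrow> nat \<Rightarrow> real \<Rightarrow> real" where
  "dens M N m = step_fun N (X M N m) (dr M N m)"

definition prim :: "nat \<Rightarrow> nat \<Rightarrow> nat \<Rightarrow> real \<Rightarrow> real" where
  "prim M N m = step_prim N (X M N m) (dr M N m)"

text \<open>Index of the time cell that contains t; the minimum assigns the final time T to the last
  cell, as \<open>time_cell\<close> does.\<close>

definition cidx :: "nat \<Rightarrow> real \<Rightarrow> nat" where
  "cidx M t = min (nat \<lfloor>t / (T / real M)\<rfloor>) (M - 1)"

definition u :: "nat \<Rightarrow> nat \<Rightarrow> real \<Rightarrow> real \<Rightarrow> real" where
  "u M N t x = discrete_density R v \<rho>\<^sub>0 T \<theta> M N (x, t)"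

text \<open>\<open>Ab\<close> and \<open>Bb\<close> enclose all particles up to time T, since no
  speed exceeds \<open>Vm\<close>.\<close>

definition Ab :: real where "Ab = A0 - T * Vm"

definition Bb :: real where "Bb = B0 + T * Vm"

lemma Ab_le_Bb: "Ab \<le> Bb"
proof -
  have "0 \<le> T * Vm" using T_pos Vm_nonneg by simp
  then show ?thesis using supp_bounds(3) by (simp add: Ab_def Bb_def)
qed

lemma time_cell_iff:
  assumes "0 < M" "t \<in> {0..T}" "m < M"
  shows "t \<in> time_cell T M m \<longleftrightarrow> m = cidx M t"
proof -
  define \<tau> where "\<tau> = T / real M"
  have \<tau>: "0 < \<tau>" "real M * \<tau> = T" using assms T_pos by (auto simp: \<tau>_def)
  have cell: "t \<in> {real m * \<tau>..<real (Suc m) * \<tau>} \<longleftrightarrow> nat \<lfloor>t / \<tau>\<rfloor> = m"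
  proof -
    have "t \<in> {real m * \<tau>..<real (Suc m) * \<tau>} \<longleftrightarrow> real m \<le> t / \<tau> \<and> t / \<tau> < real m + 1"
      using \<tau> by (auto simp: field_simps)
    also have "\<dots> \<longleftrightarrow> \<lfloor>t / \<tau>\<rfloor> = int m" by (auto simp: floor_eq_iff)
    also have "\<dots> \<longleftrightarrow> nat \<lfloor>t / \<tau>\<rfloor> = m" using assms \<tau> by auto
    finally show ?thesis .
  qed
  show ?thesis
  proof (cases "t = T")
    case True
    have "real (Suc m) * \<tau> \<le> real M * \<tau>" using assms \<tau> by (intro mult_right_mono) auto
    then have "t \<notin> {real m * \<tau>..<real (Suc m) * \<tau>}" using True \<tau> by auto
    moreover have "t / \<tau> = real M" using True \<tau> by (simp add: field_simps)
    ultimately show ?thesis using True assms unfolding time_cell_def cidx_def \<tau>_def[symmetric] by auto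
  next
    case False
    then have "t < real M * \<tau>" using assms \<tau> by auto
    then have "t / \<tau> < real M" using \<tau> by (simp add: field_simps)
    then have "\<lfloor>t / \<tau>\<rfloor> < int M" by (simp add: floor_less_iff)
    then have "nat \<lfloor>t / \<tau>\<rfloor> < M" using assms(1) by linarith
    then have "cidx M t = nat \<lfloor>t / \<tau>\<rfloor>" by (simp add: cidx_def \<tau>_def)
    then show ?thesis using cell False unfolding time_cell_def \<tau>_def[symmetric] by auto
  qed
qed

lemma cidx_less: "0 < M \<Longrightarrow> cidx M t < M"
  by (auto simp: cidx_def)

lemma cidx_time:
  assumes "0 < M" "t \<in> {0..T}"
  shows "\<bar>real (cidx M t) * (T / real M) - t\<bar> \<le> T / real M"
proof -
  have "t \<in> time_cell T M (cidx M t)" using time_cell_iff[OF assms cidx_less[OF assms(1)]] by simp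
  then consider "t \<in> {real (cidx M t) * (T / real M)..<real (Suc (cidx M t)) * (T / real M)}" | "t = T" "Suc (cidx M t) = M"
    by (auto simp: time_cell_def split: if_splits)
  then show ?thesis
  proof cases
    case 1
    then show ?thesis by (auto simp: algebra_simps)
  next
    case 2
    have "real M = real (cidx M t) + 1" using 2 by linarith
    moreover have "real M * (T / real M) = T" using assms by simp
    ultimately have "(real (cidx M t) + 1) * (T / real M) = T" by simp
    then have "real (cidx M t) * (T / real M) + T / real M = t" using 2(1) by (simp only: distrib_right mult_1)
    moreover have "0 \<le> T / real M" using T_pos by simp
    ultimately show ?thesis by linarith
  qed
qed

lemma time_cell_subset: "0 < M \<Longrightarrow> m < M \<Longrightarrow> time_cell T M m \<subseteq> {0..T}"
proof -
  assume *: "0 < M" "m < M"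
  have "real (Suc m) * (T / real M) \<le> real M * (T / real M)" using * T_pos by (intro mult_right_mono) auto
  moreover have "real M * (T / real M) = T" using * by simp
  moreover have "0 \<le> real m * (T / real M)" using T_pos by simp
  ultimately have "{real m * (T / real M)..<real (Suc m) * (T / real M)} \<subseteq> {0..T}"
    by (intro subsetI) (simp only: atLeastLessThan_iff atLeastAtMost_iff, linarith)
  then show ?thesis using T_pos by (auto simp: time_cell_def)
qed

lemma u_eq:
  assumes "0 < M" "t \<in> {0..T}"
  shows "u M N t x = dens M N (cidx M t) x"
proof -
  have "u M N t x = (\<Sum>m<M. dens M N m x * indicator (time_cell T M m) t)"
    unfolding u_def discrete_density_def Let_def dens_def step_fun_def dr_def X_def L_def by (simp only: sum_distrib_right case_prod_conv)
  also have "\<dots> = (\<Sum>m<M. if m = cidx M t then dens M N m x else 0)"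
    by (intro sum.cong refl) (use time_cell_iff[OF assms] in auto)
  also have "\<dots> = dens M N (cidx M t) x" using cidx_less[OF assms(1)] by (simp add: sum.delta)
  finally show ?thesis .
qed

lemma u_outside: "0 < M \<Longrightarrow> t \<notin> {0..T} \<Longrightarrow> u M N t x = 0"
proof -
  assume *: "0 < M" "t \<notin> {0..T}"
  then have "t \<notin> time_cell T M m" if "m < M" for m using time_cell_subset that by blast
  then show ?thesis unfolding u_def discrete_density_def Let_def by simp
qed

lemma time_cell_sets [measurable]: "time_cell T M m \<in> sets borel"
  by (auto simp: time_cell_def)

lemma discrete_density_measurable [measurable]: "discrete_density R v \<rho>\<^sub>0 T \<theta> M N \<in> borel_measurable borel"
  unfolding discrete_density_def Let_def borel_prod[symmetric] by measurable

lemma u_measurable [measurable]: "(\<lambda>(t, x). u M N t x) \<in> borel_measurable (borel \<Otimes>\<^sub>M borel)"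
proof -
  have [measurable]: "discrete_density R v \<rho>\<^sub>0 T \<theta> M N \<in> borel_measurable (borel \<Otimes>\<^sub>M borel)"
    unfolding borel_prod by (rule discrete_density_measurable)
  show ?thesis unfolding u_def by measurable
qed

context
  fixes M N :: nat
  assumes adm: "adm_pair M N"
begin

lemma MN_pos: "0 < M" "0 < N" using adm by (auto simp: adm_pair_def)

lemma cell_mass_pos: "0 < L / real N" using MN_pos L_pos by simp

lemma scheme:
  "i \<le> N \<Longrightarrow> X M N 0 i = initial_position \<rho>\<^sub>0 (L / real N) i"
  "m \<le> M \<Longrightarrow> admissible (L / real N) N (X M N m)"
  "m < M \<Longrightarrow> one_step (L / real N) N (T / real M) \<theta> (X M N m) (X M N (Suc m))"
proof -
  have l: "L / real N = (LINT y|lebesgue. \<bar>\<rho>\<^sub>0 y\<bar>) / real N" by (simp add: L_def)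
  have init: "admissible (L / real N) N (initial_position \<rho>\<^sub>0 (L / real N))"
    using initial_less[OF MN_pos(2) refl refl] initial_density_le[OF MN_pos(2) refl refl] by (simp add: admissible_def)
  have "is_particle_scheme R v \<rho>\<^sub>0 T \<theta> M N (X M N)"
    unfolding X_def using T_pos \<theta>01 adm
    by (intro particle_positions_scheme[OF l cell_mass_pos init]) (auto simp: adm_pair_def)
  then show "i \<le> N \<Longrightarrow> X M N 0 i = initial_position \<rho>\<^sub>0 (L / real N) i"
    "m \<le> M \<Longrightarrow> admissible (L / real N) N (X M N m)"
    "m < M \<Longrightarrow> one_step (L / real N) N (T / real M) \<theta> (X M N m) (X M N (Suc m))"
    unfolding is_particle_scheme_iff[OF l cell_mass_pos] by auto
qed

lemma step_locale: "m < M \<Longrightarrow> scheme_step R v v' (L / real N) (T / real M) \<theta> N (X M N m) (X M N (Suc m))"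
  using scheme(2)[of m] scheme(2)[of "Suc m"] scheme(3)[of m] adm cell_mass_pos T_pos \<theta>01
  by unfold_locales (auto simp: adm_pair_def)

lemma X_less: "m \<le> M \<Longrightarrow> i < N \<Longrightarrow> X M N m i < X M N m (Suc i)"
  using scheme(2)[of m] by (auto simp: admissible_def)

lemma dr_range: "m \<le> M \<Longrightarrow> dr M N m i \<in> {0..R}"
  unfolding dr_def by (intro admissible_density scheme(2) cell_mass_pos)

lemma dr_N: "dr M N m N = 0" by (simp add: dr_def local_density_def)

lemma dr_eq: "i < N \<Longrightarrow> dr M N m i = L / real N / (X M N m (Suc i) - X M N m i)"
  by (simp add: dr_def local_density_def)

lemma tv_bound: "m \<le> M \<Longrightarrow> (\<Sum>j\<le>N. \<bar>jump (dr M N m) j\<bar>) \<le> TV0"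
proof (induction m)
  case 0
  have "jump (dr M N 0) j = jump (local_density (L / real N) N (initial_position \<rho>\<^sub>0 (L / real N))) j" if "j \<le> N" for j
    using scheme(1) that by (auto simp: jump_def dr_def local_density_def)
  then show ?case using initial_tv[OF MN_pos(2) refl refl] by simp
next
  case (Suc m)
  then interpret scheme_step R v v' "L / real N" "T / real M" \<theta> N "X M N m" "X M N (Suc m)"
    by (intro step_locale) simp
  show ?case using tvd Suc by (simp add: dr_def)
qed

lemma X_step: "m < M \<Longrightarrow> i \<le> N \<Longrightarrow> \<bar>X M N (Suc m) i - X M N m i\<bar> \<le> T / real M * Vm"
proof -
  assume *: "m < M" "i \<le> N"
  interpret scheme_step R v v' "L / real N" "T / real M" \<theta> N "X M N m" "X M N (Suc m)"
    by (intro step_locale *)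
  have "X M N (Suc m) i - X M N m i = T / real M * V i" using z_eq[OF *(2)] by linarith
  then have "\<bar>X M N (Suc m) i - X M N m i\<bar> = T / real M * \<bar>V i\<bar>" using \<tau>_pos by (simp only: abs_mult abs_of_pos)
  also have "\<dots> \<le> T / real M * Vm" using \<tau>_pos V_bound[of i] by (intro mult_left_mono) auto
  finally show ?thesis .
qed

lemma X_displacement_le:
  assumes "m \<le> k" "k \<le> M" "i \<le> N"
  shows "\<bar>X M N k i - X M N m i\<bar> \<le> real (k - m) * (T / real M * Vm)"
  using assms(1,2)
proof (induction k)
  case (Suc k)
  show ?case
  proof (cases "m = Suc k")
    case False
    then have "m \<le> k" "k \<le> M" "k < M" using Suc.prems by auto
    then have "\<bar>X M N k i - X M N m i\<bar> \<le> real (k - m) * (T / real M * Vm)" "\<bar>X M N (Suc k) i - X M N k i\<bar> \<le> T / real M * Vm"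
      using Suc.IH X_step[of k i] assms(3) by auto
    moreover have "real (Suc k - m) = real (k - m) + 1" using \<open>m \<le> k\<close> by (simp add: Suc_diff_le)
    then have "real (Suc k - m) * (T / real M * Vm) = real (k - m) * (T / real M * Vm) + T / real M * Vm"
      by (simp only: distrib_right mult_1)
    ultimately show ?thesis by linarith
  qed simp
qed simp

lemma X_displacement:
  assumes "m \<le> M" "k \<le> M" "i \<le> N"
  shows "\<bar>X M N k i - X M N m i\<bar> \<le> \<bar>real k * (T / real M) - real m * (T / real M)\<bar> * Vm"
proof -
  have *: "\<bar>X M N k i - X M N m i\<bar> \<le> \<bar>real k * (T / real M) - real m * (T / real M)\<bar> * Vm"
    if "m \<le> k" "k \<le> M" for m k
  proof -
    have "real k * (T / real M) - real m * (T / real M) = real (k - m) * (T / real M)"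
      using that by (simp only: of_nat_diff left_diff_distrib)
    moreover have "0 \<le> real (k - m) * (T / real M)" using T_pos by simp
    ultimately have "\<bar>real k * (T / real M) - real m * (T / real M)\<bar> = real (k - m) * (T / real M)"
      by (simp only: abs_of_nonneg)
    then have "\<bar>real k * (T / real M) - real m * (T / real M)\<bar> * Vm = real (k - m) * (T / real M * Vm)"
      by (simp only: mult.assoc)
    then show ?thesis using X_displacement_le[OF that assms(3)] by simp
  qed
  show ?thesis using *[of m k] *[of k m] assms by (cases "m \<le> k") (auto simp: abs_minus_commute)
qed

lemma X_range:
  assumes "m \<le> M" "i \<le> N"
  shows "X M N m i \<in> {Ab..Bb}"
proof -
  have "\<bar>X M N m i - X M N 0 i\<bar> \<le> real m * (T / real M * Vm)" using X_displacement_le[of 0 m i] assms by simp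
  also have "\<dots> \<le> real M * (T / real M * Vm)" using assms T_pos Vm_nonneg by (intro mult_right_mono) auto
  also have "\<dots> = T * Vm" using MN_pos by simp
  finally show ?thesis
    using initial_mass[OF MN_pos(2) refl refl assms(2)] scheme(1)[OF assms(2)] by (auto simp: Ab_def Bb_def abs_le_iff)
qed

lemma dens_range: "m \<le> M \<Longrightarrow> dens M N m x \<in> {0..R}"
  unfolding dens_def using step_fun_range[of N "X M N m" "dr M N m" R x] X_less dr_range R_pos by simp

lemma dens_outside: "m \<le> M \<Longrightarrow> x \<notin> {Ab..Bb} \<Longrightarrow> dens M N m x = 0"
  unfolding dens_def using step_fun_outside[of N "X M N m" x "dr M N m"] X_less X_range[of m 0] X_range[of m N] by auto

lemma dens_measurable [measurable]: "dens M N m \<in> borel_measurable borel"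
  unfolding dens_def by measurable

lemma prim_lipschitz: "m \<le> M \<Longrightarrow> \<bar>prim M N m x - prim M N m x'\<bar> \<le> R * \<bar>x - x'\<bar>"
  unfolding prim_def using step_prim_lipschitz[of N "X M N m" "dr M N m" R x x'] X_less dr_range R_pos by simp

lemma prim_time:
  assumes "m \<le> M" "k \<le> M"
  shows "\<bar>prim M N m x - prim M N k x\<bar> \<le> R * (\<bar>real m * (T / real M) - real k * (T / real M)\<bar> * Vm)"
  unfolding prim_def
proof (rule step_prim_displacement[where l = "L / real N"])
  fix i assume "i \<le> N"
  then show "\<bar>X M N m i - X M N k i\<bar> \<le> \<bar>real m * (T / real M) - real k * (T / real M)\<bar> * Vm"
    by (intro X_displacement assms)
next
  fix i assume "i < N"
  then show "dr M N m i = L / real N / (X M N m (Suc i) - X M N m i)" "dr M N k i = L / real N / (X M N k (Suc i) - X M N k i)"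
    using dr_eq by blast+
  show "dr M N m i \<le> R" "dr M N k i \<le> R" using dr_range[of m i] dr_range[of k i] assms by auto
qed (use X_less assms R_pos cell_mass_pos in auto)

lemma prim_left: "m \<le> M \<Longrightarrow> x \<le> Ab \<Longrightarrow> prim M N m x = 0"
  unfolding prim_def step_prim_def
proof (intro sum.neutral ballI)
  fix i assume *: "m \<le> M" "x \<le> Ab" "i \<in> {..<N}"
  then have "x \<le> X M N m i" "x \<le> X M N m (Suc i)" using X_range[of m i] X_range[of m "Suc i"] by auto
  then show "dr M N m i * (max 0 (x - X M N m i) - max 0 (x - X M N m (Suc i))) = 0" by simp
qed

lemma prim_right: "m \<le> M \<Longrightarrow> Bb \<le> x \<Longrightarrow> prim M N m x = L"
proof -
  assume *: "m \<le> M" "Bb \<le> x"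
  have "prim M N m x = (\<Sum>i<N. L / real N)"
    unfolding prim_def step_prim_def
  proof (intro sum.cong refl)
    fix i assume i: "i \<in> {..<N}"
    then have "X M N m i \<le> x" "X M N m (Suc i) \<le> x" using X_range[of m i] X_range[of m "Suc i"] * by auto
    moreover have "X M N m i < X M N m (Suc i)" using X_less[of m i] * i by simp
    ultimately show "dr M N m i * (max 0 (x - X M N m i) - max 0 (x - X M N m (Suc i))) = L / real N"
      using i by (simp add: dr_eq)
  qed
  then show ?thesis using MN_pos by simp
qed

lemma prim_initial: "\<bar>prim M N 0 x - F0 x\<bar> \<le> L / real N"
proof -
  have "prim M N 0 x = step_prim N (initial_position \<rho>\<^sub>0 (L / real N)) (local_density (L / real N) N (initial_position \<rho>\<^sub>0 (L / real N))) x"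
    unfolding prim_def step_prim_def dr_def by (intro sum.cong refl) (auto simp: scheme(1) local_density_def)
  then show ?thesis using initial_prim[OF MN_pos(2) refl refl] by simp
qed

text \<open>Identifies the ramp formula with an integral of the density; this is how the initial
  value of the limit will be recognized.\<close>

lemma dens_integral: "m \<le> M \<Longrightarrow> (\<integral>y. dens M N m y * indicator {..x} y \<partial>lborel) = prim M N m x"
proof -
  assume m: "m \<le> M"
  have "has_bochner_integral lborel (\<lambda>y. \<Sum>i<N. dr M N m i * indicator ({X M N m i..<X M N m (Suc i)} \<inter> {..x}) y)
     (\<Sum>i<N. dr M N m i * (max 0 (x - X M N m i) - max 0 (x - X M N m (Suc i))))"
  proof (intro has_bochner_integral_sum has_bochner_integral_mult_right)
    fix i assume "i \<in> {..<N}"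
    then have less: "X M N m i < X M N m (Suc i)" using X_less m by simp
    let ?a = "X M N m i" and ?b = "X M N m (Suc i)"
    have "has_bochner_integral lborel (indicator ({?a..<?b} \<inter> {..x}) :: real \<Rightarrow> real) (measure lborel ({?a..<?b} \<inter> {..x}))"
      by (rule has_bochner_integral_real_indicator)
         (auto intro!: emeasure_bounded_finite[unfolded infinity_ennreal_def] bounded_subset[OF bounded_closed_interval[of ?a ?b]])
    moreover have "measure lborel ({?a..<?b} \<inter> {..x}) = max 0 (x - ?a) - max 0 (x - ?b)"
    proof -
      consider "x < ?a" | "?a \<le> x" "x < ?b" | "?b \<le> x" by linarith
      then show ?thesis
      proof cases
        case 1
        then have "{?a..<?b} \<inter> {..x} = {}" by auto
        then show ?thesis using 1 less by simp
      next
        case 2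
        then have "{?a..<?b} \<inter> {..x} = {?a..x}" by auto
        then show ?thesis using 2 by simp
      next
        case 3
        then have "{?a..<?b} \<inter> {..x} = {?a..<?b}" by auto
        then show ?thesis using 3 less by simp
      qed
    qed
    ultimately show "has_bochner_integral lborel (indicator ({?a..<?b} \<inter> {..x})) (max 0 (x - ?a) - max 0 (x - ?b))" by simp
  qed
  moreover have "(\<Sum>i<N. dr M N m i * indicator ({X M N m i..<X M N m (Suc i)} \<inter> {..x}) y) = dens M N m y * indicator {..x} y" for y
    unfolding dens_def step_fun_def sum_distrib_right indicator_inter_arith by (simp only: mult.assoc)
  ultimately show ?thesis unfolding prim_def step_prim_def by (simp add: has_bochner_integral_iff)
qed

end

definition P :: "nat \<Rightarrow> nat \<Rightarrow> real \<Rightarrow> real \<Rightarrow> real" where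
  "P M N t = prim M N (cidx M t)"

lemma cidx_le: "adm_pair M N \<Longrightarrow> cidx M t \<le> M"
  using cidx_less[of M t] by (auto simp: adm_pair_def)

lemma u_range: "adm_pair M N \<Longrightarrow> u M N t x \<in> {0..R}"
  using u_eq[of M t N x] u_outside[of M t N x] dens_range[OF _ cidx_le] R_pos
  by (cases "t \<in> {0..T}") (auto simp: adm_pair_def)

lemma u_support: "adm_pair M N \<Longrightarrow> x \<notin> {Ab..Bb} \<Longrightarrow> u M N t x = 0"
  using u_eq[of M t N x] u_outside[of M t N x] dens_outside[OF _ cidx_le]
  by (cases "t \<in> {0..T}") (auto simp: adm_pair_def)

text \<open>Being piecewise constant in time, \<open>P\<close> has no genuine modulus of continuity:
  rounding each of the two times to its time level costs \<open>T / M\<close>. The compactness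
  argument has to work with a modulus that is only asymptotic.\<close>

lemma P_modulus:
  assumes "adm_pair M N" "t \<in> {0..T}" "t' \<in> {0..T}"
  shows "\<bar>P M N t x - P M N t' x'\<bar> \<le> R * \<bar>x - x'\<bar> + R * Vm * (\<bar>t - t'\<bar> + 2 * (T / real M))"
proof -
  have M: "0 < M" using assms by (simp add: adm_pair_def)
  have "\<bar>real (cidx M t) * (T / real M) - real (cidx M t') * (T / real M)\<bar> \<le> \<bar>t - t'\<bar> + 2 * (T / real M)"
  proof -
    have "\<bar>a - b\<bar> \<le> \<bar>c - d\<bar> + 2 * e" if "\<bar>a - c\<bar> \<le> e" "\<bar>b - d\<bar> \<le> e" for a b c d e :: real
      using that by linarith
    from this[OF cidx_time[OF M assms(2)] cidx_time[OF M assms(3)]] show ?thesis .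
  qed
  then have "R * (\<bar>real (cidx M t) * (T / real M) - real (cidx M t') * (T / real M)\<bar> * Vm) \<le> R * ((\<bar>t - t'\<bar> + 2 * (T / real M)) * Vm)"
    using R_pos Vm_nonneg by (intro mult_left_mono mult_right_mono) auto
  then have "\<bar>P M N t x - P M N t' x\<bar> \<le> R * Vm * (\<bar>t - t'\<bar> + 2 * (T / real M))"
    using prim_time[OF assms(1) cidx_le[OF assms(1), of t] cidx_le[OF assms(1), of t'], of x] unfolding P_def by (simp add: algebra_simps)
  moreover have "\<bar>P M N t' x - P M N t' x'\<bar> \<le> R * \<bar>x - x'\<bar>"
    unfolding P_def by (rule prim_lipschitz[OF assms(1) cidx_le[OF assms(1)]])
  ultimately show ?thesis by linarith
qed

lemma P_outside:
  assumes "adm_pair M N"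
  shows "x \<le> Ab \<Longrightarrow> P M N t x = 0" "Bb \<le> x \<Longrightarrow> P M N t x = L"
  using prim_left[OF assms] prim_right[OF assms] cidx_le[OF assms] by (auto simp: P_def)

lemma u_L1_diff:
  assumes "adm_pair M N" "adm_pair M' N'" "t \<in> {0..T}" "t' \<in> {0..T}"
    and "\<And>x. \<bar>P M N t x - P M' N' t' x\<bar> \<le> e" "0 < h"
  shows "(\<integral>x. \<bar>u M N t x - u M' N' t' x\<bar> \<partial>lborel) \<le> 2 * h * TV0 + (Bb - Ab) * (2 * e / h)"
proof -
  have pos: "0 < M" "0 < M'" using assms by (auto simp: adm_pair_def)
  note c = cidx_le[OF assms(1), of t] cidx_le[OF assms(2), of t']
  have "(\<integral>x. \<bar>u M N t x - u M' N' t' x\<bar> \<partial>lborel) = (\<integral>x. \<bar>dens M N (cidx M t) x - dens M' N' (cidx M' t') x\<bar> \<partial>lborel)"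
    using u_eq[OF pos(1) assms(3)] u_eq[OF pos(2) assms(4)] by simp
  also have "\<dots> \<le> h * ((\<Sum>j\<le>N. \<bar>jump (dr M N (cidx M t)) j\<bar>) + (\<Sum>j\<le>N'. \<bar>jump (dr M' N' (cidx M' t')) j\<bar>)) + (Bb - Ab) * (2 * e / h)"
    unfolding dens_def
    by (rule step_fun_L1_diff[where R = R])
       (use X_less[OF assms(1) c(1)] X_less[OF assms(2) c(2)] dr_N[OF assms(1)] dr_N[OF assms(2)]
         dr_range[OF assms(1) c(1)] dr_range[OF assms(2) c(2)] X_range[OF assms(1) c(1), of 0] X_range[OF assms(1) c(1), of N]
         X_range[OF assms(2) c(2), of 0] X_range[OF assms(2) c(2), of N'] Ab_le_Bb assms(5,6) R_pos
        in \<open>auto simp: P_def prim_def\<close>)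
  also have "\<dots> \<le> h * (TV0 + TV0) + (Bb - Ab) * (2 * e / h)"
    using tv_bound[OF assms(1) c(1)] tv_bound[OF assms(2) c(2)] assms(6)
    by (intro add_right_mono mult_left_mono add_mono) auto
  finally show ?thesis by (simp add: algebra_simps)
qed

end

text \<open>The classical theorem does not apply, since the functions may be discontinuous and are
  equicontinuous only asymptotically, but its proof does: a diagonal subsequence converges on a
  countable dense set, and a finite net from this set spreads the Cauchy property uniformly over S.
  Stating the result as a Cauchy property avoids constructing a limit function.\<close>

lemma arzela_subsequence:
  fixes F :: "nat \<Rightarrow> 'a::euclidean_space \<Rightarrow> real"
  assumes S: "compact S" and B: "\<And>n x. x \<in> S \<Longrightarrow> \<bar>F n x\<bar> \<le> B"
    and eq: "\<And>e. 0 < e \<Longrightarrow> \<exists>d>0. \<exists>n0. \<forall>n\<ge>n0. \<forall>x\<in>S. \<forall>y\<in>S. dist x y < d \<longrightarrow> \<bar>F n x - F n y\<bar> < e"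
  obtains k :: "nat \<Rightarrow> nat" where "strict_mono k"
    "\<And>e. 0 < e \<Longrightarrow> \<exists>n0. \<forall>n\<ge>n0. \<forall>m\<ge>n0. \<forall>x\<in>S. \<bar>F (k n) x - F (k m) x\<bar> < e"
proof -
  obtain D where D: "countable D" "D \<subseteq> S" "S \<subseteq> closure D" using separable by blast
  obtain k where k: "strict_mono (k :: nat \<Rightarrow> nat)" "\<And>x. x \<in> D \<Longrightarrow> \<exists>l. (\<lambda>n. F (k n) x) \<longlonglongrightarrow> l"
    using function_convergent_subsequence[OF D(1), of F B] B D(2) by (metis real_norm_def subsetD)
  have "\<exists>n0. \<forall>n\<ge>n0. \<forall>m\<ge>n0. \<forall>x\<in>S. \<bar>F (k n) x - F (k m) x\<bar> < e" if e: "0 < e" for e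
  proof -
    obtain d n0 where d: "0 < d" and n0: "\<And>n x y. n \<ge> n0 \<Longrightarrow> x \<in> S \<Longrightarrow> y \<in> S \<Longrightarrow> dist x y < d \<Longrightarrow> \<bar>F n x - F n y\<bar> < e / 3"
    proof -
      have "0 < e / 3" using e by simp
      from eq[OF this] show ?thesis using that by blast
    qed
    have "S \<subseteq> (\<Union>q\<in>D. ball q d)"
    proof
      fix x assume "x \<in> S"
      then obtain q where "q \<in> D" "dist q x < d" using D(3) d closure_approachable[of x D] by blast
      then show "x \<in> (\<Union>q\<in>D. ball q d)" by auto
    qed
    then obtain D' where D': "D' \<subseteq> D" "finite D'" "S \<subseteq> (\<Union>q\<in>D'. ball q d)"
      using compactE_image[OF S, of D "\<lambda>q. ball q d"] by auto
    have "\<exists>n1. \<forall>n\<ge>n1. \<forall>m\<ge>n1. \<bar>F (k n) q - F (k m) q\<bar> < e / 3" if "q \<in> D'" for q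
    proof -
      have "Cauchy (\<lambda>n. F (k n) q)" using k(2)[of q] that D'(1) LIMSEQ_imp_Cauchy by blast
      moreover have "0 < e / 3" using e by simp
      ultimately show ?thesis unfolding Cauchy_def dist_real_def by blast
    qed
    then obtain n1 where n1: "\<And>q n m. q \<in> D' \<Longrightarrow> n \<ge> n1 q \<Longrightarrow> m \<ge> n1 q \<Longrightarrow> \<bar>F (k n) q - F (k m) q\<bar> < e / 3"
      by metis
    define n2 where "n2 = Max (insert n0 (n1 ` D'))"
    have n2: "n0 \<le> n2" "\<And>q. q \<in> D' \<Longrightarrow> n1 q \<le> n2" using D'(2) by (auto simp: n2_def)
    have "\<bar>F (k n) x - F (k m) x\<bar> < e" if *: "n \<ge> n2" "m \<ge> n2" "x \<in> S" for n m x
    proof -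
      obtain q where q: "q \<in> D'" "dist q x < d" using D'(3) *(3) by auto
      have "n0 \<le> k n" "n0 \<le> k m" using seq_suble[OF k(1)] n2(1) * by (meson order_trans)+
      moreover have "q \<in> S" using q D' D by blast
      ultimately have "\<bar>F (k n) q - F (k n) x\<bar> < e / 3" "\<bar>F (k m) q - F (k m) x\<bar> < e / 3"
        using n0 q(2) *(3) by auto
      moreover have "\<bar>F (k n) q - F (k m) q\<bar> < e / 3" using n1[OF q(1)] n2(2)[OF q(1)] * by (meson order_trans)
      ultimately show ?thesis by linarith
    qed
    then show ?thesis by blast
  qed
  then show ?thesis using that k(1) by blast
qed

text \<open>Completeness of L1 at each single time would give unrelated representatives. Along a
  geometrically fast sequence the functions converge almost everywhere in x, so a pointwise limit
  defines one function of both variables, and this function is jointly measurable.\<close>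

lemma fast_L1_limit:
  fixes u :: "nat \<Rightarrow> real \<Rightarrow> real \<Rightarrow> real"
  assumes m [measurable]: "\<And>n. (\<lambda>(t, x). u n t x) \<in> borel_measurable (borel \<Otimes>\<^sub>M borel)"
    and range: "\<And>n t x. u n t x \<in> {0..R}" and supp: "\<And>n t x. x \<notin> {A..B} \<Longrightarrow> u n t x = 0"
    and fast: "\<And>n t. t \<in> I \<Longrightarrow> (\<integral>x. \<bar>u (Suc n) t x - u n t x\<bar> \<partial>lborel) \<le> (1 / 2) ^ n"
  obtains \<rho> where "(\<lambda>(t, x). \<rho> t x) \<in> borel_measurable (borel \<Otimes>\<^sub>M borel)" "\<And>t x. \<rho> t x \<in> {0..R::real}"
    "\<And>t x. x \<notin> {A..B} \<Longrightarrow> \<rho> t x = 0"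
    "\<And>n t. t \<in> I \<Longrightarrow> (\<integral>x. \<bar>u n t x - \<rho> t x\<bar> \<partial>lborel) \<le> 2 * (1 / 2) ^ n"
proof -
  have R: "0 \<le> R" using range[of 0 0 0] by simp
  \<comment> \<open>\<open>lim\<close> is unspecified where the sequence diverges, a null set of x
    for each t in I; the truncation keeps the range bound there too. Outside [A, B] the sequence is
    constantly 0.\<close>
  define \<rho> where "\<rho> t x = max 0 (min R (lim (\<lambda>n. u n t x)))" for t x
  have sec [measurable]: "u n t \<in> borel_measurable borel" for n t
    using measurable_Pair2[OF m, of t n] by simp
  have \<rho>m: "(\<lambda>(t, x). \<rho> t x) \<in> borel_measurable (borel \<Otimes>\<^sub>M borel)"
  proof -
    have "(\<lambda>p. lim (\<lambda>n. (\<lambda>(t, x). u n t x) p)) \<in> borel_measurable (borel \<Otimes>\<^sub>M borel)" by measurable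
    then have [measurable]: "(\<lambda>(t, x). lim (\<lambda>n. u n t x)) \<in> borel_measurable (borel \<Otimes>\<^sub>M borel)"
      by (simp add: case_prod_beta')
    show ?thesis unfolding \<rho>_def by measurable
  qed
  have secr [measurable]: "\<rho> t \<in> borel_measurable borel" for t
    using measurable_Pair2[OF \<rho>m, of t] by simp
  have \<rho>r: "\<rho> t x \<in> {0..R}" for t x using R by (auto simp: \<rho>_def)
  have \<rho>s: "\<rho> t x = 0" if "x \<notin> {A..B}" for t x using supp[OF that] R by (simp add: \<rho>_def)
  have int: "integrable lborel (\<lambda>x. \<bar>f x - g x\<bar>)"
    if "f \<in> borel_measurable borel" "g \<in> borel_measurable borel" "\<And>x. f x \<in> {0..R}" "\<And>x. g x \<in> {0..R}"
      "\<And>x. x \<notin> {A..B} \<Longrightarrow> f x = 0" "\<And>x. x \<notin> {A..B} \<Longrightarrow> g x = 0" for f g :: "real \<Rightarrow> real"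
  proof (rule integrable_bounded_interval[of _ R A B])
    show "\<bar>\<bar>f x - g x\<bar>\<bar> \<le> R" for x using that(3)[of x] that(4)[of x] by (auto simp: abs_le_iff)
  qed (use that in auto)
  have uu: "integrable lborel (\<lambda>x. \<bar>u n t x - u m t x\<bar>)" for n m t
    by (rule int) (use range supp in auto)
  have ur: "integrable lborel (\<lambda>x. \<bar>u n t x - \<rho> t x\<bar>)" for n t
    by (rule int) (use range supp \<rho>r \<rho>s in auto)
  have conv: "AE x in lborel. (\<lambda>n. u n t x) \<longlonglongrightarrow> \<rho> t x" if t: "t \<in> I" for t
  proof -
    \<comment> \<open>The increments are summable in L1, hence absolutely summable at almost every
      x.\<close>
    have "(\<integral>\<^sup>+x. (\<Sum>n. ennreal \<bar>u (Suc n) t x - u n t x\<bar>) \<partial>lborel) = (\<Sum>n. \<integral>\<^sup>+x. ennreal \<bar>u (Suc n) t x - u n t x\<bar> \<partial>lborel)"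
      by (rule nn_integral_suminf) simp
    also have "\<dots> = (\<Sum>n. ennreal (\<integral>x. \<bar>u (Suc n) t x - u n t x\<bar> \<partial>lborel))"
      by (subst nn_integral_eq_integral[OF uu]) auto
    also have "\<dots> \<le> (\<Sum>n. ennreal ((1 / 2) ^ n))"
      by (intro suminf_le ennreal_leI fast t) auto
    also have "\<dots> = ennreal (\<Sum>n. (1 / 2) ^ n)"
      by (rule suminf_ennreal2) (auto intro: summable_geometric)
    also have "\<dots> < \<infinity>" by simp
    finally have "AE x in lborel. (\<Sum>n. ennreal \<bar>u (Suc n) t x - u n t x\<bar>) \<noteq> \<infinity>"
      by (intro nn_integral_PInf_AE) auto
    then show ?thesis
    proof eventually_elim
      case (elim x)
      then have "summable (\<lambda>n. \<bar>u (Suc n) t x - u n t x\<bar>)" by (intro summable_suminf_not_top) auto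
      then have "summable (\<lambda>n. u (Suc n) t x - u n t x)" by (rule summable_rabs_cancel)
      then have "convergent (\<lambda>n. u n t x - u 0 t x)"
        unfolding summable_iff_convergent sum_lessThan_telescope[of "\<lambda>n. u n t x"] .
      then have "convergent (\<lambda>n. u n t x - u 0 t x + u 0 t x)" by (intro convergent_add convergent_const)
      then have "convergent (\<lambda>n. u n t x)" by simp
      then have lim: "(\<lambda>n. u n t x) \<longlonglongrightarrow> lim (\<lambda>n. u n t x)" by (simp add: convergent_LIMSEQ_iff)
      have "0 \<le> lim (\<lambda>n. u n t x)" "lim (\<lambda>n. u n t x) \<le> R"
        using range by (auto intro!: LIMSEQ_le_const[OF lim] LIMSEQ_le_const2[OF lim])
      then show ?case using lim by (simp add: \<rho>_def)
    qed
  qed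
  have close: "(\<integral>x. \<bar>u n t x - u (n + j) t x\<bar> \<partial>lborel) \<le> 2 * (1 / 2) ^ n - 2 * (1 / 2) ^ (n + j)" if t: "t \<in> I" for n j t
  proof (induction j)
    case (Suc j)
    have "(\<integral>x. \<bar>u n t x - u (n + Suc j) t x\<bar> \<partial>lborel)
       \<le> (\<integral>x. \<bar>u n t x - u (n + j) t x\<bar> + \<bar>u (Suc (n + j)) t x - u (n + j) t x\<bar> \<partial>lborel)"
      by (intro integral_mono Bochner_Integration.integrable_add uu) auto
    also have "\<dots> = (\<integral>x. \<bar>u n t x - u (n + j) t x\<bar> \<partial>lborel) + (\<integral>x. \<bar>u (Suc (n + j)) t x - u (n + j) t x\<bar> \<partial>lborel)"
      by (intro Bochner_Integration.integral_add uu)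
    finally show ?case using Suc fast[OF t, of "n + j"] by simp
  qed simp
  have "(\<integral>x. \<bar>u n t x - \<rho> t x\<bar> \<partial>lborel) \<le> 2 * (1 / 2) ^ n" if t: "t \<in> I" for n t
  proof -
    have "(\<lambda>j. \<integral>x. \<bar>u n t x - u (n + j) t x\<bar> \<partial>lborel) \<longlonglongrightarrow> (\<integral>x. \<bar>u n t x - \<rho> t x\<bar> \<partial>lborel)"
    proof (rule integral_dominated_convergence[where w = "\<lambda>x. R * indicator {A..B} x"])
      show "integrable lborel (\<lambda>x. R * indicator {A..B} x)"
        by (rule integrable_bounded_interval[of _ R A B]) (use R in \<open>auto simp: indicator_def\<close>)
      show "AE x in lborel. (\<lambda>j. \<bar>u n t x - u (n + j) t x\<bar>) \<longlonglongrightarrow> \<bar>u n t x - \<rho> t x\<bar>"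
        using conv[OF t]
      proof eventually_elim
        case (elim x)
        then have "(\<lambda>j. u (n + j) t x) \<longlonglongrightarrow> \<rho> t x" using LIMSEQ_ignore_initial_segment[of "\<lambda>n. u n t x" _ n] by (simp add: add.commute)
        then show ?case by (intro tendsto_intros)
      qed
      fix j
      show "AE x in lborel. norm \<bar>u n t x - u (n + j) t x\<bar> \<le> R * indicator {A..B} x"
      proof (intro AE_I2)
        fix x
        show "norm \<bar>u n t x - u (n + j) t x\<bar> \<le> R * indicator {A..B} x"
          using range[of n t x] range[of "n + j" t x] supp[of x n t] supp[of x "n + j" t]
          by (cases "x \<in> {A..B}") (auto simp: abs_le_iff)
      qed
    qed simp_all
    then show ?thesis
    proof (rule LIMSEQ_le_const2, intro exI[of _ 0] allI impI)
      fix j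
      have "0 \<le> (1 / 2 :: real) ^ (n + j)" by simp
      then show "(\<integral>x. \<bar>u n t x - u (n + j) t x\<bar> \<partial>lborel) \<le> 2 * (1 / 2) ^ n" using close[OF t, of n j] by linarith
    qed
  qed
  then show ?thesis using that \<rho>m \<rho>r \<rho>s by blast
qed

text \<open>A measure on the line is determined by its tails and a density by its measure, up to
  null sets; equality of the total integrals converts integrals up to x into tails.\<close>

lemma AE_eq_from_cdf:
  fixes f g :: "real \<Rightarrow> real"
  assumes [measurable]: "f \<in> borel_measurable borel" "g \<in> borel_measurable borel"
    and nn: "\<And>x. 0 \<le> f x" "\<And>x. 0 \<le> g x" and int: "integrable lborel f" "integrable lborel g"
    and eq: "\<And>x. (\<integral>y. f y * indicator {..x} y \<partial>lborel) = (\<integral>y. g y * indicator {..x} y \<partial>lborel)"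
    and tot: "(\<integral>y. f y \<partial>lborel) = (\<integral>y. g y \<partial>lborel)"
  shows "AE x in lborel. f x = g x"
proof -
  have tail: "emeasure (density lborel (\<lambda>x. ennreal (h x))) {x<..} = ennreal ((\<integral>y. h y \<partial>lborel) - (\<integral>y. h y * indicator {..x} y \<partial>lborel))"
    if [measurable]: "h \<in> borel_measurable borel" and h: "\<And>x. 0 \<le> h x" "integrable lborel h" for h :: "real \<Rightarrow> real" and x
  proof -
    have i: "integrable lborel (\<lambda>y. h y * indicator S y)" if "S \<in> sets borel" for S
      using integrable_real_mult_indicator[of S lborel h] that h(2) by simp
    have "emeasure (density lborel (\<lambda>x. ennreal (h x))) {x<..} = (\<integral>\<^sup>+y. ennreal (h y * indicator {x<..} y) \<partial>lborel)"
      by (subst emeasure_density) (auto intro!: nn_integral_cong borel_open simp: indicator_def)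
    also have "\<dots> = ennreal (\<integral>y. h y * indicator {x<..} y \<partial>lborel)"
      by (rule nn_integral_eq_integral[OF i[OF borel_open[OF open_greaterThan]]]) (use h in \<open>auto simp: indicator_def\<close>)
    also have "(\<integral>y. h y * indicator {x<..} y \<partial>lborel) = (\<integral>y. h y - h y * indicator {..x} y \<partial>lborel)"
      by (rule Bochner_Integration.integral_cong) (auto simp: indicator_def)
    also have "\<dots> = (\<integral>y. h y \<partial>lborel) - (\<integral>y. h y * indicator {..x} y \<partial>lborel)"
      by (rule Bochner_Integration.integral_diff[OF h(2) i]) simp
    finally show ?thesis .
  qed
  have "density lborel (\<lambda>x. ennreal (f x)) = density lborel (\<lambda>x. ennreal (g x))"
    by (rule measure_eqI_lessThan) (use nn int eq tot in \<open>auto simp: tail\<close>)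
  then have "AE x in lborel. ennreal (f x) = ennreal (g x)"
    by (intro sigma_finite_measure.density_unique[OF sigma_finite_lborel]) auto
  then show ?thesis by eventually_elim (use nn in auto)
qed

lemma L1_triangle:
  fixes f g h :: "real \<Rightarrow> real"
  assumes "integrable lborel f" "integrable lborel g" "integrable lborel h"
  shows "(\<integral>x. \<bar>f x - h x\<bar> \<partial>lborel) \<le> (\<integral>x. \<bar>f x - g x\<bar> \<partial>lborel) + (\<integral>x. \<bar>g x - h x\<bar> \<partial>lborel)"
proof -
  have "(\<integral>x. \<bar>f x - h x\<bar> \<partial>lborel) \<le> (\<integral>x. \<bar>f x - g x\<bar> + \<bar>g x - h x\<bar> \<partial>lborel)"
    by (intro integral_mono Bochner_Integration.integrable_add integrable_abs Bochner_Integration.integrable_diff assms) auto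
  also have "\<dots> = (\<integral>x. \<bar>f x - g x\<bar> \<partial>lborel) + (\<integral>x. \<bar>g x - h x\<bar> \<partial>lborel)"
    by (intro Bochner_Integration.integral_add integrable_abs Bochner_Integration.integrable_diff assms)
  finally show ?thesis .
qed

lemma L1_commute: "(\<integral>x. \<bar>f x - g x :: real\<bar> \<partial>M) = (\<integral>x. \<bar>g x - f x\<bar> \<partial>M)"
  by (simp add: abs_minus_commute)

lemma integrable_shift:
  fixes f :: "real \<Rightarrow> real"
  assumes "integrable lborel f"
  shows "integrable lborel (\<lambda>x. f (x + h))" "(\<integral>x. f (x + h) \<partial>lborel) = (\<integral>x. f x \<partial>lborel)"
  using lborel_integrable_real_affine[OF assms, of 1 h] lborel_integral_real_affine[of 1 f h]
  by (simp_all add: add.commute)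

section \<open>Extraction of a limit\<close>

context lwr
begin

lemma section_measurable [measurable]: "u M N t \<in> borel_measurable borel"
  using measurable_Pair2[OF u_measurable, of t M N] by simp

lemma u_integrable: "adm_pair M N \<Longrightarrow> integrable lborel (u M N t)"
proof (rule integrable_bounded_interval[of _ R Ab Bb])
  assume adm: "adm_pair M N"
  show "\<bar>u M N t x\<bar> \<le> R" for x using u_range[OF adm, of t x] by auto
qed (use u_support in auto)

text \<open>The translation bound is the form in which bounded variation passes to the limit; it is
  what uniqueness will use. Range and support are required at every point, and measurability
  jointly, so that integrals in time and space need no further choice of representatives.\<close>

definition nice_limit :: "(real \<Rightarrow> real \<Rightarrow> real) \<Rightarrow> bool" where
  "nice_limit \<rho> \<longleftrightarrow> (\<lambda>(t, x). \<rho> t x) \<in> borel_measurable (borel \<Otimes>\<^sub>M borel) \<and> (\<forall>t x. \<rho> t x \<in> {0..R}) \<and>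
     (\<forall>t x. x \<notin> {Ab..Bb} \<longrightarrow> \<rho> t x = 0) \<and>
     (\<forall>e>0. \<exists>d>0. \<forall>s\<in>{0..T}. \<forall>t\<in>{0..T}. \<bar>s - t\<bar> < d \<longrightarrow> (\<integral>x. \<bar>\<rho> s x - \<rho> t x\<bar> \<partial>lborel) \<le> e) \<and>
     (\<forall>t\<in>{0..T}. \<forall>h. (\<integral>x. \<bar>\<rho> t (x + h) - \<rho> t x\<bar> \<partial>lborel) \<le> \<bar>h\<bar> * TV0) \<and>
     (AE x in lborel. \<rho> 0 x = \<rho>b x)"

definition L1_limit :: "(nat \<Rightarrow> nat) \<Rightarrow> (nat \<Rightarrow> nat) \<Rightarrow> (real \<Rightarrow> real \<Rightarrow> real) \<Rightarrow> bool" where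
  "L1_limit M N \<rho> \<longleftrightarrow> (\<forall>e>0. \<exists>n0. \<forall>n\<ge>n0. \<forall>t\<in>{0..T}. (\<integral>x. \<bar>u (M n) (N n) t x - \<rho> t x\<bar> \<partial>lborel) < e)"

lemma u_L1_modulus:
  assumes "adm_pair M N" "t \<in> {0..T}" "t' \<in> {0..T}" "0 < h"
  shows "(\<integral>x. \<bar>u M N t x - u M N t' x\<bar> \<partial>lborel)
     \<le> 2 * h * TV0 + (Bb - Ab) * (2 * (R * Vm * (\<bar>t - t'\<bar> + 2 * (T / real M))) / h)"
  by (rule u_L1_diff) (use assms P_modulus[OF assms(1-3), of x x for x] in auto)

lemma u_translation: "adm_pair M N \<Longrightarrow> t \<in> {0..T} \<Longrightarrow> (\<integral>x. \<bar>u M N t (x + h) - u M N t x\<bar> \<partial>lborel) \<le> \<bar>h\<bar> * TV0"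
proof -
  assume a: "adm_pair M N" "t \<in> {0..T}"
  have M: "0 < M" using a by (simp add: adm_pair_def)
  have "(\<integral>x. \<bar>u M N t (x + h) - u M N t x\<bar> \<partial>lborel) = (\<integral>x. \<bar>dens M N (cidx M t) (x + h) - dens M N (cidx M t) x\<bar> \<partial>lborel)"
    using u_eq[OF M a(2)] by simp
  also have "\<dots> \<le> \<bar>h\<bar> * (\<Sum>j\<le>N. \<bar>jump (dr M N (cidx M t)) j\<bar>)"
    unfolding dens_def
    by (rule step_fun_translation) (use X_less[OF a(1) cidx_le[OF a(1)]] dr_N[OF a(1)] in auto)
  also have "\<dots> \<le> \<bar>h\<bar> * TV0" by (intro mult_left_mono tv_bound[OF a(1) cidx_le[OF a(1)]]) auto
  finally show ?thesis .
qed

text \<open>h is chosen first, to make the variation term small, and d afterwards, small relative to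
  h. The added ones keep the denominators positive.\<close>

lemma small_modulus:
  assumes "0 < e"
  obtains h d where "0 < h" "0 < d" "2 * h * TV0 + (Bb - Ab) * (2 * d / h) < e"
proof -
  define h where "h = e / (4 * (TV0 + 1))"
  define d where "d = e * h / (8 * (Bb - Ab + 1))"
  have TV: "0 \<le> TV0" by (simp add: TV0_def)
  have AB: "0 \<le> Bb - Ab" using Ab_le_Bb by simp
  have h: "0 < h" using assms TV by (simp add: h_def)
  have d: "0 < d" using assms h AB by (simp add: d_def)
  have "2 * h * TV0 \<le> 2 * h * (TV0 + 1)" using h by simp
  also have "\<dots> = e / 2" using TV by (simp add: h_def field_simps)
  finally have 1: "2 * h * TV0 \<le> e / 2" .
  have "(Bb - Ab) * (2 * d / h) \<le> (Bb - Ab + 1) * (2 * d / h)" using h d by (intro mult_right_mono) auto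
  also have "\<dots> = e / 4"
  proof -
    have *: "Z * (2 * (e * h / (8 * Z)) / h) = e / 4" if "0 < Z" for Z using that h by (simp add: field_simps)
    show ?thesis unfolding d_def by (rule *) (use AB in simp)
  qed
  finally have 2: "(Bb - Ab) * (2 * d / h) \<le> e / 4" .
  have "2 * h * TV0 + (Bb - Ab) * (2 * d / h) < e" using 1 2 assms by linarith
  then show ?thesis using that h d by blast
qed

theorem compactness:
  assumes adm: "\<And>n. adm_pair (M n) (N n)" and N: "filterlim N at_top sequentially" and M: "filterlim M at_top sequentially"
  obtains k \<rho> where "strict_mono (k :: nat \<Rightarrow> nat)" "nice_limit \<rho>" "L1_limit (\<lambda>n. M (k n)) (\<lambda>n. N (k n)) \<rho>"
proof -
  define RV where "RV = R * Vm"
  have RV: "0 \<le> RV" using R_pos Vm_nonneg by (simp add: RV_def)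
  have Tn: "(\<lambda>n. T / real (M n)) \<longlonglongrightarrow> 0"
    by (intro tendsto_divide_0[OF tendsto_const] filterlim_at_top_imp_at_infinity filterlim_compose[OF filterlim_real_sequentially M])
  have Ln: "(\<lambda>n. L / real (N n)) \<longlonglongrightarrow> 0"
    by (intro tendsto_divide_0[OF tendsto_const] filterlim_at_top_imp_at_infinity filterlim_compose[OF filterlim_real_sequentially N])
  have small: "\<exists>n0. \<forall>n\<ge>n0. RV * (2 * (T / real (M n))) < e" if "0 < e" for e
  proof -
    have "(\<lambda>n. RV * (2 * (T / real (M n)))) \<longlonglongrightarrow> RV * (2 * 0)" by (intro tendsto_intros Tn)
    then have "(\<lambda>n. RV * (2 * (T / real (M n)))) \<longlonglongrightarrow> 0" by simp
    from order_tendstoD(2)[OF this that] show ?thesis unfolding eventually_sequentially by blast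
  qed
  define F where "F n = (\<lambda>(t, x). P (M n) (N n) t x)" for n
  define S where "S = {0..T} \<times> {Ab..Bb}"
  obtain k1 where k1: "strict_mono (k1 :: nat \<Rightarrow> nat)"
    "\<And>e. 0 < e \<Longrightarrow> \<exists>n0. \<forall>n\<ge>n0. \<forall>m\<ge>n0. \<forall>x\<in>S. \<bar>F (k1 n) x - F (k1 m) x\<bar> < e"
  proof (rule arzela_subsequence[of S F "R * (Bb - Ab)"])
    show "compact S" unfolding S_def by (intro compact_Times compact_Icc)
    show "\<bar>F n p\<bar> \<le> R * (Bb - Ab)" if "p \<in> S" for n p
    proof -
      obtain t x where p: "p = (t, x)" "t \<in> {0..T}" "x \<in> {Ab..Bb}" using \<open>p \<in> S\<close> by (auto simp: S_def)
      have "\<bar>P (M n) (N n) t x - P (M n) (N n) t Ab\<bar> \<le> R * \<bar>x - Ab\<bar>"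
        unfolding P_def by (rule prim_lipschitz[OF adm cidx_le[OF adm]])
      also have "\<dots> \<le> R * (Bb - Ab)" using p R_pos by (intro mult_left_mono) auto
      finally show ?thesis using P_outside(1)[OF adm, of Ab n t] p by (simp add: F_def)
    qed
    fix e :: real assume e: "0 < e"
    define d where "d = e / (4 * (R + RV + 1))"
    have d: "0 < d" using e R_pos RV by (simp add: d_def)
    have "(R + RV) * d \<le> (R + RV + 1) * d" using d by simp
    also have "\<dots> = e / 4" using R_pos RV by (simp add: d_def field_simps)
    finally have dd: "R * d + RV * d \<le> e / 4" by (simp add: distrib_right)
    obtain n0 where n0: "\<And>n. n \<ge> n0 \<Longrightarrow> RV * (2 * (T / real (M n))) < e / 4" using small[of "e / 4"] e by auto
    have "\<bar>F n p - F n q\<bar> < e" if *: "n \<ge> n0" "p \<in> S" "q \<in> S" "dist p q < d" for n p q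
    proof -
      obtain t x t' x' where pq: "p = (t, x)" "q = (t', x')" "t \<in> {0..T}" "t' \<in> {0..T}" using *(2,3) by (auto simp: S_def)
      have "\<bar>t - t'\<bar> < d" "\<bar>x - x'\<bar> < d"
        using dist_fst_le[of p q] dist_snd_le[of p q] *(4) by (auto simp: pq dist_real_def)
      then have "R * \<bar>x - x'\<bar> \<le> R * d" "RV * \<bar>t - t'\<bar> \<le> RV * d" using R_pos RV by (auto intro: mult_left_mono)
      moreover have "\<bar>F n p - F n q\<bar> \<le> R * \<bar>x - x'\<bar> + RV * (\<bar>t - t'\<bar> + 2 * (T / real (M n)))"
        using P_modulus[OF adm pq(3,4)] by (simp add: F_def pq RV_def)
      moreover have "RV * (\<bar>t - t'\<bar> + 2 * (T / real (M n))) = RV * \<bar>t - t'\<bar> + RV * (2 * (T / real (M n)))"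
        by (rule distrib_left)
      ultimately show ?thesis using n0[OF *(1)] dd e by linarith
    qed
    then show "\<exists>d>0. \<exists>n0. \<forall>n\<ge>n0. \<forall>x\<in>S. \<forall>y\<in>S. dist x y < d \<longrightarrow> \<bar>F n x - F n y\<bar> < e" using d by blast
  next
    fix k' :: "nat \<Rightarrow> nat"
    assume *: "strict_mono k'" "\<And>e. 0 < e \<Longrightarrow> \<exists>n0. \<forall>n\<ge>n0. \<forall>m\<ge>n0. \<forall>x\<in>S. \<bar>F (k' n) x - F (k' m) x\<bar> < e"
    show thesis by (rule that[OF *])
  qed
  \<comment> \<open>Outside [Ab, Bb] all primitives have the same constant values, so closeness on
    the compact set S extends to the whole line.\<close>
  have F_all: "\<exists>n0. \<forall>n\<ge>n0. \<forall>m\<ge>n0. \<forall>t\<in>{0..T}. \<forall>x. \<bar>P (M (k1 n)) (N (k1 n)) t x - P (M (k1 m)) (N (k1 m)) t x\<bar> \<le> e"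
    if e: "0 < e" for e
  proof -
    obtain n0 where n0: "\<And>n m p. n \<ge> n0 \<Longrightarrow> m \<ge> n0 \<Longrightarrow> p \<in> S \<Longrightarrow> \<bar>F (k1 n) p - F (k1 m) p\<bar> < e" using k1(2)[OF e] by blast
    have "\<bar>P (M (k1 n)) (N (k1 n)) t x - P (M (k1 m)) (N (k1 m)) t x\<bar> \<le> e" if *: "n \<ge> n0" "m \<ge> n0" "t \<in> {0..T}" for n m t x
    proof -
      consider "x \<le> Ab" | "Bb \<le> x" | "x \<in> {Ab..Bb}" by force
      then show ?thesis
      proof cases
        case 3
        then show ?thesis using n0[OF *(1,2), of "(t, x)"] *(3) by (simp add: F_def S_def)
      qed (use P_outside[OF adm] e in auto)
    qed
    then show ?thesis by blast
  qed
  have cauchy: "\<exists>n0. \<forall>n\<ge>n0. \<forall>m\<ge>n0. \<forall>t\<in>{0..T}. (\<integral>x. \<bar>u (M (k1 n)) (N (k1 n)) t x - u (M (k1 m)) (N (k1 m)) t x\<bar> \<partial>lborel) \<le> e"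
    if e: "0 < e" for e
  proof -
    obtain h d where hd: "0 < h" "0 < d" "2 * h * TV0 + (Bb - Ab) * (2 * d / h) < e" using small_modulus[OF e] by blast
    obtain n0 where n0: "\<And>n m t x. n \<ge> n0 \<Longrightarrow> m \<ge> n0 \<Longrightarrow> t \<in> {0..T} \<Longrightarrow>
        \<bar>P (M (k1 n)) (N (k1 n)) t x - P (M (k1 m)) (N (k1 m)) t x\<bar> \<le> d" using F_all[OF hd(2)] by blast
    have "(\<integral>x. \<bar>u (M (k1 n)) (N (k1 n)) t x - u (M (k1 m)) (N (k1 m)) t x\<bar> \<partial>lborel) \<le> e"
      if "n \<ge> n0" "m \<ge> n0" "t \<in> {0..T}" for n m t
      using u_L1_diff[OF adm adm that(3,3) n0[OF that] hd(1)] hd(3) by simp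
    then show ?thesis by blast
  qed
  have "\<exists>n0. \<forall>n\<ge>n0. \<forall>m\<ge>n0. \<forall>t\<in>{0..T}. (\<integral>x. \<bar>u (M (k1 n)) (N (k1 n)) t x - u (M (k1 m)) (N (k1 m)) t x\<bar> \<partial>lborel) \<le> (1 / 2) ^ i" for i
    by (rule cauchy) simp
  then obtain n0 where n0: "\<And>i n m t. n \<ge> n0 i \<Longrightarrow> m \<ge> n0 i \<Longrightarrow> t \<in> {0..T} \<Longrightarrow>
      (\<integral>x. \<bar>u (M (k1 n)) (N (k1 n)) t x - u (M (k1 m)) (N (k1 m)) t x\<bar> \<partial>lborel) \<le> (1 / 2) ^ i"
    by metis
  \<comment> \<open>The partial sums dominate each \<open>n0 i\<close>, and the added index makes
    the selection strictly increasing.\<close>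
  define k2 where "k2 i = (\<Sum>j\<le>i. n0 j) + i" for i
  have k2: "strict_mono k2" "n0 i \<le> k2 i" for i
  proof -
    show "strict_mono k2" by (rule strict_monoI_Suc) (simp add: k2_def)
    have "n0 i \<le> (\<Sum>j\<le>i. n0 j)" by (intro member_le_sum) auto
    then show "n0 i \<le> k2 i" by (simp add: k2_def)
  qed
  define k where "k n = k1 (k2 n)" for n
  have k: "strict_mono k" unfolding k_def using k1(1) k2(1) by (auto simp: strict_mono_def)
  obtain \<rho> where \<rho>m: "(\<lambda>(t, x). \<rho> t x) \<in> borel_measurable (borel \<Otimes>\<^sub>M borel)" and \<rho>r: "\<And>t x. \<rho> t x \<in> {0..R}"
    and \<rho>s: "\<And>t x. x \<notin> {Ab..Bb} \<Longrightarrow> \<rho> t x = 0"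
    and \<rho>l: "\<And>n t. t \<in> {0..T} \<Longrightarrow> (\<integral>x. \<bar>u (M (k n)) (N (k n)) t x - \<rho> t x\<bar> \<partial>lborel) \<le> 2 * (1 / 2) ^ n"
  proof (rule fast_L1_limit[of "\<lambda>n. u (M (k n)) (N (k n))" R Ab Bb "{0..T}"])
    fix n t assume t: "t \<in> {0..T}"
    have "n0 n \<le> k2 (Suc n)" using k2(2)[of n] strict_mono_less_eq[OF k2(1), of n "Suc n"] by linarith
    then show "(\<integral>x. \<bar>u (M (k (Suc n))) (N (k (Suc n))) t x - u (M (k n)) (N (k n)) t x\<bar> \<partial>lborel) \<le> (1 / 2) ^ n"
      unfolding k_def using n0[of n "k2 (Suc n)" "k2 n" t] k2(2)[of n] t by simp
  qed (use u_measurable u_range[OF adm] u_support[OF adm] in auto)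
  have [measurable]: "\<rho> t \<in> borel_measurable borel" for t using measurable_Pair2[OF \<rho>m, of t] by simp
  have \<rho>i: "integrable lborel (\<rho> t)" for t
    by (rule integrable_bounded_interval[of _ R Ab Bb]) (use \<rho>r[of t] \<rho>s in auto)
  note ui = u_integrable[OF adm]
  have pow: "(\<lambda>n. 2 * (1 / 2 :: real) ^ n) \<longlonglongrightarrow> 0"
    by (rule tendsto_mult_right_zero) (rule LIMSEQ_power_zero, simp)
  have lim: "L1_limit (\<lambda>n. M (k n)) (\<lambda>n. N (k n)) \<rho>"
    unfolding L1_limit_def
  proof (intro allI impI)
    fix e :: real assume "0 < e"
    then obtain n1 where "\<And>n. n \<ge> n1 \<Longrightarrow> 2 * (1 / 2 :: real) ^ n < e"
      using order_tendstoD(2)[OF pow] unfolding eventually_sequentially by blast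
    then show "\<exists>n0. \<forall>n\<ge>n0. \<forall>t\<in>{0..T}. (\<integral>x. \<bar>u (M (k n)) (N (k n)) t x - \<rho> t x\<bar> \<partial>lborel) < e"
      using \<rho>l by (meson le_less_trans)
  qed
  have ge: "n \<le> k n" for n using seq_suble[OF k] .
  have modulus: "\<exists>d>0. \<forall>s\<in>{0..T}. \<forall>t\<in>{0..T}. \<bar>s - t\<bar> < d \<longrightarrow> (\<integral>x. \<bar>\<rho> s x - \<rho> t x\<bar> \<partial>lborel) \<le> e" if e: "0 < e" for e
  proof -
    obtain h d where hd: "0 < h" "0 < d" "2 * h * TV0 + (Bb - Ab) * (2 * d / h) < e" using small_modulus[OF e] by blast
    define d' where "d' = d / (2 * (RV + 1))"
    have d': "0 < d'" using hd RV by (simp add: d'_def)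
    have "RV * d' \<le> (RV + 1) * d'" using d' by simp
    also have "\<dots> = d / 2" using RV by (simp add: d'_def field_simps)
    finally have RVd: "RV * d' \<le> d / 2" .
    obtain n1 where n1: "\<And>n. n \<ge> n1 \<Longrightarrow> RV * (2 * (T / real (M n))) < d / 2" using small[of "d / 2"] hd by auto
    have "(\<integral>x. \<bar>\<rho> s x - \<rho> t x\<bar> \<partial>lborel) \<le> e" if st: "s \<in> {0..T}" "t \<in> {0..T}" "\<bar>s - t\<bar> < d'" for s t
    proof -
      have "(\<integral>x. \<bar>\<rho> s x - \<rho> t x\<bar> \<partial>lborel) \<le> 2 * (2 * (1 / 2) ^ n) + e" if n: "n \<ge> n1" for n
      proof -
        have "RV * (\<bar>s - t\<bar> + 2 * (T / real (M (k n)))) \<le> d"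
        proof -
          have "RV * \<bar>s - t\<bar> \<le> RV * d'" using RV st(3) by (intro mult_left_mono) auto
          moreover have "RV * (2 * (T / real (M (k n)))) < d / 2" using n1 ge[of n] n by (meson order_trans)
          ultimately show ?thesis using RVd unfolding distrib_left by linarith
        qed
        then have "(Bb - Ab) * (2 * (RV * (\<bar>s - t\<bar> + 2 * (T / real (M (k n))))) / h) \<le> (Bb - Ab) * (2 * d / h)"
          using Ab_le_Bb hd(1) by (intro mult_left_mono divide_right_mono) auto
        then have 1: "(\<integral>x. \<bar>u (M (k n)) (N (k n)) s x - u (M (k n)) (N (k n)) t x\<bar> \<partial>lborel) \<le> e"
          using u_L1_modulus[OF adm st(1,2) hd(1), of "k n"] hd(3) unfolding RV_def by linarith
        have 2: "(\<integral>x. \<bar>\<rho> s x - u (M (k n)) (N (k n)) s x\<bar> \<partial>lborel) \<le> 2 * (1 / 2) ^ n"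
          using \<rho>l[OF st(1), of n] by (simp add: L1_commute)
        show ?thesis
          using L1_triangle[of "\<rho> s" "u (M (k n)) (N (k n)) s" "\<rho> t", OF \<rho>i ui \<rho>i]
            L1_triangle[of "u (M (k n)) (N (k n)) s" "u (M (k n)) (N (k n)) t" "\<rho> t", OF ui ui \<rho>i] 1 2 \<rho>l[OF st(2), of n]
          by linarith
      qed
      moreover have "(\<lambda>n. 2 * (2 * (1 / 2) ^ n) + e) \<longlonglongrightarrow> 2 * 0 + e" by (intro tendsto_intros pow)
      ultimately show ?thesis by (intro LIMSEQ_le_const[of "\<lambda>n. 2 * (2 * (1 / 2) ^ n) + e"]) auto
    qed
    then show ?thesis using d' by blast
  qed
  have trans: "(\<integral>x. \<bar>\<rho> t (x + h) - \<rho> t x\<bar> \<partial>lborel) \<le> \<bar>h\<bar> * TV0" if t: "t \<in> {0..T}" for t h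
  proof -
    have "(\<integral>x. \<bar>\<rho> t (x + h) - \<rho> t x\<bar> \<partial>lborel) \<le> 2 * (2 * (1 / 2) ^ n) + \<bar>h\<bar> * TV0" for n
    proof -
      let ?u = "u (M (k n)) (N (k n)) t"
      have "(\<integral>x. \<bar>\<rho> t (x + h) - ?u (x + h)\<bar> \<partial>lborel) = (\<integral>x. \<bar>\<rho> t x - ?u x\<bar> \<partial>lborel)"
        by (rule integrable_shift(2)) (intro integrable_abs Bochner_Integration.integrable_diff \<rho>i ui)
      then have 1: "(\<integral>x. \<bar>\<rho> t (x + h) - ?u (x + h)\<bar> \<partial>lborel) \<le> 2 * (1 / 2) ^ n" using \<rho>l[OF t, of n] by (simp add: L1_commute)
      have 2: "(\<integral>x. \<bar>?u (x + h) - ?u x\<bar> \<partial>lborel) \<le> \<bar>h\<bar> * TV0" by (rule u_translation[OF adm t])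
      show ?thesis
        using L1_triangle[of "\<lambda>x. \<rho> t (x + h)" "\<lambda>x. ?u (x + h)" "\<rho> t", OF integrable_shift(1)[OF \<rho>i] integrable_shift(1)[OF ui] \<rho>i]
          L1_triangle[of "\<lambda>x. ?u (x + h)" ?u "\<rho> t", OF integrable_shift(1)[OF ui] ui \<rho>i] 1 2 \<rho>l[OF t, of n]
        by linarith
    qed
    moreover have "(\<lambda>n. 2 * (2 * (1 / 2) ^ n) + \<bar>h\<bar> * TV0) \<longlonglongrightarrow> 2 * 0 + \<bar>h\<bar> * TV0" by (intro tendsto_intros pow)
    ultimately show ?thesis by (intro LIMSEQ_le_const[of "\<lambda>n. 2 * (2 * (1 / 2) ^ n) + \<bar>h\<bar> * TV0"]) auto
  qed
  \<comment> \<open>The initial value is identified through its primitive: at time 0 the discrete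
    primitives are within \<open>L / N\<close> of \<open>F0\<close>, and L1 convergence carries over
    to primitives.\<close>
  have cdf: "(\<integral>y. \<rho> 0 y * indicator {..x} y \<partial>lborel) = F0 x" for x
  proof -
    have i: "integrable lborel (\<lambda>y. f y * indicator {..x} y)" if "integrable lborel f" for f :: "real \<Rightarrow> real"
      using integrable_real_mult_indicator[of "{..x}" lborel f] that by simp
    have 0: "(0::real) \<in> {0..T}" using T_pos by simp
    have c0: "cidx (M n) 0 = 0" for n by (simp add: cidx_def)
    have U: "(\<integral>y. u (M (k n)) (N (k n)) 0 y * indicator {..x} y \<partial>lborel) = prim (M (k n)) (N (k n)) 0 x" for n
      using dens_integral[OF adm, of 0 "k n" x] u_eq[OF _ 0, of "M (k n)" "N (k n)"] adm[of "k n"] c0 by (simp add: adm_pair_def)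
    have "\<bar>(\<integral>y. \<rho> 0 y * indicator {..x} y \<partial>lborel) - F0 x\<bar> \<le> 2 * (1 / 2) ^ n + L / real (N (k n))" for n
    proof -
      have "\<bar>(\<integral>y. \<rho> 0 y * indicator {..x} y \<partial>lborel) - (\<integral>y. u (M (k n)) (N (k n)) 0 y * indicator {..x} y \<partial>lborel)\<bar>
         = \<bar>\<integral>y. \<rho> 0 y * indicator {..x} y - u (M (k n)) (N (k n)) 0 y * indicator {..x} y \<partial>lborel\<bar>"
        by (subst Bochner_Integration.integral_diff[OF i[OF \<rho>i] i[OF ui]]) simp
      also have "\<dots> \<le> (\<integral>y. \<bar>\<rho> 0 y * indicator {..x} y - u (M (k n)) (N (k n)) 0 y * indicator {..x} y\<bar> \<partial>lborel)"
        by (rule integral_abs_bound)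
      also have "\<dots> \<le> (\<integral>y. \<bar>u (M (k n)) (N (k n)) 0 y - \<rho> 0 y\<bar> \<partial>lborel)"
        by (intro integral_mono integrable_abs Bochner_Integration.integrable_diff i \<rho>i ui) (auto simp: indicator_def)
      also have "\<dots> \<le> 2 * (1 / 2) ^ n" by (rule \<rho>l[OF 0])
      finally show ?thesis using prim_initial[OF adm, of "k n" x] U[of n] by linarith
    qed
    moreover have "(\<lambda>n. 2 * (1 / 2) ^ n + L / real (N (k n))) \<longlonglongrightarrow> 0 + 0"
      using LIMSEQ_subseq_LIMSEQ[OF Ln k] by (intro tendsto_add pow) (simp add: o_def)
    ultimately have "\<bar>(\<integral>y. \<rho> 0 y * indicator {..x} y \<partial>lborel) - F0 x\<bar> \<le> 0"
      by (intro LIMSEQ_le_const[of "\<lambda>n. 2 * (1 / 2) ^ n + L / real (N (k n))"]) auto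
    then show ?thesis by simp
  qed
  have "AE x in lborel. \<rho> 0 x = \<rho>b x"
  proof (rule AE_eq_from_cdf)
    show "(\<integral>y. \<rho> 0 y * indicator {..x} y \<partial>lborel) = (\<integral>y. \<rho>b y * indicator {..x} y \<partial>lborel)" for x
      using cdf[of x] by (simp add: F0_def)
    have "(\<integral>y. \<rho> 0 y \<partial>lborel) = (\<integral>y. \<rho> 0 y * indicator {..max Bb B0} y \<partial>lborel)"
    proof (rule Bochner_Integration.integral_cong)
      show "\<rho> 0 y = \<rho> 0 y * indicator {..max Bb B0} y" for y
      proof (cases "y \<le> max Bb B0")
        case False
        then have "y \<notin> {Ab..Bb}" by (auto simp: not_le)
        from \<rho>s[OF this] show ?thesis by simp
      qed simp
    qed simp
    also have "\<dots> = L" using cdf F0_right[of "max Bb B0"] by simp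
    finally show "(\<integral>y. \<rho> 0 y \<partial>lborel) = (\<integral>y. \<rho>b y \<partial>lborel)" using L_eq_integral by simp
  qed (use \<rho>r \<rho>b(2) \<rho>i integrable_\<rho>b in auto)
  then have "nice_limit \<rho>"
    unfolding nice_limit_def using \<rho>m \<rho>r \<rho>s modulus trans by blast
  then show ?thesis using that k lim by blast
qed

end

section \<open>Passage to the limit\<close>

text \<open>A test function extended by 0 in time, described by the properties that the limit
  passage uses. The time derivative occurs only through the integral identity \<open>tint\<close>,
  which avoids one-sided derivatives at time 0.\<close>

locale test_ext =
  fixes T a b Bd :: real and \<Phi> \<Phi>x \<Phi>t :: "real \<times> real \<Rightarrow> real"
  assumes T0: "0 < T" and ab: "a \<le> b"
    and \<Phi>_meas [measurable]: "\<Phi> \<in> borel_measurable borel" and \<Phi>x_meas [measurable]: "\<Phi>x \<in> borel_measurable borel"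
    and \<Phi>t_meas [measurable]: "\<Phi>t \<in> borel_measurable borel"
    and bd: "\<And>p. \<bar>\<Phi> p\<bar> \<le> Bd" "\<And>p. \<bar>\<Phi>x p\<bar> \<le> Bd" "\<And>p. \<bar>\<Phi>t p\<bar> \<le> Bd"
    and supp: "\<And>x t. x \<notin> {a..b} \<Longrightarrow> \<Phi> (x, t) = 0" "\<And>x t. x \<notin> {a..b} \<Longrightarrow> \<Phi>x (x, t) = 0"
      "\<And>x t. x \<notin> {a..b} \<Longrightarrow> \<Phi>t (x, t) = 0"
    and final: "\<And>x. \<Phi> (x, T) = 0"
    and xder: "\<And>x t. t \<in> {0..T} \<Longrightarrow> ((\<lambda>x. \<Phi> (x, t)) has_real_derivative \<Phi>x (x, t)) (at x)"
    and xcont: "\<And>t. t \<in> {0..T} \<Longrightarrow> continuous_on UNIV (\<lambda>x. \<Phi>x (x, t))"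
    and tint: "\<And>x s t. 0 \<le> s \<Longrightarrow> s \<le> t \<Longrightarrow> t \<le> T \<Longrightarrow>
       (\<integral>r. \<Phi>t (x, r) * indicator {s..<t} r \<partial>lborel) = \<Phi> (x, t) - \<Phi> (x, s)"
    and ucx: "\<And>e. 0 < e \<Longrightarrow> \<exists>d>0. \<forall>x x'. \<forall>t\<in>{0..T}. \<forall>t'\<in>{0..T}. \<bar>x - x'\<bar> < d \<longrightarrow> \<bar>t - t'\<bar> < d \<longrightarrow>
       \<bar>\<Phi>x (x, t) - \<Phi>x (x', t')\<bar> < e"

text \<open>The derivative is taken within a half-open interval and is one-sided at time 0. It is
  still unique, because every point of the interval is a limit point of it.\<close>

lemma real_derivative_zero_within:
  assumes "(f has_real_derivative D) (at t within {0..<T})" "t \<in> {0..<T}" "open U" "t \<in> U"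
    and "\<And>s. s \<in> U \<inter> {0..<T} \<Longrightarrow> f s = 0"
  shows "D = (0::real)"
proof -
  have "connected {0..<T}" "\<not> (\<exists>x. {0..<T} = {x})"
  proof -
    have "0 \<in> {0..<T}" "T / 2 \<in> {0..<T}" "T / 2 \<noteq> 0" using assms(2) by auto
    then show "\<not> (\<exists>x. {0..<T} = {x})" by (metis singletonD)
  qed auto
  then have "t islimpt {0..<T}" using connected_imp_perfect assms(2) by blast
  then have nb: "at t within {0..<T} \<noteq> bot" by (simp add: trivial_limit_within)
  have "((\<lambda>s. (f s - f t) / (s - t)) \<longlongrightarrow> D) (at t within {0..<T})"
    using assms(1) by (simp add: has_field_derivative_iff)
  moreover have "((\<lambda>s. (f s - f t) / (s - t)) \<longlongrightarrow> 0) (at t within {0..<T})"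
  proof (rule tendsto_eventually)
    have "\<forall>\<^sub>F s in at t within {0..<T}. s \<in> U" using assms(3,4) by (rule eventually_at_in_open'[THEN filter_leD[OF at_le[OF subset_UNIV]]])
    moreover have "\<forall>\<^sub>F s in at t within {0..<T}. s \<in> {0..<T}" by (simp add: eventually_at_filter)
    ultimately show "\<forall>\<^sub>F s in at t within {0..<T}. (f s - f t) / (s - t) = 0"
      by eventually_elim (use assms in auto)
  qed
  ultimately show ?thesis using tendsto_unique nb by blast
qed

text \<open>Since f vanishes after T1 < T, its extension by 0 can be glued from two closed strips
  that meet at a time T2 between T1 and T.\<close>

lemma extend_continuous:
  fixes f :: "real \<times> real \<Rightarrow> real"
  assumes c: "continuous_on (UNIV \<times> {0..<T}) f" and T1: "0 \<le> T1" "T1 < T"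
    and z: "\<And>x t. t \<in> {0..<T} \<Longrightarrow> T1 < t \<Longrightarrow> f (x, t) = 0"
  shows "continuous_on (UNIV \<times> {0..T}) (\<lambda>p. if snd p \<in> {0..<T} then f p else 0)"
proof -
  define T2 where "T2 = (T1 + T) / 2"
  have T2: "T1 < T2" "T2 < T" "0 < T2" using T1 by (auto simp: T2_def)
  have 1: "continuous_on (UNIV \<times> {0..T2}) (\<lambda>p. if snd p \<in> {0..<T} then f p else 0)"
  proof (subst continuous_on_cong[of _ "UNIV \<times> {0..T2}" _ f])
    show "continuous_on (UNIV \<times> {0..T2}) f" by (rule continuous_on_subset[OF c]) (use T2 in auto)
  qed (use T2 in auto)
  have 2: "continuous_on (UNIV \<times> {T2..T}) (\<lambda>p. if snd p \<in> {0..<T} then f p else 0)"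
    using T2 T1 z by (subst continuous_on_cong[of _ "UNIV \<times> {T2..T}" _ "\<lambda>_. 0"]) auto
  have eq: "UNIV \<times> {0..T} = (UNIV \<times> {0..T2} \<union> UNIV \<times> {T2..T} :: (real \<times> real) set)" using T2 by auto
  have cl: "closed (UNIV \<times> {0..T2} :: (real \<times> real) set)" "closed (UNIV \<times> {T2..T} :: (real \<times> real) set)"
    by (intro closed_Times closed_UNIV closed_atLeastAtMost)+
  show ?thesis unfolding eq by (rule continuous_on_closed_Un[OF cl 1 2])
qed

lemma bounded_support_properties:
  fixes f :: "real \<times> real \<Rightarrow> real"
  assumes c: "continuous_on (UNIV \<times> {0..T}) f" and x: "\<And>x t. x \<notin> {a..b} \<Longrightarrow> f (x, t) = 0"
    and t: "\<And>x t. t \<notin> {0..T} \<Longrightarrow> f (x, t) = 0"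
  shows "\<exists>B. \<forall>p. \<bar>f p\<bar> \<le> B" "f \<in> borel_measurable borel"
    "0 < e \<Longrightarrow> \<exists>d>0. \<forall>x x'. \<forall>t\<in>{0..T}. \<forall>t'\<in>{0..T}. \<bar>x - x'\<bar> < d \<longrightarrow> \<bar>t - t'\<bar> < d \<longrightarrow> \<bar>f (x, t) - f (x', t')\<bar> < e"
proof -
  \<comment> \<open>The margin of width 1 guarantees that two points with abscissas closer than 1
    both lie in Q as soon as one abscissa is in [a, b].\<close>
  define Q where "Q = {a - 1..b + 1} \<times> {0..T}"
  have Q: "compact Q" unfolding Q_def by (intro compact_Times compact_Icc)
  have cQ: "continuous_on Q f" by (rule continuous_on_subset[OF c]) (auto simp: Q_def)
  have out: "f p = 0" if "p \<notin> Q" for p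
    using that x[of "fst p" "snd p"] t[of "snd p" "fst p"] by (cases "fst p \<in> {a..b}") (auto simp: Q_def mem_Times_iff)
  have "bounded (f ` Q)" by (intro compact_imp_bounded compact_continuous_image cQ Q)
  then obtain B where B: "\<And>p. p \<in> Q \<Longrightarrow> \<bar>f p\<bar> \<le> B" by (auto simp: bounded_iff)
  have "\<bar>f p\<bar> \<le> max B 0" for p using B[of p] out[of p] by (cases "p \<in> Q") auto
  then show "\<exists>B. \<forall>p. \<bar>f p\<bar> \<le> B" by blast
  have "(\<lambda>p. indicator Q p *\<^sub>R f p) \<in> borel_measurable borel"
    by (rule borel_measurable_continuous_on_indicator[OF _ cQ]) (use Q in \<open>simp add: borel_closed compact_imp_closed\<close>)
  moreover have "(\<lambda>p. indicator Q p *\<^sub>R f p) = f" using out by (auto simp: indicator_def fun_eq_iff)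
  ultimately show "f \<in> borel_measurable borel" by simp
  assume "0 < e"
  then obtain d where d: "0 < d" "\<And>p q. p \<in> Q \<Longrightarrow> q \<in> Q \<Longrightarrow> dist p q < d \<Longrightarrow> dist (f p) (f q) < e"
    using compact_uniformly_continuous[OF cQ Q] unfolding uniformly_continuous_on_def by metis
  have "\<bar>f (x, t) - f (x', t')\<bar> < e"
    if *: "t \<in> {0..T}" "t' \<in> {0..T}" "\<bar>x - x'\<bar> < min 1 (d / 2)" "\<bar>t - t'\<bar> < min 1 (d / 2)" for x x' t t'
  proof (cases "x \<in> {a..b} \<or> x' \<in> {a..b}")
    case True
    then have "(x, t) \<in> Q" "(x', t') \<in> Q" using * by (auto simp: Q_def abs_less_iff)
    moreover have "dist (x, t) (x', t') < d"
    proof -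
      have "dist (x, t) (x', t') \<le> dist x x' + dist t t'"
        unfolding dist_prod_def fst_conv snd_conv by (rule sqrt_sum_squares_le_sum) auto
      then show ?thesis using * by (simp add: dist_real_def)
    qed
    ultimately show ?thesis using d(2) by (fastforce simp: dist_real_def)
  next
    case False
    then show ?thesis using x[of x t] x[of x' t'] \<open>0 < e\<close> by simp
  qed
  then show "\<exists>d>0. \<forall>x x'. \<forall>t\<in>{0..T}. \<forall>t'\<in>{0..T}. \<bar>x - x'\<bar> < d \<longrightarrow> \<bar>t - t'\<bar> < d \<longrightarrow> \<bar>f (x, t) - f (x', t')\<bar> < e"
    using d(1) by (intro exI[of _ "min 1 (d / 2)"]) simp
qed

lemma test_function_extension:
  assumes tf: "test_function T \<phi> \<phi>x \<phi>t" and T: "0 < T"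
  obtains a b Bd \<Phi> \<Phi>x \<Phi>t where "test_ext T a b Bd \<Phi> \<Phi>x \<Phi>t"
    "\<And>x t. t \<in> {0..<T} \<Longrightarrow> \<Phi> (x, t) = \<phi> (x, t) \<and> \<Phi>x (x, t) = \<phi>x (x, t) \<and> \<Phi>t (x, t) = \<phi>t (x, t)"
    "\<And>x t. t \<notin> {0..<T} \<Longrightarrow> \<Phi> (x, t) = 0"
proof -
  note tf' = tf[unfolded test_function_def]
  have der: "(\<phi> has_derivative (\<lambda>(h, s). \<phi>x p * h + \<phi>t p * s)) (at p within UNIV \<times> {0..<T})"
    if "p \<in> UNIV \<times> {0..<T}" for p
    using tf'[THEN conjunct1, rule_format, OF that] .
  have cx: "continuous_on (UNIV \<times> {0..<T}) \<phi>x" and ct: "continuous_on (UNIV \<times> {0..<T}) \<phi>t"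
    using tf'[THEN conjunct2, THEN conjunct1] tf'[THEN conjunct2, THEN conjunct2, THEN conjunct1] .
  obtain K where "compact K \<and> K \<subseteq> UNIV \<times> {0..<T} \<and> (\<forall>p\<in>UNIV \<times> {0..<T} - K. \<phi> p = 0)"
    using tf'[THEN conjunct2, THEN conjunct2, THEN conjunct2] by (rule exE)
  then have K: "compact K" "K \<subseteq> UNIV \<times> {0..<T}" "\<And>p. p \<in> UNIV \<times> {0..<T} \<Longrightarrow> p \<notin> K \<Longrightarrow> \<phi> p = 0"
    by simp_all
  have c: "continuous_on (UNIV \<times> {0..<T}) \<phi>"
    by (rule has_derivative_continuous_on) (rule der)
  obtain a b T1 where box: "K \<subseteq> {a..b} \<times> {0..T1}" "a \<le> b" "0 \<le> T1" "T1 < T"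
  proof (cases "K = {}")
    case True
    then show ?thesis using T by (intro that[of 0 0 0]) auto
  next
    case False
    have "compact (snd ` K)" "compact (fst ` K)" using K(1) by (intro compact_continuous_image continuous_on_fst continuous_on_snd continuous_on_id; assumption)+
    moreover have ne: "snd ` K \<noteq> {}" "fst ` K \<noteq> {}" using False by auto
    ultimately obtain t1 a b where t: "t1 \<in> snd ` K" "\<And>t. t \<in> snd ` K \<Longrightarrow> t \<le> t1"
      and a: "a \<in> fst ` K" "\<And>x. x \<in> fst ` K \<Longrightarrow> a \<le> x" and b: "\<And>x. x \<in> fst ` K \<Longrightarrow> x \<le> b"
      using compact_attains_sup[of "snd ` K"] compact_attains_inf[of "fst ` K"] compact_attains_sup[of "fst ` K"] by blast
    show ?thesis
    proof (rule that[of a b t1])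
      show "0 \<le> t1" "t1 < T" using t(1) K(2) by auto
      show "a \<le> b" using a(1) b by blast
      show "K \<subseteq> {a..b} \<times> {0..t1}" using t a b K(2) by (force simp: mem_Times_iff)
    qed
  qed
  have z: "\<phi> (x, t) = 0" if "t \<in> {0..<T}" "x \<notin> {a..b} \<or> T1 < t" for x t
  proof (rule K(3))
    have "(x, t) \<notin> {a..b} \<times> {0..T1}" using that by auto
    then show "(x, t) \<notin> K" using box(1) by blast
  qed (use that in simp)
  have xd: "((\<lambda>x. \<phi> (x, t)) has_real_derivative \<phi>x (x, t)) (at x)" if t: "t \<in> {0..<T}" for x t
  proof -
    have "((\<lambda>x. \<phi> (x, t)) has_derivative (\<lambda>h. (\<lambda>(h, s). \<phi>x (x, t) * h + \<phi>t (x, t) * s) (h, 0))) (at x)"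
      by (rule has_derivative_in_compose[of "\<lambda>x. (x, t)" "\<lambda>h. (h, 0)"])
         (use t in \<open>auto intro!: derivative_eq_intros has_derivative_subset[OF der]\<close>)
    then show ?thesis unfolding has_field_derivative_def by (rule has_derivative_eq_rhs) auto
  qed
  have td: "((\<lambda>t. \<phi> (x, t)) has_real_derivative \<phi>t (x, t)) (at t within {0..<T})" if t: "t \<in> {0..<T}" for x t
  proof -
    have "((\<lambda>t. \<phi> (x, t)) has_derivative (\<lambda>s. (\<lambda>(h, s). \<phi>x (x, t) * h + \<phi>t (x, t) * s) (0, s))) (at t within {0..<T})"
      by (rule has_derivative_in_compose[of "\<lambda>t. (x, t)" "\<lambda>s. (0, s)"])
         (use t in \<open>auto intro!: derivative_eq_intros has_derivative_subset[OF der]\<close>)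
    then show ?thesis unfolding has_field_derivative_def by (rule has_derivative_eq_rhs) auto
  qed
  \<comment> \<open>The support condition speaks of \<open>\<phi>\<close> only. Its partial
    derivatives vanish off the box because \<open>\<phi>\<close> vanishes nearby along the variable
    of differentiation.\<close>
  have zx: "\<phi>x (x, t) = 0" if t: "t \<in> {0..<T}" and *: "x \<notin> {a..b} \<or> T1 < t" for x t
  proof -
    define U where "U = (if T1 < t then UNIV else - {a..b})"
    have U: "open U" "x \<in> U" using * by (auto simp: U_def)
    have zU: "\<phi> (y, t) = 0" if "y \<in> U" for y using z[OF t] that by (auto simp: U_def split: if_splits)
    have "((\<lambda>x. \<phi> (x, t)) has_real_derivative 0) (at x)"
      by (rule has_field_derivative_transform_within_open[of "\<lambda>_. 0" 0 x U]) (simp_all add: U zU)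
    then show ?thesis using xd[OF t] DERIV_unique by blast
  qed
  have zt: "\<phi>t (x, t) = 0" if t: "t \<in> {0..<T}" and *: "x \<notin> {a..b} \<or> T1 < t" for x t
  proof (cases "T1 < t")
    case True
    show ?thesis by (rule real_derivative_zero_within[OF td[OF t] t, of "{T1<..}"]) (use True z in auto)
  next
    case False
    show ?thesis by (rule real_derivative_zero_within[OF td[OF t] t, of UNIV]) (use False z * in auto)
  qed
  define E :: "(real \<times> real \<Rightarrow> real) \<Rightarrow> real \<times> real \<Rightarrow> real"
    where "E f p = (if snd p \<in> {0..<T} then f p else 0 :: real)" for f p
  have "continuous_on (UNIV \<times> {0..T}) (E \<phi>)"
    unfolding E_def by (rule extend_continuous[OF c box(3,4)]) (simp add: z)
  moreover have "continuous_on (UNIV \<times> {0..T}) (E \<phi>x)"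
    unfolding E_def by (rule extend_continuous[OF cx box(3,4)]) (simp add: zx)
  moreover have "continuous_on (UNIV \<times> {0..T}) (E \<phi>t)"
    unfolding E_def by (rule extend_continuous[OF ct box(3,4)]) (simp add: zt)
  ultimately have cE: "continuous_on (UNIV \<times> {0..T}) (E \<phi>)" "continuous_on (UNIV \<times> {0..T}) (E \<phi>x)"
    "continuous_on (UNIV \<times> {0..T}) (E \<phi>t)" by blast+
  have E0: "E \<phi> (x, t) = 0" "E \<phi>x (x, t) = 0" "E \<phi>t (x, t) = 0" if "x \<notin> {a..b}" for x t
    using z zx zt that by (auto simp: E_def)
  have ET: "E f (x, t) = 0" if "t \<notin> {0..<T}" for f x t using that by (auto simp: E_def)
  have ET': "E f (x, t) = 0" if "t \<notin> {0..T}" for f x t using that by (auto simp: E_def)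
  note p1 = bounded_support_properties[of T "E \<phi>" a b, OF cE(1) E0(1) ET']
    and p2 = bounded_support_properties[of T "E \<phi>x" a b, OF cE(2) E0(2) ET']
    and p3 = bounded_support_properties[of T "E \<phi>t" a b, OF cE(3) E0(3) ET']
  obtain B1 where B1: "\<And>p. \<bar>E \<phi> p\<bar> \<le> B1" using p1(1) by blast
  obtain B2 where B2: "\<And>p. \<bar>E \<phi>x p\<bar> \<le> B2" using p2(1) by blast
  obtain B3 where B3: "\<And>p. \<bar>E \<phi>t p\<bar> \<le> B3" using p3(1) by blast
  have EtD: "((\<lambda>t. E \<phi> (x, t)) has_real_derivative E \<phi>t (x, t)) (at t within {0..T})" if t: "t \<in> {0..T}" for x t
  proof (cases "t < T")
    case True
    have "((\<lambda>t. E \<phi> (x, t)) has_real_derivative E \<phi>t (x, t)) (at t within {0..<T})"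
    proof -
      have t': "t \<in> {0..<T}" using t True by simp
      then have e: "E \<phi>t (x, t) = \<phi>t (x, t)" by (simp add: E_def)
      show ?thesis
        unfolding e by (rule has_field_derivative_transform_within[OF td[OF t'], of 1]) (use t' in \<open>auto simp: E_def\<close>)
    qed
    moreover have "at t within {0..<T} = at t within {0..T}"
      by (rule at_within_nhd[of t "{..<T}"]) (use True in auto)
    ultimately show ?thesis by simp
  next
    case False
    then have tT: "t = T" using t by simp
    have "((\<lambda>t. 0) has_real_derivative 0) (at T within {0..T})" by simp
    then have "((\<lambda>t. E \<phi> (x, t)) has_real_derivative 0) (at T within {0..T})"
      by (rule has_field_derivative_transform_within[where d = "T - T1"])
         (use box z in \<open>auto simp: E_def dist_real_def\<close>)
    then show ?thesis using tT ET[of T "\<phi>t" x] by simp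
  qed
  have mE: "E \<phi>t \<in> borel_measurable borel" by (rule p3(2))
  have tint: "(\<integral>r. E \<phi>t (x, r) * indicator {s..<t} r \<partial>lborel) = E \<phi> (x, t) - E \<phi> (x, s)"
    if st: "0 \<le> s" "s \<le> t" "t \<le> T" for x s t
  proof -
    have [measurable]: "(\<lambda>r. E \<phi>t (x, r)) \<in> borel_measurable borel"
      by (rule measurable_compose[OF _ mE]) (auto simp: borel_prod[symmetric])
    have "((\<lambda>r. E \<phi>t (x, r)) has_integral (E \<phi> (x, t) - E \<phi> (x, s))) {s..t}"
    proof (rule fundamental_theorem_of_calculus[OF st(2)])
      fix r assume "r \<in> {s..t}"
      then show "((\<lambda>r. E \<phi> (x, r)) has_vector_derivative E \<phi>t (x, r)) (at r within {s..t})"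
        using DERIV_subset[OF EtD[of r x]] st by (auto simp: has_real_derivative_iff_has_vector_derivative)
    qed
    moreover have "set_integrable lborel {s..t} (\<lambda>r. E \<phi>t (x, r))"
      unfolding set_integrable_def
      by (rule integrable_bounded_interval[of _ "B3" s t]) (use B3 abs_ge_zero[THEN order_trans, OF B3] in \<open>auto simp: indicator_def\<close>)
    ultimately have "(\<integral>r. indicator {s..t} r *\<^sub>R E \<phi>t (x, r) \<partial>lborel) = E \<phi> (x, t) - E \<phi> (x, s)"
      using set_borel_integral_eq_integral(2)[of "{s..t}" "\<lambda>r. E \<phi>t (x, r)"] by (simp add: integral_unique set_lebesgue_integral_def)
    moreover have "(\<integral>r. indicator {s..t} r *\<^sub>R E \<phi>t (x, r) \<partial>lborel) = (\<integral>r. E \<phi>t (x, r) * indicator {s..<t} r \<partial>lborel)"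
    proof (rule integral_cong_AE)
      show "AE r in lborel. indicator {s..t} r *\<^sub>R E \<phi>t (x, r) = E \<phi>t (x, r) * indicator {s..<t} r"
        using AE_lborel_singleton[of t] by eventually_elim (auto simp: indicator_def)
    qed auto
    ultimately show ?thesis by simp
  qed
  have "test_ext T a b (max B1 (max B2 B3)) (E \<phi>) (E \<phi>x) (E \<phi>t)"
  proof
    show "0 < T" "a \<le> b" by fact+
    show "E \<phi> \<in> borel_measurable borel" "E \<phi>x \<in> borel_measurable borel" "E \<phi>t \<in> borel_measurable borel"
      by (rule p1(2) p2(2) p3(2); simp)+
    show "\<bar>E \<phi> p\<bar> \<le> max B1 (max B2 B3)" "\<bar>E \<phi>x p\<bar> \<le> max B1 (max B2 B3)" "\<bar>E \<phi>t p\<bar> \<le> max B1 (max B2 B3)" for p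
      using B1[of p] B2[of p] B3[of p] by (simp_all add: le_max_iff_disj)
    show "E \<phi> (x, t) = 0" "E \<phi>x (x, t) = 0" "E \<phi>t (x, t) = 0" if "x \<notin> {a..b}" for x t using E0[OF that] by blast+
    show "E \<phi> (x, T) = 0" for x by (rule ET) simp
    show "((\<lambda>x. E \<phi> (x, t)) has_real_derivative E \<phi>x (x, t)) (at x)" if "t \<in> {0..T}" for x t
      using xd[of t x] that by (cases "t = T") (auto simp: E_def)
    show "continuous_on UNIV (\<lambda>x. E \<phi>x (x, t))" if "t \<in> {0..T}" for t
      by (rule continuous_on_compose2[OF cE(2)]) (use that in \<open>auto intro!: continuous_intros\<close>)
    show "(\<integral>r. E \<phi>t (x, r) * indicator {s..<t} r \<partial>lborel) = E \<phi> (x, t) - E \<phi> (x, s)"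
      if "0 \<le> s" "s \<le> t" "t \<le> T" for x s t by (rule tint[OF that])
    show "\<exists>d>0. \<forall>x x'. \<forall>t\<in>{0..T}. \<forall>t'\<in>{0..T}. \<bar>x - x'\<bar> < d \<longrightarrow> \<bar>t - t'\<bar> < d \<longrightarrow> \<bar>E \<phi>x (x, t) - E \<phi>x (x', t')\<bar> < e"
      if "0 < e" for e by (rule p2(3)[OF _ _ that])
  qed
  then show ?thesis by (rule that) (auto simp: E_def)
qed

section \<open>Entropy pairs integrated over time and space\<close>

lemma measurable_comp_Icc:
  fixes g :: "real \<Rightarrow> real"
  assumes "continuous_on {0..R} g" "f \<in> borel_measurable M" "\<And>x. f x \<in> {0..R}"
  shows "(\<lambda>x. g (f x)) \<in> borel_measurable M"
proof -
  \<comment> \<open>\<open>g\<close> is continuous on [0, R] only; composed with the truncation it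
    becomes continuous on the line and is unchanged on the range of \<open>f\<close>.\<close>
  have "continuous_on UNIV (\<lambda>r. g (max 0 (min R r)))"
  proof (rule continuous_on_compose2[OF assms(1)])
    have "0 \<le> R" using assms(3)[of undefined] by simp
    then show "(\<lambda>r. max 0 (min R r)) ` UNIV \<subseteq> {0..R}" by auto
  qed (intro continuous_intros)
  then have "(\<lambda>r. g (max 0 (min R r))) \<in> borel_measurable borel" by (rule borel_measurable_continuous_onI)
  from measurable_compose[OF assms(2) this] have "(\<lambda>x. g (max 0 (min R (f x)))) \<in> borel_measurable M" .
  moreover have "max 0 (min R (f x)) = f x" for x using assms(3)[of x] by auto
  ultimately show ?thesis by simp
qed

text \<open>Common frame for both parts: it covers the Kruzkov pairs as well as the identity with
  its flux, taken with both signs, whose two inequalities make up the weak equation.\<close>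

locale flux_pair =
  fixes R :: real and \<eta> q :: "real \<Rightarrow> real" and \<Lambda> Q :: real
  assumes R0: "0 < R" and \<Lambda>0: "0 \<le> \<Lambda>"
    and \<eta>_lip: "\<And>a b. a \<in> {0..R} \<Longrightarrow> b \<in> {0..R} \<Longrightarrow> \<bar>\<eta> a - \<eta> b\<bar> \<le> \<Lambda> * \<bar>a - b\<bar>"
    and q_lip: "\<And>a b. a \<in> {0..R} \<Longrightarrow> b \<in> {0..R} \<Longrightarrow> \<bar>q a - q b\<bar> \<le> \<Lambda> * \<bar>a - b\<bar>"
    and \<eta>_bd: "\<And>a. a \<in> {0..R} \<Longrightarrow> \<bar>\<eta> a\<bar> \<le> Q" and q_bd: "\<And>a. a \<in> {0..R} \<Longrightarrow> \<bar>q a\<bar> \<le> Q"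
begin

lemma Q0: "0 \<le> Q" using \<eta>_bd[of 0] R0 by simp

lemma lip_cont: "continuous_on {0..R} \<eta>" "continuous_on {0..R} q"
proof -
  have "\<Lambda>-lipschitz_on {0..R} \<eta>" "\<Lambda>-lipschitz_on {0..R} q"
    using \<eta>_lip q_lip \<Lambda>0 by (auto intro!: lipschitz_onI simp: dist_real_def)
  then show "continuous_on {0..R} \<eta>" "continuous_on {0..R} q" by (auto intro: lipschitz_on_continuous_on)
qed

end

locale entropy_form = flux_pair R \<eta> q \<Lambda> Q + test_ext T a b Bd \<Phi> \<Phi>x \<Phi>t
  for R :: real and \<eta> q :: "real \<Rightarrow> real" and \<Lambda> Q T a b Bd :: real and \<Phi> \<Phi>x \<Phi>t :: "real \<times> real \<Rightarrow> real"
begin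

definition G :: "(real \<Rightarrow> real) \<Rightarrow> real \<Rightarrow> real" where
  "G w t = (\<integral>x. \<eta> (w x) * \<Phi>t (x, t) + q (w x) * \<Phi>x (x, t) \<partial>lborel)"

definition W :: "(real \<Rightarrow> real \<Rightarrow> real) \<Rightarrow> real" where
  "W \<rho> = (\<integral>t. indicator {0..<T} t * G (\<rho> t) t \<partial>lborel)"

lemma Bd0: "0 \<le> Bd" using bd(1)[of "(0, 0)"] by linarith

lemma slice_measurable [measurable]:
  "(\<lambda>x. \<Phi> (x, t)) \<in> borel_measurable borel" "(\<lambda>x. \<Phi>x (x, t)) \<in> borel_measurable borel" "(\<lambda>x. \<Phi>t (x, t)) \<in> borel_measurable borel"
  using measurable_compose[OF _ \<Phi>_meas, of "\<lambda>x. (x, t)" borel] measurable_compose[OF _ \<Phi>x_meas, of "\<lambda>x. (x, t)" borel]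
    measurable_compose[OF _ \<Phi>t_meas, of "\<lambda>x. (x, t)" borel]
  by (simp_all add: borel_prod[symmetric])

lemma pair_measurable [measurable]:
  "(\<lambda>(t, x). \<Phi> (x, t)) \<in> borel_measurable (borel \<Otimes>\<^sub>M borel)" "(\<lambda>(t, x). \<Phi>x (x, t)) \<in> borel_measurable (borel \<Otimes>\<^sub>M borel)"
  "(\<lambda>(t, x). \<Phi>t (x, t)) \<in> borel_measurable (borel \<Otimes>\<^sub>M borel)"
  using measurable_compose[OF _ \<Phi>_meas, of "\<lambda>(t, x). (x, t)" "borel \<Otimes>\<^sub>M borel"]
    measurable_compose[OF _ \<Phi>x_meas, of "\<lambda>(t, x). (x, t)" "borel \<Otimes>\<^sub>M borel"]
    measurable_compose[OF _ \<Phi>t_meas, of "\<lambda>(t, x). (x, t)" "borel \<Otimes>\<^sub>M borel"]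
  by (simp_all add: borel_prod[symmetric] case_prod_beta')

lemma integrable_prod:
  assumes "g \<in> borel_measurable borel" "h \<in> borel_measurable borel" "\<And>x. \<bar>g x\<bar> \<le> K" "\<And>x. \<bar>h x\<bar> \<le> K'" "\<And>x. x \<notin> {a..b} \<Longrightarrow> h x = 0"
  shows "integrable lborel (\<lambda>x. g x * h x :: real)"
proof (rule integrable_bounded_interval[of _ "K * K'" a b])
  show "\<bar>g x * h x\<bar> \<le> K * K'" for x
    unfolding abs_mult using assms(3)[of x] assms(4)[of x] by (intro mult_mono) auto
qed (use assms in auto)

lemma integral_prod_bound:
  assumes "\<And>x. \<bar>g x\<bar> \<le> K" "\<And>x. \<bar>h x\<bar> \<le> K'" "\<And>x. x \<notin> {a..b} \<Longrightarrow> h x = 0"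
  shows "\<bar>\<integral>x. g x * h x \<partial>lborel\<bar> \<le> K * K' * (b - a :: real)"
proof (cases "integrable lborel (\<lambda>x. g x * h x)")
  case True
  have K: "0 \<le> K" "0 \<le> K'" using assms(1)[of 0] assms(2)[of 0] by linarith+
  have "\<bar>\<integral>x. g x * h x \<partial>lborel\<bar> \<le> (\<integral>x. \<bar>g x * h x\<bar> \<partial>lborel)" by (rule integral_abs_bound)
  also have "\<dots> \<le> (\<integral>x. K * K' * indicator {a..b} x \<partial>lborel)"
  proof (intro integral_mono integrable_abs True)
    show "integrable lborel (\<lambda>x. K * K' * indicator {a..b} x)"
      by (rule integrable_bounded_interval[of _ "K * K'" a b]) (use K in \<open>auto simp: indicator_def\<close>)
    fix x
    show "\<bar>g x * h x\<bar> \<le> K * K' * indicator {a..b} x"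
      using assms(1)[of x] assms(2)[of x] assms(3)[of x] K
      by (cases "x \<in> {a..b}") (auto simp: abs_mult intro!: mult_mono)
  qed
  also have "\<dots> = K * K' * (b - a)" using ab by simp
  finally show ?thesis .
next
  case False
  have "0 \<le> K" "0 \<le> K'" using assms(1)[of 0] assms(2)[of 0] by linarith+
  then show ?thesis using False ab by (simp add: not_integrable_integral_eq)
qed

context
  fixes w :: "real \<Rightarrow> real"
  assumes w [measurable]: "w \<in> borel_measurable borel" and wr: "\<And>x. w x \<in> {0..R}"
begin

lemma comp_meas [measurable]: "(\<lambda>x. \<eta> (w x)) \<in> borel_measurable borel" "(\<lambda>x. q (w x)) \<in> borel_measurable borel"
  by (rule measurable_comp_Icc[OF lip_cont(1) w wr], rule measurable_comp_Icc[OF lip_cont(2) w wr])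

lemma int_parts:
  "integrable lborel (\<lambda>x. \<eta> (w x) * \<Phi> (x, t))" "integrable lborel (\<lambda>x. \<eta> (w x) * \<Phi>t (x, t))" "integrable lborel (\<lambda>x. q (w x) * \<Phi>x (x, t))"
  by (rule integrable_prod[of _ _ Q Bd]; use comp_meas wr \<eta>_bd q_bd bd supp slice_measurable in auto)+

lemma G_split: "G w t = (\<integral>x. \<eta> (w x) * \<Phi>t (x, t) \<partial>lborel) + (\<integral>x. q (w x) * \<Phi>x (x, t) \<partial>lborel)"
  unfolding G_def by (intro Bochner_Integration.integral_add int_parts)

lemma G_bound: "\<bar>G w t\<bar> \<le> 2 * (Q * Bd * (b - a))"
proof -
  have "\<bar>\<integral>x. \<eta> (w x) * \<Phi>t (x, t) \<partial>lborel\<bar> \<le> Q * Bd * (b - a)"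
    by (rule integral_prod_bound) (use wr \<eta>_bd bd supp in auto)
  moreover have "\<bar>\<integral>x. q (w x) * \<Phi>x (x, t) \<partial>lborel\<bar> \<le> Q * Bd * (b - a)"
    by (rule integral_prod_bound) (use wr q_bd bd supp in auto)
  ultimately show ?thesis unfolding G_split by linarith
qed

lemma G_diff:
  assumes [measurable]: "w' \<in> borel_measurable borel" and w'r: "\<And>x. w' x \<in> {0..R}" and i: "integrable lborel (\<lambda>x. \<bar>w x - w' x\<bar>)"
  shows "\<bar>G w t - G w' t\<bar> \<le> 2 * \<Lambda> * Bd * (\<integral>x. \<bar>w x - w' x\<bar> \<partial>lborel)"
proof -
  have m': "(\<lambda>x. \<eta> (w' x)) \<in> borel_measurable borel" "(\<lambda>x. q (w' x)) \<in> borel_measurable borel"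
    by (rule measurable_comp_Icc[OF lip_cont(1) assms(1) w'r], rule measurable_comp_Icc[OF lip_cont(2) assms(1) w'r])
  have i1: "integrable lborel (\<lambda>x. \<eta> (w' x) * \<Phi>t (x, t))"
    by (rule integrable_prod[of _ _ Q Bd]) (use m' w'r \<eta>_bd bd supp slice_measurable in auto)
  have i2: "integrable lborel (\<lambda>x. q (w' x) * \<Phi>x (x, t))"
    by (rule integrable_prod[of _ _ Q Bd]) (use m' w'r q_bd bd supp slice_measurable in auto)
  let ?D = "\<lambda>x. (\<eta> (w x) * \<Phi>t (x, t) + q (w x) * \<Phi>x (x, t)) - (\<eta> (w' x) * \<Phi>t (x, t) + q (w' x) * \<Phi>x (x, t))"
  have iD: "integrable lborel ?D"
    by (rule Bochner_Integration.integrable_diff) (intro Bochner_Integration.integrable_add int_parts i1 i2)+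
  have eq: "G w t - G w' t = (\<integral>x. ?D x \<partial>lborel)"
    unfolding G_def by (rule Bochner_Integration.integral_diff[symmetric]) (intro Bochner_Integration.integrable_add int_parts i1 i2)+
  have "(\<integral>x. \<bar>?D x\<bar> \<partial>lborel) \<le> (\<integral>x. 2 * \<Lambda> * Bd * \<bar>w x - w' x\<bar> \<partial>lborel)"
  proof (rule integral_mono[OF integrable_abs[OF iD] integrable_mult_right[OF i]])
    fix x
    have "\<bar>(\<eta> (w x) - \<eta> (w' x)) * \<Phi>t (x, t)\<bar> \<le> \<Lambda> * \<bar>w x - w' x\<bar> * Bd"
      unfolding abs_mult by (intro mult_mono \<eta>_lip wr w'r bd) (use \<Lambda>0 in auto)
    moreover have "\<bar>(q (w x) - q (w' x)) * \<Phi>x (x, t)\<bar> \<le> \<Lambda> * \<bar>w x - w' x\<bar> * Bd"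
      unfolding abs_mult by (intro mult_mono q_lip wr w'r bd) (use \<Lambda>0 in auto)
    moreover have "?D x = (\<eta> (w x) - \<eta> (w' x)) * \<Phi>t (x, t) + (q (w x) - q (w' x)) * \<Phi>x (x, t)" by (simp add: algebra_simps)
    moreover have "2 * \<Lambda> * Bd * \<bar>w x - w' x\<bar> = \<Lambda> * \<bar>w x - w' x\<bar> * Bd + \<Lambda> * \<bar>w x - w' x\<bar> * Bd" by simp
    moreover have "\<bar>\<alpha> + \<beta>\<bar> \<le> \<gamma> + \<gamma>" if "\<bar>\<alpha>\<bar> \<le> \<gamma>" "\<bar>\<beta>\<bar> \<le> \<gamma>" for \<alpha> \<beta> \<gamma> :: real using that by linarith
    ultimately show "\<bar>?D x\<bar> \<le> 2 * \<Lambda> * Bd * \<bar>w x - w' x\<bar>" by (simp only:)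
  qed
  then have "(\<integral>x. \<bar>?D x\<bar> \<partial>lborel) \<le> 2 * \<Lambda> * Bd * (\<integral>x. \<bar>w x - w' x\<bar> \<partial>lborel)" by simp
  then show ?thesis unfolding eq by (rule order_trans[OF integral_abs_bound])
qed

lemma G_measurable [measurable]: "(\<lambda>t. G w t) \<in> borel_measurable borel"
  unfolding G_def using lborel.borel_measurable_lebesgue_integral[of "\<lambda>t x. \<eta> (w x) * \<Phi>t (x, t) + q (w x) * \<Phi>x (x, t)" borel]
  by (auto intro!: lborel.borel_measurable_lebesgue_integral)

text \<open>One time slab: the time derivative integrates exactly and the flux is frozen at the final time.\<close>

lemma slab:
  assumes st: "0 \<le> s" "s \<le> t" "t \<le> T" and \<omega>: "\<And>x r. r \<in> {s..t} \<Longrightarrow> \<bar>\<Phi>x (x, r) - \<Phi>x (x, t)\<bar> \<le> \<omega>"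
  shows "(\<integral>r. indicator {s..<t} r * G w r \<partial>lborel) \<ge> (\<integral>x. \<eta> (w x) * \<Phi> (x, t) \<partial>lborel) - (\<integral>x. \<eta> (w x) * \<Phi> (x, s) \<partial>lborel)
     + (t - s) * (\<integral>x. q (w x) * \<Phi>x (x, t) \<partial>lborel) - (t - s) * (Q * \<omega> * (b - a))"
proof -
  let ?I = "indicator {s..<t} :: real \<Rightarrow> real"
  have \<omega>0: "0 \<le> \<omega>" using \<omega>[of t 0] st by simp
  have m1 [measurable]: "(\<lambda>r. \<integral>x. \<eta> (w x) * \<Phi>t (x, r) \<partial>lborel) \<in> borel_measurable borel"
    by (auto intro!: lborel.borel_measurable_lebesgue_integral)
  have m2 [measurable]: "(\<lambda>r. \<integral>x. q (w x) * \<Phi>x (x, r) \<partial>lborel) \<in> borel_measurable borel"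
    by (auto intro!: lborel.borel_measurable_lebesgue_integral)
  have i1: "integrable lborel (\<lambda>r. ?I r * (\<integral>x. \<eta> (w x) * \<Phi>t (x, r) \<partial>lborel))"
  proof (rule integrable_bounded_interval[of _ "Q * Bd * (b - a)" s t])
    show "\<bar>?I r * (\<integral>x. \<eta> (w x) * \<Phi>t (x, r) \<partial>lborel)\<bar> \<le> Q * Bd * (b - a)" for r
      using integral_prod_bound[of "\<lambda>x. \<eta> (w x)" Q "\<lambda>x. \<Phi>t (x, r)" Bd] wr \<eta>_bd bd supp Q0 Bd0 ab by (auto simp: indicator_def)
  qed auto
  have i2: "integrable lborel (\<lambda>r. ?I r * (\<integral>x. q (w x) * \<Phi>x (x, r) \<partial>lborel))"
  proof (rule integrable_bounded_interval[of _ "Q * Bd * (b - a)" s t])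
    show "\<bar>?I r * (\<integral>x. q (w x) * \<Phi>x (x, r) \<partial>lborel)\<bar> \<le> Q * Bd * (b - a)" for r
      using integral_prod_bound[of "\<lambda>x. q (w x)" Q "\<lambda>x. \<Phi>x (x, r)" Bd] wr q_bd bd supp Q0 Bd0 ab by (auto simp: indicator_def)
  qed auto
  \<comment> \<open>As w does not depend on time in the slab, Fubini's theorem moves the time
    integral inside, where \<open>tint\<close> evaluates it.\<close>
  have A: "(\<integral>r. ?I r * (\<integral>x. \<eta> (w x) * \<Phi>t (x, r) \<partial>lborel) \<partial>lborel)
     = (\<integral>x. \<eta> (w x) * \<Phi> (x, t) \<partial>lborel) - (\<integral>x. \<eta> (w x) * \<Phi> (x, s) \<partial>lborel)"
  proof -
    let ?h = "\<lambda>x r. \<eta> (w x) * (\<Phi>t (x, r) * ?I r)"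
    have hm: "case_prod ?h \<in> borel_measurable borel"
      unfolding borel_prod[symmetric] using \<Phi>t_meas unfolding borel_prod[symmetric] by measurable
    have "integrable lborel (case_prod ?h)"
    proof (rule integrable_bounded_box[of _ "Q * Bd" "(a, s)" "(b, t)"])
      show "\<bar>case_prod ?h p\<bar> \<le> Q * Bd" for p
      proof (cases p)
        case (Pair x r)
        have "\<bar>\<eta> (w x)\<bar> * \<bar>\<Phi>t (x, r) * ?I r\<bar> \<le> Q * Bd"
          using \<eta>_bd[OF wr, of x] bd(3)[of "(x, r)"] Bd0 by (intro mult_mono) (auto simp: indicator_def)
        then show ?thesis by (simp add: Pair abs_mult)
      qed
      show "case_prod ?h p = 0" if "p \<notin> cbox (a, s) (b, t)" for p
        using that supp(3) by (cases p) (auto simp: cbox_Pair_eq indicator_def)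
    qed (rule hm)
    then have hi: "integrable (lborel \<Otimes>\<^sub>M lborel) (case_prod ?h)" by (simp add: lborel_prod)
    have "(\<integral>r. ?I r * (\<integral>x. \<eta> (w x) * \<Phi>t (x, r) \<partial>lborel) \<partial>lborel) = (\<integral>r. (\<integral>x. ?h x r \<partial>lborel) \<partial>lborel)"
      by (rule Bochner_Integration.integral_cong) (auto simp: indicator_def)
    also have "\<dots> = (\<integral>x. (\<integral>r. ?h x r \<partial>lborel) \<partial>lborel)" by (rule lborel_pair.Fubini_integral[OF hi])
    also have "\<dots> = (\<integral>x. \<eta> (w x) * \<Phi> (x, t) - \<eta> (w x) * \<Phi> (x, s) \<partial>lborel)"
      by (rule Bochner_Integration.integral_cong) (auto simp: tint[OF st] right_diff_distrib)
    also have "\<dots> = (\<integral>x. \<eta> (w x) * \<Phi> (x, t) \<partial>lborel) - (\<integral>x. \<eta> (w x) * \<Phi> (x, s) \<partial>lborel)"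
      by (intro Bochner_Integration.integral_diff int_parts)
    finally show ?thesis .
  qed
  \<comment> \<open>The final time t is the one at which the one-step estimates are tested; freezing
    the flux there costs the oscillation \<open>\<omega>\<close> of \<open>\<Phi>x\<close>.\<close>
  have B: "(\<integral>r. ?I r * (\<integral>x. q (w x) * \<Phi>x (x, r) \<partial>lborel) \<partial>lborel) \<ge> (t - s) * (\<integral>x. q (w x) * \<Phi>x (x, t) \<partial>lborel) - (t - s) * (Q * \<omega> * (b - a))"
  proof -
    let ?c = "(\<integral>x. q (w x) * \<Phi>x (x, t) \<partial>lborel) - Q * \<omega> * (b - a)"
    have "(\<integral>r. ?I r * ?c \<partial>lborel) \<le> (\<integral>r. ?I r * (\<integral>x. q (w x) * \<Phi>x (x, r) \<partial>lborel) \<partial>lborel)"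
    proof (intro integral_mono i2)
      show "integrable lborel (\<lambda>r. ?I r * ?c)"
        by (rule integrable_bounded_interval[of _ "\<bar>?c\<bar>" s t]) (auto simp: indicator_def)
      fix r
      show "?I r * ?c \<le> ?I r * (\<integral>x. q (w x) * \<Phi>x (x, r) \<partial>lborel)"
      proof (cases "r \<in> {s..<t}")
        case True
        have "\<bar>\<integral>x. q (w x) * (\<Phi>x (x, r) - \<Phi>x (x, t)) \<partial>lborel\<bar> \<le> Q * \<omega> * (b - a)"
          by (rule integral_prod_bound) (use wr q_bd \<omega> supp True in auto)
        moreover have "(\<integral>x. q (w x) * (\<Phi>x (x, r) - \<Phi>x (x, t)) \<partial>lborel) = (\<integral>x. q (w x) * \<Phi>x (x, r) \<partial>lborel) - (\<integral>x. q (w x) * \<Phi>x (x, t) \<partial>lborel)"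
          unfolding right_diff_distrib by (intro Bochner_Integration.integral_diff int_parts)
        ultimately have "?c \<le> (\<integral>x. q (w x) * \<Phi>x (x, r) \<partial>lborel)" by linarith
        then show ?thesis using True by simp
      qed simp
    qed
    moreover have "(\<integral>r. ?I r * ?c \<partial>lborel) = (t - s) * ?c" using st by simp
    ultimately show ?thesis by (simp add: right_diff_distrib)
  qed
  have "(\<integral>r. ?I r * G w r \<partial>lborel) = (\<integral>r. ?I r * (\<integral>x. \<eta> (w x) * \<Phi>t (x, r) \<partial>lborel) + ?I r * (\<integral>x. q (w x) * \<Phi>x (x, r) \<partial>lborel) \<partial>lborel)"
    unfolding G_split distrib_left ..
  also have "\<dots> = (\<integral>r. ?I r * (\<integral>x. \<eta> (w x) * \<Phi>t (x, r) \<partial>lborel) \<partial>lborel) + (\<integral>r. ?I r * (\<integral>x. q (w x) * \<Phi>x (x, r) \<partial>lborel) \<partial>lborel)"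
    by (rule Bochner_Integration.integral_add[OF i1 i2])
  finally show ?thesis using A B by linarith
qed

end

lemma W_integrable:
  assumes "(\<lambda>(t, x). \<rho> t x) \<in> borel_measurable (borel \<Otimes>\<^sub>M borel)" "\<And>t x. \<rho> t x \<in> {0..R}"
  shows "integrable lborel (\<lambda>t. indicator {0..<T} t * G (\<rho> t) t)"
proof (rule integrable_bounded_interval[of _ "2 * (Q * Bd * (b - a))" 0 T])
  have [measurable]: "\<rho> t \<in> borel_measurable borel" for t using measurable_Pair2[OF assms(1), of t] by simp
  have "(\<lambda>p. \<eta> (case p of (t, x) \<Rightarrow> \<rho> t x)) \<in> borel_measurable (borel \<Otimes>\<^sub>M borel)"
    by (rule measurable_comp_Icc[OF lip_cont(1) assms(1)]) (use assms(2) in \<open>simp add: split_beta\<close>)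
  then have [measurable]: "(\<lambda>(t, x). \<eta> (\<rho> t x)) \<in> borel_measurable (borel \<Otimes>\<^sub>M borel)" by (simp add: split_beta)
  have "(\<lambda>p. q (case p of (t, x) \<Rightarrow> \<rho> t x)) \<in> borel_measurable (borel \<Otimes>\<^sub>M borel)"
    by (rule measurable_comp_Icc[OF lip_cont(2) assms(1)]) (use assms(2) in \<open>simp add: split_beta\<close>)
  then have [measurable]: "(\<lambda>(t, x). q (\<rho> t x)) \<in> borel_measurable (borel \<Otimes>\<^sub>M borel)" by (simp add: split_beta)
  have "(\<lambda>t. \<integral>x. \<eta> (\<rho> t x) * \<Phi>t (x, t) + q (\<rho> t x) * \<Phi>x (x, t) \<partial>lborel) \<in> borel_measurable borel"
    by (rule lborel.borel_measurable_lebesgue_integral) measurable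
  then show "(\<lambda>t. indicator {0..<T} t * G (\<rho> t) t) \<in> borel_measurable borel" unfolding G_def by measurable
  show "\<bar>indicator {0..<T} t * G (\<rho> t) t\<bar> \<le> 2 * (Q * Bd * (b - a))" for t
    using G_bound[of "\<rho> t" t] assms(2) Q0 Bd0 ab by (auto simp: indicator_def)
qed auto

lemma W_diff:
  assumes "(\<lambda>(t, x). \<rho> t x) \<in> borel_measurable (borel \<Otimes>\<^sub>M borel)" "\<And>t x. \<rho> t x \<in> {0..R}"
    and "(\<lambda>(t, x). \<rho>' t x) \<in> borel_measurable (borel \<Otimes>\<^sub>M borel)" "\<And>t x. \<rho>' t x \<in> {0..R}"
    and i: "\<And>t. t \<in> {0..T} \<Longrightarrow> integrable lborel (\<lambda>x. \<bar>\<rho> t x - \<rho>' t x\<bar>)"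
    and e: "\<And>t. t \<in> {0..T} \<Longrightarrow> (\<integral>x. \<bar>\<rho> t x - \<rho>' t x\<bar> \<partial>lborel) \<le> e"
  shows "\<bar>W \<rho> - W \<rho>'\<bar> \<le> T * (2 * \<Lambda> * Bd * e)"
proof -
  have [measurable]: "\<rho> t \<in> borel_measurable borel" "\<rho>' t \<in> borel_measurable borel" for t
    using measurable_Pair2[OF assms(1), of t] measurable_Pair2[OF assms(3), of t] by simp_all
  have e0: "0 \<le> e" using T0 by (intro order_trans[OF _ e[of 0]]) auto
  let ?I = "indicator {0..<T} :: real \<Rightarrow> real"
  note wi = W_integrable[of \<rho>, OF assms(1,2)] W_integrable[of \<rho>', OF assms(3,4)]
  let ?D = "\<lambda>t. ?I t * G (\<rho> t) t - ?I t * G (\<rho>' t) t"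
  have eq: "W \<rho> - W \<rho>' = (\<integral>t. ?D t \<partial>lborel)"
    unfolding W_def by (rule Bochner_Integration.integral_diff[symmetric, OF wi])
  have "(\<integral>t. \<bar>?D t\<bar> \<partial>lborel) \<le> (\<integral>t. (2 * \<Lambda> * Bd * e) * ?I t \<partial>lborel)"
  proof (rule integral_mono[OF integrable_abs[OF Bochner_Integration.integrable_diff[OF wi]]])
    show "integrable lborel (\<lambda>t. (2 * \<Lambda> * Bd * e) * ?I t)"
      by (rule integrable_bounded_interval[of _ "2 * \<Lambda> * Bd * e" 0 T]) (use \<Lambda>0 Bd0 e0 in \<open>auto simp: indicator_def\<close>)
    fix t
    show "\<bar>?D t\<bar> \<le> (2 * \<Lambda> * Bd * e) * ?I t"
    proof (cases "t \<in> {0..<T}")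
      case True
      have "\<bar>G (\<rho> t) t - G (\<rho>' t) t\<bar> \<le> 2 * \<Lambda> * Bd * (\<integral>x. \<bar>\<rho> t x - \<rho>' t x\<bar> \<partial>lborel)"
        by (rule G_diff) (use assms(2,4) i True in auto)
      also have "\<dots> \<le> 2 * \<Lambda> * Bd * e" using True \<Lambda>0 Bd0 by (intro mult_left_mono e) auto
      finally show ?thesis using True by simp
    qed simp
  qed
  moreover have "(\<integral>t. (2 * \<Lambda> * Bd * e) * ?I t \<partial>lborel) = T * (2 * \<Lambda> * Bd * e)" using T0 by simp
  ultimately show ?thesis using integral_abs_bound[of lborel ?D] unfolding eq by linarith
qed


end

section \<open>From one step to the limit inequality\<close>

context lwr
begin

lemma dens_sections: "adm_pair M N \<Longrightarrow> m \<le> M \<Longrightarrow> dens M N m \<in> borel_measurable borel \<and> (\<forall>x. dens M N m x \<in> {0..R})"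
  using dens_measurable dens_range by blast

text \<open>In a slab the density is constant in time and only the test function moves;
  \<open>step\<close> then exchanges the density at the later end, so the slabs telescope. Since the
  test function vanishes at T, what is left is the initial term and M errors proportional to
  \<open>T / M\<close>.\<close>

lemma discrete_inequality:
  assumes ef: "entropy_form R \<eta> q \<Lambda> Q T a b Bd \<Phi> \<Phi>x \<Phi>t" and adm: "adm_pair M N"
    and \<omega>: "\<And>x r t. r \<in> {0..T} \<Longrightarrow> t \<in> {0..T} \<Longrightarrow> \<bar>r - t\<bar> \<le> T / real M \<Longrightarrow> \<bar>\<Phi>x (x, r) - \<Phi>x (x, t)\<bar> \<le> \<omega>"
    and step: "\<And>m. m < M \<Longrightarrow>
       (\<integral>x. \<eta> (dens M N (Suc m) x) * \<Phi> (x, real (Suc m) * (T / real M)) \<partial>lborel)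
       - (\<integral>x. \<eta> (dens M N m x) * \<Phi> (x, real (Suc m) * (T / real M)) \<partial>lborel)
       - T / real M * (\<integral>x. q (dens M N m x) * \<Phi>x (x, real (Suc m) * (T / real M)) \<partial>lborel) \<le> T / real M * \<epsilon>"
  shows "entropy_form.W \<eta> q T \<Phi>x \<Phi>t (u M N) \<ge> - (\<integral>x. \<eta> (dens M N 0 x) * \<Phi> (x, 0) \<partial>lborel) - T * (\<epsilon> + Q * \<omega> * (b - a))"
proof -
  interpret entropy_form R \<eta> q \<Lambda> Q T a b Bd \<Phi> \<Phi>x \<Phi>t by (rule ef)
  have M: "0 < M" using adm by (simp add: adm_pair_def)
  define \<tau> where "\<tau> = T / real M"
  have \<tau>: "0 < \<tau>" "real M * \<tau> = T" using M T_pos by (auto simp: \<tau>_def)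
  define E where "E m = (\<integral>x. \<eta> (dens M N m x) * \<Phi> (x, real m * \<tau>) \<partial>lborel)" for m
  define I where "I m = (indicator {real m * \<tau>..<real (Suc m) * \<tau>} :: real \<Rightarrow> real)" for m
  have times: "0 \<le> real m * \<tau>" "real m * \<tau> \<le> real (Suc m) * \<tau>" "real (Suc m) * \<tau> \<le> T" "real (Suc m) * \<tau> - real m * \<tau> = \<tau>"
    if "m < M" for m
  proof -
    show "0 \<le> real m * \<tau>" "real m * \<tau> \<le> real (Suc m) * \<tau>" using \<tau> by (auto intro: mult_right_mono)
    have "real (Suc m) * \<tau> \<le> real M * \<tau>" using that \<tau> by (intro mult_right_mono) auto
    then show "real (Suc m) * \<tau> \<le> T" using \<tau> by simp
    show "real (Suc m) * \<tau> - real m * \<tau> = \<tau>" by (simp add: distrib_right)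
  qed
  have cell: "(\<integral>t. I m t * G (dens M N m) t \<partial>lborel) \<ge> E (Suc m) - E m - \<tau> * (\<epsilon> + Q * \<omega> * (b - a))" if m: "m < M" for m
  proof -
    have "(\<integral>t. I m t * G (dens M N m) t \<partial>lborel) \<ge> (\<integral>x. \<eta> (dens M N m x) * \<Phi> (x, real (Suc m) * \<tau>) \<partial>lborel) - E m
      + (real (Suc m) * \<tau> - real m * \<tau>) * (\<integral>x. q (dens M N m x) * \<Phi>x (x, real (Suc m) * \<tau>) \<partial>lborel)
      - (real (Suc m) * \<tau> - real m * \<tau>) * (Q * \<omega> * (b - a))"
      unfolding I_def E_def
    proof (rule slab)
      show "dens M N m \<in> borel_measurable borel" "dens M N m x \<in> {0..R}" for x using dens_sections[OF adm, of m] m by auto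
      fix x r assume r: "r \<in> {real m * \<tau>..real (Suc m) * \<tau>}"
      show "\<bar>\<Phi>x (x, r) - \<Phi>x (x, real (Suc m) * \<tau>)\<bar> \<le> \<omega>"
      proof (rule \<omega>)
        have "0 \<le> r" by (rule order_trans[OF times(1)[OF m]]) (use r in simp)
        moreover have "r \<le> T" by (rule order_trans[OF _ times(3)[OF m]]) (use r in simp)
        ultimately show "r \<in> {0..T}" by simp
        show "real (Suc m) * \<tau> \<in> {0..T}" using times(3)[OF m] \<tau>(1) by simp
        show "\<bar>r - real (Suc m) * \<tau>\<bar> \<le> T / real M" unfolding \<tau>_def[symmetric] using r times(4)[OF m] by auto
      qed
    qed (use times[OF m] in auto)
    then show ?thesis
      using step[OF m] unfolding \<tau>_def[symmetric] times(4)[OF m] E_def distrib_left by linarith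
  qed
  have W_eq: "W (u M N) = (\<Sum>m<M. \<integral>t. I m t * G (dens M N m) t \<partial>lborel)"
  proof -
    have eq: "indicator {0..<T} t * G (u M N t) t = (\<Sum>m<M. I m t * G (dens M N m) t)" for t
    proof (cases "t \<in> {0..<T}")
      case True
      then have t: "t \<in> {0..T}" "t \<noteq> T" by auto
      have "I m t * G (dens M N m) t = (if m = cidx M t then G (u M N t) t else 0)" if "m < M" for m
      proof -
        have "I m t = (if m = cidx M t then 1 else 0)"
        proof -
          have "t \<in> time_cell T M m \<longleftrightarrow> t \<in> {real m * \<tau>..<real (Suc m) * \<tau>}"
            unfolding time_cell_def \<tau>_def[symmetric] using t(2) by (cases "Suc m = M") simp_all
          then show ?thesis using time_cell_iff[OF M t(1) that] unfolding I_def indicator_def by simp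
        qed
        moreover have "u M N t = dens M N (cidx M t)" using u_eq[OF M t(1)] by auto
        ultimately show ?thesis by simp
      qed
      then have "(\<Sum>m<M. I m t * G (dens M N m) t) = (\<Sum>m<M. if m = cidx M t then G (u M N t) t else 0)" by (intro sum.cong) auto
      then show ?thesis using True cidx_less[OF M, of t] by (simp add: sum.delta)
    next
      case False
      have "I m t = 0" if "m < M" for m
      proof -
        have "t \<notin> {real m * \<tau>..<real (Suc m) * \<tau>}"
        proof
          assume *: "t \<in> {real m * \<tau>..<real (Suc m) * \<tau>}"
          have "0 \<le> t" by (rule order_trans[OF times(1)[OF that]]) (use * in simp)
          moreover have "t < T" by (rule less_le_trans[OF _ times(3)[OF that]]) (use * in simp)
          ultimately show False using False by simp
        qed
        then show ?thesis unfolding I_def by (simp add: indicator_def del: of_nat_Suc atLeastLessThan_iff)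
      qed
      then show ?thesis using False by simp
    qed
    show ?thesis
      unfolding W_def eq
    proof (rule Bochner_Integration.integral_sum)
      fix m assume "m \<in> {..<M}"
      then have m: "m < M" by simp
      show "integrable lborel (\<lambda>t. I m t * G (dens M N m) t)"
      proof (rule integrable_bounded_interval[of _ "2 * (Q * Bd * (b - a))" "real m * \<tau>" "real (Suc m) * \<tau>"])
        have d: "dens M N m \<in> borel_measurable borel" "\<And>x. dens M N m x \<in> {0..R}" using dens_sections[OF adm, of m] m by auto
        show "(\<lambda>t. I m t * G (dens M N m) t) \<in> borel_measurable borel"
          unfolding I_def using G_measurable[OF d] by measurable
        show "\<bar>I m t * G (dens M N m) t\<bar> \<le> 2 * (Q * Bd * (b - a))" for t
          using G_bound[OF d, of t] Q0 Bd0 ab unfolding I_def by (auto simp: indicator_def simp del: of_nat_Suc)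
      qed (auto simp: I_def)
    qed
  qed
  have "E M = 0" using \<tau> final by (simp add: E_def)
  moreover have "E 0 = (\<integral>x. \<eta> (dens M N 0 x) * \<Phi> (x, 0) \<partial>lborel)" by (simp add: E_def)
  moreover have "(\<Sum>m<M. E (Suc m) - E m - \<tau> * (\<epsilon> + Q * \<omega> * (b - a))) = E M - E 0 - T * (\<epsilon> + Q * \<omega> * (b - a))"
  proof -
    have "(\<Sum>m<M. E (Suc m) - E m - \<tau> * (\<epsilon> + Q * \<omega> * (b - a))) = (\<Sum>m<M. E (Suc m) - E m) - real M * (\<tau> * (\<epsilon> + Q * \<omega> * (b - a)))"
      by (simp add: sum_subtractf)
    then show ?thesis unfolding sum_lessThan_telescope \<tau>(2)[symmetric] by (simp only: mult.assoc)
  qed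
  moreover have "(\<Sum>m<M. E (Suc m) - E m - \<tau> * (\<epsilon> + Q * \<omega> * (b - a))) \<le> W (u M N)"
    unfolding W_eq by (intro sum_mono cell) auto
  ultimately show ?thesis by linarith
qed

lemma nice_limitD:
  assumes "nice_limit \<rho>"
  shows "(\<lambda>(t, x). \<rho> t x) \<in> borel_measurable (borel \<Otimes>\<^sub>M borel)" "\<And>t x. \<rho> t x \<in> {0..R}" "\<And>t x. x \<notin> {Ab..Bb} \<Longrightarrow> \<rho> t x = 0"
    "\<And>t. \<rho> t \<in> borel_measurable borel" "\<And>t. integrable lborel (\<rho> t)" "AE x in lborel. \<rho> 0 x = \<rho>b x"
proof -
  show 1: "(\<lambda>(t, x). \<rho> t x) \<in> borel_measurable (borel \<Otimes>\<^sub>M borel)" "\<And>t x. \<rho> t x \<in> {0..R}" "\<And>t x. x \<notin> {Ab..Bb} \<Longrightarrow> \<rho> t x = 0"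
    "AE x in lborel. \<rho> 0 x = \<rho>b x"
    using assms unfolding nice_limit_def by blast+
  show 2: "\<rho> t \<in> borel_measurable borel" for t using measurable_Pair2[OF 1(1), of t] by simp
  show "integrable lborel (\<rho> t)" for t
    by (rule integrable_bounded_interval[of _ R Ab Bb]) (use 1(2)[of t] 1(3) 2 in auto)
qed

lemma limit_inequality:
  assumes ef: "entropy_form R \<eta> q \<Lambda> Q T a b Bd \<Phi> \<Phi>x \<Phi>t" and adm: "\<And>n. adm_pair (M n) (N n)"
    and M: "filterlim M at_top sequentially" and nice: "nice_limit \<rho>" and lim: "L1_limit M N \<rho>"
    and step: "\<And>\<epsilon>. 0 < \<epsilon> \<Longrightarrow> \<exists>n0. \<forall>n\<ge>n0. \<forall>m<M n.
       (\<integral>x. \<eta> (dens (M n) (N n) (Suc m) x) * \<Phi> (x, real (Suc m) * (T / real (M n))) \<partial>lborel)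
       - (\<integral>x. \<eta> (dens (M n) (N n) m x) * \<Phi> (x, real (Suc m) * (T / real (M n))) \<partial>lborel)
       - T / real (M n) * (\<integral>x. q (dens (M n) (N n) m x) * \<Phi>x (x, real (Suc m) * (T / real (M n))) \<partial>lborel) \<le> T / real (M n) * \<epsilon>"
  shows "entropy_form.W \<eta> q T \<Phi>x \<Phi>t \<rho> + (\<integral>x. \<eta> (\<rho>b x) * \<Phi> (x, 0) \<partial>lborel) \<ge> 0"
proof -
  interpret entropy_form R \<eta> q \<Lambda> Q T a b Bd \<Phi> \<Phi>x \<Phi>t by (rule ef)
  note nl = nice_limitD[OF nice]
  have Tn: "(\<lambda>n. T / real (M n)) \<longlonglongrightarrow> 0"
    by (intro tendsto_divide_0[OF tendsto_const] filterlim_at_top_imp_at_infinity filterlim_compose[OF filterlim_real_sequentially M])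
  define Z where "Z = W \<rho> + (\<integral>x. \<eta> (\<rho>b x) * \<Phi> (x, 0) \<partial>lborel)"
  \<comment> \<open>K collects three errors, each proportional to \<open>\<delta>\<close>: replacing
    the discrete density in the space-time term, replacing it in the initial term, and the defect of
    the discrete inequality.\<close>
  define K where "K = T * (2 * \<Lambda> * Bd) + \<Lambda> * Bd + T * (1 + Q * (b - a))"
  have K0: "0 \<le> K" unfolding K_def using T_pos \<Lambda>0 Bd0 Q0 ab by (intro add_nonneg_nonneg mult_nonneg_nonneg) auto
  have main: "- (K * \<delta>) \<le> Z" if \<delta>: "0 < \<delta>" for \<delta>
  proof -
    obtain n1 where n1: "\<And>n t. n \<ge> n1 \<Longrightarrow> t \<in> {0..T} \<Longrightarrow> (\<integral>x. \<bar>u (M n) (N n) t x - \<rho> t x\<bar> \<partial>lborel) < \<delta>"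
      using lim \<delta> unfolding L1_limit_def by blast
    obtain n2 where n2: "\<And>n m. n \<ge> n2 \<Longrightarrow> m < M n \<Longrightarrow>
       (\<integral>x. \<eta> (dens (M n) (N n) (Suc m) x) * \<Phi> (x, real (Suc m) * (T / real (M n))) \<partial>lborel)
       - (\<integral>x. \<eta> (dens (M n) (N n) m x) * \<Phi> (x, real (Suc m) * (T / real (M n))) \<partial>lborel)
       - T / real (M n) * (\<integral>x. q (dens (M n) (N n) m x) * \<Phi>x (x, real (Suc m) * (T / real (M n))) \<partial>lborel) \<le> T / real (M n) * \<delta>"
      using step[OF \<delta>] by blast
    obtain d where d: "0 < d" "\<And>x t t'. t \<in> {0..T} \<Longrightarrow> t' \<in> {0..T} \<Longrightarrow> \<bar>t - t'\<bar> < d \<Longrightarrow> \<bar>\<Phi>x (x, t) - \<Phi>x (x, t')\<bar> < \<delta>"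
      using ucx[OF \<delta>] by (metis abs_zero diff_self)
    obtain n3 where n3: "\<And>n. n \<ge> n3 \<Longrightarrow> T / real (M n) < d"
      using order_tendstoD(2)[OF Tn d(1)] unfolding eventually_sequentially by blast
    define n where "n = max n1 (max n2 n3)"
    have n: "n \<ge> n1" "n \<ge> n2" "n \<ge> n3" by (auto simp: n_def)
    let ?u = "u (M n) (N n)"
    have M0: "0 < M n" using adm[of n] by (simp add: adm_pair_def)
    have c0: "cidx (M n) 0 = 0" by (simp add: cidx_def)
    have u0: "?u 0 = dens (M n) (N n) 0" using u_eq[OF M0, of 0 "N n"] T_pos c0 by auto
    have 1: "W ?u \<ge> - (\<integral>x. \<eta> (?u 0 x) * \<Phi> (x, 0) \<partial>lborel) - T * (\<delta> + Q * \<delta> * (b - a))"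
      unfolding u0
    proof (rule discrete_inequality[OF ef adm])
      show "\<bar>\<Phi>x (x, r) - \<Phi>x (x, t)\<bar> \<le> \<delta>" if "r \<in> {0..T}" "t \<in> {0..T}" "\<bar>r - t\<bar> \<le> T / real (M n)" for x r t
        using d(2)[OF that(1,2), of x] that(3) n3[OF n(3)] by simp
    qed (rule n2[OF n(2)])
    have ud: "?u t \<in> borel_measurable borel" "\<And>x. ?u t x \<in> {0..R}" for t
      using section_measurable u_range[OF adm] by auto
    have id: "integrable lborel (\<lambda>x. \<bar>?u t x - \<rho> t x\<bar>)" for t
      by (intro integrable_abs Bochner_Integration.integrable_diff u_integrable adm nl)
    have 2: "\<bar>W ?u - W \<rho>\<bar> \<le> T * (2 * \<Lambda> * Bd * \<delta>)"
      by (rule W_diff[OF u_measurable _ nl(1,2) id]) (use u_range[OF adm] n1[OF n(1)] in \<open>auto intro: less_imp_le\<close>)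
    have 3: "\<bar>(\<integral>x. \<eta> (?u 0 x) * \<Phi> (x, 0) \<partial>lborel) - (\<integral>x. \<eta> (\<rho> 0 x) * \<Phi> (x, 0) \<partial>lborel)\<bar> \<le> \<Lambda> * Bd * \<delta>"
    proof -
      note i1 = int_parts(1)[OF ud(1) ud(2), of 0 0] and i2 = int_parts(1)[OF nl(4) nl(2), of 0 0]
      have eq: "(\<integral>x. \<eta> (?u 0 x) * \<Phi> (x, 0) \<partial>lborel) - (\<integral>x. \<eta> (\<rho> 0 x) * \<Phi> (x, 0) \<partial>lborel)
         = (\<integral>x. \<eta> (?u 0 x) * \<Phi> (x, 0) - \<eta> (\<rho> 0 x) * \<Phi> (x, 0) \<partial>lborel)"
        by (rule Bochner_Integration.integral_diff[symmetric, OF i1 i2])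
      have "(\<integral>x. \<bar>\<eta> (?u 0 x) * \<Phi> (x, 0) - \<eta> (\<rho> 0 x) * \<Phi> (x, 0)\<bar> \<partial>lborel) \<le> (\<integral>x. \<Lambda> * Bd * \<bar>?u 0 x - \<rho> 0 x\<bar> \<partial>lborel)"
      proof (rule integral_mono[OF integrable_abs[OF Bochner_Integration.integrable_diff[OF i1 i2]] integrable_mult_right[OF id]])
        fix x
        have "\<bar>(\<eta> (?u 0 x) - \<eta> (\<rho> 0 x)) * \<Phi> (x, 0)\<bar> \<le> \<Lambda> * \<bar>?u 0 x - \<rho> 0 x\<bar> * Bd"
          unfolding abs_mult by (intro mult_mono \<eta>_lip ud nl bd) (use \<Lambda>0 in auto)
        moreover have "\<Lambda> * \<bar>?u 0 x - \<rho> 0 x\<bar> * Bd = \<Lambda> * Bd * \<bar>?u 0 x - \<rho> 0 x\<bar>" by simp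
        ultimately show "\<bar>\<eta> (?u 0 x) * \<Phi> (x, 0) - \<eta> (\<rho> 0 x) * \<Phi> (x, 0)\<bar> \<le> \<Lambda> * Bd * \<bar>?u 0 x - \<rho> 0 x\<bar>"
          by (simp only: left_diff_distrib)
      qed
      then have "(\<integral>x. \<bar>\<eta> (?u 0 x) * \<Phi> (x, 0) - \<eta> (\<rho> 0 x) * \<Phi> (x, 0)\<bar> \<partial>lborel) \<le> \<Lambda> * Bd * (\<integral>x. \<bar>?u 0 x - \<rho> 0 x\<bar> \<partial>lborel)"
        by simp
      also have "\<dots> \<le> \<Lambda> * Bd * \<delta>" using n1[OF n(1), of 0] T_pos \<Lambda>0 Bd0 by (intro mult_left_mono) auto
      finally show ?thesis unfolding eq by (rule order_trans[OF integral_abs_bound])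
    qed
    have 4: "(\<integral>x. \<eta> (\<rho> 0 x) * \<Phi> (x, 0) \<partial>lborel) = (\<integral>x. \<eta> (\<rho>b x) * \<Phi> (x, 0) \<partial>lborel)"
    proof (rule integral_cong_AE)
      show "AE x in lborel. \<eta> (\<rho> 0 x) * \<Phi> (x, 0) = \<eta> (\<rho>b x) * \<Phi> (x, 0)" using nl(6) by eventually_elim simp
      show "(\<lambda>x. \<eta> (\<rho> 0 x) * \<Phi> (x, 0)) \<in> borel_measurable lborel" "(\<lambda>x. \<eta> (\<rho>b x) * \<Phi> (x, 0)) \<in> borel_measurable lborel"
        using int_parts(1)[OF nl(4) nl(2), of 0 0] int_parts(1)[OF \<rho>b(1,2), of 0] by (auto dest: borel_measurable_integrable)
    qed
    have "K * \<delta> = T * (2 * \<Lambda> * Bd * \<delta>) + \<Lambda> * Bd * \<delta> + T * (\<delta> + Q * \<delta> * (b - a))"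
      by (simp add: K_def algebra_simps)
    then show ?thesis using 1 2 3 4 unfolding Z_def by linarith
  qed
  have "0 \<le> Z"
  proof (rule field_le_epsilon)
    fix e :: real assume e: "0 < e"
    have "- (K * (e / (K + 1))) \<le> Z" using main[of "e / (K + 1)"] e K0 by simp
    moreover have "K * (e / (K + 1)) \<le> e" using e K0 by (simp add: field_simps)
    ultimately show "0 \<le> Z + e" by linarith
  qed
  then show ?thesis by (simp add: Z_def)
qed

lemma continuous_L1_map_limit:
  assumes nice: "nice_limit \<rho>"
  shows "continuous_L1_map R T \<rho>"
proof -
  note nl = nice_limitD[OF nice]
  have lm: "\<rho> t \<in> borel_measurable lebesgue" for t using nl(4) by (intro measurable_completion) simp
  have "\<rho> t \<in> Linfty_c" for t
  proof -
    have "- {Ab..Bb} \<subseteq> - ess_supp (\<rho> t)"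
      unfolding ess_supp_def using nl(3)[of _ t] by (auto intro!: exI[of _ "- {Ab..Bb}"] AE_I2 open_Compl)
    then have "ess_supp (\<rho> t) \<subseteq> {Ab..Bb}" by auto
    then have "compact (ess_supp (\<rho> t))"
      using closed_ess_supp by (auto simp: compact_eq_bounded_closed intro: bounded_subset[OF bounded_closed_interval])
    moreover have "AE x in lebesgue. \<bar>\<rho> t x\<bar> \<le> R" using nl(2)[of t] by (intro AE_I2) auto
    ultimately show ?thesis using lm by (auto simp: Linfty_c_def)
  qed
  moreover have "AE x in lebesgue. \<rho> t x \<in> {0..R}" for t using nl(2)[of t] by (intro AE_I2) auto
  moreover have "((\<lambda>s. LINT x|lebesgue. \<bar>\<rho> s x - \<rho> t x\<bar>) \<longlongrightarrow> 0) (at t within {0..T})" if t: "t \<in> {0..T}" for t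
  proof (rule tendstoI)
    fix e :: real assume "0 < e"
    then have "0 < e / 2" by simp
    then obtain d where d: "0 < d" "\<And>s. s \<in> {0..T} \<Longrightarrow> \<bar>s - t\<bar> < d \<Longrightarrow> (\<integral>x. \<bar>\<rho> s x - \<rho> t x\<bar> \<partial>lborel) \<le> e / 2"
      using nice t unfolding nice_limit_def by blast
    have eq: "(LINT x|lebesgue. \<bar>\<rho> s x - \<rho> t x\<bar>) = (\<integral>x. \<bar>\<rho> s x - \<rho> t x\<bar> \<partial>lborel)" for s
      by (rule integral_completion) (use nl(4) in auto)
    have "dist (LINT x|lebesgue. \<bar>\<rho> s x - \<rho> t x\<bar>) 0 < e" if "s \<in> {0..T}" "dist s t < d" for s
    proof -
      have "\<bar>\<integral>x. \<bar>\<rho> s x - \<rho> t x\<bar> \<partial>lborel\<bar> = (\<integral>x. \<bar>\<rho> s x - \<rho> t x\<bar> \<partial>lborel)" by (intro abs_of_nonneg integral_nonneg_AE) auto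
      then show ?thesis using d(2)[of s] that \<open>0 < e\<close> unfolding eq by (simp add: dist_real_def)
    qed
    then show "\<forall>\<^sub>F s in at t within {0..T}. dist (LINT x|lebesgue. \<bar>\<rho> s x - \<rho> t x\<bar>) 0 < e"
      unfolding eventually_at using d(1) by blast
  qed
  ultimately show ?thesis unfolding continuous_L1_map_def by blast
qed

lemma double_integral_W:
  assumes ef: "entropy_form R \<eta> q \<Lambda> Q T a b Bd \<Phi> \<Phi>x \<Phi>t" and nice: "nice_limit \<rho>"
    and agree: "\<And>x t. t \<in> {0..<T} \<Longrightarrow> \<Phi>x (x, t) = \<phi>x (x, t) \<and> \<Phi>t (x, t) = \<phi>t (x, t)"
  shows "(LINT t:{0..<T}|lebesgue. LINT x|lebesgue. \<eta> (\<rho> t x) * \<phi>t (x, t) + q (\<rho> t x) * \<phi>x (x, t)) = entropy_form.W \<eta> q T \<Phi>x \<Phi>t \<rho>"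
proof -
  interpret entropy_form R \<eta> q \<Lambda> Q T a b Bd \<Phi> \<Phi>x \<Phi>t by (rule ef)
  note nl = nice_limitD[OF nice]
  have inner: "(LINT x|lebesgue. \<eta> (\<rho> t x) * \<phi>t (x, t) + q (\<rho> t x) * \<phi>x (x, t)) = G (\<rho> t) t" if "t \<in> {0..<T}" for t
  proof -
    have "(LINT x|lebesgue. \<eta> (\<rho> t x) * \<phi>t (x, t) + q (\<rho> t x) * \<phi>x (x, t)) = (LINT x|lebesgue. \<eta> (\<rho> t x) * \<Phi>t (x, t) + q (\<rho> t x) * \<Phi>x (x, t))"
      using agree[OF that] by simp
    also have "\<dots> = G (\<rho> t) t"
      unfolding G_def
      by (rule integral_completion, rule borel_measurable_integrable, intro Bochner_Integration.integrable_add int_parts nl)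
    finally show ?thesis .
  qed
  have "(LINT t:{0..<T}|lebesgue. LINT x|lebesgue. \<eta> (\<rho> t x) * \<phi>t (x, t) + q (\<rho> t x) * \<phi>x (x, t))
    = (LINT t|lebesgue. indicator {0..<T} t * G (\<rho> t) t)"
    unfolding set_lebesgue_integral_def by (rule Bochner_Integration.integral_cong) (auto simp: inner indicator_def)
  also have "\<dots> = W \<rho>"
    unfolding W_def by (rule integral_completion) (rule borel_measurable_integrable[OF W_integrable[OF nl(1,2)]])
  finally show ?thesis .
qed

lemma initial_integral:
  assumes ef: "entropy_form R \<eta> q \<Lambda> Q T a b Bd \<Phi> \<Phi>x \<Phi>t" and [measurable]: "\<eta> \<in> borel_measurable borel"
    and agree: "\<And>x. \<Phi> (x, 0) = \<phi> (x, 0)"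
  shows "(LINT x|lebesgue. \<eta> (\<rho>\<^sub>0 x) * \<phi> (x, 0)) = (\<integral>x. \<eta> (\<rho>b x) * \<Phi> (x, 0) \<partial>lborel)"
proof -
  interpret entropy_form R \<eta> q \<Lambda> Q T a b Bd \<Phi> \<Phi>x \<Phi>t by (rule ef)
  have [measurable]: "(\<lambda>x. \<Phi> (x, 0)) \<in> borel_measurable lebesgue"
    using slice_measurable(1)[of 0] by (intro measurable_completion) simp
  have [measurable]: "\<rho>b \<in> borel_measurable lebesgue" using \<rho>b(1) by (intro measurable_completion) simp
  have "(LINT x|lebesgue. \<eta> (\<rho>\<^sub>0 x) * \<Phi> (x, 0)) = (LINT x|lebesgue. \<eta> (\<rho>b x) * \<Phi> (x, 0))"
  proof (rule integral_cong_AE)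
    show "AE x in lebesgue. \<eta> (\<rho>\<^sub>0 x) * \<Phi> (x, 0) = \<eta> (\<rho>b x) * \<Phi> (x, 0)" using \<rho>b(4) by eventually_elim simp
  qed measurable
  also have "\<dots> = (\<integral>x. \<eta> (\<rho>b x) * \<Phi> (x, 0) \<partial>lborel)"
    by (rule integral_completion) (use slice_measurable(1)[of 0] in measurable)
  finally show ?thesis by (simp add: agree)
qed

end

lemma integrable_lebesgue_strip:
  fixes f :: "real \<times> real \<Rightarrow> real"
  assumes [measurable]: "f \<in> borel_measurable borel" and "\<And>p. \<bar>f p\<bar> \<le> B" "\<And>x t. x \<notin> {a..b} \<Longrightarrow> f (x, t) = 0"
  shows "integrable (lebesgue_on (UNIV \<times> {0..T})) f"
    "(LINT p|lebesgue_on (UNIV \<times> {0..T}). f p) = (\<integral>t. indicator {0..T} t * (\<integral>x. f (x, t) \<partial>lborel) \<partial>lborel)"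
proof -
  let ?S = "UNIV \<times> {0..T} :: (real \<times> real) set"
  have S: "?S \<in> sets borel" by (intro borel_closed closed_Times closed_UNIV closed_atLeastAtMost)
  then have Sl: "?S \<inter> space lebesgue \<in> sets lebesgue" by simp
  let ?g = "\<lambda>p. indicator ?S p * f p"
  have gm: "?g \<in> borel_measurable borel" using S by measurable
  have B: "0 \<le> B" using assms(2)[of "(0, 0)"] by linarith
  have gi: "integrable lborel ?g"
  proof (rule integrable_bounded_box[of _ B "(a, 0)" "(b, T)"])
    show "\<bar>?g p\<bar> \<le> B" for p using assms(2)[of p] B by (auto simp: indicator_def)
    show "?g p = 0" if "p \<notin> cbox (a, 0) (b, T)" for p
      using that assms(3)[of "fst p" "snd p"] by (cases p) (auto simp: cbox_Pair_eq indicator_def)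
  qed (rule gm)
  then have gl: "integrable lebesgue ?g" using integrable_completion[of ?g lborel] gm by simp
  then show "integrable (lebesgue_on ?S) f" using integrable_restrict_space[OF Sl, of f] by simp
  have "(LINT p|lebesgue_on ?S. f p) = (LINT p|lebesgue. ?g p)" using integral_restrict_space[OF Sl, of f] by simp
  also have "\<dots> = (\<integral>p. ?g p \<partial>lborel)" by (rule integral_completion) (use gm in simp)
  also have "\<dots> = (\<integral>p. (case p of (x, t) \<Rightarrow> ?g (x, t)) \<partial>(lborel \<Otimes>\<^sub>M lborel))" by (simp add: lborel_prod)
  also have "\<dots> = (\<integral>t. (\<integral>x. ?g (x, t) \<partial>lborel) \<partial>lborel)"
    by (rule lborel_pair.integral_snd[symmetric]) (use gi in \<open>simp add: lborel_prod case_prod_beta'\<close>)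
  also have "\<dots> = (\<integral>t. indicator {0..T} t * (\<integral>x. f (x, t) \<partial>lborel) \<partial>lborel)"
    by (rule Bochner_Integration.integral_cong) (auto simp: indicator_def)
  finally show "(LINT p|lebesgue_on ?S. f p) = (\<integral>t. indicator {0..T} t * (\<integral>x. f (x, t) \<partial>lborel) \<partial>lborel)" .
qed

section \<open>Convergence on the strip and identification of the limit\<close>

context lwr
begin

lemma swap_measurable: "(\<lambda>(t, x). f t x) \<in> borel_measurable (borel \<Otimes>\<^sub>M borel) \<Longrightarrow> (\<lambda>(x, t). f t x :: real) \<in> borel_measurable (borel :: (real \<times> real) measure)"
  unfolding borel_prod[symmetric] using measurable_pair_swap[of "\<lambda>(t, x). f t x" borel borel borel] by (simp add: split_beta')

lemma converges_L1:
  assumes adm: "\<And>n. adm_pair (M n) (N n)" and nice: "nice_limit \<rho>" and lim: "L1_limit M N \<rho>"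
  shows "converges_L1_on (UNIV \<times> {0..T}) (\<lambda>n. discrete_density R v \<rho>\<^sub>0 T \<theta> (M n) (N n)) (\<lambda>(x, t). \<rho> t x)"
proof -
  note nl = nice_limitD[OF nice]
  let ?d = "\<lambda>n. discrete_density R v \<rho>\<^sub>0 T \<theta> (M n) (N n)"
  have du: "?d n (x, t) = u (M n) (N n) t x" for n x t by (simp add: u_def)
  have [measurable]: "(\<lambda>(x, t). \<rho> t x) \<in> borel_measurable borel" by (rule swap_measurable[OF nl(1)])
  have "integrable (lebesgue_on (UNIV \<times> {0..T})) (?d n)" for n
  proof (rule integrable_lebesgue_strip(1)[of _ R Ab Bb])
    show "\<bar>?d n p\<bar> \<le> R" for p using u_range[OF adm, of n "snd p" "fst p"] du[of n "fst p" "snd p"] by simp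
  qed (auto simp: du u_support[OF adm])
  moreover have "integrable (lebesgue_on (UNIV \<times> {0..T})) (\<lambda>(x, t). \<rho> t x)"
  proof (rule integrable_lebesgue_strip(1)[of _ R Ab Bb])
    show "\<bar>case p of (x, t) \<Rightarrow> \<rho> t x\<bar> \<le> R" for p using nl(2)[of "snd p" "fst p"] by (simp add: split_beta)
  qed (auto simp: nl(3))
  moreover have "(\<lambda>n. LINT p|lebesgue_on (UNIV \<times> {0..T}). \<bar>?d n p - (case p of (x, t) \<Rightarrow> \<rho> t x)\<bar>) \<longlonglongrightarrow> 0"
  proof (rule LIMSEQ_I)
    fix e :: real assume e: "0 < e"
    then have "0 < e / (T + 1)" using T_pos by simp
    then obtain n0 where n0: "\<And>n t. n \<ge> n0 \<Longrightarrow> t \<in> {0..T} \<Longrightarrow> (\<integral>x. \<bar>u (M n) (N n) t x - \<rho> t x\<bar> \<partial>lborel) < e / (T + 1)"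
      using lim unfolding L1_limit_def by blast
    have "norm ((LINT p|lebesgue_on (UNIV \<times> {0..T}). \<bar>?d n p - (case p of (x, t) \<Rightarrow> \<rho> t x)\<bar>) - 0) < e" if n: "n \<ge> n0" for n
    proof -
      let ?f = "\<lambda>p. \<bar>?d n p - (case p of (x, t) \<Rightarrow> \<rho> t x)\<bar>"
      have eq: "(LINT p|lebesgue_on (UNIV \<times> {0..T}). ?f p) = (\<integral>t. indicator {0..T} t * (\<integral>x. ?f (x, t) \<partial>lborel) \<partial>lborel)"
      proof (rule integrable_lebesgue_strip(2)[of _ R Ab Bb])
        show "\<bar>?f p\<bar> \<le> R" for p
          using u_range[OF adm, of n "snd p" "fst p"] du[of n "fst p" "snd p"] nl(2)[of "snd p" "fst p"]
          by (simp add: split_beta abs_le_iff)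
      qed (auto simp: du u_support[OF adm] nl(3))
      have "(\<integral>t. indicator {0..T} t * (\<integral>x. ?f (x, t) \<partial>lborel) \<partial>lborel) \<le> (\<integral>t. e / (T + 1) * indicator {0..T} t \<partial>lborel)"
      proof (rule integral_mono')
        show "integrable lborel (\<lambda>t. e / (T + 1) * indicator {0..T} t)"
          by (rule integrable_bounded_interval[of _ "e / (T + 1)" 0 T]) (use e T_pos in \<open>auto simp: indicator_def\<close>)
        fix t
        show "0 \<le> e / (T + 1) * indicator {0..T} t" using e T_pos by simp
        show "indicator {0..T} t * (\<integral>x. ?f (x, t) \<partial>lborel) \<le> e / (T + 1) * indicator {0..T} t"
          using n0[OF n, of t] by (auto simp: indicator_def du less_imp_le)
      qed
      also have "\<dots> = e / (T + 1) * T" using T_pos by simp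
      also have "\<dots> < e" using e T_pos by (simp add: field_simps)
      finally have "(LINT p|lebesgue_on (UNIV \<times> {0..T}). ?f p) < e" unfolding eq .
      moreover have "0 \<le> (LINT p|lebesgue_on (UNIV \<times> {0..T}). ?f p)" by (intro integral_nonneg_AE) auto
      ultimately show ?thesis by simp
    qed
    then show "\<exists>n0. \<forall>n\<ge>n0. norm ((LINT p|lebesgue_on (UNIV \<times> {0..T}). \<bar>?d n p - (case p of (x, t) \<Rightarrow> \<rho> t x)\<bar>) - 0) < e" by blast
  qed
  ultimately show ?thesis unfolding converges_L1_on_def by blast
qed

lemma flux_bound: "a \<in> {0..R} \<Longrightarrow> \<bar>flux a\<bar> \<le> R * Vm"
  unfolding flux_def abs_mult using v_bound[of a] by (intro mult_mono) auto

lemma flux_pair_weak: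
  assumes "c \<in> {-1, 1}"
  shows "flux_pair R (\<lambda>r. c * r) (\<lambda>r. c * flux r) (max 1 Lf) (max R (R * Vm))"
proof
  show "0 < R" by (rule R_pos)
  fix a b :: real assume ab: "a \<in> {0..R}" "b \<in> {0..R}"
  have c: "\<bar>c * x\<bar> = \<bar>x\<bar>" for x using assms by auto
  have "1 * \<bar>a - b\<bar> \<le> max 1 Lf * \<bar>a - b\<bar>" by (intro mult_right_mono) auto
  then show "\<bar>c * a - c * b\<bar> \<le> max 1 Lf * \<bar>a - b\<bar>" using c[of "a - b"] by (simp add: right_diff_distrib)
  have "\<bar>flux a - flux b\<bar> \<le> Lf * \<bar>a - b\<bar>" by (rule flux_lip[OF ab])
  also have "\<dots> \<le> max 1 Lf * \<bar>a - b\<bar>" by (intro mult_right_mono) auto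
  finally show "\<bar>c * flux a - c * flux b\<bar> \<le> max 1 Lf * \<bar>a - b\<bar>" using c[of "flux a - flux b"] by (simp add: right_diff_distrib)
  show "\<bar>c * a\<bar> \<le> max R (R * Vm)" using ab(1) unfolding c by auto
  show "\<bar>c * flux a\<bar> \<le> max R (R * Vm)" using flux_bound[OF ab(1)] unfolding c by auto
qed simp

lemma flux_pair_entropy:
  assumes k: "k \<in> {0..R}"
  shows "flux_pair R (\<lambda>r. \<bar>r - k\<bar>) (eflux k) (max 1 Lf) (max R (2 * (R * Vm)))"
proof
  show "0 < R" by (rule R_pos)
  fix a b :: real assume ab: "a \<in> {0..R}" "b \<in> {0..R}"
  have "1 * \<bar>a - b\<bar> \<le> max 1 Lf * \<bar>a - b\<bar>" by (intro mult_right_mono) auto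
  then show "\<bar>\<bar>a - k\<bar> - \<bar>b - k\<bar>\<bar> \<le> max 1 Lf * \<bar>a - b\<bar>" by simp
  have "\<bar>eflux k a - eflux k b\<bar> \<le> Lf * \<bar>a - b\<bar>" by (rule eflux_lip[OF ab k])
  also have "\<dots> \<le> max 1 Lf * \<bar>a - b\<bar>" by (intro mult_right_mono) auto
  finally show "\<bar>eflux k a - eflux k b\<bar> \<le> max 1 Lf * \<bar>a - b\<bar>" .
  show "\<bar>\<bar>a - k\<bar>\<bar> \<le> max R (2 * (R * Vm))" using ab(1) k by (auto simp: le_max_iff_disj)
  have "\<bar>eflux k a\<bar> \<le> \<bar>flux a - flux k\<bar>" by (simp add: eflux_def sgn_if abs_mult)
  also have "\<dots> \<le> 2 * (R * Vm)" using flux_bound[OF ab(1)] flux_bound[OF k] by linarith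
  finally show "\<bar>eflux k a\<bar> \<le> max R (2 * (R * Vm))" by (simp add: le_max_iff_disj)
qed simp

context
  fixes M N :: "nat \<Rightarrow> nat"
  assumes adm: "\<And>n. adm_pair (M n) (N n)"
    and N: "filterlim N at_top sequentially" and M: "filterlim M at_top sequentially"
begin

lemma tau_tendsto: "(\<lambda>n. T / real (M n)) \<longlonglongrightarrow> 0"
  by (intro tendsto_divide_0[OF tendsto_const] filterlim_at_top_imp_at_infinity filterlim_compose[OF filterlim_real_sequentially M])

lemma ell_tendsto: "(\<lambda>n. L / real (N n)) \<longlonglongrightarrow> 0"
  by (intro tendsto_divide_0[OF tendsto_const] filterlim_at_top_imp_at_infinity filterlim_compose[OF filterlim_real_sequentially N])

lemma weak_step_small:
  assumes te: "test_ext T a b Bd \<Phi> \<Phi>x \<Phi>t" and \<epsilon>: "0 < \<epsilon>"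
  shows "\<exists>n0. \<forall>n\<ge>n0. \<forall>m<M n.
       \<bar>(\<integral>x. dens (M n) (N n) (Suc m) x * \<Phi> (x, real (Suc m) * (T / real (M n))) \<partial>lborel)
       - (\<integral>x. dens (M n) (N n) m x * \<Phi> (x, real (Suc m) * (T / real (M n))) \<partial>lborel)
       - T / real (M n) * (\<integral>x. flux (dens (M n) (N n) m x) * \<Phi>x (x, real (Suc m) * (T / real (M n))) \<partial>lborel)\<bar> \<le> T / real (M n) * \<epsilon>"
proof -
  interpret test_ext T a b Bd \<Phi> \<Phi>x \<Phi>t by (rule te)
  \<comment> \<open>Because \<open>l * N = L\<close>, the oscillation term of
    \<open>weak_step\<close> is \<open>L * Vm * \<omega>\<close>; half of \<open>\<epsilon>\<close>
    is reserved for it and the other half for the terms that vanish with the mesh sizes.\<close>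
  define \<omega> where "\<omega> = \<epsilon> / (2 * (L * Vm + 1))"
  have LV: "0 \<le> L * Vm" using L_pos Vm_nonneg by simp
  have \<omega>: "0 < \<omega>" using \<epsilon> LV by (simp add: \<omega>_def)
  have "L * Vm * \<omega> \<le> (L * Vm + 1) * \<omega>" using \<omega> by simp
  also have "\<dots> = \<epsilon> / 2" using LV by (simp add: \<omega>_def field_simps)
  finally have w2: "L * (\<omega> * Vm) \<le> \<epsilon> / 2" by (simp add: algebra_simps)
  obtain d where d: "0 < d" "\<And>x x' t. t \<in> {0..T} \<Longrightarrow> \<bar>x - x'\<bar> < d \<Longrightarrow> \<bar>\<Phi>x (x, t) - \<Phi>x (x', t)\<bar> < \<omega>"
    using ucx[OF \<omega>] by (metis abs_zero diff_self)
  have "(\<lambda>n. T / real (M n) * Vm) \<longlonglongrightarrow> 0 * Vm" by (intro tendsto_intros tau_tendsto)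
  then have "\<forall>\<^sub>F n in sequentially. T / real (M n) * Vm < d" using order_tendstoD(2) d(1) by fastforce
  moreover have "(\<lambda>n. Bd * (L / real (N n) * (Lv * TV0) + R\<^sup>2 * (T / real (M n)) * Lv * (Lv * TV0))) \<longlonglongrightarrow> Bd * (0 * (Lv * TV0) + R\<^sup>2 * 0 * Lv * (Lv * TV0))"
    by (intro tendsto_intros tau_tendsto ell_tendsto)
  then have "\<forall>\<^sub>F n in sequentially. Bd * (L / real (N n) * (Lv * TV0) + R\<^sup>2 * (T / real (M n)) * Lv * (Lv * TV0)) < \<epsilon> / 2"
    using order_tendstoD(2)[of _ _ sequentially "\<epsilon> / 2"] \<epsilon> by fastforce
  ultimately have "\<forall>\<^sub>F n in sequentially. T / real (M n) * Vm < d \<and>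
     Bd * (L / real (N n) * (Lv * TV0) + R\<^sup>2 * (T / real (M n)) * Lv * (Lv * TV0)) < \<epsilon> / 2" by eventually_elim simp
  then obtain n0 where n0: "\<And>n. n \<ge> n0 \<Longrightarrow> T / real (M n) * Vm < d"
     "\<And>n. n \<ge> n0 \<Longrightarrow> Bd * (L / real (N n) * (Lv * TV0) + R\<^sup>2 * (T / real (M n)) * Lv * (Lv * TV0)) < \<epsilon> / 2"
    unfolding eventually_sequentially by blast
  show ?thesis
  proof (intro exI allI impI)
    fix n m assume n: "n \<ge> n0" and m: "m < M n"
    interpret s: scheme_step R v v' "L / real (N n)" "T / real (M n)" \<theta> "N n" "X (M n) (N n) m" "X (M n) (N n) (Suc m)"
      by (rule step_locale[OF adm m])
    define t where "t = real (Suc m) * (T / real (M n))"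
    have t: "t \<in> {0..T}"
    proof -
      have "t \<le> real (M n) * (T / real (M n))" unfolding t_def using m T_pos by (intro mult_right_mono) auto
      moreover have "0 \<le> t" unfolding t_def using T_pos by simp
      ultimately show ?thesis using m by simp
    qed
    have LN: "L / real (N n) * real (N n) = L" using adm[of n] by (simp add: adm_pair_def)
    have "\<bar>(\<integral>x. dens (M n) (N n) (Suc m) x * \<Phi> (x, t) \<partial>lborel) - (\<integral>x. dens (M n) (N n) m x * \<Phi> (x, t) \<partial>lborel)
       - T / real (M n) * (\<integral>x. flux (dens (M n) (N n) m x) * \<Phi>x (x, t) \<partial>lborel)\<bar>
      \<le> T / real (M n) * (L / real (N n) * real (N n) * (\<omega> * Vm) + Bd * (L / real (N n) * (Lv * TV0) + R\<^sup>2 * (T / real (M n)) * Lv * (Lv * TV0)))"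
      unfolding dens_def dr_def
    proof (rule s.weak_step)
      show "((\<lambda>x. \<Phi> (x, t)) has_real_derivative \<Phi>x (x, t)) (at x)" for x by (rule xder[OF t])
      show "continuous_on UNIV (\<lambda>x. \<Phi>x (x, t))" by (rule xcont[OF t])
      show "\<bar>\<Phi>x (x, t)\<bar> \<le> Bd" for x by (rule bd)
      show "\<bar>\<Phi>x (x, t) - \<Phi>x (x', t)\<bar> \<le> \<omega>" if "\<bar>x - x'\<bar> \<le> T / real (M n) * Vm" for x x'
        using d(2)[OF t, of x x'] that n0(1)[OF n] by simp
      show "(\<Sum>j\<le>N n. \<bar>jump (local_density (L / real (N n)) (N n) (X (M n) (N n) m)) j\<bar>) \<le> TV0"
        using tv_bound[OF adm, of m n] m by (simp add: dr_def)
    qed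
    also have "\<dots> \<le> T / real (M n) * \<epsilon>"
      unfolding LN by (rule mult_left_mono, use n0(2)[OF n] w2 in linarith, use T_pos in simp)
    finally show "\<bar>(\<integral>x. dens (M n) (N n) (Suc m) x * \<Phi> (x, real (Suc m) * (T / real (M n))) \<partial>lborel)
       - (\<integral>x. dens (M n) (N n) m x * \<Phi> (x, real (Suc m) * (T / real (M n))) \<partial>lborel)
       - T / real (M n) * (\<integral>x. flux (dens (M n) (N n) m x) * \<Phi>x (x, real (Suc m) * (T / real (M n))) \<partial>lborel)\<bar> \<le> T / real (M n) * \<epsilon>"
      unfolding t_def .
  qed
qed

lemma weak_limit:
  assumes nice: "nice_limit \<rho>" and lim: "L1_limit M N \<rho>"
  shows "weak_solution R v \<rho>\<^sub>0 T \<rho>"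
  unfolding weak_solution_def Let_def
proof (intro conjI allI impI)
  show "continuous_L1_map R T \<rho>" by (rule continuous_L1_map_limit[OF nice])
  fix \<phi> \<phi>x \<phi>t assume tf: "test_function T \<phi> \<phi>x \<phi>t"
  obtain a b Bd \<Phi> \<Phi>x \<Phi>t where te: "test_ext T a b Bd \<Phi> \<Phi>x \<Phi>t"
    and agree: "\<And>x t. t \<in> {0..<T} \<Longrightarrow> \<Phi> (x, t) = \<phi> (x, t) \<and> \<Phi>x (x, t) = \<phi>x (x, t) \<and> \<Phi>t (x, t) = \<phi>t (x, t)"
    and "\<And>x t. t \<notin> {0..<T} \<Longrightarrow> \<Phi> (x, t) = 0"
  proof (rule test_function_extension[OF tf T_pos])
    fix a b Bd \<Phi> \<Phi>x \<Phi>t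
    assume *: "test_ext T a b Bd \<Phi> \<Phi>x \<Phi>t"
      "\<And>x t. t \<in> {0..<T} \<Longrightarrow> \<Phi> (x, t) = \<phi> (x, t) \<and> \<Phi>x (x, t) = \<phi>x (x, t) \<and> \<Phi>t (x, t) = \<phi>t (x, t)"
      "\<And>x t. t \<notin> {0..<T} \<Longrightarrow> \<Phi> (x, t) = 0"
    show thesis by (rule that[OF *])
  qed
  define I where "I = (LINT t:{0..<T}|lebesgue. LINT x|lebesgue. \<rho> t x * \<phi>t (x, t) + flux (\<rho> t x) * \<phi>x (x, t)) + (LINT x|lebesgue. \<rho>\<^sub>0 x * \<phi> (x, 0))"
  \<comment> \<open>The limit passage gives one-sided inequalities; applied to the pair and to its
    negative it yields the equation.\<close>
  have sgn: "c * I \<ge> 0" if c: "c \<in> {-1, 1}" for c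
  proof -
    have ef: "entropy_form R (\<lambda>r. c * r) (\<lambda>r. c * flux r) (max 1 Lf) (max R (R * Vm)) T a b Bd \<Phi> \<Phi>x \<Phi>t"
      using flux_pair_weak[OF c] te by (simp add: entropy_form_def)
    have "entropy_form.W (\<lambda>r. c * r) (\<lambda>r. c * flux r) T \<Phi>x \<Phi>t \<rho> + (\<integral>x. c * \<rho>b x * \<Phi> (x, 0) \<partial>lborel) \<ge> 0"
    proof (rule limit_inequality[OF ef adm M nice lim])
      fix \<epsilon> :: real assume "0 < \<epsilon>"
      from weak_step_small[OF te this] obtain n0 where n0: "\<And>n m. n \<ge> n0 \<Longrightarrow> m < M n \<Longrightarrow>
       \<bar>(\<integral>x. dens (M n) (N n) (Suc m) x * \<Phi> (x, real (Suc m) * (T / real (M n))) \<partial>lborel)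
       - (\<integral>x. dens (M n) (N n) m x * \<Phi> (x, real (Suc m) * (T / real (M n))) \<partial>lborel)
       - T / real (M n) * (\<integral>x. flux (dens (M n) (N n) m x) * \<Phi>x (x, real (Suc m) * (T / real (M n))) \<partial>lborel)\<bar> \<le> T / real (M n) * \<epsilon>"
        by blast
      have pm: "c * A - c * B - \<tau> * (c * D) \<le> E" if "\<bar>A - B - \<tau> * D\<bar> \<le> E" for A B D E \<tau> :: real
        using c that by (auto simp: abs_le_iff)
      show "\<exists>n0. \<forall>n\<ge>n0. \<forall>m<M n.
         (\<integral>x. c * dens (M n) (N n) (Suc m) x * \<Phi> (x, real (Suc m) * (T / real (M n))) \<partial>lborel)
         - (\<integral>x. c * dens (M n) (N n) m x * \<Phi> (x, real (Suc m) * (T / real (M n))) \<partial>lborel)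
         - T / real (M n) * (\<integral>x. c * flux (dens (M n) (N n) m x) * \<Phi>x (x, real (Suc m) * (T / real (M n))) \<partial>lborel) \<le> T / real (M n) * \<epsilon>"
        unfolding mult.assoc integral_mult_right_zero using n0 pm by blast
    qed
    moreover have "(LINT t:{0..<T}|lebesgue. LINT x|lebesgue. c * \<rho> t x * \<phi>t (x, t) + c * flux (\<rho> t x) * \<phi>x (x, t))
       = entropy_form.W (\<lambda>r. c * r) (\<lambda>r. c * flux r) T \<Phi>x \<Phi>t \<rho>"
      by (rule double_integral_W[OF ef nice]) (use agree in auto)
    moreover have "(LINT t:{0..<T}|lebesgue. LINT x|lebesgue. c * \<rho> t x * \<phi>t (x, t) + c * flux (\<rho> t x) * \<phi>x (x, t))
       = c * (LINT t:{0..<T}|lebesgue. LINT x|lebesgue. \<rho> t x * \<phi>t (x, t) + flux (\<rho> t x) * \<phi>x (x, t))"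
      unfolding set_lebesgue_integral_def mult.assoc distrib_left[symmetric] integral_mult_right_zero
      by (simp add: mult.left_commute)
    moreover have "(LINT x|lebesgue. c * \<rho>\<^sub>0 x * \<phi> (x, 0)) = (\<integral>x. c * \<rho>b x * \<Phi> (x, 0) \<partial>lborel)"
      by (rule initial_integral[OF ef]) (use agree T_pos in auto)
    moreover have "(LINT x|lebesgue. c * \<rho>\<^sub>0 x * \<phi> (x, 0)) = c * (LINT x|lebesgue. \<rho>\<^sub>0 x * \<phi> (x, 0))"
      unfolding mult.assoc by (rule integral_mult_right_zero)
    ultimately show ?thesis by (simp add: I_def distrib_left)
  qed
  have "I = 0" using sgn[of 1] sgn[of "-1"] by simp
  then show "(LINT t:{0..<T}|lebesgue. LINT x|lebesgue. \<rho> t x * \<phi>t (x, t) + \<rho> t x * v (\<rho> t x) * \<phi>x (x, t)) + (LINT x|lebesgue. \<rho>\<^sub>0 x * \<phi> (x, 0)) = 0"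
    by (simp add: I_def flux_def)
qed

lemma entropy_step_small:
  assumes te: "test_ext T a b Bd \<Phi> \<Phi>x \<Phi>t" and nn: "\<And>p. 0 \<le> \<Phi> p" and k: "k \<in> {0..R}" and \<epsilon>: "0 < \<epsilon>"
    and ratio: "(\<lambda>n. real (N n) / real (M n)) \<longlonglongrightarrow> 0"
  shows "\<exists>n0. \<forall>n\<ge>n0. \<forall>m<M n.
       (\<integral>x. \<bar>dens (M n) (N n) (Suc m) x - k\<bar> * \<Phi> (x, real (Suc m) * (T / real (M n))) \<partial>lborel)
       - (\<integral>x. \<bar>dens (M n) (N n) m x - k\<bar> * \<Phi> (x, real (Suc m) * (T / real (M n))) \<partial>lborel)
       - T / real (M n) * (\<integral>x. eflux k (dens (M n) (N n) m x) * \<Phi>x (x, real (Suc m) * (T / real (M n))) \<partial>lborel) \<le> T / real (M n) * \<epsilon>"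
proof -
  interpret entropy_form R "\<lambda>r. \<bar>r - k\<bar>" "eflux k" "max 1 Lf" "max R (2 * (R * Vm))" T a b Bd \<Phi> \<Phi>x \<Phi>t
    using flux_pair_entropy[OF k] te by (simp add: entropy_form_def)
  \<comment> \<open>The error of \<open>entropy_step\<close> divided by \<open>\<tau>\<close>. Its
    first and last summands are multiples of \<open>N / M\<close>, the middle one vanishes with the
    two mesh sizes.\<close>
  define Err where "Err n = 2 * real (N n) * R * Bd * Vm\<^sup>2 * (T / real (M n)) + Bd * (L / real (N n) + 2 * R * (T / real (M n)) * Vm) * (Lv * TV0)
          + (2 * Bd * Lf + 4 * R * Bd * Lv) * (R\<^sup>2 * ((T / real (M n)) / (L / real (N n))) * (Lv * TV0))" for n
  have "Err \<longlonglongrightarrow> 0"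
  proof -
    have "(\<lambda>n. (2 * R * Bd * Vm\<^sup>2 * T) * (real (N n) / real (M n)) + Bd * (L / real (N n) + 2 * R * (T / real (M n)) * Vm) * (Lv * TV0)
          + (2 * Bd * Lf + 4 * R * Bd * Lv) * (R\<^sup>2 * (T / L * (real (N n) / real (M n))) * (Lv * TV0)))
      \<longlonglongrightarrow> (2 * R * Bd * Vm\<^sup>2 * T) * 0 + Bd * (0 + 2 * R * 0 * Vm) * (Lv * TV0)
          + (2 * Bd * Lf + 4 * R * Bd * Lv) * (R\<^sup>2 * (T / L * 0) * (Lv * TV0))"
      by (intro tendsto_intros tau_tendsto ell_tendsto ratio)
    moreover have "(2 * R * Bd * Vm\<^sup>2 * T) * (real (N n) / real (M n)) + Bd * (L / real (N n) + 2 * R * (T / real (M n)) * Vm) * (Lv * TV0)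
          + (2 * Bd * Lf + 4 * R * Bd * Lv) * (R\<^sup>2 * (T / L * (real (N n) / real (M n))) * (Lv * TV0)) = Err n" for n
      unfolding Err_def by (simp add: ac_simps)
    ultimately show ?thesis by simp
  qed
  from order_tendstoD(2)[OF this \<epsilon>] obtain n0 where n0: "\<And>n. n \<ge> n0 \<Longrightarrow> Err n < \<epsilon>"
    unfolding eventually_sequentially by blast
  show ?thesis
  proof (intro exI allI impI)
    fix n m assume n: "n \<ge> n0" and m: "m < M n"
    interpret s: scheme_step R v v' "L / real (N n)" "T / real (M n)" \<theta> "N n" "X (M n) (N n) m" "X (M n) (N n) (Suc m)"
      by (rule step_locale[OF adm m])
    define t where "t = real (Suc m) * (T / real (M n))"
    have t: "t \<in> {0..T}"
    proof -
      have "t \<le> real (M n) * (T / real (M n))" unfolding t_def using m T_pos by (intro mult_right_mono) auto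
      moreover have "0 \<le> t" unfolding t_def using T_pos by simp
      ultimately show ?thesis using m by simp
    qed
    have d1: "dens (M n) (N n) m \<in> borel_measurable borel" "\<And>x. dens (M n) (N n) m x \<in> {0..R}"
      and d2: "dens (M n) (N n) (Suc m) \<in> borel_measurable borel" "\<And>x. dens (M n) (N n) (Suc m) x \<in> {0..R}"
      using dens_sections[OF adm, of m n] dens_sections[OF adm, of "Suc m" n] m by auto
    have i\<Phi>: "integrable lborel (\<lambda>x. k * \<Phi> (x, t))"
      by (rule integrable_bounded_interval[of _ "k * Bd" a b])
         (use slice_measurable bd supp k in \<open>auto simp: abs_mult intro!: mult_left_mono\<close>)
    have ix: "integrable lborel (\<lambda>x. \<Phi>x (x, t))"
      by (rule integrable_bounded_interval[of _ "Bd" a b]) (use slice_measurable bd supp in auto)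
    \<comment> \<open>This undoes the normalization at density 0: the subtracted k contributes
      equally at both time levels, and the constant flux \<open>eflux k 0\<close> integrates to 0
      against a derivative of compact support.\<close>
    have zero: "(\<integral>x. \<Phi>x (x, t) \<partial>lborel) = 0"
    proof -
      have "has_bochner_integral lborel (\<lambda>x. \<Phi>x (x, t) * indicator {a - 1..b + 1} x) (\<Phi> (b + 1, t) - \<Phi> (a - 1, t))"
        by (rule has_bochner_integral_FTC_Icc_real)
           (use ab xder[OF t] xcont[OF t] in \<open>auto simp: continuous_on_eq_continuous_at\<close>)
      moreover have "(\<lambda>x. \<Phi>x (x, t) * indicator {a - 1..b + 1} x) = (\<lambda>x. \<Phi>x (x, t))"
      proof
        fix x
        show "\<Phi>x (x, t) * indicator {a - 1..b + 1} x = \<Phi>x (x, t)"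
          using supp(2)[of x t] by (cases "x \<in> {a..b}") (auto simp: indicator_def)
      qed
      ultimately show ?thesis using supp(1)[of "b + 1" t] supp(1)[of "a - 1" t] by (simp add: has_bochner_integral_iff)
    qed
    have s1: "(\<integral>x. (\<bar>dens (M n) (N n) (Suc m) x - k\<bar> - k) * \<Phi> (x, t) \<partial>lborel) - (\<integral>x. (\<bar>dens (M n) (N n) m x - k\<bar> - k) * \<Phi> (x, t) \<partial>lborel)
       - T / real (M n) * (\<integral>x. (eflux k (dens (M n) (N n) m x) - eflux k 0) * \<Phi>x (x, t) \<partial>lborel) \<le> T / real (M n) * Err n"
      unfolding dens_def dr_def Err_def
    proof (rule s.entropy_step[OF k])
      show "((\<lambda>x. \<Phi> (x, t)) has_real_derivative \<Phi>x (x, t)) (at x)" for x by (rule xder[OF t])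
      show "continuous_on UNIV (\<lambda>x. \<Phi>x (x, t))" by (rule xcont[OF t])
      show "\<bar>\<Phi>x (x, t)\<bar> \<le> Bd" for x by (rule bd)
      show "\<Phi> (x, t) \<in> {0..Bd}" for x using bd(1)[of "(x, t)"] nn[of "(x, t)"] by auto
      show "(\<Sum>j\<le>N n. \<bar>jump (local_density (L / real (N n)) (N n) (X (M n) (N n) m)) j\<bar>) \<le> TV0"
        using tv_bound[OF adm, of m n] m by (simp add: dr_def)
    qed
    have s2: "(\<integral>x. (\<bar>dens (M n) (N n) (Suc m) x - k\<bar> - k) * \<Phi> (x, t) \<partial>lborel)
       = (\<integral>x. \<bar>dens (M n) (N n) (Suc m) x - k\<bar> * \<Phi> (x, t) \<partial>lborel) - (\<integral>x. k * \<Phi> (x, t) \<partial>lborel)"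
      unfolding left_diff_distrib by (rule Bochner_Integration.integral_diff[OF int_parts(1)[OF d2] i\<Phi>])
    have s3: "(\<integral>x. (\<bar>dens (M n) (N n) m x - k\<bar> - k) * \<Phi> (x, t) \<partial>lborel)
       = (\<integral>x. \<bar>dens (M n) (N n) m x - k\<bar> * \<Phi> (x, t) \<partial>lborel) - (\<integral>x. k * \<Phi> (x, t) \<partial>lborel)"
      unfolding left_diff_distrib by (rule Bochner_Integration.integral_diff[OF int_parts(1)[OF d1] i\<Phi>])
    have s4: "(\<integral>x. (eflux k (dens (M n) (N n) m x) - eflux k 0) * \<Phi>x (x, t) \<partial>lborel)
       = (\<integral>x. eflux k (dens (M n) (N n) m x) * \<Phi>x (x, t) \<partial>lborel) - (\<integral>x. eflux k 0 * \<Phi>x (x, t) \<partial>lborel)"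
      unfolding left_diff_distrib by (rule Bochner_Integration.integral_diff[OF int_parts(3)[OF d1] integrable_mult_right[OF ix]])
    have s5: "(\<integral>x. eflux k 0 * \<Phi>x (x, t) \<partial>lborel) = 0" by (simp add: zero)
    have "(\<integral>x. \<bar>dens (M n) (N n) (Suc m) x - k\<bar> * \<Phi> (x, t) \<partial>lborel) - (\<integral>x. \<bar>dens (M n) (N n) m x - k\<bar> * \<Phi> (x, t) \<partial>lborel)
       - T / real (M n) * (\<integral>x. eflux k (dens (M n) (N n) m x) * \<Phi>x (x, t) \<partial>lborel) \<le> T / real (M n) * Err n"
      using s1 unfolding s2 s3 s4 s5 diff_0_right by linarith
    also have "\<dots> \<le> T / real (M n) * \<epsilon>"
      by (rule mult_left_mono, use n0[OF n] in linarith, use T_pos in simp)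
    finally show "(\<integral>x. \<bar>dens (M n) (N n) (Suc m) x - k\<bar> * \<Phi> (x, real (Suc m) * (T / real (M n))) \<partial>lborel)
       - (\<integral>x. \<bar>dens (M n) (N n) m x - k\<bar> * \<Phi> (x, real (Suc m) * (T / real (M n))) \<partial>lborel)
       - T / real (M n) * (\<integral>x. eflux k (dens (M n) (N n) m x) * \<Phi>x (x, real (Suc m) * (T / real (M n))) \<partial>lborel) \<le> T / real (M n) * \<epsilon>"
      unfolding t_def .
  qed
qed

lemma entropy_limit:
  assumes nice: "nice_limit \<rho>" and lim: "L1_limit M N \<rho>" and ratio: "(\<lambda>n. real (N n) / real (M n)) \<longlonglongrightarrow> 0"
  shows "entropy_solution R v \<rho>\<^sub>0 T \<rho>"
  unfolding entropy_solution_def Let_def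
proof (intro conjI allI impI ballI)
  show "continuous_L1_map R T \<rho>" by (rule continuous_L1_map_limit[OF nice])
  fix k \<phi> \<phi>x \<phi>t assume k: "k \<in> {0..R}" and tf: "test_function T \<phi> \<phi>x \<phi>t" and nn: "\<forall>p\<in>UNIV \<times> {0..<T}. 0 \<le> \<phi> p"
  obtain a b Bd \<Phi> \<Phi>x \<Phi>t where te: "test_ext T a b Bd \<Phi> \<Phi>x \<Phi>t"
    and agree: "\<And>x t. t \<in> {0..<T} \<Longrightarrow> \<Phi> (x, t) = \<phi> (x, t) \<and> \<Phi>x (x, t) = \<phi>x (x, t) \<and> \<Phi>t (x, t) = \<phi>t (x, t)"
    and out: "\<And>x t. t \<notin> {0..<T} \<Longrightarrow> \<Phi> (x, t) = 0"
  proof (rule test_function_extension[OF tf T_pos])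
    fix a b Bd \<Phi> \<Phi>x \<Phi>t
    assume *: "test_ext T a b Bd \<Phi> \<Phi>x \<Phi>t"
      "\<And>x t. t \<in> {0..<T} \<Longrightarrow> \<Phi> (x, t) = \<phi> (x, t) \<and> \<Phi>x (x, t) = \<phi>x (x, t) \<and> \<Phi>t (x, t) = \<phi>t (x, t)"
      "\<And>x t. t \<notin> {0..<T} \<Longrightarrow> \<Phi> (x, t) = 0"
    show thesis by (rule that[OF *])
  qed
  have nn': "0 \<le> \<Phi> p" for p using agree[of "snd p" "fst p"] out[of "snd p" "fst p"] nn by (cases p; cases "snd p \<in> {0..<T}") auto
  have ef: "entropy_form R (\<lambda>r. \<bar>r - k\<bar>) (eflux k) (max 1 Lf) (max R (2 * (R * Vm))) T a b Bd \<Phi> \<Phi>x \<Phi>t"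
    using flux_pair_entropy[OF k] te by (simp add: entropy_form_def)
  have "entropy_form.W (\<lambda>r. \<bar>r - k\<bar>) (eflux k) T \<Phi>x \<Phi>t \<rho> + (\<integral>x. \<bar>\<rho>b x - k\<bar> * \<Phi> (x, 0) \<partial>lborel) \<ge> 0"
    by (rule limit_inequality[OF ef adm M nice lim]) (rule entropy_step_small[OF te nn' k _ ratio])
  moreover have "(LINT t:{0..<T}|lebesgue. LINT x|lebesgue. \<bar>\<rho> t x - k\<bar> * \<phi>t (x, t) + eflux k (\<rho> t x) * \<phi>x (x, t))
       = entropy_form.W (\<lambda>r. \<bar>r - k\<bar>) (eflux k) T \<Phi>x \<Phi>t \<rho>"
    by (rule double_integral_W[OF ef nice]) (use agree in auto)
  moreover have "(LINT x|lebesgue. \<bar>\<rho>\<^sub>0 x - k\<bar> * \<phi> (x, 0)) = (\<integral>x. \<bar>\<rho>b x - k\<bar> * \<Phi> (x, 0) \<partial>lborel)"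
    by (rule initial_integral[OF ef]) (use agree T_pos in auto)
  ultimately show "0 \<le> (LINT t:{0..<T}|lebesgue. LINT x|lebesgue. \<bar>\<rho> t x - k\<bar> * \<phi>t (x, t)
      + sgn (\<rho> t x - k) * (\<rho> t x * v (\<rho> t x) - k * v k) * \<phi>x (x, t)) + (LINT x|lebesgue. \<bar>\<rho>\<^sub>0 x - k\<bar> * \<phi> (x, 0))"
    by (simp add: eflux_def flux_def)
qed

end

end

section \<open>Uniqueness of the entropy solution\<close>

text \<open>Rounding t down to a multiple of 1 / (n + 1) leaves countably many time values, hence a
  jointly measurable function; continuity in t gives pointwise convergence to f.\<close>

lemma caratheodory_measurable:
  fixes f :: "real \<Rightarrow> real \<Rightarrow> real"
  assumes m: "\<And>t. f t \<in> borel_measurable borel" and c: "\<And>y. continuous_on UNIV (\<lambda>t. f t y)"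
  shows "(\<lambda>(t, y). f t y) \<in> borel_measurable (borel \<Otimes>\<^sub>M borel)"
proof (rule borel_measurable_LIMSEQ_real)
  let ?a = "\<lambda>n t. real_of_int \<lfloor>real (Suc n) * t\<rfloor> / real (Suc n)"
  show "(\<lambda>n. (\<lambda>(t, y). f (?a n t) y) p) \<longlonglongrightarrow> (\<lambda>(t, y). f t y) p" for p
  proof (cases p)
    case (Pair t y)
    have "(\<lambda>n. ?a n t) \<longlonglongrightarrow> t"
    proof (rule tendsto_sandwich[of "\<lambda>n. t - inverse (real (Suc n))" _ _ "\<lambda>_. t"])
      show "\<forall>\<^sub>F n in sequentially. t - inverse (real (Suc n)) \<le> ?a n t"
      proof (intro always_eventually allI)
        fix n
        have "real (Suc n) * t - 1 \<le> real_of_int \<lfloor>real (Suc n) * t\<rfloor>" by linarith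
        then have "(real (Suc n) * t - 1) / real (Suc n) \<le> ?a n t" by (rule divide_right_mono) simp
        moreover have "(real (Suc n) * t - 1) / real (Suc n) = t - inverse (real (Suc n))" by (simp add: diff_divide_distrib inverse_eq_divide del: of_nat_Suc)
        ultimately show "t - inverse (real (Suc n)) \<le> ?a n t" by simp
      qed
      show "\<forall>\<^sub>F n in sequentially. ?a n t \<le> t"
      proof (intro always_eventually allI)
        fix n
        have "?a n t \<le> (real (Suc n) * t) / real (Suc n)" by (rule divide_right_mono) simp_all
        then show "?a n t \<le> t" by (simp del: of_nat_Suc)
      qed
      show "(\<lambda>n. t - inverse (real (Suc n))) \<longlonglongrightarrow> t"
        using tendsto_diff[OF tendsto_const LIMSEQ_inverse_real_of_nat, of t] by simp
    qed simp
    moreover have "isCont (\<lambda>t. f t y) t" using c[of y] by (simp add: continuous_on_eq_continuous_at)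
    ultimately have "(\<lambda>n. f (?a n t) y) \<longlonglongrightarrow> f t y" by (rule isCont_tendsto_compose[rotated])
    then show ?thesis by (simp add: Pair)
  qed
  show "(\<lambda>(t, y). f (?a n t) y) \<in> borel_measurable (borel \<Otimes>\<^sub>M borel)" for n
  proof -
    have g: "(\<lambda>p::real \<times> real. \<lfloor>real (Suc n) * fst p\<rfloor>) \<in> measurable (borel \<Otimes>\<^sub>M borel) (count_space UNIV)"
      by measurable
    have h: "(\<lambda>p::real \<times> real. f (real_of_int i / real (Suc n)) (snd p)) \<in> borel_measurable (borel \<Otimes>\<^sub>M borel)" for i
      using measurable_compose[OF measurable_snd m] .
    have "(\<lambda>p::real \<times> real. f (real_of_int \<lfloor>real (Suc n) * fst p\<rfloor> / real (Suc n)) (snd p)) \<in> borel_measurable (borel \<Otimes>\<^sub>M borel)"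
      by (rule measurable_compose_countable[OF h g])
    then show ?thesis by (simp add: split_beta')
  qed
qed

section \<open>Integrating a distributional inequality in time\<close>

lemma pos_square_derivative: "((\<lambda>z::real. (max 0 z)\<^sup>2) has_real_derivative 2 * max 0 z) (at z)"
proof (cases z "0::real" rule: linorder_cases)
  case less
  show ?thesis
    by (rule has_field_derivative_transform_within_open[of "\<lambda>_. 0" _ _ "{..<0}"]) (use less in auto)
next
  case equal
  have "((\<lambda>h. (max 0 (0 + h))\<^sup>2 / h) \<longlongrightarrow> 0) (at (0::real))"
  proof (rule Lim_null_comparison[of _ "\<lambda>h. \<bar>h\<bar>"])
    show "\<forall>\<^sub>F h::real in at 0. norm ((max 0 (0 + h))\<^sup>2 / h) \<le> \<bar>h\<bar>"
      by (intro always_eventually allI) (auto simp: power2_eq_square max_def)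
    show "((\<lambda>h::real. \<bar>h\<bar>) \<longlongrightarrow> 0) (at 0)" by (auto intro!: tendsto_eq_intros)
  qed
  then show ?thesis using equal by (simp add: DERIV_def)
next
  case greater
  have "((\<lambda>z::real. z\<^sup>2) has_real_derivative 2 * max 0 z) (at z)"
    using greater by (auto intro!: derivative_eq_intros)
  then show ?thesis
    by (rule has_field_derivative_transform_within_open[of _ _ _ "{0<..}"]) (use greater in auto)
qed

text \<open>For \<open>\<delta> > 0\<close>, the tent of height \<open>\<delta>\<close> over
  [-\<delta>, \<delta>], written as a second difference of positive parts; its integral is
  \<open>\<delta>\<^sup>2\<close>.\<close>

definition hat :: "real \<Rightarrow> real \<Rightarrow> real" where
  "hat \<delta> z = max 0 (z + \<delta>) - 2 * max 0 z + max 0 (z - \<delta>)"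

text \<open>The C1 step with derivative \<open>- hat \<delta>\<close>, falling from
  \<open>\<delta>\<^sup>2\<close> to 0 across [-\<delta>, \<delta>] when
  \<open>\<delta> > 0\<close>. Its height is left unnormalized, which keeps it a polynomial in
  positive parts.\<close>

definition cutoff :: "real \<Rightarrow> real \<Rightarrow> real" where
  "cutoff \<delta> z = \<delta>\<^sup>2 - ((max 0 (z + \<delta>))\<^sup>2 - 2 * (max 0 z)\<^sup>2 + (max 0 (z - \<delta>))\<^sup>2) / 2"

lemma hat_cont: "continuous_on S (\<lambda>t. hat \<delta> (t - s))"
  unfolding hat_def by (intro continuous_intros)

lemma hat_nonneg: "0 < \<delta> \<Longrightarrow> 0 \<le> hat \<delta> z"
  by (auto simp: hat_def max_def)

lemma hat_outside: "0 < \<delta> \<Longrightarrow> \<delta> \<le> \<bar>z\<bar> \<Longrightarrow> hat \<delta> z = 0"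
  by (auto simp: hat_def max_def)

lemma cutoff_derivative: "((\<lambda>t. cutoff \<delta> (t - s)) has_real_derivative - hat \<delta> (t - s)) (at t)"
proof -
  have sh: "((\<lambda>t. (max 0 (t - s + c))\<^sup>2) has_real_derivative 2 * max 0 (t - s + c)) (at t)" for c
  proof -
    have "((\<lambda>t. t - s + c) has_real_derivative 1) (at t)" by (auto intro!: derivative_eq_intros)
    from DERIV_chain2[OF pos_square_derivative this] show ?thesis by simp
  qed
  have "((\<lambda>t. \<delta>\<^sup>2 - ((max 0 (t - s + \<delta>))\<^sup>2 - 2 * (max 0 (t - s + 0))\<^sup>2 + (max 0 (t - s + - \<delta>))\<^sup>2) / 2)
     has_real_derivative 0 - (2 * max 0 (t - s + \<delta>) - 2 * (2 * max 0 (t - s + 0)) + 2 * max 0 (t - s + - \<delta>)) / 2) (at t)"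
    by (intro DERIV_diff DERIV_const DERIV_cdivide DERIV_add DERIV_cmult sh)
  moreover have "0 - (2 * max 0 (t - s + \<delta>) - 2 * (2 * max 0 (t - s + 0)) + 2 * max 0 (t - s + - \<delta>)) / 2 = - hat \<delta> (t - s)"
  proof -
    have "0 - (2 * A - 2 * (2 * B) + 2 * D) / 2 = - (A - 2 * B + D)" for A B D :: real by (simp add: field_simps)
    from this[of "max 0 (t - s + \<delta>)" "max 0 (t - s + 0)" "max 0 (t - s + - \<delta>)"] show ?thesis
      unfolding hat_def by (simp only: add_0_right diff_conv_add_uminus)
  qed
  ultimately show ?thesis unfolding cutoff_def by simp
qed

lemma cutoff_left: "0 < \<delta> \<Longrightarrow> z \<le> - \<delta> \<Longrightarrow> cutoff \<delta> z = \<delta>\<^sup>2"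
  by (simp add: cutoff_def)

lemma cutoff_right: "0 < \<delta> \<Longrightarrow> \<delta> \<le> z \<Longrightarrow> cutoff \<delta> z = 0"
  by (simp add: cutoff_def power2_eq_square algebra_simps)

lemma cutoff_antimono:
  assumes "0 < \<delta>" "z \<le> z'"
  shows "cutoff \<delta> z' \<le> cutoff \<delta> z"
proof (rule DERIV_nonpos_imp_nonincreasing[OF assms(2)])
  fix x
  show "\<exists>y. (cutoff \<delta> has_real_derivative y) (at x) \<and> y \<le> 0"
    using cutoff_derivative[of \<delta> 0 x] hat_nonneg[OF assms(1), of x] by auto
qed

lemma cutoff_nonneg: "0 < \<delta> \<Longrightarrow> 0 \<le> cutoff \<delta> z"
  using cutoff_antimono[of \<delta> z "max z \<delta>"] cutoff_right[of \<delta> "max z \<delta>"] by simp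

lemma hat_integral:
  assumes "0 < \<delta>" "\<delta> \<le> s" "s + \<delta> \<le> T"
  shows "((\<lambda>t. hat \<delta> (t - s)) has_integral \<delta>\<^sup>2) {0..T}"
proof -
  have "((\<lambda>t. hat \<delta> (t - s)) has_integral (- cutoff \<delta> (T - s)) - (- cutoff \<delta> (0 - s))) {0..T}"
  proof (rule fundamental_theorem_of_calculus)
    show "0 \<le> T" using assms by simp
    fix x
    have "((\<lambda>t. - cutoff \<delta> (t - s)) has_real_derivative hat \<delta> (x - s)) (at x)"
      using DERIV_minus[OF cutoff_derivative[of \<delta> s x]] by simp
    then show "((\<lambda>t. - cutoff \<delta> (t - s)) has_vector_derivative hat \<delta> (x - s)) (at x within {0..T})"
      by (simp add: has_real_derivative_iff_has_vector_derivative has_vector_derivative_at_within)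
  qed
  then show ?thesis using cutoff_left[of \<delta> "0 - s"] cutoff_right[of \<delta> "T - s"] assms by simp
qed

text \<open>The hypothesis says that g' \<le> c in the sense of distributions, with g0 as initial
  value. After subtraction of an antiderivative of c a continuous function h remains that is
  nonincreasing in the weak sense, and tests concentrated near single times turn this into pointwise
  statements.\<close>

lemma time_extraction:
  fixes g c :: "real \<Rightarrow> real"
  assumes T: "0 < T" and g: "continuous_on {0..T} g" and c: "continuous_on {0..T} c"
    and ineq: "\<And>\<eta> \<eta>' \<delta>. (\<And>t. (\<eta> has_real_derivative \<eta>' t) (at t)) \<Longrightarrow> continuous_on UNIV \<eta>' \<Longrightarrow> (\<And>t. 0 \<le> \<eta> t) \<Longrightarrow>
       0 < \<delta> \<Longrightarrow> \<delta> < T \<Longrightarrow> (\<And>t. T - \<delta> \<le> t \<Longrightarrow> \<eta> t = 0) \<Longrightarrow> 0 \<le> integral {0..T} (\<lambda>t. g t * \<eta>' t + c t * \<eta> t) + g0 * \<eta> 0"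
  shows "g 0 \<le> g0" "0 \<le> t1 \<Longrightarrow> t1 \<le> t2 \<Longrightarrow> t2 \<le> T \<Longrightarrow> g t2 - g t1 \<le> integral {t1..t2} c"
proof -
  define C where "C t = integral {0..t} c" for t
  define h where "h t = g t - C t" for t
  have Cd: "(C has_real_derivative c t) (at t within {0..T})" if "t \<in> {0..T}" for t
    unfolding C_def by (rule integral_has_real_derivative[OF c that])
  have Cc: "continuous_on {0..T} C" by (rule DERIV_continuous_on[OF Cd])
  have hc: "continuous_on {0..T} h" unfolding h_def by (intro continuous_intros g Cc)
  have C0: "C 0 = 0" by (simp add: C_def)
  \<comment> \<open>Integration by parts removes c; the boundary terms vanish because
    \<open>C 0 = 0\<close> and \<open>\<eta>\<close> vanishes at T.\<close>
  have parts: "0 \<le> integral {0..T} (\<lambda>t. h t * \<eta>' t) + g0 * \<eta> 0"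
    if e: "\<And>t. (\<eta> has_real_derivative \<eta>' t) (at t)" "continuous_on UNIV \<eta>'" "\<And>t. 0 \<le> \<eta> t"
       "0 < \<delta>" "\<delta> < T" "\<And>t. T - \<delta> \<le> t \<Longrightarrow> \<eta> t = 0" for \<eta> \<eta>' \<delta>
  proof -
    have \<eta>c: "continuous_on {0..T} \<eta>" using e(1) by (intro DERIV_continuous_on) (auto intro: has_field_derivative_at_within)
    have \<eta>'c: "continuous_on {0..T} \<eta>'" by (rule continuous_on_subset[OF e(2)]) simp
    have "((\<lambda>t. C t * \<eta>' t + c t * \<eta> t) has_integral C T * \<eta> T - C 0 * \<eta> 0) {0..T}"
    proof (rule fundamental_theorem_of_calculus)
      fix t assume t: "t \<in> {0..T}"
      have "((\<lambda>t. C t * \<eta> t) has_real_derivative c t * \<eta> t + \<eta>' t * C t) (at t within {0..T})"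
        by (rule DERIV_mult[OF Cd[OF t] has_field_derivative_at_within[OF e(1)]])
      then show "((\<lambda>t. C t * \<eta> t) has_vector_derivative C t * \<eta>' t + c t * \<eta> t) (at t within {0..T})"
        by (simp add: has_real_derivative_iff_has_vector_derivative algebra_simps)
    qed (use T in simp)
    then have 1: "((\<lambda>t. C t * \<eta>' t + c t * \<eta> t) has_integral 0) {0..T}" using C0 e(4) e(6)[of T] by simp
    have 2: "(\<lambda>t. h t * \<eta>' t) integrable_on {0..T}"
      by (intro integrable_continuous_interval continuous_intros hc \<eta>'c)
    have "((\<lambda>t. h t * \<eta>' t + (C t * \<eta>' t + c t * \<eta> t)) has_integral integral {0..T} (\<lambda>t. h t * \<eta>' t) + 0) {0..T}"
      by (intro has_integral_add 1 integrable_integral 2)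
    moreover have "h t * \<eta>' t + (C t * \<eta>' t + c t * \<eta> t) = g t * \<eta>' t + c t * \<eta> t" for t
      by (simp add: h_def algebra_simps)
    ultimately have "integral {0..T} (\<lambda>t. g t * \<eta>' t + c t * \<eta> t) = integral {0..T} (\<lambda>t. h t * \<eta>' t)"
      by (simp add: integral_unique)
    moreover have "0 \<le> integral {0..T} (\<lambda>t. g t * \<eta>' t + c t * \<eta> t) + g0 * \<eta> 0" by (rule ineq[OF e])
    ultimately show ?thesis by simp
  qed
  have hi: "(\<lambda>t. h t * hat \<delta> (t - s)) integrable_on {0..T}" for \<delta> s
    by (intro integrable_continuous_interval continuous_intros hc hat_cont)
  have upper: "integral {0..T} (\<lambda>t. h t * hat \<delta> (t - s)) \<le> m * \<delta>\<^sup>2"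
    if "0 < \<delta>" "\<delta> \<le> s" "s + \<delta> \<le> T" "\<And>t. t \<in> {0..T} \<Longrightarrow> \<bar>t - s\<bar> < \<delta> \<Longrightarrow> h t \<le> m" for \<delta> s m
  proof (rule has_integral_le[OF integrable_integral[OF hi] has_integral_mult_right[OF hat_integral[OF that(1-3)]]])
    fix t assume "t \<in> {0..T}"
    then show "h t * hat \<delta> (t - s) \<le> m * hat \<delta> (t - s)"
      using that(4)[of t] hat_nonneg[OF that(1), of "t - s"] hat_outside[OF that(1), of "t - s"]
      by (cases "\<bar>t - s\<bar> < \<delta>") (auto intro: mult_right_mono)
  qed
  have lower: "m * \<delta>\<^sup>2 \<le> integral {0..T} (\<lambda>t. h t * hat \<delta> (t - s))"
    if "0 < \<delta>" "\<delta> \<le> s" "s + \<delta> \<le> T" "\<And>t. t \<in> {0..T} \<Longrightarrow> \<bar>t - s\<bar> < \<delta> \<Longrightarrow> m \<le> h t" for \<delta> s m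
  proof (rule has_integral_le[OF has_integral_mult_right[OF hat_integral[OF that(1-3)]] integrable_integral[OF hi]])
    fix t assume "t \<in> {0..T}"
    then show "m * hat \<delta> (t - s) \<le> h t * hat \<delta> (t - s)"
      using that(4)[of t] hat_nonneg[OF that(1), of "t - s"] hat_outside[OF that(1), of "t - s"]
      by (cases "\<bar>t - s\<bar> < \<delta>") (auto intro: mult_right_mono)
  qed
  have near: "\<exists>d>0. \<forall>t\<in>{0..T}. \<bar>t - s\<bar> < d \<longrightarrow> \<bar>h t - h s\<bar> < e" if "s \<in> {0..T}" "0 < e" for s e
    using hc that unfolding continuous_on_iff dist_real_def by blast
  show "g 0 \<le> g0"
  proof (rule ccontr)
    assume "\<not> g 0 \<le> g0"
    then have e: "0 < h 0 - g0" using C0 by (simp add: h_def)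
    obtain d where d: "0 < d" "\<And>t. t \<in> {0..T} \<Longrightarrow> \<bar>t - 0\<bar> < d \<Longrightarrow> \<bar>h t - h 0\<bar> < (h 0 - g0) / 2"
      using near[of 0 "(h 0 - g0) / 2"] T e by auto
    define \<delta> where "\<delta> = min (d / 2) (T / 4)"
    have \<delta>: "0 < \<delta>" "2 * \<delta> \<le> d" "4 * \<delta> \<le> T" using d T by (auto simp: \<delta>_def)
    \<comment> \<open>This cutoff falls between the times 0 and 2\<delta>, so at time 0 it still has
      its full height \<open>\<delta>\<^sup>2\<close>.\<close>
    have "0 \<le> integral {0..T} (\<lambda>t. h t * (- hat \<delta> (t - \<delta>))) + g0 * cutoff \<delta> (0 - \<delta>)"
    proof (rule parts[of "\<lambda>t. cutoff \<delta> (t - \<delta>)" _ \<delta>])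
      show "continuous_on UNIV (\<lambda>t. - hat \<delta> (t - \<delta>))" by (intro continuous_intros hat_cont)
      show "\<And>t. 0 \<le> cutoff \<delta> (t - \<delta>)" by (rule cutoff_nonneg[OF \<delta>(1)])
      show "cutoff \<delta> (t - \<delta>) = 0" if "T - \<delta> \<le> t" for t by (rule cutoff_right[OF \<delta>(1)]) (use that \<delta> in linarith)
    qed (use \<delta> cutoff_derivative in auto)
    then have "0 \<le> - integral {0..T} (\<lambda>t. h t * hat \<delta> (t - \<delta>)) + g0 * \<delta>\<^sup>2"
      using cutoff_left[OF \<delta>(1), of "0 - \<delta>"] by simp
    moreover have "(g0 + (h 0 - g0) / 2) * \<delta>\<^sup>2 \<le> integral {0..T} (\<lambda>t. h t * hat \<delta> (t - \<delta>))"
    proof (rule lower)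
      fix t assume t: "t \<in> {0..T}" "\<bar>t - \<delta>\<bar> < \<delta>"
      then have "\<bar>t - 0\<bar> < d" using \<delta> by auto
      from d(2)[OF t(1) this] show "g0 + (h 0 - g0) / 2 \<le> h t" by argo
    qed (use \<delta> in auto)
    ultimately have "(h 0 - g0) / 2 * \<delta>\<^sup>2 \<le> 0" unfolding distrib_right by linarith
    then show False using e \<delta>(1) by (simp add: mult_le_0_iff)
  qed
  have inner: "h t2 \<le> h t1" if t: "0 < t1" "t1 < t2" "t2 < T" for t1 t2
  proof (rule ccontr)
    assume "\<not> h t2 \<le> h t1"
    then have e: "0 < h t2 - h t1" by simp
    define e' where "e' = (h t2 - h t1) / 3"
    have e': "0 < e'" using e by (simp add: e'_def)
    obtain d1 where d1: "0 < d1" "\<And>t. t \<in> {0..T} \<Longrightarrow> \<bar>t - t1\<bar> < d1 \<Longrightarrow> \<bar>h t - h t1\<bar> < e'"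
      using near[of t1 e'] t e' by auto
    obtain d2 where d2: "0 < d2" "\<And>t. t \<in> {0..T} \<Longrightarrow> \<bar>t - t2\<bar> < d2 \<Longrightarrow> \<bar>h t - h t2\<bar> < e'"
      using near[of t2 e'] t e' by auto
    define \<delta> where "\<delta> = min (min d1 d2) (min t1 ((T - t2) / 2))"
    have "0 < \<delta>" using d1(1) d2(1) t by (simp add: \<delta>_def)
    moreover have "\<delta> \<le> min d1 d2" "\<delta> \<le> min t1 ((T - t2) / 2)" unfolding \<delta>_def by (rule min.cobounded1, rule min.cobounded2)
    ultimately have \<delta>: "0 < \<delta>" "\<delta> \<le> d1" "\<delta> \<le> d2" "\<delta> \<le> t1" "2 * \<delta> \<le> T - t2" by auto
    \<comment> \<open>Up to the factor \<open>\<delta>\<^sup>2\<close>, the difference of the two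
      cutoffs approximates the indicator of [t1, t2]. Both have full height at time 0, so the
      initial term cancels.\<close>
    have "0 \<le> integral {0..T} (\<lambda>t. h t * (hat \<delta> (t - t1) - hat \<delta> (t - t2))) + g0 * (cutoff \<delta> (0 - t2) - cutoff \<delta> (0 - t1))"
    proof (rule parts[of "\<lambda>t. cutoff \<delta> (t - t2) - cutoff \<delta> (t - t1)" _ \<delta>])
      fix t
      show "((\<lambda>t. cutoff \<delta> (t - t2) - cutoff \<delta> (t - t1)) has_real_derivative hat \<delta> (t - t1) - hat \<delta> (t - t2)) (at t)"
        using DERIV_diff[OF cutoff_derivative[of \<delta> t2 t] cutoff_derivative[of \<delta> t1 t]] by simp
      show "0 \<le> cutoff \<delta> (t - t2) - cutoff \<delta> (t - t1)"
        using cutoff_antimono[OF \<delta>(1), of "t - t2" "t - t1"] t by simp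
      show "cutoff \<delta> (t - t2) - cutoff \<delta> (t - t1) = 0" if "T - \<delta> \<le> t"
        using cutoff_right[OF \<delta>(1), of "t - t2"] cutoff_right[OF \<delta>(1), of "t - t1"] that \<delta> t by simp
    next
      show "continuous_on UNIV (\<lambda>t. hat \<delta> (t - t1) - hat \<delta> (t - t2))" by (intro continuous_intros hat_cont)
    qed (use \<delta> t in auto)
    moreover have "cutoff \<delta> (0 - t2) - cutoff \<delta> (0 - t1) = 0"
      using cutoff_left[OF \<delta>(1), of "0 - t2"] cutoff_left[OF \<delta>(1), of "0 - t1"] \<delta> t by simp
    moreover have "integral {0..T} (\<lambda>t. h t * (hat \<delta> (t - t1) - hat \<delta> (t - t2)))
      = integral {0..T} (\<lambda>t. h t * hat \<delta> (t - t1)) - integral {0..T} (\<lambda>t. h t * hat \<delta> (t - t2))"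
      unfolding right_diff_distrib by (rule Henstock_Kurzweil_Integration.integral_diff[OF hi hi])
    moreover have "integral {0..T} (\<lambda>t. h t * hat \<delta> (t - t1)) \<le> (h t1 + e') * \<delta>\<^sup>2"
    proof (rule upper)
      fix s assume s: "s \<in> {0..T}" "\<bar>s - t1\<bar> < \<delta>"
      then have "\<bar>h s - h t1\<bar> < e'" using d1(2)[of s] \<delta> by simp
      then show "h s \<le> h t1 + e'" by linarith
    qed (use \<delta> t in auto)
    moreover have "(h t2 - e') * \<delta>\<^sup>2 \<le> integral {0..T} (\<lambda>t. h t * hat \<delta> (t - t2))"
    proof (rule lower)
      fix s assume s: "s \<in> {0..T}" "\<bar>s - t2\<bar> < \<delta>"
      then have "\<bar>h s - h t2\<bar> < e'" using d2(2)[of s] \<delta> by simp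
      then show "h t2 - e' \<le> h s" by linarith
    qed (use \<delta> t in auto)
    ultimately have "(h t2 - e') * \<delta>\<^sup>2 \<le> (h t1 + e') * \<delta>\<^sup>2" by simp
    then have "h t2 - e' \<le> h t1 + e'" using \<delta>(1) by simp
    then show False using e by (simp add: e'_def field_simps)
  qed
  assume t: "0 \<le> t1" "t1 \<le> t2" "t2 \<le> T"
  have "h t2 \<le> h t1"
  proof (cases "t1 = t2")
    case False
    define d where "d = t2 - t1"
    have d: "0 < d" using False t by (simp add: d_def)
    \<comment> \<open>The localized tests require t1 and t2 to be interior times; in general both
      are approached from inside [t1, t2] and h is continuous.\<close>
    define a where "a n = d * inverse (real (Suc n)) / 3" for n
    have a: "0 < a n" "a n \<le> d / 3" for n
    proof -
      show "0 < a n" using d by (simp add: a_def)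
      have "d * inverse (real (Suc n)) \<le> d * 1" using d by (intro mult_left_mono) (auto simp: inverse_le_1_iff)
      then show "a n \<le> d / 3" by (simp add: a_def)
    qed
    have a0: "a \<longlonglongrightarrow> 0"
    proof -
      have "(\<lambda>n. d * inverse (real (Suc n)) / 3) \<longlonglongrightarrow> d * 0 / 3" by (intro tendsto_intros LIMSEQ_inverse_real_of_nat) simp
      then show ?thesis by (simp add: a_def[abs_def])
    qed
    have in1: "t1 + a n \<in> {0..T}" "t2 - a n \<in> {0..T}" and le: "h (t2 - a n) \<le> h (t1 + a n)" for n
    proof -
      have "0 < t1 + a n" "t1 + a n < t2 - a n" "t2 - a n < T" using a[of n] d t by (auto simp: d_def)
      then show "t1 + a n \<in> {0..T}" "t2 - a n \<in> {0..T}" "h (t2 - a n) \<le> h (t1 + a n)" using inner by auto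
    qed
    have "(\<lambda>n. t1 + a n) \<longlonglongrightarrow> t1 + 0" "(\<lambda>n. t2 - a n) \<longlonglongrightarrow> t2 - 0" by (intro tendsto_intros a0)+
    then have "(\<lambda>n. h (t1 + a n)) \<longlonglongrightarrow> h t1" "(\<lambda>n. h (t2 - a n)) \<longlonglongrightarrow> h t2"
      using continuous_on_tendsto_compose[OF hc, of "\<lambda>n. t1 + a n" t1 sequentially]
        continuous_on_tendsto_compose[OF hc, of "\<lambda>n. t2 - a n" t2 sequentially] in1 t by auto
    then show ?thesis using le by (intro LIMSEQ_le) auto
  qed simp
  moreover have "C t2 - C t1 = integral {t1..t2} c"
  proof -
    have "integral {0..t1} c + integral {t1..t2} c = integral {0..t2} c"
      by (rule Henstock_Kurzweil_Integration.integral_combine)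
         (use t in \<open>auto intro!: integrable_continuous_interval continuous_on_subset[OF c]\<close>)
    then show ?thesis by (simp add: C_def)
  qed
  ultimately show "g t2 - g t1 \<le> integral {t1..t2} c" by (simp add: h_def)
qed

section \<open>Kernels and their double integrals\<close>

definition ker :: "real \<Rightarrow> real \<Rightarrow> real" where "ker \<epsilon> z = (max 0 (\<epsilon>\<^sup>2 - z\<^sup>2))\<^sup>2"

definition ker' :: "real \<Rightarrow> real \<Rightarrow> real" where "ker' \<epsilon> z = - 4 * z * max 0 (\<epsilon>\<^sup>2 - z\<^sup>2)"

lemma ker_derivative: "(ker \<epsilon> has_real_derivative ker' \<epsilon> z) (at z)"
proof -
  have "((\<lambda>z. \<epsilon>\<^sup>2 - z\<^sup>2) has_real_derivative - (2 * z)) (at z)" by (auto intro!: derivative_eq_intros)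
  from DERIV_chain2[OF pos_square_derivative this] show ?thesis
    unfolding ker_def[abs_def] ker'_def by (simp add: algebra_simps)
qed

lemma ker_nonneg: "0 \<le> ker \<epsilon> z" by (simp add: ker_def)

lemma ker_even: "ker \<epsilon> (- z) = ker \<epsilon> z" and ker'_odd: "ker' \<epsilon> (- z) = - ker' \<epsilon> z"
  by (simp_all add: ker_def ker'_def)

lemma ker_outside:
  assumes "0 < \<epsilon>" "\<epsilon> \<le> \<bar>z\<bar>"
  shows "ker \<epsilon> z = 0" "ker' \<epsilon> z = 0"
proof -
  have "\<epsilon>\<^sup>2 \<le> z\<^sup>2" using power_mono[OF assms(2), of 2] assms(1) by simp
  then show "ker \<epsilon> z = 0" "ker' \<epsilon> z = 0" by (simp_all add: ker_def ker'_def)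
qed

lemma ker_cont: "continuous_on UNIV (ker \<epsilon>)" "continuous_on UNIV (ker' \<epsilon>)"
  unfolding ker_def[abs_def] ker'_def[abs_def] by (intro continuous_intros)+

lemma continuous_compact_support_bound:
  fixes \<kappa> :: "real \<Rightarrow> real"
  assumes "continuous_on UNIV \<kappa>" "\<And>z. \<epsilon> \<le> \<bar>z\<bar> \<Longrightarrow> \<kappa> z = 0"
  obtains B where "\<And>z. \<bar>\<kappa> z\<bar> \<le> B"
proof -
  have "compact (\<kappa> ` {- \<epsilon>..\<epsilon>})" by (intro compact_continuous_image continuous_on_subset[OF assms(1)]) auto
  then obtain B where B: "\<And>z. z \<in> {- \<epsilon>..\<epsilon>} \<Longrightarrow> \<bar>\<kappa> z\<bar> \<le> B"
    using compact_imp_bounded bounded_iff by (metis imageI real_norm_def)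
  have "\<bar>\<kappa> z\<bar> \<le> \<bar>B\<bar>" for z
  proof (cases "\<epsilon> \<le> \<bar>z\<bar>")
    case False
    then have "z \<in> {- \<epsilon>..\<epsilon>}" by auto
    then show ?thesis using B[of z] by linarith
  qed (simp add: assms(2))
  then show ?thesis using that by blast
qed

text \<open>Used both for the smoothing kernel and for its derivative, which changes sign; hence the
  absolute values throughout.\<close>

locale compact_kernel =
  fixes \<kappa> :: "real \<Rightarrow> real" and \<epsilon> :: real
  assumes \<kappa>_cont: "continuous_on UNIV \<kappa>" and \<kappa>_out: "\<And>z. \<epsilon> \<le> \<bar>z\<bar> \<Longrightarrow> \<kappa> z = 0"
begin

text \<open>The kernels are not normalized. The mass of \<open>ker\<close> appears as a common
  factor on both sides of the final estimate and is cancelled there.\<close>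

definition K :: real where "K = (\<integral>z. \<bar>\<kappa> z\<bar> \<partial>lborel)"

lemma \<kappa>_meas [measurable]: "\<kappa> \<in> borel_measurable borel"
  using \<kappa>_cont by (rule borel_measurable_continuous_onI)

lemma K_nonneg: "0 \<le> K" by (simp add: K_def)

lemma \<kappa>_bound: obtains B where "\<And>z. \<bar>\<kappa> z\<bar> \<le> B"
  using continuous_compact_support_bound[OF \<kappa>_cont \<kappa>_out] by blast

lemma \<kappa>_int: "integrable lborel (\<lambda>z. \<bar>\<kappa> z\<bar>)"
proof -
  obtain B where B: "\<And>z. \<bar>\<kappa> z\<bar> \<le> B" using \<kappa>_bound by blast
  show ?thesis by (rule integrable_bounded_interval[of _ B "- \<epsilon>" \<epsilon>]) (use B \<kappa>_out in auto)
qed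

lemma \<kappa>_shift:
  "integrable lborel (\<lambda>y. \<bar>\<kappa> (x - y)\<bar>)" "(\<integral>y. \<bar>\<kappa> (x - y)\<bar> \<partial>lborel) = K"
  "integrable lborel (\<lambda>x. \<bar>\<kappa> (x - y)\<bar>)" "(\<integral>x. \<bar>\<kappa> (x - y)\<bar> \<partial>lborel) = K"
  using lborel_integrable_real_affine[OF \<kappa>_int, of "-1" x] lborel_integral_real_affine[of "-1" "\<lambda>z. \<bar>\<kappa> z\<bar>" x]
    lborel_integrable_real_affine[OF \<kappa>_int, of 1 "- y"] lborel_integral_real_affine[of 1 "\<lambda>z. \<bar>\<kappa> z\<bar>" "- y"]
  by (simp_all add: K_def)

lemma prod_integrable1:
  assumes f: "integrable lborel f"
  shows "integrable (lborel \<Otimes>\<^sub>M lborel) (\<lambda>(x, y). \<bar>f x :: real\<bar> * \<bar>\<kappa> (x - y)\<bar>)"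
    "(\<integral>x. (\<integral>y. \<bar>f x\<bar> * \<bar>\<kappa> (x - y)\<bar> \<partial>lborel) \<partial>lborel) = (\<integral>x. \<bar>f x\<bar> \<partial>lborel) * K"
    "(\<integral>y. (\<integral>x. \<bar>f x\<bar> * \<bar>\<kappa> (x - y)\<bar> \<partial>lborel) \<partial>lborel) = (\<integral>x. \<bar>f x\<bar> \<partial>lborel) * K"
proof -
  have [measurable]: "f \<in> borel_measurable borel" using borel_measurable_integrable[OF f] by simp
  have inner: "(\<integral>y. \<bar>f x\<bar> * \<bar>\<kappa> (x - y)\<bar> \<partial>lborel) = \<bar>f x\<bar> * K" for x by (simp add: \<kappa>_shift)
  show 1: "integrable (lborel \<Otimes>\<^sub>M lborel) (\<lambda>(x, y). \<bar>f x\<bar> * \<bar>\<kappa> (x - y)\<bar>)"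
  proof (rule lborel_pair.Fubini_integrable)
    show "integrable lborel (\<lambda>x. \<integral>y. norm (case (x, y) of (x, y) \<Rightarrow> \<bar>f x\<bar> * \<bar>\<kappa> (x - y)\<bar>) \<partial>lborel)"
      using f by (simp add: \<kappa>_shift abs_mult)
    show "AE x in lborel. integrable lborel (\<lambda>y. case (x, y) of (x, y) \<Rightarrow> \<bar>f x\<bar> * \<bar>\<kappa> (x - y)\<bar>)"
      by (auto intro!: integrable_mult_right \<kappa>_shift)
  qed measurable
  show 2: "(\<integral>x. (\<integral>y. \<bar>f x\<bar> * \<bar>\<kappa> (x - y)\<bar> \<partial>lborel) \<partial>lborel) = (\<integral>x. \<bar>f x\<bar> \<partial>lborel) * K" unfolding inner by simp
  show "(\<integral>y. (\<integral>x. \<bar>f x\<bar> * \<bar>\<kappa> (x - y)\<bar> \<partial>lborel) \<partial>lborel) = (\<integral>x. \<bar>f x\<bar> \<partial>lborel) * K"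
    using lborel_pair.Fubini_integral[OF 1] 2 by simp
qed

lemma prod_integrable2:
  assumes g: "integrable lborel g"
  shows "integrable (lborel \<Otimes>\<^sub>M lborel) (\<lambda>(x, y). \<bar>g y :: real\<bar> * \<bar>\<kappa> (x - y)\<bar>)"
    "(\<integral>y. (\<integral>x. \<bar>g y\<bar> * \<bar>\<kappa> (x - y)\<bar> \<partial>lborel) \<partial>lborel) = (\<integral>y. \<bar>g y\<bar> \<partial>lborel) * K"
proof -
  \<comment> \<open>Reflecting the kernel exchanges the roles of the two variables.\<close>
  interpret r: compact_kernel "\<lambda>z. \<kappa> (- z)" \<epsilon>
    by unfold_locales (auto intro!: continuous_on_compose2[OF \<kappa>_cont] continuous_intros \<kappa>_out)
  show "integrable (lborel \<Otimes>\<^sub>M lborel) (\<lambda>(x, y). \<bar>g y\<bar> * \<bar>\<kappa> (x - y)\<bar>)"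
    using lborel_pair.integrable_product_swap[OF r.prod_integrable1(1)[OF g]] by (simp add: split_beta')
  show "(\<integral>y. (\<integral>x. \<bar>g y\<bar> * \<bar>\<kappa> (x - y)\<bar> \<partial>lborel) \<partial>lborel) = (\<integral>y. \<bar>g y\<bar> \<partial>lborel) * K" by (simp add: \<kappa>_shift)
qed

text \<open>A Young-type estimate: the L1 norm of the double integrand is controlled by the mass of
  the kernel times L1 norms of one variable. It supplies the integrability behind exchanging x and y
  in the Kruzkov functional.\<close>

lemma dominated_prod:
  assumes f: "integrable lborel f" and g: "integrable lborel g" and "0 \<le> \<Lambda>"
    and m: "(\<lambda>(x, y). F x y) \<in> borel_measurable (lborel \<Otimes>\<^sub>M lborel)"
    and le: "\<And>x y. \<bar>F x y\<bar> \<le> \<Lambda> * (\<bar>f x\<bar> + \<bar>g y\<bar>) * \<bar>\<kappa> (x - y)\<bar>"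
  shows "integrable (lborel \<Otimes>\<^sub>M lborel) (\<lambda>(x, y). F x y :: real)"
    "\<bar>\<integral>y. (\<integral>x. F x y \<partial>lborel) \<partial>lborel\<bar> \<le> \<Lambda> * ((\<integral>x. \<bar>f x\<bar> \<partial>lborel) + (\<integral>y. \<bar>g y\<bar> \<partial>lborel)) * K"
    "(\<integral>y. \<bar>\<integral>x. F x y \<partial>lborel\<bar> \<partial>lborel) \<le> \<Lambda> * ((\<integral>x. \<bar>f x\<bar> \<partial>lborel) + (\<integral>y. \<bar>g y\<bar> \<partial>lborel)) * K"
proof -
  let ?D = "\<lambda>(x, y). \<Lambda> * (\<bar>f x\<bar> * \<bar>\<kappa> (x - y)\<bar> + \<bar>g y\<bar> * \<bar>\<kappa> (x - y)\<bar>)"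
  have D: "integrable (lborel \<Otimes>\<^sub>M lborel) ?D"
    using integrable_mult_right[OF Bochner_Integration.integrable_add[OF prod_integrable1(1)[OF f] prod_integrable2(1)[OF g]], of \<Lambda>]
    by (simp add: split_beta')
  have le': "\<bar>F x y\<bar> \<le> \<Lambda> * (\<bar>f x\<bar> * \<bar>\<kappa> (x - y)\<bar> + \<bar>g y\<bar> * \<bar>\<kappa> (x - y)\<bar>)" for x y
    using le[of x y] by (simp add: algebra_simps)
  have D0: "0 \<le> \<Lambda> * (\<bar>f x\<bar> * \<bar>\<kappa> (x - y)\<bar> + \<bar>g y\<bar> * \<bar>\<kappa> (x - y)\<bar>)" for x y using assms(3) by simp
  show 1: "integrable (lborel \<Otimes>\<^sub>M lborel) (\<lambda>(x, y). F x y)"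
    by (rule Bochner_Integration.integrable_bound[OF D m]) (use le' D0 in auto)
  have "(\<integral>y. \<bar>\<integral>x. F x y \<partial>lborel\<bar> \<partial>lborel) \<le> (\<integral>y. (\<integral>x. \<Lambda> * (\<bar>f x\<bar> * \<bar>\<kappa> (x - y)\<bar> + \<bar>g y\<bar> * \<bar>\<kappa> (x - y)\<bar>) \<partial>lborel) \<partial>lborel)"
  proof (rule integral_mono_AE)
    show "integrable lborel (\<lambda>y. \<bar>\<integral>x. F x y \<partial>lborel\<bar>)" by (rule integrable_abs[OF lborel_pair.integrable_snd[OF 1]])
    show "integrable lborel (\<lambda>y. \<integral>x. \<Lambda> * (\<bar>f x\<bar> * \<bar>\<kappa> (x - y)\<bar> + \<bar>g y\<bar> * \<bar>\<kappa> (x - y)\<bar>) \<partial>lborel)" by (rule lborel_pair.integrable_snd[OF D])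
    show "AE y in lborel. \<bar>\<integral>x. F x y \<partial>lborel\<bar> \<le> (\<integral>x. \<Lambda> * (\<bar>f x\<bar> * \<bar>\<kappa> (x - y)\<bar> + \<bar>g y\<bar> * \<bar>\<kappa> (x - y)\<bar>) \<partial>lborel)"
      using lborel_pair.AE_integrable_snd[OF 1] lborel_pair.AE_integrable_snd[OF D]
    proof eventually_elim
      case (elim y)
      have "(\<integral>x. \<bar>F x y\<bar> \<partial>lborel) \<le> (\<integral>x. \<Lambda> * (\<bar>f x\<bar> * \<bar>\<kappa> (x - y)\<bar> + \<bar>g y\<bar> * \<bar>\<kappa> (x - y)\<bar>) \<partial>lborel)"
        by (rule integral_mono[OF integrable_abs[OF elim(1)] elim(2) le'])
      then show ?case by (rule order_trans[OF integral_abs_bound])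
    qed
  qed
  also have "\<dots> = \<Lambda> * ((\<integral>x. \<bar>f x\<bar> \<partial>lborel) + (\<integral>y. \<bar>g y\<bar> \<partial>lborel)) * K"
  proof -
    have "(\<integral>y. (\<integral>x. \<Lambda> * (\<bar>f x\<bar> * \<bar>\<kappa> (x - y)\<bar> + \<bar>g y\<bar> * \<bar>\<kappa> (x - y)\<bar>) \<partial>lborel) \<partial>lborel)
      = integral\<^sup>L (lborel \<Otimes>\<^sub>M lborel) ?D" by (rule lborel_pair.integral_snd[OF D])
    also have "\<dots> = \<Lambda> * (integral\<^sup>L (lborel \<Otimes>\<^sub>M lborel) (\<lambda>(x, y). \<bar>f x\<bar> * \<bar>\<kappa> (x - y)\<bar>) + integral\<^sup>L (lborel \<Otimes>\<^sub>M lborel) (\<lambda>(x, y). \<bar>g y\<bar> * \<bar>\<kappa> (x - y)\<bar>))"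
      using Bochner_Integration.integral_add[OF prod_integrable1(1)[OF f] prod_integrable2(1)[OF g]] by (simp add: split_beta')
    also have "\<dots> = \<Lambda> * ((\<integral>x. \<bar>f x\<bar> \<partial>lborel) * K + (\<integral>y. \<bar>g y\<bar> \<partial>lborel) * K)"
      unfolding lborel_pair.integral_snd[OF prod_integrable1(1)[OF f], symmetric] lborel_pair.integral_snd[OF prod_integrable2(1)[OF g], symmetric]
        prod_integrable1(3)[OF f] prod_integrable2(2)[OF g] ..
    finally show ?thesis by (simp add: algebra_simps)
  qed
  finally show 3: "(\<integral>y. \<bar>\<integral>x. F x y \<partial>lborel\<bar> \<partial>lborel) \<le> \<Lambda> * ((\<integral>x. \<bar>f x\<bar> \<partial>lborel) + (\<integral>y. \<bar>g y\<bar> \<partial>lborel)) * K" .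
  show "\<bar>\<integral>y. (\<integral>x. F x y \<partial>lborel) \<partial>lborel\<bar> \<le> \<Lambda> * ((\<integral>x. \<bar>f x\<bar> \<partial>lborel) + (\<integral>y. \<bar>g y\<bar> \<partial>lborel)) * K"
    by (rule order_trans[OF integral_abs_bound 3])
qed

end

text \<open>Symmetry in the two densities; with the oddness of the kernel derivative it makes the
  flux terms of two solutions cancel.\<close>

lemma (in velocity) eflux_commute: "eflux k a = eflux a k"
  by (simp add: eflux_def sgn_if)

lemma (in velocity) eflux_le:
  assumes "a \<in> {0..R}" "k \<in> {0..R}"
  shows "\<bar>eflux k a\<bar> \<le> Lf * \<bar>a - k\<bar>"
  using eflux_lip[OF assms(1) assms(2) assms(2)] by (simp add: eflux_def)

section \<open>Entropy solutions as curves tested in space\<close>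

context lwr
begin

definition nice :: "(real \<Rightarrow> real) \<Rightarrow> bool" where
  "nice f \<longleftrightarrow> f \<in> borel_measurable borel \<and> (\<forall>x. f x \<in> {0..R}) \<and> integrable lborel f"

definition spatial_test :: "(real \<Rightarrow> real) \<Rightarrow> (real \<Rightarrow> real) \<Rightarrow> bool" where
  "spatial_test \<psi> \<psi>' \<longleftrightarrow> (\<forall>x. (\<psi> has_real_derivative \<psi>' x) (at x)) \<and> continuous_on UNIV \<psi>' \<and> (\<forall>x. 0 \<le> \<psi> x) \<and>
     (\<exists>a b. \<forall>x. x \<notin> {a..b} \<longrightarrow> \<psi> x = 0 \<and> \<psi>' x = 0)"

text \<open>The entropy inequality integrated between arbitrary times and tested in space only.
  Every \<open>w t\<close> is Borel, but nothing is asked of w jointly in t and x, since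
  representatives at different times are chosen independently.\<close>

definition evolution :: "(real \<Rightarrow> real \<Rightarrow> real) \<Rightarrow> bool" where
  "evolution w \<longleftrightarrow> (\<forall>t\<in>{0..T}. nice (w t)) \<and>
     (\<forall>t\<in>{0..T}. ((\<lambda>s. \<integral>x. \<bar>w s x - w t x\<bar> \<partial>lborel) \<longlongrightarrow> 0) (at t within {0..T})) \<and>
     (\<forall>k\<in>{0..R}. \<forall>\<psi> \<psi>'. spatial_test \<psi> \<psi>' \<longrightarrow>
        (\<integral>x. \<bar>w 0 x - k\<bar> * \<psi> x \<partial>lborel) \<le> (\<integral>x. \<bar>\<rho>b x - k\<bar> * \<psi> x \<partial>lborel) \<and>
        (\<forall>t1 t2. 0 \<le> t1 \<longrightarrow> t1 \<le> t2 \<longrightarrow> t2 \<le> T \<longrightarrow>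
           (\<integral>x. \<bar>w t2 x - k\<bar> * \<psi> x \<partial>lborel) - (\<integral>x. \<bar>w t1 x - k\<bar> * \<psi> x \<partial>lborel)
             \<le> integral {t1..t2} (\<lambda>t. \<integral>x. eflux k (w t x) * \<psi>' x \<partial>lborel)))"

lemma nice_flux_measurable: "nice f \<Longrightarrow> (\<lambda>x. flux (f x)) \<in> borel_measurable borel"
proof -
  assume f: "nice f"
  have "Lf-lipschitz_on {0..R} flux" using flux_lip Lf_nonneg by (auto intro!: lipschitz_onI simp: dist_real_def)
  then have "continuous_on {0..R} flux" by (rule lipschitz_on_continuous_on)
  then show ?thesis by (rule measurable_comp_Icc) (use f in \<open>auto simp: nice_def\<close>)
qed

lemma nice_eflux_measurable:
  assumes "nice f"
  shows "(\<lambda>x. eflux k (f x)) \<in> borel_measurable borel"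
proof -
  have [measurable]: "f \<in> borel_measurable borel" "(\<lambda>x. flux (f x)) \<in> borel_measurable borel"
    using assms nice_flux_measurable by (auto simp: nice_def)
  show ?thesis unfolding eflux_def by measurable
qed

lemma nice_representative:
  assumes f: "f \<in> Linfty_c" and r: "AE x in lebesgue. f x \<in> {0..R}"
  shows "\<exists>g. nice g \<and> (AE x in lebesgue. f x = g x)"
proof -
  have "f \<in> borel_measurable (completion lborel)" "compact (ess_supp f)" using f by (auto simp: Linfty_c_def)
  then obtain g where g: "g \<in> borel_measurable lborel" "AE x in lborel. f x = g x"
    using completion_ex_borel_measurable_real by blast
  obtain a b where ab: "ess_supp f \<subseteq> cbox a b" using bounded_subset_cbox_symmetric compact_imp_bounded[OF \<open>compact (ess_supp f)\<close>] by metis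
  have [measurable]: "g \<in> borel_measurable borel" using g(1) by simp
  define h where "h x = indicator {a..b} x * max 0 (min R (g x))" for x
  have "AE x in lebesgue. f x = h x"
    using AE_ess_supp[of f] r AE_completion[OF g(2)]
  proof eventually_elim
    case (elim x)
    then show ?case using ab by (cases "x \<in> {a..b}") (auto simp: h_def)
  qed
  moreover have hm: "h \<in> borel_measurable borel" unfolding h_def[abs_def] by measurable
  moreover have hr: "h x \<in> {0..R}" for x using R_pos by (auto simp: h_def indicator_def)
  moreover have "integrable lborel h"
    by (rule integrable_bounded_interval[of _ R a b]) (use hm hr in \<open>auto simp: h_def\<close>)
  ultimately show ?thesis unfolding nice_def by blast
qed

lemma spatial_test_bounds:
  assumes "spatial_test \<psi> \<psi>'"
  obtains a b B where "a \<le> b" "\<And>x. x \<notin> {a..b} \<Longrightarrow> \<psi> x = 0" "\<And>x. x \<notin> {a..b} \<Longrightarrow> \<psi>' x = 0" "\<And>x. \<bar>\<psi> x\<bar> \<le> B" "\<And>x. \<bar>\<psi>' x\<bar> \<le> B"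
    "0 \<le> B" "\<psi> \<in> borel_measurable borel" "\<psi>' \<in> borel_measurable borel"
proof -
  obtain a b where ab: "\<And>x. x \<notin> {a..b} \<Longrightarrow> \<psi> x = 0 \<and> \<psi>' x = 0" using assms unfolding spatial_test_def by blast
  define c where "c = max \<bar>a\<bar> \<bar>b\<bar> + 1"
  have out: "\<psi> x = 0" "\<psi>' x = 0" if "c \<le> \<bar>x\<bar>" for x
  proof -
    have "x \<notin> {a..b}" using that by (auto simp: c_def max_def abs_if split: if_splits)
    then show "\<psi> x = 0" "\<psi>' x = 0" using ab by auto
  qed
  have c1: "continuous_on UNIV \<psi>" using assms unfolding spatial_test_def
    by (intro DERIV_continuous_on) (auto intro: has_field_derivative_at_within)
  have c2: "continuous_on UNIV \<psi>'" using assms unfolding spatial_test_def by blast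
  obtain B1 where B1: "\<And>z. \<bar>\<psi> z\<bar> \<le> B1" using continuous_compact_support_bound[OF c1, of c] out by blast
  obtain B2 where B2: "\<And>z. \<bar>\<psi>' z\<bar> \<le> B2" using continuous_compact_support_bound[OF c2, of c] out by blast
  show ?thesis
  proof (rule that[of "- c" c "max B1 B2"])
    show "- c \<le> c" by (auto simp: c_def)
    show "\<psi> x = 0" "\<psi>' x = 0" if "x \<notin> {- c..c}" for x using out[of x] that by auto
    show "\<bar>\<psi> x\<bar> \<le> max B1 B2" "\<bar>\<psi>' x\<bar> \<le> max B1 B2" for x using B1[of x] B2[of x] by (simp_all add: le_max_iff_disj)
    have "0 \<le> B1" using B1[of 0] by linarith
    then show "0 \<le> max B1 B2" by simp
    show "\<psi> \<in> borel_measurable borel" "\<psi>' \<in> borel_measurable borel"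
      using c1 c2 by (auto intro: borel_measurable_continuous_onI)
  qed
qed

lemma product_test_function:
  assumes st: "spatial_test \<psi> \<psi>'" and \<eta>: "\<And>t. (\<eta> has_real_derivative \<eta>' t) (at t)" "continuous_on UNIV \<eta>'" "0 < \<delta>" "\<delta> < T"
    "\<And>t. T - \<delta> \<le> t \<Longrightarrow> \<eta> t = 0"
  shows "test_function T (\<lambda>(x, t). \<psi> x * \<eta> t) (\<lambda>(x, t). \<psi>' x * \<eta> t) (\<lambda>(x, t). \<psi> x * \<eta>' t)"
  unfolding test_function_def
proof (intro conjI ballI)
  have d: "\<And>x. (\<psi> has_real_derivative \<psi>' x) (at x)" and c': "continuous_on UNIV \<psi>'" using st by (auto simp: spatial_test_def)
  have c: "continuous_on UNIV \<psi>" by (rule DERIV_continuous_on) (auto intro: has_field_derivative_at_within d)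
  have \<eta>c: "continuous_on UNIV \<eta>" by (rule DERIV_continuous_on) (auto intro: has_field_derivative_at_within \<eta>(1))
  show "continuous_on (UNIV \<times> {0..<T}) (\<lambda>(x, t). \<psi>' x * \<eta> t)" "continuous_on (UNIV \<times> {0..<T}) (\<lambda>(x, t). \<psi> x * \<eta>' t)"
    unfolding split_beta
    by (intro continuous_intros continuous_on_compose2[OF c'] continuous_on_compose2[OF c] continuous_on_compose2[OF \<eta>c] continuous_on_compose2[OF \<eta>(2)]; simp)+
  fix p :: "real \<times> real"
  obtain x t where p: "p = (x, t)" by (cases p)
  have "((\<lambda>p. \<psi> (fst p)) has_derivative (\<lambda>h. fst h * \<psi>' x)) (at p within UNIV \<times> {0..<T})"
    using has_derivative_compose[OF has_derivative_fst[OF has_derivative_ident], of \<psi> "\<lambda>h. h * \<psi>' x" p] d[of x]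
    by (auto simp: p has_field_derivative_def mult.commute[of _ "\<psi>' x"])
  moreover have "((\<lambda>p. \<eta> (snd p)) has_derivative (\<lambda>h. snd h * \<eta>' t)) (at p within UNIV \<times> {0..<T})"
    using has_derivative_compose[OF has_derivative_snd[OF has_derivative_ident], of \<eta> "\<lambda>h. h * \<eta>' t" p] \<eta>(1)[of t]
    by (auto simp: p has_field_derivative_def mult.commute[of _ "\<eta>' t"])
  ultimately have "((\<lambda>p. \<psi> (fst p) * \<eta> (snd p)) has_derivative (\<lambda>h. \<psi> (fst p) * (snd h * \<eta>' t) + (fst h * \<psi>' x) * \<eta> (snd p))) (at p within UNIV \<times> {0..<T})"
    by (rule has_derivative_mult)
  then show "((\<lambda>(x, t). \<psi> x * \<eta> t) has_derivative (\<lambda>(h, s). (case p of (x, t) \<Rightarrow> \<psi>' x * \<eta> t) * h + (case p of (x, t) \<Rightarrow> \<psi> x * \<eta>' t) * s)) (at p within UNIV \<times> {0..<T})"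
    by (auto simp: p split_beta' algebra_simps elim!: has_derivative_eq_rhs)
next
  obtain a b where ab: "\<And>x. x \<notin> {a..b} \<Longrightarrow> \<psi> x = 0 \<and> \<psi>' x = 0" using st unfolding spatial_test_def by blast
  show "\<exists>K. compact K \<and> K \<subseteq> UNIV \<times> {0..<T} \<and> (\<forall>p\<in>UNIV \<times> {0..<T} - K. (case p of (x, t) \<Rightarrow> \<psi> x * \<eta> t) = 0)"
  proof (intro exI conjI ballI)
    show "compact ({a..b} \<times> {0..T - \<delta>})" by (intro compact_Times compact_Icc)
    show "{a..b} \<times> {0..T - \<delta>} \<subseteq> UNIV \<times> {0..<T}" using \<eta>(3) by auto
    fix p assume "p \<in> UNIV \<times> {0..<T} - {a..b} \<times> {0..T - \<delta>}"
    then obtain x t where p: "p = (x, t)" "0 \<le> t" "x \<notin> {a..b} \<or> T - \<delta> < t" by (cases p) auto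
    then show "(case p of (x, t) \<Rightarrow> \<psi> x * \<eta> t) = 0" using ab[of x] \<eta>(5)[of t] by auto
  qed
qed

text \<open>What is regular in time for an arbitrary entropy solution are the spatial integrals g
  and c, which inherit continuity from the L1 continuity of the curve. Product test functions reduce
  the entropy inequality to one between g and c, and \<open>time_extraction\<close> integrates
  it.\<close>

lemma entropy_evolution:
  assumes es: "entropy_solution R v \<rho>\<^sub>0 T \<sigma>"
  obtains w where "evolution w" "\<And>t. t \<in> {0..T} \<Longrightarrow> AE x in lebesgue. \<sigma> t x = w t x"
proof -
  have cm: "continuous_L1_map R T \<sigma>" using es unfolding entropy_solution_def Let_def by (rule conjunct1)
  have ei: "(LINT t:{0..<T}|lebesgue. LINT x|lebesgue. \<bar>\<sigma> t x - k\<bar> * \<phi>t (x, t) + eflux k (\<sigma> t x) * \<phi>x (x, t))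
        + (LINT x|lebesgue. \<bar>\<rho>\<^sub>0 x - k\<bar> * \<phi> (x, 0)) \<ge> 0"
    if "k \<in> {0..R}" "test_function T \<phi> \<phi>x \<phi>t" "\<And>p. p \<in> UNIV \<times> {0..<T} \<Longrightarrow> \<phi> p \<ge> 0" for k \<phi> \<phi>x \<phi>t
    using es that unfolding entropy_solution_def Let_def eflux_def flux_def by blast
  have rep: "\<exists>g. nice g \<and> (AE x in lebesgue. \<sigma> t x = g x)" if "t \<in> {0..T}" for t
    using cm that unfolding continuous_L1_map_def by (intro nice_representative) blast+
  define w where "w t = (SOME g. nice g \<and> (AE x in lebesgue. \<sigma> t x = g x))" for t
  have w: "nice (w t)" "AE x in lebesgue. \<sigma> t x = w t x" if "t \<in> {0..T}" for t
    using someI_ex[OF rep[OF that]] unfolding w_def[symmetric] by blast+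
  have wm: "w t \<in> borel_measurable borel" and wr: "\<And>x. w t x \<in> {0..R}" and wi: "integrable lborel (w t)" if "t \<in> {0..T}" for t
    using w(1)[OF that] by (auto simp: nice_def)
  have leb: "f \<in> borel_measurable borel \<Longrightarrow> f \<in> borel_measurable lebesgue" for f :: "real \<Rightarrow> real"
    by (intro measurable_completion) simp
  \<comment> \<open>Nothing is assumed about the measurability of f: it follows from completeness of
    the measure, since f agrees almost everywhere with a Borel function.\<close>
  have AE_int: "(LINT x|lebesgue. f x) = (\<integral>x. g x \<partial>lborel)" if "g \<in> borel_measurable borel" "AE x in lebesgue. g x = f x" for f g :: "real \<Rightarrow> real"
  proof -
    have "f \<in> borel_measurable lebesgue" by (rule borel_measurable_AE[OF leb[OF that(1)] that(2)])
    then have "(LINT x|lebesgue. f x) = (LINT x|lebesgue. g x)"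
      by (rule integral_cong_AE[OF _ leb[OF that(1)]]) (use that(2) in eventually_elim, auto)
    then show ?thesis using integral_completion[of g lborel] that(1) by simp
  qed
  have L1c: "((\<lambda>s. \<integral>x. \<bar>w s x - w t x\<bar> \<partial>lborel) \<longlongrightarrow> 0) (at t within {0..T})" if t: "t \<in> {0..T}" for t
  proof -
    have eq: "(LINT x|lebesgue. \<bar>\<sigma> s x - \<sigma> t x\<bar>) = (\<integral>x. \<bar>w s x - w t x\<bar> \<partial>lborel)" if s: "s \<in> {0..T}" for s
    proof (rule AE_int)
      show "(\<lambda>x. \<bar>w s x - w t x\<bar>) \<in> borel_measurable borel" using wm[OF s] wm[OF t] by measurable
      show "AE x in lebesgue. \<bar>w s x - w t x\<bar> = \<bar>\<sigma> s x - \<sigma> t x\<bar>" using w(2)[OF s] w(2)[OF t] by eventually_elim simp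
    qed
    have "((\<lambda>s. LINT x|lebesgue. \<bar>\<sigma> s x - \<sigma> t x\<bar>) \<longlongrightarrow> 0) (at t within {0..T})"
      using cm t unfolding continuous_L1_map_def by blast
    then show ?thesis
      by (rule Lim_transform_eventually) (auto simp: eventually_at_filter eq intro!: always_eventually)
  qed
  have ev: "(\<integral>x. \<bar>w 0 x - k\<bar> * \<psi> x \<partial>lborel) \<le> (\<integral>x. \<bar>\<rho>b x - k\<bar> * \<psi> x \<partial>lborel) \<and>
        (\<forall>t1 t2. 0 \<le> t1 \<longrightarrow> t1 \<le> t2 \<longrightarrow> t2 \<le> T \<longrightarrow>
           (\<integral>x. \<bar>w t2 x - k\<bar> * \<psi> x \<partial>lborel) - (\<integral>x. \<bar>w t1 x - k\<bar> * \<psi> x \<partial>lborel)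
             \<le> integral {t1..t2} (\<lambda>t. \<integral>x. eflux k (w t x) * \<psi>' x \<partial>lborel))"
    if k: "k \<in> {0..R}" and st: "spatial_test \<psi> \<psi>'" for k \<psi> \<psi>'
  proof -
    obtain a b B where ab: "a \<le> b" and out: "\<And>x. x \<notin> {a..b} \<Longrightarrow> \<psi> x = 0" "\<And>x. x \<notin> {a..b} \<Longrightarrow> \<psi>' x = 0"
      and B: "\<And>x. \<bar>\<psi> x\<bar> \<le> B" "\<And>x. \<bar>\<psi>' x\<bar> \<le> B" "0 \<le> B"
      and \<psi>m: "\<psi> \<in> borel_measurable borel" "\<psi>' \<in> borel_measurable borel"
    proof (rule spatial_test_bounds[OF st], goal_cases)
      case (1 a b B)
      show ?case by (rule 1(1)[OF 1(2-)])
    qed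
    define g where "g t = (\<integral>x. \<bar>w t x - k\<bar> * \<psi> x \<partial>lborel)" for t
    define c where "c t = (\<integral>x. eflux k (w t x) * \<psi>' x \<partial>lborel)" for t
    define g0 where "g0 = (\<integral>x. \<bar>\<rho>b x - k\<bar> * \<psi> x \<partial>lborel)"
    have gi: "integrable lborel (\<lambda>x. \<bar>w t x - k\<bar> * \<psi> x)" and ci: "integrable lborel (\<lambda>x. eflux k (w t x) * \<psi>' x)" if t: "t \<in> {0..T}" for t
    proof -
      show "integrable lborel (\<lambda>x. \<bar>w t x - k\<bar> * \<psi> x)"
      proof (rule integrable_bounded_interval[of _ "R * B" a b])
        show "\<bar>\<bar>w t x - k\<bar> * \<psi> x\<bar> \<le> R * B" for x
          unfolding abs_mult using wr[OF t, of x] k B(1)[of x] by (intro mult_mono) auto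
      qed (use wm[OF t] \<psi>m out in auto)
      show "integrable lborel (\<lambda>x. eflux k (w t x) * \<psi>' x)"
      proof (rule integrable_bounded_interval[of _ "Lf * R * B" a b])
        show "\<bar>eflux k (w t x) * \<psi>' x\<bar> \<le> Lf * R * B" for x
        proof -
          have "\<bar>eflux k (w t x)\<bar> \<le> Lf * \<bar>w t x - k\<bar>" by (rule eflux_le[OF wr[OF t] k])
          also have "\<dots> \<le> Lf * R" using wr[OF t, of x] k Lf_nonneg by (intro mult_left_mono) auto
          finally show ?thesis unfolding abs_mult using B(2)[of x] by (intro mult_mono) auto
        qed
      qed (use nice_eflux_measurable[OF w(1)[OF t]] \<psi>m out in auto)
    qed
    have di: "integrable lborel (\<lambda>x. \<bar>w s x - w t x\<bar>)" if "s \<in> {0..T}" "t \<in> {0..T}" for s t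
      by (intro integrable_abs Bochner_Integration.integrable_diff wi that)
    have lip_g: "\<bar>g s - g t\<bar> \<le> B * (\<integral>x. \<bar>w s x - w t x\<bar> \<partial>lborel)" if s: "s \<in> {0..T}" and t: "t \<in> {0..T}" for s t
    proof -
      have eq: "g s - g t = (\<integral>x. \<bar>w s x - k\<bar> * \<psi> x - \<bar>w t x - k\<bar> * \<psi> x \<partial>lborel)"
        unfolding g_def by (rule Bochner_Integration.integral_diff[symmetric, OF gi[OF s] gi[OF t]])
      have "(\<integral>x. \<bar>\<bar>w s x - k\<bar> * \<psi> x - \<bar>w t x - k\<bar> * \<psi> x\<bar> \<partial>lborel) \<le> (\<integral>x. B * \<bar>w s x - w t x\<bar> \<partial>lborel)"
      proof (rule integral_mono[OF integrable_abs[OF Bochner_Integration.integrable_diff[OF gi[OF s] gi[OF t]]] integrable_mult_right[OF di[OF s t]]])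
        fix x
        have "\<bar>(\<bar>w s x - k\<bar> - \<bar>w t x - k\<bar>) * \<psi> x\<bar> \<le> \<bar>w s x - w t x\<bar> * B"
          unfolding abs_mult using B(1)[of x] by (intro mult_mono) auto
        moreover have "\<bar>w s x - w t x\<bar> * B = B * \<bar>w s x - w t x\<bar>" by simp
        ultimately show "\<bar>\<bar>w s x - k\<bar> * \<psi> x - \<bar>w t x - k\<bar> * \<psi> x\<bar> \<le> B * \<bar>w s x - w t x\<bar>"
          by (simp only: left_diff_distrib)
      qed
      then have "(\<integral>x. \<bar>\<bar>w s x - k\<bar> * \<psi> x - \<bar>w t x - k\<bar> * \<psi> x\<bar> \<partial>lborel) \<le> B * (\<integral>x. \<bar>w s x - w t x\<bar> \<partial>lborel)" by simp
      then show ?thesis unfolding eq by (rule order_trans[OF integral_abs_bound])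
    qed
    have lip_c: "\<bar>c s - c t\<bar> \<le> Lf * B * (\<integral>x. \<bar>w s x - w t x\<bar> \<partial>lborel)" if s: "s \<in> {0..T}" and t: "t \<in> {0..T}" for s t
    proof -
      have eq: "c s - c t = (\<integral>x. eflux k (w s x) * \<psi>' x - eflux k (w t x) * \<psi>' x \<partial>lborel)"
        unfolding c_def by (rule Bochner_Integration.integral_diff[symmetric, OF ci[OF s] ci[OF t]])
      have "(\<integral>x. \<bar>eflux k (w s x) * \<psi>' x - eflux k (w t x) * \<psi>' x\<bar> \<partial>lborel) \<le> (\<integral>x. Lf * B * \<bar>w s x - w t x\<bar> \<partial>lborel)"
      proof (rule integral_mono[OF integrable_abs[OF Bochner_Integration.integrable_diff[OF ci[OF s] ci[OF t]]] integrable_mult_right[OF di[OF s t]]])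
        fix x
        have "\<bar>(eflux k (w s x) - eflux k (w t x)) * \<psi>' x\<bar> \<le> (Lf * \<bar>w s x - w t x\<bar>) * B"
          unfolding abs_mult using B(2)[of x] eflux_lip[OF wr[OF s] wr[OF t] k] Lf_nonneg by (intro mult_mono) auto
        moreover have "(Lf * \<bar>w s x - w t x\<bar>) * B = Lf * B * \<bar>w s x - w t x\<bar>" by simp
        ultimately show "\<bar>eflux k (w s x) * \<psi>' x - eflux k (w t x) * \<psi>' x\<bar> \<le> Lf * B * \<bar>w s x - w t x\<bar>"
          by (simp only: left_diff_distrib)
      qed
      then have "(\<integral>x. \<bar>eflux k (w s x) * \<psi>' x - eflux k (w t x) * \<psi>' x\<bar> \<partial>lborel) \<le> Lf * B * (\<integral>x. \<bar>w s x - w t x\<bar> \<partial>lborel)" by simp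
      then show ?thesis unfolding eq by (rule order_trans[OF integral_abs_bound])
    qed
    have cont: "continuous_on {0..T} f" if "\<And>s t. s \<in> {0..T} \<Longrightarrow> t \<in> {0..T} \<Longrightarrow> \<bar>f s - f t\<bar> \<le> D * (\<integral>x. \<bar>w s x - w t x\<bar> \<partial>lborel)" for f :: "real \<Rightarrow> real" and D
      unfolding continuous_on_def
    proof (intro ballI)
      fix t assume t: "t \<in> {0..T}"
      have "((\<lambda>s. f s - f t) \<longlongrightarrow> 0) (at t within {0..T})"
      proof (rule Lim_null_comparison)
        show "((\<lambda>s. D * (\<integral>x. \<bar>w s x - w t x\<bar> \<partial>lborel)) \<longlongrightarrow> 0) (at t within {0..T})"
          by (rule tendsto_mult_right_zero[OF L1c[OF t]])
        show "\<forall>\<^sub>F s in at t within {0..T}. norm (f s - f t) \<le> D * (\<integral>x. \<bar>w s x - w t x\<bar> \<partial>lborel)"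
          using that[OF _ t] by (auto simp: eventually_at_filter intro!: always_eventually)
      qed
      then show "(f \<longlongrightarrow> f t) (at t within {0..T})" by (rule LIM_zero_cancel)
    qed
    have gc: "continuous_on {0..T} g" by (rule cont[OF lip_g])
    have cc: "continuous_on {0..T} c" by (rule cont[OF lip_c])
    have ineq: "0 \<le> integral {0..T} (\<lambda>t. g t * \<eta>' t + c t * \<eta> t) + g0 * \<eta> 0"
      if \<eta>: "\<And>t. (\<eta> has_real_derivative \<eta>' t) (at t)" "continuous_on UNIV \<eta>'" "\<And>t. 0 \<le> \<eta> t"
       "0 < \<delta>" "\<delta> < T" "\<And>t. T - \<delta> \<le> t \<Longrightarrow> \<eta> t = 0" for \<eta> \<eta>' \<delta>
    proof -
      let ?F = "\<lambda>t. g t * \<eta>' t + c t * \<eta> t"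
      have \<eta>c: "continuous_on {0..T} \<eta>" by (rule DERIV_continuous_on) (auto intro: has_field_derivative_at_within \<eta>(1))
      have Fc: "continuous_on {0..T} ?F"
        by (intro continuous_intros gc cc \<eta>c continuous_on_subset[OF \<eta>(2)]) auto
      have inner: "(LINT x|lebesgue. \<bar>\<sigma> t x - k\<bar> * (\<psi> x * \<eta>' t) + eflux k (\<sigma> t x) * (\<psi>' x * \<eta> t)) = ?F t" if t: "t \<in> {0..T}" for t
      proof -
        have i1: "integrable lborel (\<lambda>x. (\<bar>w t x - k\<bar> * \<psi> x) * \<eta>' t)" by (rule integrable_mult_left[OF gi[OF t]])
        have i2: "integrable lborel (\<lambda>x. (eflux k (w t x) * \<psi>' x) * \<eta> t)" by (rule integrable_mult_left[OF ci[OF t]])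
        have "(LINT x|lebesgue. \<bar>\<sigma> t x - k\<bar> * (\<psi> x * \<eta>' t) + eflux k (\<sigma> t x) * (\<psi>' x * \<eta> t))
          = (\<integral>x. (\<bar>w t x - k\<bar> * \<psi> x) * \<eta>' t + (eflux k (w t x) * \<psi>' x) * \<eta> t \<partial>lborel)"
        proof (rule AE_int)
          show "(\<lambda>x. (\<bar>w t x - k\<bar> * \<psi> x) * \<eta>' t + (eflux k (w t x) * \<psi>' x) * \<eta> t) \<in> borel_measurable borel"
            using borel_measurable_integrable[OF Bochner_Integration.integrable_add[OF i1 i2]] by simp
          show "AE x in lebesgue. (\<bar>w t x - k\<bar> * \<psi> x) * \<eta>' t + (eflux k (w t x) * \<psi>' x) * \<eta> t
              = \<bar>\<sigma> t x - k\<bar> * (\<psi> x * \<eta>' t) + eflux k (\<sigma> t x) * (\<psi>' x * \<eta> t)"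
            using w(2)[OF t] by eventually_elim simp
        qed
        also have "\<dots> = ?F t" unfolding Bochner_Integration.integral_add[OF i1 i2] g_def c_def by simp
        finally show ?thesis .
      qed
      have "(LINT t:{0..<T}|lebesgue. LINT x|lebesgue. \<bar>\<sigma> t x - k\<bar> * (\<psi> x * \<eta>' t) + eflux k (\<sigma> t x) * (\<psi>' x * \<eta> t))
         = (LINT t:{0..<T}|lebesgue. ?F t)"
        unfolding set_lebesgue_integral_def by (rule Bochner_Integration.integral_cong) (auto simp: inner indicator_def)
      also have "\<dots> = integral {0..<T} ?F"
        by (rule set_lebesgue_integral_eq_integral(2), rule set_integrable_subset[OF absolutely_integrable_continuous_real[OF Fc]]) auto
      also have "\<dots> = integral {0..T} ?F"
        by (rule integral_spike_set) (auto intro: negligible_subset[of "{T}"])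
      finally have 1: "(LINT t:{0..<T}|lebesgue. LINT x|lebesgue. \<bar>\<sigma> t x - k\<bar> * (\<psi> x * \<eta>' t) + eflux k (\<sigma> t x) * (\<psi>' x * \<eta> t)) = integral {0..T} ?F" .
      have 2: "(LINT x|lebesgue. \<bar>\<rho>\<^sub>0 x - k\<bar> * (\<psi> x * \<eta> 0)) = g0 * \<eta> 0"
      proof -
        have "(LINT x|lebesgue. \<bar>\<rho>\<^sub>0 x - k\<bar> * (\<psi> x * \<eta> 0)) = (\<integral>x. (\<bar>\<rho>b x - k\<bar> * \<psi> x) * \<eta> 0 \<partial>lborel)"
        proof (rule AE_int)
          show "(\<lambda>x. (\<bar>\<rho>b x - k\<bar> * \<psi> x) * \<eta> 0) \<in> borel_measurable borel" using \<psi>m by measurable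
          show "AE x in lebesgue. (\<bar>\<rho>b x - k\<bar> * \<psi> x) * \<eta> 0 = \<bar>\<rho>\<^sub>0 x - k\<bar> * (\<psi> x * \<eta> 0)"
            using \<rho>b(4) by eventually_elim simp
        qed
        then show ?thesis by (simp add: g0_def)
      qed
      have "0 \<le> (LINT t:{0..<T}|lebesgue. LINT x|lebesgue. \<bar>\<sigma> t x - k\<bar> * (case (x, t) of (x, t) \<Rightarrow> \<psi> x * \<eta>' t) + eflux k (\<sigma> t x) * (case (x, t) of (x, t) \<Rightarrow> \<psi>' x * \<eta> t))
        + (LINT x|lebesgue. \<bar>\<rho>\<^sub>0 x - k\<bar> * (case (x, 0) of (x, t) \<Rightarrow> \<psi> x * \<eta> t))"
        by (rule ei[OF k product_test_function[OF st \<eta>(1,2,4,5,6)]])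
           (use st \<eta>(3) in \<open>auto simp: spatial_test_def\<close>)
      then show ?thesis unfolding prod.case 1 2 .
    qed
    show ?thesis
      unfolding g_def[symmetric] c_def[symmetric] g0_def[symmetric]
    proof (intro conjI allI impI)
      show "g 0 \<le> g0"
      proof (rule time_extraction(1)[OF T_pos gc cc, of g0])
        fix \<eta> \<eta>' :: "real \<Rightarrow> real" and \<delta> :: real
        assume *: "\<And>t. (\<eta> has_real_derivative \<eta>' t) (at t)" "continuous_on UNIV \<eta>'" "\<And>t. 0 \<le> \<eta> t"
          "0 < \<delta>" "\<delta> < T" "\<And>t. T - \<delta> \<le> t \<Longrightarrow> \<eta> t = 0"
        show "0 \<le> integral {0..T} (\<lambda>t. g t * \<eta>' t + c t * \<eta> t) + g0 * \<eta> 0" by (rule ineq[OF *])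
      qed
      fix t1 t2 assume t: "0 \<le> t1" "t1 \<le> t2" "t2 \<le> T"
      show "g t2 - g t1 \<le> integral {t1..t2} c"
      proof (rule time_extraction(2)[OF T_pos gc cc _ t, of g0])
        fix \<eta> \<eta>' :: "real \<Rightarrow> real" and \<delta> :: real
        assume *: "\<And>t. (\<eta> has_real_derivative \<eta>' t) (at t)" "continuous_on UNIV \<eta>'" "\<And>t. 0 \<le> \<eta> t"
          "0 < \<delta>" "\<delta> < T" "\<And>t. T - \<delta> \<le> t \<Longrightarrow> \<eta> t = 0"
        show "0 \<le> integral {0..T} (\<lambda>t. g t * \<eta>' t + c t * \<eta> t) + g0 * \<eta> 0" by (rule ineq[OF *])
      qed
    qed
  qed
  have "evolution w" unfolding evolution_def using w(1) L1c ev by blast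
  then show ?thesis using that w(2) by blast
qed

end

section \<open>The Kruzkov functional and its dissipation\<close>

locale kruzkov = lwr R v v' \<rho>\<^sub>0 T \<theta>
  for R :: real and v v' :: "real \<Rightarrow> real" and \<rho>\<^sub>0 :: "real \<Rightarrow> real" and T \<theta> :: real +
  fixes \<epsilon> :: real
  assumes \<epsilon>_pos: "0 < \<epsilon>"
begin

sublocale k: compact_kernel "ker \<epsilon>" \<epsilon>
  by unfold_locales (auto intro: ker_cont ker_outside \<epsilon>_pos)

sublocale k': compact_kernel "ker' \<epsilon>" \<epsilon>
  by unfold_locales (auto intro: ker_cont ker_outside \<epsilon>_pos)

definition H :: "(real \<Rightarrow> real) \<Rightarrow> (real \<Rightarrow> real) \<Rightarrow> real" where
  "H f g = (\<integral>y. (\<integral>x. \<bar>f x - g y\<bar> * ker \<epsilon> (x - y) \<partial>lborel) \<partial>lborel)"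

definition Q :: "(real \<Rightarrow> real) \<Rightarrow> (real \<Rightarrow> real) \<Rightarrow> real" where
  "Q f g = (\<integral>y. (\<integral>x. eflux (g y) (f x) * ker' \<epsilon> (x - y) \<partial>lborel) \<partial>lborel)"

lemma K_pos: "0 < k.K"
proof -
  have "0 \<le> ker \<epsilon> z" for z by (rule ker_nonneg)
  \<comment> \<open>For \<open>\<bar>z\<bar> \<le> \<epsilon> / 2\<close> the difference
    \<open>\<epsilon>\<^sup>2 - z\<^sup>2\<close> is at least three quarters of
    \<open>\<epsilon>\<^sup>2\<close>.\<close>
  have le: "(3 / 4 * \<epsilon>\<^sup>2)\<^sup>2 * indicator {- \<epsilon> / 2..\<epsilon> / 2} z \<le> \<bar>ker \<epsilon> z\<bar>" for z
  proof (cases "z \<in> {- \<epsilon> / 2..\<epsilon> / 2}")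
    case True
    then have "\<bar>z\<bar> \<le> \<epsilon> / 2" by auto
    then have "\<bar>z\<bar>\<^sup>2 \<le> (\<epsilon> / 2)\<^sup>2" by (intro power_mono) auto
    then have "3 / 4 * \<epsilon>\<^sup>2 \<le> \<epsilon>\<^sup>2 - z\<^sup>2" by (simp add: power_divide)
    then have "3 / 4 * \<epsilon>\<^sup>2 \<le> max 0 (\<epsilon>\<^sup>2 - z\<^sup>2)" by (rule max.coboundedI2)
    then have "(3 / 4 * \<epsilon>\<^sup>2)\<^sup>2 \<le> ker \<epsilon> z" unfolding ker_def by (intro power_mono) auto
    then show ?thesis using True by simp
  qed simp
  have i: "integrable lborel (\<lambda>z. (3 / 4 * \<epsilon>\<^sup>2)\<^sup>2 * indicator {- \<epsilon> / 2..\<epsilon> / 2} z)"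
    by (rule integrable_bounded_interval[of _ "(3 / 4 * \<epsilon>\<^sup>2)\<^sup>2" "- \<epsilon> / 2" "\<epsilon> / 2"]) (auto simp: indicator_def)
  have "(\<integral>z. (3 / 4 * \<epsilon>\<^sup>2)\<^sup>2 * indicator {- \<epsilon> / 2..\<epsilon> / 2} z \<partial>lborel) \<le> k.K"
    unfolding k.K_def by (rule integral_mono[OF i k.\<kappa>_int le])
  moreover have "(\<integral>z. (3 / 4 * \<epsilon>\<^sup>2)\<^sup>2 * indicator {- \<epsilon> / 2..\<epsilon> / 2} z \<partial>lborel) = (3 / 4 * \<epsilon>\<^sup>2)\<^sup>2 * \<epsilon>" using \<epsilon>_pos by simp
  moreover have "0 < (3 / 4 * \<epsilon>\<^sup>2)\<^sup>2 * \<epsilon>" using \<epsilon>_pos by simp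
  ultimately show ?thesis by linarith
qed

lemma spatial_test_ker: "spatial_test (\<lambda>x. ker \<epsilon> (x - y)) (\<lambda>x. ker' \<epsilon> (x - y))"
  unfolding spatial_test_def
proof (intro conjI allI)
  fix x
  have "((\<lambda>x. x - y) has_real_derivative 1) (at x)" by (auto intro!: derivative_eq_intros)
  from DERIV_chain2[OF ker_derivative this] show "((\<lambda>x. ker \<epsilon> (x - y)) has_real_derivative ker' \<epsilon> (x - y)) (at x)" by simp
next
  show "continuous_on UNIV (\<lambda>x. ker' \<epsilon> (x - y))" by (intro continuous_on_compose2[OF ker_cont(2)] continuous_intros) auto
  show "\<exists>a b. \<forall>x. x \<notin> {a..b} \<longrightarrow> ker \<epsilon> (x - y) = 0 \<and> ker' \<epsilon> (x - y) = 0"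
    by (intro exI[of _ "y - \<epsilon>"] exI[of _ "y + \<epsilon>"]) (auto intro!: ker_outside \<epsilon>_pos)
qed (rule ker_nonneg)

lemma H_measurable:
  assumes "nice f" "nice g"
  shows "(\<lambda>(x, y). \<bar>f x - g y\<bar> * ker \<epsilon> (x - y)) \<in> borel_measurable (lborel \<Otimes>\<^sub>M lborel)"
proof -
  have [measurable]: "f \<in> borel_measurable borel" "g \<in> borel_measurable borel" using assms by (auto simp: nice_def)
  show ?thesis by measurable
qed

lemma Q_measurable:
  assumes "nice f" "nice g"
  shows "(\<lambda>(x, y). eflux (g y) (f x) * ker' \<epsilon> (x - y)) \<in> borel_measurable (lborel \<Otimes>\<^sub>M lborel)"
proof -
  have [measurable]: "f \<in> borel_measurable borel" "g \<in> borel_measurable borel" using assms by (auto simp: nice_def)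
  have [measurable]: "(\<lambda>x. flux (f x)) \<in> borel_measurable borel" "(\<lambda>x. flux (g x)) \<in> borel_measurable borel"
    using assms by (auto intro: nice_flux_measurable)
  show ?thesis unfolding eflux_def by measurable
qed

lemma eflux_nice: "nice f \<Longrightarrow> nice g \<Longrightarrow> \<bar>eflux (g y) (f x)\<bar> \<le> Lf * (\<bar>f x\<bar> + \<bar>g y\<bar>)"
proof -
  assume "nice f" "nice g"
  then have "\<bar>eflux (g y) (f x)\<bar> \<le> Lf * \<bar>f x - g y\<bar>" by (intro eflux_le) (auto simp: nice_def)
  also have "\<dots> \<le> Lf * (\<bar>f x\<bar> + \<bar>g y\<bar>)" using Lf_nonneg by (intro mult_left_mono) auto
  finally show ?thesis .
qed

lemma H_integrable:
  assumes "nice f" "nice g"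
  shows "integrable (lborel \<Otimes>\<^sub>M lborel) (\<lambda>(x, y). \<bar>f x - g y\<bar> * ker \<epsilon> (x - y))"
proof (rule k.dominated_prod(1)[of f g 1])
  show "\<bar>\<bar>f x - g y\<bar> * ker \<epsilon> (x - y)\<bar> \<le> 1 * (\<bar>f x\<bar> + \<bar>g y\<bar>) * \<bar>ker \<epsilon> (x - y)\<bar>" for x y
    unfolding abs_mult by (intro mult_right_mono) auto
qed (use assms H_measurable in \<open>auto simp: nice_def\<close>)

lemma Q_dominated:
  assumes "nice f" "nice g"
  shows "integrable (lborel \<Otimes>\<^sub>M lborel) (\<lambda>(x, y). eflux (g y) (f x) * ker' \<epsilon> (x - y))"
    "(\<integral>y. \<bar>\<integral>x. eflux (g y) (f x) * ker' \<epsilon> (x - y) \<partial>lborel\<bar> \<partial>lborel) \<le> Lf * ((\<integral>x. \<bar>f x\<bar> \<partial>lborel) + (\<integral>y. \<bar>g y\<bar> \<partial>lborel)) * k'.K"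
proof -
  have i: "integrable lborel f" "integrable lborel g" using assms by (auto simp: nice_def)
  have le: "\<bar>eflux (g y) (f x) * ker' \<epsilon> (x - y)\<bar> \<le> Lf * (\<bar>f x\<bar> + \<bar>g y\<bar>) * \<bar>ker' \<epsilon> (x - y)\<bar>" for x y
    unfolding abs_mult using eflux_nice[OF assms] by (intro mult_right_mono) auto
  show "integrable (lborel \<Otimes>\<^sub>M lborel) (\<lambda>(x, y). eflux (g y) (f x) * ker' \<epsilon> (x - y))"
    "(\<integral>y. \<bar>\<integral>x. eflux (g y) (f x) * ker' \<epsilon> (x - y) \<partial>lborel\<bar> \<partial>lborel) \<le> Lf * ((\<integral>x. \<bar>f x\<bar> \<partial>lborel) + (\<integral>y. \<bar>g y\<bar> \<partial>lborel)) * k'.K"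
    using k'.dominated_prod(1,3)[OF i Lf_nonneg Q_measurable[OF assms] le] by blast+
qed

lemma H_commute:
  assumes "nice f" "nice g"
  shows "H f g = H g f"
proof -
  have "H f g = (\<integral>x. (\<integral>y. \<bar>f x - g y\<bar> * ker \<epsilon> (x - y) \<partial>lborel) \<partial>lborel)"
    unfolding H_def by (rule lborel_pair.Fubini_integral[OF H_integrable[OF assms]])
  also have "\<dots> = H g f" unfolding H_def
    by (intro Bochner_Integration.integral_cong refl) (metis abs_minus_commute ker_even minus_diff_eq)
  finally show ?thesis .
qed

text \<open>Exchanging the arguments amounts to exchanging x and y: \<open>ker'\<close> changes its
  sign and \<open>eflux\<close> does not. This is the cancellation at the heart of Kruzkov's
  argument.\<close>

lemma Q_antisym:
  assumes "nice f" "nice g"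
  shows "Q g f = - Q f g"
proof -
  have "Q f g = (\<integral>x. (\<integral>y. eflux (g y) (f x) * ker' \<epsilon> (x - y) \<partial>lborel) \<partial>lborel)"
    unfolding Q_def by (rule lborel_pair.Fubini_integral[OF Q_dominated(1)[OF assms]])
  also have "\<dots> = (\<integral>x. (\<integral>y. - (eflux (f x) (g y) * ker' \<epsilon> (y - x)) \<partial>lborel) \<partial>lborel)"
  proof (intro Bochner_Integration.integral_cong refl)
    fix x y
    have "ker' \<epsilon> (x - y) = - ker' \<epsilon> (y - x)" using ker'_odd[of \<epsilon> "y - x"] by simp
    then show "eflux (g y) (f x) * ker' \<epsilon> (x - y) = - (eflux (f x) (g y) * ker' \<epsilon> (y - x))"
      by (simp add: eflux_commute[of "g y" "f x"])
  qed
  also have "\<dots> = - Q g f" unfolding Q_def by simp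
  finally show ?thesis by simp
qed

lemma Q_lipschitz:
  assumes f: "nice f" and f': "nice f'" and g: "nice g"
  shows "\<bar>Q f g - Q f' g\<bar> \<le> Lf * k'.K * (\<integral>x. \<bar>f x - f' x\<bar> \<partial>lborel)"
proof -
  let ?F = "\<lambda>x y. eflux (g y) (f x) * ker' \<epsilon> (x - y) - eflux (g y) (f' x) * ker' \<epsilon> (x - y)"
  note i1 = Q_dominated(1)[OF f g] and i2 = Q_dominated(1)[OF f' g]
  have m: "(\<lambda>(x, y). ?F x y) \<in> borel_measurable (lborel \<Otimes>\<^sub>M lborel)"
    using borel_measurable_diff[OF Q_measurable[OF f g] Q_measurable[OF f' g]] by (simp add: split_beta')
  have d: "integrable lborel (\<lambda>x. f x - f' x)" using f f' by (auto simp: nice_def)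
  have "\<bar>?F x y\<bar> \<le> Lf * (\<bar>f x - f' x\<bar> + \<bar>0\<bar>) * \<bar>ker' \<epsilon> (x - y)\<bar>" for x y
  proof -
    have "\<bar>eflux (g y) (f x) - eflux (g y) (f' x)\<bar> \<le> Lf * \<bar>f x - f' x\<bar>"
      using f f' g by (intro eflux_lip) (auto simp: nice_def)
    then have "\<bar>(eflux (g y) (f x) - eflux (g y) (f' x)) * ker' \<epsilon> (x - y)\<bar> \<le> Lf * \<bar>f x - f' x\<bar> * \<bar>ker' \<epsilon> (x - y)\<bar>"
      unfolding abs_mult by (intro mult_right_mono) auto
    then show ?thesis by (simp add: left_diff_distrib)
  qed
  from k'.dominated_prod(1,2)[OF d _ Lf_nonneg m this]
  have i3: "integrable (lborel \<Otimes>\<^sub>M lborel) (\<lambda>(x, y). ?F x y)"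
    and le: "\<bar>\<integral>y. (\<integral>x. ?F x y \<partial>lborel) \<partial>lborel\<bar> \<le> Lf * ((\<integral>x. \<bar>f x - f' x\<bar> \<partial>lborel) + (\<integral>y. \<bar>0::real\<bar> \<partial>(lborel :: real measure))) * k'.K"
    by simp_all
  have "(\<integral>y. (\<integral>x. ?F x y \<partial>lborel) \<partial>lborel) = integral\<^sup>L (lborel \<Otimes>\<^sub>M lborel) (\<lambda>(x, y). ?F x y)"
    by (rule lborel_pair.integral_snd[OF i3])
  also have "\<dots> = integral\<^sup>L (lborel \<Otimes>\<^sub>M lborel) (\<lambda>(x, y). eflux (g y) (f x) * ker' \<epsilon> (x - y)) - integral\<^sup>L (lborel \<Otimes>\<^sub>M lborel) (\<lambda>(x, y). eflux (g y) (f' x) * ker' \<epsilon> (x - y))"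
    using Bochner_Integration.integral_diff[OF i1 i2] by (simp add: split_beta')
  also have "\<dots> = Q f g - Q f' g"
    unfolding Q_def lborel_pair.integral_snd[OF i1] lborel_pair.integral_snd[OF i2] ..
  finally show ?thesis using le by (simp add: mult.commute mult.left_commute)
qed

text \<open>With the second argument frozen as g, the evolution inequality is used for each y with
  the constant \<open>k = g y\<close> and the kernel centred at y, and is then integrated over y.
  Replacing the flux term at a time r by the one at s costs at most
  \<open>Lf * k'.K * e\<close>.\<close>

lemma H_increment:
  assumes w: "evolution w" and g: "nice g" and t: "0 \<le> t1" "t1 \<le> t2" "t2 \<le> T" and s: "s \<in> {t1..t2}"
    and e: "\<And>r. r \<in> {t1..t2} \<Longrightarrow> (\<integral>x. \<bar>w r x - w s x\<bar> \<partial>lborel) \<le> e"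
  shows "H (w t2) g - H (w t1) g \<le> (t2 - t1) * (Q (w s) g + Lf * k'.K * e)"
proof -
  have wn: "nice (w r)" if "r \<in> {t1..t2}" for r using w that t unfolding evolution_def by auto
  have wi: "integrable lborel (w r)" if "r \<in> {t1..t2}" for r using wn[OF that] by (simp add: nice_def)
  have e0: "0 \<le> e" by (rule order_trans[OF _ e[OF s]]) simp
  obtain B' where B': "\<And>z. \<bar>ker' \<epsilon> z\<bar> \<le> B'" using k'.\<kappa>_bound by metis
  have B'0: "0 \<le> B'" using B'[of 0] by linarith
  \<comment> \<open>Times are clamped to [t1, t2] so that J is defined and continuous in r on the
    whole line, as joint measurability requires.\<close>
  define cl where "cl r = max t1 (min t2 r)" for r
  have cl: "cl r \<in> {t1..t2}" "r \<in> {t1..t2} \<Longrightarrow> cl r = r" for r using t by (auto simp: cl_def)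
  define J where "J r y = (\<integral>x. eflux (g y) (w (cl r) x) * ker' \<epsilon> (x - y) \<partial>lborel)" for r y
  have xi: "integrable lborel (\<lambda>x. eflux (g y) (f x) * ker' \<epsilon> (x - y))" if f: "nice f" for f y
  proof (rule integrable_bounded_interval[of _ "Lf * (R + R) * B'" "y - \<epsilon>" "y + \<epsilon>"])
    show "\<bar>eflux (g y) (f x) * ker' \<epsilon> (x - y)\<bar> \<le> Lf * (R + R) * B'" for x
    proof -
      have "Lf * (\<bar>f x\<bar> + \<bar>g y\<bar>) \<le> Lf * (R + R)" using f g Lf_nonneg by (intro mult_left_mono add_mono) (auto simp: nice_def)
      then have "\<bar>eflux (g y) (f x)\<bar> \<le> Lf * (R + R)" using eflux_nice[OF f g, of y x] by linarith
      then show ?thesis unfolding abs_mult using B' B'0 Lf_nonneg R_pos by (intro mult_mono) auto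
    qed
    show "(\<lambda>x. eflux (g y) (f x) * ker' \<epsilon> (x - y)) \<in> borel_measurable borel"
      using nice_eflux_measurable[OF f, of "g y"] by measurable
    show "eflux (g y) (f x) * ker' \<epsilon> (x - y) = 0" if "x \<notin> {y - \<epsilon>..y + \<epsilon>}" for x
    proof -
      have "\<epsilon> \<le> \<bar>x - y\<bar>" using that unfolding atLeastAtMost_iff by linarith
      then show ?thesis by (simp add: ker_outside(2)[OF \<epsilon>_pos])
    qed
  qed
  have Jlip: "\<bar>J r y - J r' y\<bar> \<le> Lf * B' * (\<integral>x. \<bar>w (cl r) x - w (cl r') x\<bar> \<partial>lborel)" for r r' y
  proof -
    note n = wn[OF cl(1)[of r]] wn[OF cl(1)[of r']]
    have di: "integrable lborel (\<lambda>x. \<bar>w (cl r) x - w (cl r') x\<bar>)"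
      by (intro integrable_abs Bochner_Integration.integrable_diff wi cl)
    have eq: "J r y - J r' y = (\<integral>x. eflux (g y) (w (cl r) x) * ker' \<epsilon> (x - y) - eflux (g y) (w (cl r') x) * ker' \<epsilon> (x - y) \<partial>lborel)"
      unfolding J_def by (rule Bochner_Integration.integral_diff[symmetric, OF xi[OF n(1)] xi[OF n(2)]])
    have "(\<integral>x. \<bar>eflux (g y) (w (cl r) x) * ker' \<epsilon> (x - y) - eflux (g y) (w (cl r') x) * ker' \<epsilon> (x - y)\<bar> \<partial>lborel)
       \<le> (\<integral>x. Lf * B' * \<bar>w (cl r) x - w (cl r') x\<bar> \<partial>lborel)"
    proof (rule integral_mono[OF integrable_abs[OF Bochner_Integration.integrable_diff[OF xi[OF n(1)] xi[OF n(2)]]] integrable_mult_right[OF di]])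
      fix x
      have "\<bar>eflux (g y) (w (cl r) x) - eflux (g y) (w (cl r') x)\<bar> \<le> Lf * \<bar>w (cl r) x - w (cl r') x\<bar>"
        using n g by (intro eflux_lip) (auto simp: nice_def)
      then have "\<bar>(eflux (g y) (w (cl r) x) - eflux (g y) (w (cl r') x)) * ker' \<epsilon> (x - y)\<bar> \<le> Lf * \<bar>w (cl r) x - w (cl r') x\<bar> * B'"
        unfolding abs_mult using B' Lf_nonneg by (intro mult_mono) auto
      moreover have "Lf * \<bar>w (cl r) x - w (cl r') x\<bar> * B' = Lf * B' * \<bar>w (cl r) x - w (cl r') x\<bar>" by simp
      ultimately show "\<bar>eflux (g y) (w (cl r) x) * ker' \<epsilon> (x - y) - eflux (g y) (w (cl r') x) * ker' \<epsilon> (x - y)\<bar> \<le> Lf * B' * \<bar>w (cl r) x - w (cl r') x\<bar>"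
        by (simp only: left_diff_distrib)
    qed
    then have "(\<integral>x. \<bar>eflux (g y) (w (cl r) x) * ker' \<epsilon> (x - y) - eflux (g y) (w (cl r') x) * ker' \<epsilon> (x - y)\<bar> \<partial>lborel)
       \<le> Lf * B' * (\<integral>x. \<bar>w (cl r) x - w (cl r') x\<bar> \<partial>lborel)" by simp
    then show ?thesis unfolding eq by (rule order_trans[OF integral_abs_bound])
  qed
  have Jcont: "continuous_on UNIV (\<lambda>r. J r y)" for y
    unfolding continuous_on_def
  proof (intro ballI)
    fix r :: real
    have crT: "cl r' \<in> {0..T}" for r' using cl(1)[of r'] t by auto
    have clc: "((\<lambda>r'. cl r') \<longlongrightarrow> cl r) (at r)" unfolding cl_def by (intro tendsto_intros)
    have L1: "((\<lambda>s. \<integral>x. \<bar>w s x - w (cl r) x\<bar> \<partial>lborel) \<longlongrightarrow> 0) (at (cl r) within {0..T})"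
      using w crT[of r] unfolding evolution_def by blast
    have "((\<lambda>r'. \<integral>x. \<bar>w (cl r') x - w (cl r) x\<bar> \<partial>lborel) \<longlongrightarrow> 0) (at r)"
    proof (rule tendstoI)
      fix d :: real assume d: "0 < d"
      from tendstoD[OF L1 d] obtain \<delta> where \<delta>: "0 < \<delta>" "\<And>s. s \<in> {0..T} \<Longrightarrow> s \<noteq> cl r \<Longrightarrow> dist s (cl r) < \<delta> \<Longrightarrow> dist (\<integral>x. \<bar>w s x - w (cl r) x\<bar> \<partial>lborel) 0 < d"
        unfolding eventually_at by blast
      from tendstoD[OF clc \<delta>(1)] show "\<forall>\<^sub>F r' in at r. dist (\<integral>x. \<bar>w (cl r') x - w (cl r) x\<bar> \<partial>lborel) 0 < d"
      proof eventually_elim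
        case (elim r')
        then show ?case using \<delta>(2)[OF crT, of r'] d by (cases "cl r' = cl r") auto
      qed
    qed
    then have "((\<lambda>r'. Lf * B' * (\<integral>x. \<bar>w (cl r') x - w (cl r) x\<bar> \<partial>lborel)) \<longlongrightarrow> 0) (at r)" by (rule tendsto_mult_right_zero)
    then have "((\<lambda>r'. J r' y - J r y) \<longlongrightarrow> 0) (at r)"
      by (rule Lim_null_comparison[rotated]) (intro always_eventually allI, simp add: Jlip)
    then show "((\<lambda>r. J r y) \<longlongrightarrow> J r y) (at r within UNIV)" by (simp add: LIM_zero_cancel)
  qed
  have Jint: "integrable lborel (J r)" for r
    unfolding J_def by (rule lborel_pair.integrable_snd[OF Q_dominated(1)[OF wn[OF cl(1)] g]])
  have Jm: "J r \<in> borel_measurable borel" for r using borel_measurable_integrable[OF Jint] by simp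
  have Jpair [measurable]: "(\<lambda>(r, y). J r y) \<in> borel_measurable (borel \<Otimes>\<^sub>M borel)"
    by (rule caratheodory_measurable[OF Jm Jcont])
  let ?I = "indicator {t1..t2} :: real \<Rightarrow> real"
  define N where "N = Lf * (((\<integral>x. \<bar>w s x\<bar> \<partial>lborel) + e) + (\<integral>y. \<bar>g y\<bar> \<partial>lborel)) * k'.K"
  have Nb: "(\<integral>y. \<bar>J r y\<bar> \<partial>lborel) \<le> N" for r
  proof -
    have "(\<integral>x. \<bar>w (cl r) x\<bar> \<partial>lborel) \<le> (\<integral>x. \<bar>w s x\<bar> + \<bar>w (cl r) x - w s x\<bar> \<partial>lborel)"
      by (intro integral_mono Bochner_Integration.integrable_add integrable_abs Bochner_Integration.integrable_diff wi cl s) auto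
    also have "\<dots> = (\<integral>x. \<bar>w s x\<bar> \<partial>lborel) + (\<integral>x. \<bar>w (cl r) x - w s x\<bar> \<partial>lborel)"
      by (intro Bochner_Integration.integral_add integrable_abs Bochner_Integration.integrable_diff wi cl s)
    finally have "(\<integral>x. \<bar>w (cl r) x\<bar> \<partial>lborel) \<le> (\<integral>x. \<bar>w s x\<bar> \<partial>lborel) + e" using e[OF cl(1), of r] by linarith
    then have "Lf * ((\<integral>x. \<bar>w (cl r) x\<bar> \<partial>lborel) + (\<integral>y. \<bar>g y\<bar> \<partial>lborel)) * k'.K \<le> N"
      unfolding N_def using Lf_nonneg k'.K_nonneg by (intro mult_right_mono mult_left_mono add_right_mono) auto
    then show ?thesis using Q_dominated(2)[OF wn[OF cl(1)] g, of r] unfolding J_def by linarith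
  qed
  have pint: "integrable (lborel \<Otimes>\<^sub>M lborel) (\<lambda>(r, y). ?I r * J r y)"
  proof (rule lborel_pair.Fubini_integrable)
    show "(\<lambda>(r, y). ?I r * J r y) \<in> borel_measurable (lborel \<Otimes>\<^sub>M lborel)" by measurable
    have "(\<lambda>r. \<integral>y. \<bar>J r y\<bar> \<partial>lborel) \<in> borel_measurable borel"
      by (rule lborel.borel_measurable_lebesgue_integral) measurable
    then have "integrable lborel (\<lambda>r. ?I r * (\<integral>y. \<bar>J r y\<bar> \<partial>lborel))"
      by (intro integrable_bounded_interval[of _ "N" t1 t2])
         (use Nb order_trans[OF _ Nb[of 0]] in \<open>auto simp: indicator_def abs_of_nonneg\<close>)
    then show "integrable lborel (\<lambda>r. \<integral>y. norm (case (r, y) of (r, y) \<Rightarrow> ?I r * J r y) \<partial>lborel)"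
      by (simp add: abs_mult)
    show "AE r in lborel. integrable lborel (\<lambda>y. case (r, y) of (r, y) \<Rightarrow> ?I r * J r y)"
      by (auto intro!: integrable_mult_right Jint)
  qed
  have t12: "t1 \<in> {t1..t2}" "t2 \<in> {t1..t2}" using t by auto
  have step: "(\<integral>x. \<bar>w t2 x - g y\<bar> * ker \<epsilon> (x - y) \<partial>lborel) - (\<integral>x. \<bar>w t1 x - g y\<bar> * ker \<epsilon> (x - y) \<partial>lborel)
      \<le> (\<integral>r. ?I r * J r y \<partial>lborel)" for y
  proof -
    have gy: "g y \<in> {0..R}" using g by (simp add: nice_def)
    have "(\<integral>x. \<bar>w t2 x - g y\<bar> * ker \<epsilon> (x - y) \<partial>lborel) - (\<integral>x. \<bar>w t1 x - g y\<bar> * ker \<epsilon> (x - y) \<partial>lborel)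
       \<le> integral {t1..t2} (\<lambda>r. \<integral>x. eflux (g y) (w r x) * ker' \<epsilon> (x - y) \<partial>lborel)"
      using w gy spatial_test_ker[of y] t unfolding evolution_def by blast
    also have "\<dots> = integral {t1..t2} (\<lambda>r. J r y)"
      by (rule Henstock_Kurzweil_Integration.integral_cong) (simp add: J_def cl(2))
    also have "\<dots> = (LINT r:{t1..t2}|lborel. J r y)"
      by (rule set_borel_integral_eq_integral(2)[symmetric], rule borel_integrable_atLeastAtMost', rule continuous_on_subset[OF Jcont]) auto
    finally show ?thesis by (simp add: set_lebesgue_integral_def)
  qed
  note h1 = lborel_pair.integrable_snd[OF H_integrable[OF wn[OF t12(1)] g]]
    and h2 = lborel_pair.integrable_snd[OF H_integrable[OF wn[OF t12(2)] g]]
  have "H (w t2) g - H (w t1) g = (\<integral>y. (\<integral>x. \<bar>w t2 x - g y\<bar> * ker \<epsilon> (x - y) \<partial>lborel) - (\<integral>x. \<bar>w t1 x - g y\<bar> * ker \<epsilon> (x - y) \<partial>lborel) \<partial>lborel)"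
    unfolding H_def by (rule Bochner_Integration.integral_diff[symmetric, OF h2 h1])
  also have "\<dots> \<le> (\<integral>y. (\<integral>r. ?I r * J r y \<partial>lborel) \<partial>lborel)"
    by (rule integral_mono[OF Bochner_Integration.integrable_diff[OF h2 h1] lborel_pair.integrable_snd[OF pint] step])
  also have "\<dots> = (\<integral>r. (\<integral>y. ?I r * J r y \<partial>lborel) \<partial>lborel)"
    by (rule lborel_pair.Fubini_integral[OF pint])
  also have "\<dots> = (\<integral>r. ?I r * Q (w (cl r)) g \<partial>lborel)"
    by (simp add: Q_def J_def)
  also have "\<dots> \<le> (\<integral>r. ?I r * (Q (w s) g + Lf * k'.K * e) \<partial>lborel)"
  proof (rule integral_mono)
    show "integrable lborel (\<lambda>r. ?I r * Q (w (cl r)) g)"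
      using lborel_pair.integrable_fst[OF pint] by (simp add: Q_def J_def)
    show "integrable lborel (\<lambda>r. ?I r * (Q (w s) g + Lf * k'.K * e))"
      by (rule integrable_bounded_interval[of _ "\<bar>Q (w s) g + Lf * k'.K * e\<bar>" t1 t2]) (auto simp: indicator_def)
    fix r
    have "\<bar>Q (w (cl r)) g - Q (w s) g\<bar> \<le> Lf * k'.K * (\<integral>x. \<bar>w (cl r) x - w s x\<bar> \<partial>lborel)"
      by (rule Q_lipschitz[OF wn[OF cl(1)] wn[OF s] g])
    also have "\<dots> \<le> Lf * k'.K * e" using e[OF cl(1)] Lf_nonneg k'.K_nonneg by (intro mult_left_mono) auto
    finally have "Q (w (cl r)) g \<le> Q (w s) g + Lf * k'.K * e" by linarith
    then show "?I r * Q (w (cl r)) g \<le> ?I r * (Q (w s) g + Lf * k'.K * e)" by (intro mult_left_mono) auto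
  qed
  also have "\<dots> = (t2 - t1) * (Q (w s) g + Lf * k'.K * e)" using t by simp
  finally show ?thesis .
qed

end

section \<open>Contraction and comparison with the L1 distance\<close>

context kruzkov
begin

lemma H_cong_AE:
  assumes "nice f" "nice f'" "nice g" and ae: "AE x in lborel. f x = f' x"
  shows "H f g = H f' g"
  unfolding H_def
proof (rule Bochner_Integration.integral_cong[OF refl])
  fix y
  have [measurable]: "f \<in> borel_measurable borel" "f' \<in> borel_measurable borel" using assms by (auto simp: nice_def)
  show "(\<integral>x. \<bar>f x - g y\<bar> * ker \<epsilon> (x - y) \<partial>lborel) = (\<integral>x. \<bar>f' x - g y\<bar> * ker \<epsilon> (x - y) \<partial>lborel)"
  proof (rule integral_cong_AE)
    show "AE x in lborel. \<bar>f x - g y\<bar> * ker \<epsilon> (x - y) = \<bar>f' x - g y\<bar> * ker \<epsilon> (x - y)" using ae by eventually_elim simp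
  qed (measurable, measurable)
qed

text \<open>In the difference variable z the functional is an average of translation differences of
  f, and the kernel confines z to modulus at most \<open>\<epsilon>\<close>.\<close>

lemma H_diagonal:
  assumes f: "nice f" and trans: "\<And>h. (\<integral>x. \<bar>f (x + h) - f x\<bar> \<partial>lborel) \<le> \<bar>h\<bar> * V" and V: "0 \<le> V"
  shows "H f f \<le> \<epsilon> * V * k.K"
proof -
  have [measurable]: "f \<in> borel_measurable borel" and fi: "integrable lborel f" using f by (auto simp: nice_def)
  let ?F = "\<lambda>x z. \<bar>f (x + z) - f x\<bar> * ker \<epsilon> z"
  have shift: "(\<integral>y. \<bar>f x - f y\<bar> * ker \<epsilon> (x - y) \<partial>lborel) = (\<integral>z. ?F x z \<partial>lborel)" for x
    using lborel_integral_real_affine[of 1 "\<lambda>y. \<bar>f x - f y\<bar> * ker \<epsilon> (x - y)" x] by (simp add: ker_even abs_minus_commute)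
  have pint: "integrable (lborel \<Otimes>\<^sub>M lborel) (\<lambda>(x, z). ?F x z)"
  proof (rule lborel_pair.Fubini_integrable)
    show "(\<lambda>(x, z). ?F x z) \<in> borel_measurable (lborel \<Otimes>\<^sub>M lborel)" by measurable
    have "integrable lborel (\<lambda>x. \<integral>y. \<bar>f x - f y\<bar> * ker \<epsilon> (x - y) \<partial>lborel)"
      by (rule lborel_pair.integrable_fst[OF H_integrable[OF f f]])
    then show "integrable lborel (\<lambda>x. \<integral>z. norm (case (x, z) of (x, z) \<Rightarrow> ?F x z) \<partial>lborel)"
      by (simp add: shift abs_mult ker_nonneg)
    show "AE x in lborel. integrable lborel (\<lambda>z. case (x, z) of (x, z) \<Rightarrow> ?F x z)"
      using lborel_pair.AE_integrable_fst[OF H_integrable[OF f f]]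
    proof eventually_elim
      case (elim x)
      from lborel_integrable_real_affine[OF elim, of 1 x] show ?case by (simp add: ker_even abs_minus_commute)
    qed
  qed
  have "H f f = (\<integral>x. (\<integral>y. \<bar>f x - f y\<bar> * ker \<epsilon> (x - y) \<partial>lborel) \<partial>lborel)"
    unfolding H_def by (rule lborel_pair.Fubini_integral[OF H_integrable[OF f f]])
  also have "\<dots> = (\<integral>x. (\<integral>z. ?F x z \<partial>lborel) \<partial>lborel)" unfolding shift ..
  also have "\<dots> = (\<integral>z. (\<integral>x. ?F x z \<partial>lborel) \<partial>lborel)" by (rule lborel_pair.Fubini_integral[OF pint, symmetric])
  also have "\<dots> \<le> (\<integral>z. \<epsilon> * V * \<bar>ker \<epsilon> z\<bar> \<partial>lborel)"
  proof (rule integral_mono[OF lborel_pair.integrable_snd[OF pint] integrable_mult_right[OF k.\<kappa>_int]])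
    fix z
    have eq: "(\<integral>x. ?F x z \<partial>lborel) = (\<integral>x. \<bar>f (x + z) - f x\<bar> \<partial>lborel) * ker \<epsilon> z" by simp
    have "(\<integral>x. \<bar>f (x + z) - f x\<bar> \<partial>lborel) * ker \<epsilon> z \<le> \<epsilon> * V * ker \<epsilon> z"
    proof (cases "\<epsilon> \<le> \<bar>z\<bar>")
      case True then show ?thesis by (simp add: ker_outside(1)[OF \<epsilon>_pos])
    next
      case False
      then have "\<bar>z\<bar> * V \<le> \<epsilon> * V" using V by (intro mult_right_mono) auto
      with trans[of z] have "(\<integral>x. \<bar>f (x + z) - f x\<bar> \<partial>lborel) \<le> \<epsilon> * V" by linarith
      then show ?thesis by (rule mult_right_mono) (rule ker_nonneg)
    qed
    then show "(\<integral>x. ?F x z \<partial>lborel) \<le> \<epsilon> * V * \<bar>ker \<epsilon> z\<bar>" unfolding eq by (simp add: ker_nonneg)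
  qed
  also have "\<dots> = \<epsilon> * V * k.K" by (simp add: k.K_def)
  finally show ?thesis .
qed

text \<open>Insert \<open>g y\<close> into the triangle inequality and integrate against the kernel;
  the diagonal term \<open>H g g\<close> is the price of the smoothing, and only one of the two
  functions has to pay it.\<close>

lemma L1_le_H:
  assumes f: "nice f" and g: "nice g"
  shows "(\<integral>x. \<bar>f x - g x\<bar> \<partial>lborel) * k.K \<le> H f g + H g g"
proof -
  have i: "integrable lborel (\<lambda>x. f x - g x)" using f g by (auto simp: nice_def)
  note p = k.prod_integrable1[OF i] and h1 = H_integrable[OF f g] and h2 = H_integrable[OF g g]
  have sum: "integrable (lborel \<Otimes>\<^sub>M lborel) (\<lambda>p. (case p of (x, y) \<Rightarrow> \<bar>f x - g y\<bar> * ker \<epsilon> (x - y)) + (case p of (x, y) \<Rightarrow> \<bar>g x - g y\<bar> * ker \<epsilon> (x - y)))"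
    by (rule Bochner_Integration.integrable_add[OF h1 h2])
  have "(\<integral>x. \<bar>f x - g x\<bar> \<partial>lborel) * k.K = integral\<^sup>L (lborel \<Otimes>\<^sub>M lborel) (\<lambda>(x, y). \<bar>f x - g x\<bar> * \<bar>ker \<epsilon> (x - y)\<bar>)"
    using lborel_pair.integral_snd[OF p(1)] p(3) by simp
  also have "\<dots> \<le> integral\<^sup>L (lborel \<Otimes>\<^sub>M lborel) (\<lambda>p. (case p of (x, y) \<Rightarrow> \<bar>f x - g y\<bar> * ker \<epsilon> (x - y)) + (case p of (x, y) \<Rightarrow> \<bar>g x - g y\<bar> * ker \<epsilon> (x - y)))"
  proof (rule integral_mono[OF p(1) sum])
    fix p :: "real \<times> real"
    obtain x y where xy: "p = (x, y)" by (cases p)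
    have "\<bar>f x - g x\<bar> * ker \<epsilon> (x - y) \<le> (\<bar>f x - g y\<bar> + \<bar>g x - g y\<bar>) * ker \<epsilon> (x - y)"
      by (intro mult_right_mono ker_nonneg) linarith
    then show "(case p of (x, y) \<Rightarrow> \<bar>f x - g x\<bar> * \<bar>ker \<epsilon> (x - y)\<bar>)
      \<le> (case p of (x, y) \<Rightarrow> \<bar>f x - g y\<bar> * ker \<epsilon> (x - y)) + (case p of (x, y) \<Rightarrow> \<bar>g x - g y\<bar> * ker \<epsilon> (x - y))"
      by (simp add: xy distrib_right ker_nonneg)
  qed
  also have "\<dots> = H f g + H g g"
    unfolding Bochner_Integration.integral_add[OF h1 h2] H_def lborel_pair.integral_snd[OF h1] lborel_pair.integral_snd[OF h2] ..
  finally show ?thesis .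
qed

lemma H_initial:
  assumes w: "evolution w" and g: "nice g"
  shows "H (w 0) g \<le> H \<rho>b g"
proof -
  have n: "nice (w 0)" "nice \<rho>b" using w T_pos \<rho>b integrable_\<rho>b by (auto simp: evolution_def nice_def)
  show ?thesis unfolding H_def
  proof (rule integral_mono[OF lborel_pair.integrable_snd[OF H_integrable[OF n(1) g]] lborel_pair.integrable_snd[OF H_integrable[OF n(2) g]]])
    fix y
    have "g y \<in> {0..R}" using g by (simp add: nice_def)
    then show "(\<integral>x. \<bar>w 0 x - g y\<bar> * ker \<epsilon> (x - y) \<partial>lborel) \<le> (\<integral>x. \<bar>\<rho>b x - g y\<bar> * ker \<epsilon> (x - y) \<partial>lborel)"
      using w spatial_test_ker[of y] unfolding evolution_def by blast
  qed
qed

text \<open>The arguments move one after the other: \<open>\<mu>\<close> while w is frozen at t2,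
  then w while \<open>\<mu>\<close> is frozen at t1. Both flux terms are then taken at the same pair
  \<open>\<mu> t1\<close>, \<open>w t2\<close>, so they cancel exactly and only oscillations in time
  remain.\<close>

lemma H_pair_increment:
  assumes \<mu>: "evolution \<mu>" and w: "evolution w" and t: "0 \<le> t1" "t1 \<le> x" "x \<le> t2" "t2 \<le> T"
    and e: "\<And>r. r \<in> {t1..t2} \<Longrightarrow> (\<integral>z. \<bar>\<mu> r z - \<mu> x z\<bar> \<partial>lborel) \<le> e" "\<And>r. r \<in> {t1..t2} \<Longrightarrow> (\<integral>z. \<bar>w r z - w x z\<bar> \<partial>lborel) \<le> e"
  shows "H (\<mu> t2) (w t2) - H (\<mu> t1) (w t1) \<le> (t2 - t1) * (4 * (Lf * k'.K) * e)"
proof -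
  \<comment> \<open>The hypotheses compare with the intermediate time x, whereas the flux terms are
    frozen at t1 and t2; passing through x doubles e.\<close>
  have tri: "(\<integral>z. \<bar>f r z - f s z\<bar> \<partial>lborel) \<le> 2 * e"
    if f: "evolution f" and "\<And>r. r \<in> {t1..t2} \<Longrightarrow> (\<integral>z. \<bar>f r z - f x z\<bar> \<partial>lborel) \<le> e" and rs: "r \<in> {t1..t2}" "s \<in> {t1..t2}" for f r s
  proof -
    have i: "integrable lborel (f r)" if "r \<in> {t1..t2}" for r
      using f that t unfolding evolution_def nice_def by auto
    have x: "x \<in> {t1..t2}" using t by auto
    have "(\<integral>z. \<bar>f r z - f s z\<bar> \<partial>lborel) \<le> (\<integral>z. \<bar>f r z - f x z\<bar> + \<bar>f s z - f x z\<bar> \<partial>lborel)"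
      by (intro integral_mono Bochner_Integration.integrable_add integrable_abs Bochner_Integration.integrable_diff i rs x) linarith
    also have "\<dots> = (\<integral>z. \<bar>f r z - f x z\<bar> \<partial>lborel) + (\<integral>z. \<bar>f s z - f x z\<bar> \<partial>lborel)"
      by (intro Bochner_Integration.integral_add integrable_abs Bochner_Integration.integrable_diff i rs x)
    finally show ?thesis using that(2)[OF rs(1)] that(2)[OF rs(2)] by linarith
  qed
  have t12: "t1 \<le> t2" "t1 \<in> {t1..t2}" "t2 \<in> {t1..t2}" using t by auto
  have n: "nice (\<mu> t1)" "nice (\<mu> t2)" "nice (w t1)" "nice (w t2)" using \<mu> w t unfolding evolution_def by auto
  have 1: "H (\<mu> t2) (w t2) - H (\<mu> t1) (w t2) \<le> (t2 - t1) * (Q (\<mu> t1) (w t2) + Lf * k'.K * (2 * e))"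
    by (rule H_increment[OF \<mu> n(4) t(1) t12(1) t(4) t12(2)]) (rule tri[OF \<mu> e(1) _ t12(2)])
  have 2: "H (w t2) (\<mu> t1) - H (w t1) (\<mu> t1) \<le> (t2 - t1) * (Q (w t2) (\<mu> t1) + Lf * k'.K * (2 * e))"
    by (rule H_increment[OF w n(1) t(1) t12(1) t(4) t12(3)]) (rule tri[OF w e(2) _ t12(3)])
  have 3: "(t2 - t1) * (Q (\<mu> t1) (w t2) + Lf * k'.K * (2 * e)) + (t2 - t1) * (- Q (\<mu> t1) (w t2) + Lf * k'.K * (2 * e)) = (t2 - t1) * (4 * (Lf * k'.K) * e)"
    by (simp add: algebra_simps)
  show ?thesis using 1 2 3 unfolding Q_antisym[OF n(1) n(4)] H_commute[OF n(4) n(1)] H_commute[OF n(3) n(1)] by linarith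
qed

text \<open>On short intervals the functional grows at most by a small multiple of their length, and
  such bounds add up under concatenation. Bolzano's bisection principle makes this global and needs
  continuity only at one time after the other, in place of a uniform partition.\<close>

lemma H_contraction:
  assumes \<mu>: "evolution \<mu>" and w: "evolution w" and t: "t \<in> {0..T}"
  shows "H (\<mu> t) (w t) \<le> H (\<mu> 0) (w 0)"
proof (rule field_le_epsilon)
  fix d :: real assume d: "0 < d"
  define C where "C = 4 * (Lf * k'.K)"
  have C: "0 \<le> C" using Lf_nonneg k'.K_nonneg by (simp add: C_def)
  \<comment> \<open>Chosen so that the total growth, at most \<open>T * (C + 1) * e\<close>, is
    d.\<close>
  define e where "e = d / (T * (C + 1))"
  have e: "0 < e" using d C T_pos by (simp add: e_def)
  define P where "P a b \<longleftrightarrow> (0 \<le> a \<longrightarrow> b \<le> T \<longrightarrow> H (\<mu> b) (w b) - H (\<mu> a) (w a) \<le> (b - a) * (C * e))" for a b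
  have "P 0 t"
  proof (rule Bolzano)
    show "0 \<le> t" using t by simp
    show "P a c" if *: "P a b" "P b c" "a \<le> b" "b \<le> c" for a b c
    proof -
      have "(b - a) * (C * e) + (c - b) * (C * e) = (c - a) * (C * e)" by (simp add: algebra_simps)
      then show ?thesis using * unfolding P_def by fastforce
    qed
    fix x assume x: "0 \<le> x" "x \<le> t"
    have mod: "\<exists>\<delta>>0. \<forall>r\<in>{0..T}. \<bar>r - x\<bar> < \<delta> \<longrightarrow> (\<integral>z. \<bar>f r z - f x z\<bar> \<partial>lborel) \<le> e" if f: "evolution f" for f
    proof -
      have "((\<lambda>s. \<integral>z. \<bar>f s z - f x z\<bar> \<partial>lborel) \<longlongrightarrow> 0) (at x within {0..T})"
        using f x t unfolding evolution_def by auto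
      from tendstoD[OF this e] obtain \<delta> where \<delta>: "0 < \<delta>"
        "\<And>s. s \<in> {0..T} \<Longrightarrow> s \<noteq> x \<Longrightarrow> dist s x < \<delta> \<Longrightarrow> dist (\<integral>z. \<bar>f s z - f x z\<bar> \<partial>lborel) 0 < e"
        unfolding eventually_at by blast
      have "(\<integral>z. \<bar>f r z - f x z\<bar> \<partial>lborel) \<le> e" if "r \<in> {0..T}" "\<bar>r - x\<bar> < \<delta>" for r
        using \<delta>(2)[of r] that e by (cases "r = x") (auto simp: dist_real_def)
      then show ?thesis using \<delta>(1) by blast
    qed
    obtain \<delta>1 where \<delta>1: "0 < \<delta>1" "\<And>r. r \<in> {0..T} \<Longrightarrow> \<bar>r - x\<bar> < \<delta>1 \<Longrightarrow> (\<integral>z. \<bar>\<mu> r z - \<mu> x z\<bar> \<partial>lborel) \<le> e" using mod[OF \<mu>] by blast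
    obtain \<delta>2 where \<delta>2: "0 < \<delta>2" "\<And>r. r \<in> {0..T} \<Longrightarrow> \<bar>r - x\<bar> < \<delta>2 \<Longrightarrow> (\<integral>z. \<bar>w r z - w x z\<bar> \<partial>lborel) \<le> e" using mod[OF w] by blast
    show "\<exists>\<delta>>0. \<forall>a b. a \<le> x \<and> x \<le> b \<and> b - a < \<delta> \<longrightarrow> P a b"
    proof (intro exI conjI allI impI)
      show "0 < min \<delta>1 \<delta>2" using \<delta>1 \<delta>2 by simp
      fix a b assume ab: "a \<le> x \<and> x \<le> b \<and> b - a < min \<delta>1 \<delta>2"
      show "P a b" unfolding P_def C_def
      proof (intro impI)
        assume "0 \<le> a" "b \<le> T"
        show "H (\<mu> b) (w b) - H (\<mu> a) (w a) \<le> (b - a) * (4 * (Lf * k'.K) * e)"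
        proof (rule H_pair_increment[OF \<mu> w \<open>0 \<le> a\<close> _ _ \<open>b \<le> T\<close>])
          show "a \<le> x" "x \<le> b" using ab by auto
          fix r assume r: "r \<in> {a..b}"
          then have "r \<in> {0..T}" "\<bar>r - x\<bar> < \<delta>1" "\<bar>r - x\<bar> < \<delta>2" using ab \<open>0 \<le> a\<close> \<open>b \<le> T\<close> by auto
          then show "(\<integral>z. \<bar>\<mu> r z - \<mu> x z\<bar> \<partial>lborel) \<le> e" "(\<integral>z. \<bar>w r z - w x z\<bar> \<partial>lborel) \<le> e" using \<delta>1(2) \<delta>2(2) by auto
        qed
      qed
    qed
  qed
  then have "H (\<mu> t) (w t) - H (\<mu> 0) (w 0) \<le> t * (C * e)" using t by (simp add: P_def)
  also have "\<dots> \<le> T * ((C + 1) * e)" using t C e by (intro mult_mono mult_right_mono) auto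
  also have "\<dots> = d" using C T_pos by (simp add: e_def)
  finally show "H (\<mu> t) (w t) \<le> H (\<mu> 0) (w 0) + d" by linarith
qed

end

context lwr
begin

text \<open>Only \<open>\<rho>\<close> comes with the translation bound. It controls the diagonal of
  the functional twice: for the initial datum, where the contraction starts, and for
  \<open>\<rho>\<close> at time t, where the L1 distance is recovered.\<close>

theorem entropy_solution_unique:
  assumes \<sigma>: "entropy_solution R v \<rho>\<^sub>0 T \<sigma>" and \<rho>: "entropy_solution R v \<rho>\<^sub>0 T \<rho>" and nl: "nice_limit \<rho>" and t: "t \<in> {0..T}"
  shows "AE x in lebesgue. \<sigma> t x = \<rho> t x"
proof -
  obtain \<mu> where \<mu>: "evolution \<mu>" "\<And>t. t \<in> {0..T} \<Longrightarrow> AE x in lebesgue. \<sigma> t x = \<mu> t x" using entropy_evolution[OF \<sigma>] by blast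
  obtain w where w: "evolution w" "\<And>t. t \<in> {0..T} \<Longrightarrow> AE x in lebesgue. \<rho> t x = w t x" using entropy_evolution[OF \<rho>] by blast
  note \<rho>n = nice_limitD[OF nl]
  have n: "nice (\<rho> s)" "nice \<rho>b" for s using \<rho>n(2,4,5) \<rho>b integrable_\<rho>b by (auto simp: nice_def)
  have nu: "nice (\<mu> s)" "nice (w s)" if "s \<in> {0..T}" for s using \<mu>(1) w(1) that by (auto simp: evolution_def)
  have V: "0 \<le> TV0" by (simp add: TV0_def)
  have tr: "(\<integral>x. \<bar>\<rho> s (x + h) - \<rho> s x\<bar> \<partial>lborel) \<le> \<bar>h\<bar> * TV0" if "s \<in> {0..T}" for s h
    using nl that unfolding nice_limit_def by blast
  have bound: "(\<integral>x. \<bar>\<mu> t x - w t x\<bar> \<partial>lborel) \<le> 2 * \<epsilon> * TV0" if \<epsilon>: "0 < \<epsilon>" for \<epsilon>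
  proof -
    interpret kruzkov R v v' \<rho>\<^sub>0 T \<theta> \<epsilon> by unfold_locales (rule \<epsilon>)
    have 0: "0 \<in> {0..T}" using T_pos by simp
    have self: "H f f \<le> \<epsilon> * TV0 * k.K" if f: "nice f" and ae: "AE x in lborel. \<rho> s x = f x" and s: "s \<in> {0..T}" for f s
    proof -
      have "H f f = H (\<rho> s) f" by (rule H_cong_AE[OF n(1) f f ae, symmetric])
      also have "\<dots> = H f (\<rho> s)" by (rule H_commute[OF n(1) f])
      also have "\<dots> = H (\<rho> s) (\<rho> s)" by (rule H_cong_AE[OF n(1) f n(1) ae, symmetric])
      also have "\<dots> \<le> \<epsilon> * TV0 * k.K" by (rule H_diagonal[OF n(1) tr[OF s] V])
      finally show ?thesis .
    qed
    \<comment> \<open>At time 0 an evolution satisfies only one-sided comparisons with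
      \<open>\<rho>b\<close>; they are applied to one argument and then, after a swap, to the
      other.\<close>
    have "H (\<mu> t) (w t) \<le> H (\<mu> 0) (w 0)" by (rule H_contraction[OF \<mu>(1) w(1) t])
    also have "\<dots> \<le> H \<rho>b (w 0)" by (rule H_initial[OF \<mu>(1) nu(2)[OF 0]])
    also have "\<dots> = H (w 0) \<rho>b" by (rule H_commute[OF n(2) nu(2)[OF 0]])
    also have "\<dots> \<le> H \<rho>b \<rho>b" by (rule H_initial[OF w(1) n(2)])
    also have "\<dots> \<le> \<epsilon> * TV0 * k.K" by (rule self[OF n(2) \<rho>n(6) 0])
    finally have 1: "H (\<mu> t) (w t) \<le> \<epsilon> * TV0 * k.K" .
    have "AE x in lborel. \<rho> t x = w t x" using w(2)[OF t] by (simp add: AE_completion_iff)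
    then have 2: "H (w t) (w t) \<le> \<epsilon> * TV0 * k.K" by (intro self[OF nu(2)[OF t] _ t])
    have "(\<integral>x. \<bar>\<mu> t x - w t x\<bar> \<partial>lborel) * k.K \<le> (2 * \<epsilon> * TV0) * k.K"
      using L1_le_H[OF nu(1)[OF t] nu(2)[OF t]] 1 2 by linarith
    then show ?thesis using K_pos by (simp only: mult_le_cancel_right_pos)
  qed
  have "(\<integral>x. \<bar>\<mu> t x - w t x\<bar> \<partial>lborel) \<le> 0"
  proof (rule field_le_epsilon)
    fix d :: real assume d: "0 < d"
    have "(\<integral>x. \<bar>\<mu> t x - w t x\<bar> \<partial>lborel) \<le> 2 * (d / (2 * (TV0 + 1))) * TV0" by (rule bound) (use d V in auto)
    also have "\<dots> = d * (TV0 / (TV0 + 1))" using V by (simp add: field_simps)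
    also have "\<dots> \<le> d * 1" using d V by (intro mult_left_mono) (auto simp: divide_le_eq)
    finally show "(\<integral>x. \<bar>\<mu> t x - w t x\<bar> \<partial>lborel) \<le> 0 + d" by simp
  qed
  moreover have "0 \<le> (\<integral>x. \<bar>\<mu> t x - w t x\<bar> \<partial>lborel)" by simp
  ultimately have "(\<integral>x. \<bar>\<mu> t x - w t x\<bar> \<partial>lborel) = 0" by linarith
  moreover have "integrable lborel (\<lambda>x. \<bar>\<mu> t x - w t x\<bar>)" using nu[OF t] by (auto simp: nice_def)
  ultimately have "AE x in lborel. \<bar>\<mu> t x - w t x\<bar> = 0" by (subst (asm) integral_nonneg_eq_0_iff_AE) auto
  then have "AE x in lebesgue. \<bar>\<mu> t x - w t x\<bar> = 0" by (rule AE_completion)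
  then show ?thesis using \<mu>(2)[OF t] w(2)[OF t] by eventually_elim simp
qed

end

section \<open>Convergence of the scheme\<close>

context lwr
begin

text \<open>For \<open>\<theta> > 0\<close> the CFL condition bounds M from below by a positive
  multiple of N. For \<open>\<theta> = 0\<close> it does not link M to N, and the divergence of M is
  an assumption of its own.\<close>

lemma M_at_top:
  assumes cfl: "\<And>n. \<theta> * real (N n) * T * Lv * R\<^sup>2 < L * real (M n)"
    and N: "filterlim N at_top sequentially" and \<theta>0: "\<theta> = 0 \<longrightarrow> filterlim M at_top sequentially"
  shows "filterlim M at_top sequentially"
proof (cases "\<theta> = 0")
  case False
  define c where "c = \<theta> * T * Lv * R\<^sup>2 / L"
  have c: "0 < c" using False \<theta>01 T_pos Lv_pos R_pos L_pos by (simp add: c_def)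
  have "c * real (N n) \<le> real (M n)" for n
  proof -
    have "c * real (N n) = (\<theta> * real (N n) * T * Lv * R\<^sup>2) / L" by (simp add: c_def)
    also have "\<dots> \<le> real (M n)" using cfl[of n] L_pos by (simp add: divide_le_eq mult.commute)
    finally show ?thesis .
  qed
  then have "\<forall>\<^sub>F n in sequentially. c * real (N n) \<le> real (M n)" by simp
  moreover have "filterlim (\<lambda>n. c * real (N n)) at_top sequentially"
    by (rule filterlim_tendsto_pos_mult_at_top[OF tendsto_const c filterlim_compose[OF filterlim_real_sequentially N]])
  ultimately have "filterlim (\<lambda>n. real (M n)) at_top sequentially"
    by (metis filterlim_at_top_mono)
  then show ?thesis by (rule filterlim_sequentially_iff_filterlim_real[THEN iffD2])
qed (use \<theta>0 in simp)

lemma ratio_M_at_top: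
  fixes M N :: "nat \<Rightarrow> nat"
  assumes N: "filterlim N at_top sequentially" and M: "\<And>n. 0 < M n" and r: "(\<lambda>n. real (N n) / real (M n)) \<longlonglongrightarrow> 0"
  shows "filterlim M at_top sequentially"
proof -
  have "\<forall>\<^sub>F n in sequentially. real (N n) / real (M n) < 1" by (rule order_tendstoD(2)[OF r]) simp
  then have "\<forall>\<^sub>F n in sequentially. N n \<le> M n" by eventually_elim (use M in \<open>simp add: divide_less_eq\<close>)
  then show ?thesis by (rule filterlim_at_top_mono[OF N])
qed

lemma subsequence_compactness:
  assumes adm: "\<And>n. adm_pair (M n) (N n)" and N: "filterlim N at_top sequentially" and M: "filterlim M at_top sequentially"
    and r: "strict_mono (r :: nat \<Rightarrow> nat)"
  obtains k \<rho> where "strict_mono (k :: nat \<Rightarrow> nat)" "nice_limit \<rho>" "L1_limit (\<lambda>n. M (r (k n))) (\<lambda>n. N (r (k n))) \<rho>"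
proof (rule compactness[of "\<lambda>n. M (r n)" "\<lambda>n. N (r n)"])
  show "adm_pair (M (r n)) (N (r n))" for n by (rule adm)
  show "filterlim (\<lambda>n. N (r n)) at_top sequentially" "filterlim (\<lambda>n. M (r n)) at_top sequentially"
    by (rule filterlim_compose[OF N filterlim_subseq[OF r]], rule filterlim_compose[OF M filterlim_subseq[OF r]])
qed (rule that)

lemma entropy_limit_subsequence:
  assumes adm: "\<And>n. adm_pair (M n) (N n)" and N: "filterlim N at_top sequentially" and M: "filterlim M at_top sequentially"
    and ratio: "(\<lambda>n. real (N n) / real (M n)) \<longlonglongrightarrow> 0"
    and s: "strict_mono (s :: nat \<Rightarrow> nat)" and nl: "nice_limit \<rho>" and lim: "L1_limit (\<lambda>n. M (s n)) (\<lambda>n. N (s n)) \<rho>"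
  shows "entropy_solution R v \<rho>\<^sub>0 T \<rho>"
proof (rule entropy_limit[OF _ _ _ nl lim])
  show "adm_pair (M (s n)) (N (s n))" for n by (rule adm)
  show "filterlim (\<lambda>n. N (s n)) at_top sequentially" "filterlim (\<lambda>n. M (s n)) at_top sequentially"
    "(\<lambda>n. real (N (s n)) / real (M (s n))) \<longlonglongrightarrow> 0"
    by (rule filterlim_compose[OF N filterlim_subseq[OF s]], rule filterlim_compose[OF M filterlim_subseq[OF s]],
        rule filterlim_compose[OF ratio filterlim_subseq[OF s]])
qed

text \<open>If convergence failed, some subsequence would keep a distance e from
  \<open>\<rho>\<close>. Compactness extracts from it a further limit, which is an entropy solution
  and therefore agrees with \<open>\<rho>\<close> at every time, a contradiction.\<close>

lemma whole_sequence:
  assumes adm: "\<And>n. adm_pair (M n) (N n)" and N: "filterlim N at_top sequentially" and M: "filterlim M at_top sequentially"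
    and ratio: "(\<lambda>n. real (N n) / real (M n)) \<longlonglongrightarrow> 0" and nl: "nice_limit \<rho>" and es: "entropy_solution R v \<rho>\<^sub>0 T \<rho>"
  shows "L1_limit M N \<rho>"
proof (rule ccontr)
  define d where "d n t = (\<integral>x. \<bar>u (M n) (N n) t x - \<rho> t x\<bar> \<partial>lborel)" for n t
  assume "\<not> L1_limit M N \<rho>"
  then obtain e where e: "0 < e" "\<And>n0. \<exists>n\<ge>n0. \<exists>t\<in>{0..T}. e \<le> d n t"
    unfolding L1_limit_def d_def[symmetric] by (auto simp: not_less)
  have "infinite {n. \<exists>t\<in>{0..T}. e \<le> d n t}" unfolding infinite_nat_iff_unbounded_le using e(2) by auto
  then obtain r where r: "strict_mono (r :: nat \<Rightarrow> nat)" "\<And>n. r n \<in> {n. \<exists>t\<in>{0..T}. e \<le> d n t}"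
    using infinite_enumerate by blast
  obtain k \<rho>' where k: "strict_mono (k :: nat \<Rightarrow> nat)" "nice_limit \<rho>'" "L1_limit (\<lambda>n. M (r (k n))) (\<lambda>n. N (r (k n))) \<rho>'"
    using subsequence_compactness[OF adm N M r(1)] by metis
  have rk: "strict_mono (\<lambda>n. r (k n))" using strict_mono_o[OF r(1) k(1)] by (simp add: o_def)
  have es': "entropy_solution R v \<rho>\<^sub>0 T \<rho>'" by (rule entropy_limit_subsequence[OF adm N M ratio rk k(2,3)])
  obtain n where n: "\<And>t. t \<in> {0..T} \<Longrightarrow> (\<integral>x. \<bar>u (M (r (k n))) (N (r (k n))) t x - \<rho>' t x\<bar> \<partial>lborel) < e"
    using k(3) e(1) unfolding L1_limit_def by blast
  obtain t where t: "t \<in> {0..T}" "e \<le> d (r (k n)) t" using r(2)[of "k n"] by blast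
  have "AE x in lborel. \<rho>' t x = \<rho> t x"
    using entropy_solution_unique[OF es' es nl t(1)] by (simp add: AE_completion_iff)
  moreover have "u (M (r (k n))) (N (r (k n))) t \<in> borel_measurable borel" by simp
  ultimately have "(\<integral>x. \<bar>u (M (r (k n))) (N (r (k n))) t x - \<rho>' t x\<bar> \<partial>lborel) = d (r (k n)) t"
    unfolding d_def using nice_limitD(4)[OF nl, of t] nice_limitD(4)[OF k(2), of t] by (intro integral_cong_AE) auto
  with n[OF t(1)] t(2) show False by simp
qed

end

theorem theorem2p5:
  fixes R T \<theta> L :: real and v v' \<rho>\<^sub>0 :: "real \<Rightarrow> real" and M N :: "nat \<Rightarrow> nat"
  defines "\<rho>n \<equiv> \<lambda>n. discrete_density R v \<rho>\<^sub>0 T \<theta> (M n) (N n)"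
  assumes "R > 0"
    and "\<And>r. r \<in> {0..R} \<Longrightarrow> (v has_real_derivative v' r) (at r within {0..R})"
    and "continuous_on {0..R} v'"
    and "\<And>r. r \<in> {0..R} \<Longrightarrow> v' r < 0"
    and "\<rho>\<^sub>0 \<in> Linfty_c \<inter> BV"
    and "AE x in lebesgue. 0 \<le> \<rho>\<^sub>0 x \<and> \<rho>\<^sub>0 x \<le> R"
    and "L = (LINT x|lebesgue. \<bar>\<rho>\<^sub>0 x\<bar>)" and "L > 0"
    and "T > 0" and "\<theta> \<in> {0..1}"
    and "monoseq M" and "monoseq N" and "\<And>n. M n > 0" and "\<And>n. N n > 0"
    and "\<And>n. \<theta> * real (N n) * T * lip_const v {0..R} * R^2 < L * real (M n)"
  shows "(filterlim N at_top sequentially \<and> (\<theta> = 0 \<longrightarrow> filterlim M at_top sequentially) \<longrightarrow>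
           (\<exists>s \<rho>. strict_mono s \<and> weak_solution R v \<rho>\<^sub>0 T \<rho> \<and>
              converges_L1_on (UNIV \<times> {0..T}) (\<lambda>n. \<rho>n (s n)) (\<lambda>(x, t). \<rho> t x)))
       \<and> (filterlim N at_top sequentially \<and> (\<lambda>n. real (N n) / real (M n)) \<longlonglongrightarrow> 0 \<longrightarrow>
           (\<exists>\<rho>. entropy_solution R v \<rho>\<^sub>0 T \<rho> \<and>
              (\<forall>\<sigma>. entropy_solution R v \<rho>\<^sub>0 T \<sigma> \<longrightarrow>
                 (\<forall>t\<in>{0..T}. AE x in lebesgue. \<sigma> t x = \<rho> t x)) \<and>
              converges_L1_on (UNIV \<times> {0..T}) \<rho>n (\<lambda>(x, t). \<rho> t x)))"
proof -
  interpret lw: lwr R v v' \<rho>\<^sub>0 T \<theta> by unfold_locales (use assms in simp_all)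
  have L: "lw.L = L" unfolding lw.L_def using assms(8) by simp
  have cfl: "\<theta> * real (N n) * T * lw.Lv * R\<^sup>2 < lw.L * real (M n)" for n
    unfolding L lw.Lv_def by (rule assms(16))
  have adm: "lw.adm_pair (M n) (N n)" for n
  proof -
    have "\<theta> * (T / real (M n)) * lw.Lv * R\<^sup>2 \<le> lw.L / real (N n)"
      \<comment> \<open>The single-step form arises from the global CFL condition on division by the
        product of M and N.\<close>
      using cfl[of n] assms(14,15)[of n] by (simp add: field_simps)
    then show ?thesis using assms(14,15)[of n] by (simp add: lw.adm_pair_def)
  qed
  show ?thesis
  proof (intro conjI impI; elim conjE)
    assume N: "filterlim N at_top sequentially" and \<theta>0: "\<theta> = 0 \<longrightarrow> filterlim M at_top sequentially"
    have M: "filterlim M at_top sequentially" by (rule lw.M_at_top[OF cfl N \<theta>0])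
    obtain k \<rho> where k: "strict_mono (k :: nat \<Rightarrow> nat)" "lw.nice_limit \<rho>" "lw.L1_limit (\<lambda>n. M (k n)) (\<lambda>n. N (k n)) \<rho>"
      using lw.compactness[OF adm N M] by metis
    have "weak_solution R v \<rho>\<^sub>0 T \<rho>"
      by (rule lw.weak_limit[OF adm filterlim_compose[OF N filterlim_subseq[OF k(1)]] filterlim_compose[OF M filterlim_subseq[OF k(1)]] k(2,3)])
    moreover have "converges_L1_on (UNIV \<times> {0..T}) (\<lambda>n. \<rho>n (k n)) (\<lambda>(x, t). \<rho> t x)"
      unfolding \<rho>n_def by (rule lw.converges_L1[OF adm k(2,3)])
    ultimately show "\<exists>s \<rho>. strict_mono s \<and> weak_solution R v \<rho>\<^sub>0 T \<rho> \<and>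
        converges_L1_on (UNIV \<times> {0..T}) (\<lambda>n. \<rho>n (s n)) (\<lambda>(x, t). \<rho> t x)" using k(1) by blast
  next
    assume N: "filterlim N at_top sequentially" and ratio: "(\<lambda>n. real (N n) / real (M n)) \<longlonglongrightarrow> 0"
    have M: "filterlim M at_top sequentially" by (rule lw.ratio_M_at_top[OF N assms(14) ratio])
    obtain k \<rho> where k: "strict_mono (k :: nat \<Rightarrow> nat)" "lw.nice_limit \<rho>" "lw.L1_limit (\<lambda>n. M (k n)) (\<lambda>n. N (k n)) \<rho>"
      using lw.compactness[OF adm N M] by metis
    have es: "entropy_solution R v \<rho>\<^sub>0 T \<rho>"
      by (rule lw.entropy_limit_subsequence[OF adm N M ratio k])
    have "lw.L1_limit M N \<rho>" by (rule lw.whole_sequence[OF adm N M ratio k(2) es])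
    then have "converges_L1_on (UNIV \<times> {0..T}) \<rho>n (\<lambda>(x, t). \<rho> t x)"
      unfolding \<rho>n_def by (rule lw.converges_L1[OF adm k(2)])
    then show "\<exists>\<rho>. entropy_solution R v \<rho>\<^sub>0 T \<rho> \<and>
              (\<forall>\<sigma>. entropy_solution R v \<rho>\<^sub>0 T \<sigma> \<longrightarrow>
                 (\<forall>t\<in>{0..T}. AE x in lebesgue. \<sigma> t x = \<rho> t x)) \<and>
              converges_L1_on (UNIV \<times> {0..T}) \<rho>n (\<lambda>(x, t). \<rho> t x)"
      using es lw.entropy_solution_unique[OF _ es k(2)] by blast
  qed
qed

end
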